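(* Let $k$ be a field, $a\geq1$ and $n\geq2$ integers, $d=an$, $S=k[x_1,\ldots,x_d]$, and $R=S^{(n)}$ the $n$-th Veronese subring. The algebra $\Gamma=\bigoplus_{i\geq0}\underline{\mathrm{Hom}}_R(S,\Omega^iS)$ is presented by the quiver $Q$ with (a) vertices $\{M_i\mid1\leq i\leq n-1\}\simeq\{1,2,\ldots,n-1\}$, (b) two types of arrows: - $d$ arrows $x_s=x_s^i\colon M_i\to M_{i+1}$, $1\leq s\leq d$, for each $1\leq i<n-1$, - $\binom{d}{2}$ arrows $x_{st}\colon M_{n-1}\to M_1$, $1\leq s<t\leq d$, (c) relations: - $\binom d2$ relations $x_s^{i+1}x_t^i=x_t^{i+1}x_s^i$, $1\leq s<t\leq d$, for each $1\leq i<n-2$, - if $n\geq3$, $\binom d3$ relations $x^1_sx_{tu}-x^1_tx_{su}+x^1_ux_{st}=0$, $1\leq s<t<u\leq d$, and similarly $x_{st}x_u^{n-2}-x_{su}x_t^{n-2}+x_{tu}x_s^{n-2}=0$, $1\leq s<t<u\leq d$, - if $n=2$, $\binom d4$ relations $x_{uv}x_{st}-x_{tv}x_{su}+x_{tu}x_{sv}+x_{sv}x_{tu}-x_{su}x_{tv}+x_{st}x_{uv}=0$ for $1\leq s<t<u<v\leq d$.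
   Context: $S=\bigoplus_{i=0}^{n-1}M_i$ as $R$-modules, where $M_i$ is spanned by the polynomials of degrees congruent to $i$ modulo $n$ (so $M_0=R$). $S$ (and $R$) is graded by giving a monomial of usual degree $cn+j$, $0\leq j\leq n-1$, the degree $c$; $\Omega M$ is the kernel of the projective cover of $M$ in the category of finitely generated graded $R$-modules. $\underline{\mathrm{Hom}}_R$ denotes homomorphisms modulo those factoring through projective modules. The product of $g\in\underline{\mathrm{Hom}}_R(S,\Omega^jS)$ and $f\in\underline{\mathrm{Hom}}_R(S,\Omega^iS)$ in $\Gamma$ is $gf=\Omega^i(g)\circ f$. Paths are composed like maps: $\beta\alpha$ means first $\alpha$, then $\beta$. *)

theory Defs
  imports
    "HOL-Algebra.QuotRing"
    "HOL-Algebra.Module"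
    "HOL-Library.Poly_Mapping"
    "Graph_Theory.Arc_Walk"
begin

section \<open>Modules and homomorphisms\<close>

text \<open>
  The fields \<open>mult\<close> and \<open>one\<close> that a module record inherits from rings carry no meaning for a
  mere module and are left undefined below.
\<close>

text \<open>Homomorphisms are extensional functions, so that they are equal iff they agree on \<open>M\<close>.\<close>

definition mod_hom ::
    "('a, 'r) ring_scheme \<Rightarrow> ('a, 'b, 'm) module_scheme \<Rightarrow> ('a, 'c, 'n) module_scheme \<Rightarrow> ('b \<Rightarrow> 'c) set"
  where "mod_hom R M N = {f \<in> carrier M \<rightarrow>\<^sub>E carrier N.
     (\<forall>x \<in> carrier M. \<forall>y \<in> carrier M. f (x \<oplus>\<^bsub>M\<^esub> y) = f x \<oplus>\<^bsub>N\<^esub> f y) \<and>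
     (\<forall>r \<in> carrier R. \<forall>x \<in> carrier M. f (r \<odot>\<^bsub>M\<^esub> x) = r \<odot>\<^bsub>N\<^esub> f x)}"

definition hom_module ::
    "('a, 'r) ring_scheme \<Rightarrow> ('a, 'b, 'm) module_scheme \<Rightarrow> ('a, 'c, 'n) module_scheme
      \<Rightarrow> ('a, 'b \<Rightarrow> 'c) module"
  where "hom_module R M N =
    \<lparr>carrier = mod_hom R M N, mult = undefined, one = undefined,
     zero = (\<lambda>x \<in> carrier M. \<zero>\<^bsub>N\<^esub>),
     add = (\<lambda>f g. \<lambda>x \<in> carrier M. f x \<oplus>\<^bsub>N\<^esub> g x),
     smult = (\<lambda>r f. \<lambda>x \<in> carrier M. r \<odot>\<^bsub>N\<^esub> f x)\<rparr>"

definition free_module :: "('a, 'r) ring_scheme \<Rightarrow> 'x set \<Rightarrow> ('a, 'x \<Rightarrow> 'a) module"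
  where "free_module R X =
    \<lparr>carrier = {f. (\<forall>x \<in> X. f x \<in> carrier R) \<and> (\<forall>x. x \<notin> X \<longrightarrow> f x = \<zero>\<^bsub>R\<^esub>) \<and>
                 finite {x. f x \<noteq> \<zero>\<^bsub>R\<^esub>}},
     mult = undefined, one = undefined,
     zero = (\<lambda>_. \<zero>\<^bsub>R\<^esub>),
     add = (\<lambda>f g x. f x \<oplus>\<^bsub>R\<^esub> g x),
     smult = (\<lambda>r f x. r \<otimes>\<^bsub>R\<^esub> f x)\<rparr>"

text \<open>
  Projective means direct summand of a free module.  Basis elements may be taken from the carrier
  type of \<open>P\<close>, since a projective module is a summand of the free module on its own elements.
\<close>

definition projective :: "('a, 'r) ring_scheme \<Rightarrow> ('a, 'b, 'm) module_scheme \<Rightarrow> bool"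
  where "projective R P \<longleftrightarrow> Module.module R P \<and>
    (\<exists>(X :: 'b set) s r. s \<in> mod_hom R P (free_module R X) \<and> r \<in> mod_hom R (free_module R X) P \<and>
       (\<forall>x \<in> carrier P. r (s x) = x))"

text \<open>
  HOL cannot quantify over the carrier type of the projective module \<open>Q\<close>.  For finitely generated
  \<open>M\<close>, a map that factors through any projective module factors through some free module of finite
  rank \<open>m\<close>, and \<open>free_module R {..<m}\<close> has carrier type \<open>nat \<Rightarrow> 'a\<close>.
\<close>

definition factors_through_projective ::
    "('a, 'r) ring_scheme \<Rightarrow> ('a, 'b, 'm) module_scheme \<Rightarrow> ('a, 'c, 'n) module_scheme \<Rightarrow> ('b \<Rightarrow> 'c) set"
  where "factors_through_projective R M N = {f \<in> mod_hom R M N.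
    \<exists>(Q :: ('a, nat \<Rightarrow> 'a) module) u v.
      projective R Q \<and> u \<in> mod_hom R M Q \<and> v \<in> mod_hom R Q N \<and> (\<forall>x \<in> carrier M. f x = v (u x))}"

definition stable_class ::
    "('a, 'r) ring_scheme \<Rightarrow> ('a, 'b, 'm) module_scheme \<Rightarrow> ('a, 'c, 'n) module_scheme
      \<Rightarrow> ('b \<Rightarrow> 'c) \<Rightarrow> ('b \<Rightarrow> 'c) set"
  where "stable_class R M N f = factors_through_projective R M N +>\<^bsub>hom_module R M N\<^esub> f"

definition stable_hom ::
    "('a, 'r) ring_scheme \<Rightarrow> ('a, 'b, 'm) module_scheme \<Rightarrow> ('a, 'c, 'n) module_scheme
      \<Rightarrow> ('a, ('b \<Rightarrow> 'c) set) module"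
  where "stable_hom R M N =
    \<lparr>carrier = a_rcosets\<^bsub>hom_module R M N\<^esub> (factors_through_projective R M N),
     mult = undefined, one = undefined,
     zero = factors_through_projective R M N,
     add = set_add (hom_module R M N),
     smult = (\<lambda>r A. \<Union>f \<in> A. stable_class R M N (r \<odot>\<^bsub>hom_module R M N\<^esub> f))\<rparr>"

section \<open>Graded modules, projective covers and syzygies\<close>

record ('a, 'b) gmodule = "('a, 'b) module" +
  component :: "int \<Rightarrow> 'b set"

text \<open>
  A graded ring is represented as a graded module over itself; its \<open>component\<close> field is the grading.
\<close>

definition graded_module :: "('a, 'a) gmodule \<Rightarrow> ('a, 'b) gmodule \<Rightarrow> bool"
  where "graded_module R M \<longleftrightarrow> Module.module R M \<and>
    (\<forall>c. additive_subgroup (component M c) M) \<and>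
    (\<forall>x \<in> carrier M. \<exists>!f. (\<forall>c. f c \<in> component M c) \<and> finite {c. f c \<noteq> \<zero>\<^bsub>M\<^esub>} \<and>
        (\<Oplus>\<^bsub>M\<^esub>c \<in> {c. f c \<noteq> \<zero>\<^bsub>M\<^esub>}. f c) = x) \<and>
    (\<forall>b c. \<forall>r \<in> component R b. \<forall>x \<in> component M c. r \<odot>\<^bsub>M\<^esub> x \<in> component M (b + c))"

definition gmod_hom :: "('a, 'a) gmodule \<Rightarrow> ('a, 'b) gmodule \<Rightarrow> ('a, 'c) gmodule \<Rightarrow> ('b \<Rightarrow> 'c) set"
  where "gmod_hom R M N = {f \<in> mod_hom R M N. \<forall>c. f ` component M c \<subseteq> component N c}"

definition gmod_iso :: "('a, 'a) gmodule \<Rightarrow> ('a, 'b) gmodule \<Rightarrow> ('a, 'c) gmodule \<Rightarrow> ('b \<Rightarrow> 'c) set"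
  where "gmod_iso R M N = {f \<in> mod_hom R M N. bij_betw f (carrier M) (carrier N) \<and>
    (\<forall>c. f ` component M c = component N c)}"

definition finitely_generated :: "('a, 'a) gmodule \<Rightarrow> ('a, 'b) gmodule \<Rightarrow> bool"
  where "finitely_generated R M \<longleftrightarrow> (\<exists>X. finite X \<and> X \<subseteq> carrier M \<and>
    (\<forall>N. submodule N R M \<and> X \<subseteq> N \<longrightarrow> N = carrier M))"

definition grestrict :: "('a, 'b) gmodule \<Rightarrow> 'b set \<Rightarrow> ('a, 'b) gmodule"
  where "grestrict M N = M\<lparr>carrier := N, component := (\<lambda>c. component M c \<inter> N)\<rparr>"

definition graded_submodule :: "'b set \<Rightarrow> ('a, 'a) gmodule \<Rightarrow> ('a, 'b) gmodule \<Rightarrow> bool"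
  where "graded_submodule N R M \<longleftrightarrow> submodule N R M \<and> graded_module R (grestrict M N)"

text \<open>
  \<open>gfree_module R m s\<close> is the graded free module with homogeneous basis elements of degrees
  \<open>s 0, \<dots>, s (m - 1)\<close>.
\<close>

definition gfree_module :: "('a, 'a) gmodule \<Rightarrow> nat \<Rightarrow> (nat \<Rightarrow> int) \<Rightarrow> ('a, nat \<Rightarrow> 'a) gmodule"
  where "gfree_module R m s = module.extend (free_module R {..<m})
    \<lparr>component = (\<lambda>c. {f \<in> carrier (free_module R {..<m}). \<forall>j<m. f j \<in> component R (c - s j)})\<rparr>"

text \<open>Projective objects of the category of finitely generated graded modules.\<close>

definition gprojective :: "('a, 'a) gmodule \<Rightarrow> ('a, 'b) gmodule \<Rightarrow> bool"
  where "gprojective R P \<longleftrightarrow> graded_module R P \<and>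
    (\<exists>m s i r. i \<in> gmod_hom R P (gfree_module R m s) \<and> r \<in> gmod_hom R (gfree_module R m s) P \<and>
       (\<forall>x \<in> carrier P. r (i x) = x))"

definition projective_cover ::
    "('a, 'a) gmodule \<Rightarrow> ('a, 'b) gmodule \<Rightarrow> ('a, 'c) gmodule \<Rightarrow> ('b \<Rightarrow> 'c) \<Rightarrow> bool"
  where "projective_cover R P M p \<longleftrightarrow>
    graded_module R M \<and> finitely_generated R M \<and>
    gprojective R P \<and> finitely_generated R P \<and>
    p \<in> gmod_hom R P M \<and> p ` carrier P = carrier M \<and>
    (\<forall>N. graded_submodule N R P \<and> N <+>\<^bsub>P\<^esub> a_kernel P M p = carrier P \<longrightarrow> N = carrier P)"

text \<open>
  A choice of all syzygies of a graded module \<open>M\<close>: \<open>syz T i\<close> is \<open>\<Omega>\<^sup>iM\<close>, with projective cover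
  \<open>cmap T i : cov T i \<rightarrow> syz T i\<close> whose kernel is \<open>syz T (i + 1)\<close>.  To let all syzygies have one carrier
  type, \<open>\<Omega>\<^sup>0M\<close> is allowed to be an isomorphic copy of \<open>M\<close>, identified with \<open>M\<close> by \<open>aug T\<close>.
\<close>

record ('a, 'b, 'c) syzygies =
  syz :: "nat \<Rightarrow> ('a, 'c) gmodule"
  cov :: "nat \<Rightarrow> ('a, 'c) gmodule"
  cmap :: "nat \<Rightarrow> 'c \<Rightarrow> 'c"
  aug :: "'b \<Rightarrow> 'c"

definition is_syzygies :: "('a, 'a) gmodule \<Rightarrow> ('a, 'b) gmodule \<Rightarrow> ('a, 'b, 'c) syzygies \<Rightarrow> bool"
  where "is_syzygies R M T \<longleftrightarrow>
    aug T \<in> gmod_iso R M (syz T 0) \<and>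
    (\<forall>i. projective_cover R (cov T i) (syz T i) (cmap T i) \<and>
         syz T (Suc i) = grestrict (cov T i) (a_kernel (cov T i) (syz T i) (cmap T i)))"

text \<open>
  \<open>syz_map R M T i j g h\<close>: the map \<open>h : \<Omega>\<^sup>iM \<rightarrow> \<Omega>\<^bsup>i+j\<^esup>M\<close> represents \<open>\<Omega>\<^sup>i(g)\<close> for \<open>g : M \<rightarrow> \<Omega>\<^sup>jM\<close>.
  One application of \<open>\<Omega>\<close> lifts a map to the projective covers and restricts the lift to their
  kernels; the lift, and hence \<open>h\<close>, is unique only modulo maps factoring through projectives.
\<close>

primrec syz_map ::
    "('a, 'a) gmodule \<Rightarrow> ('a, 'b) gmodule \<Rightarrow> ('a, 'b, 'c) syzygies \<Rightarrow> nat \<Rightarrow> nat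
      \<Rightarrow> ('b \<Rightarrow> 'c) \<Rightarrow> ('c \<Rightarrow> 'c) \<Rightarrow> bool"
  where
    "syz_map R M T 0 j g h \<longleftrightarrow>
       h \<in> mod_hom R (syz T 0) (syz T j) \<and> (\<forall>x \<in> carrier M. h (aug T x) = g x)"
  | "syz_map R M T (Suc i) j g h \<longleftrightarrow>
       (\<exists>h' l. syz_map R M T i j g h' \<and>
          l \<in> mod_hom R (cov T i) (cov T (i + j)) \<and>
          (\<forall>x \<in> carrier (cov T i). cmap T (i + j) (l x) = h' (cmap T i x)) \<and>
          h = restrict l (carrier (syz T (Suc i))))"

text \<open>
  The product of stable classes \<open>B\<close> of maps \<open>g : M \<rightarrow> \<Omega>\<^sup>jM\<close> and \<open>A\<close> of maps \<open>f : M \<rightarrow> \<Omega>\<^sup>iM\<close>, namely the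
  stable class of \<open>\<Omega>\<^sup>i(g) \<circ> f\<close>, written as a union over representatives as in \<^const>\<open>rcoset_mult\<close>.
\<close>

definition stable_prod ::
    "('a, 'a) gmodule \<Rightarrow> ('a, 'b) gmodule \<Rightarrow> ('a, 'b, 'c) syzygies \<Rightarrow> nat \<Rightarrow> nat
      \<Rightarrow> ('b \<Rightarrow> 'c) set \<Rightarrow> ('b \<Rightarrow> 'c) set \<Rightarrow> ('b \<Rightarrow> 'c) set"
  where "stable_prod R M T j i B A = (\<Union>f \<in> A. \<Union>g \<in> B. \<Union>h \<in> {h. syz_map R M T i j g h}.
    stable_class R M (syz T (i + j)) (compose (carrier M) h f))"

text \<open>
  The direct sum of the stable groups of maps \<open>M \<rightarrow> \<Omega>\<^sup>iM\<close>; elements are finitely supported families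
  indexed by \<open>i\<close>.  Scalars act through a given ring homomorphism \<open>\<iota>\<close> into \<open>R\<close>.
\<close>

definition homog ::
    "('a, 'a) gmodule \<Rightarrow> ('a, 'b) gmodule \<Rightarrow> ('a, 'b, 'c) syzygies \<Rightarrow> nat \<Rightarrow> ('b \<Rightarrow> 'c) set
      \<Rightarrow> nat \<Rightarrow> ('b \<Rightarrow> 'c) set"
  where "homog R M T i A = (\<lambda>l. if l = i then A else \<zero>\<^bsub>stable_hom R M (syz T l)\<^esub>)"

definition stable_syz_algebra ::
    "('k \<Rightarrow> 'a) \<Rightarrow> ('a, 'a) gmodule \<Rightarrow> ('a, 'b) gmodule \<Rightarrow> ('a, 'b, 'c) syzygies
      \<Rightarrow> ('k, nat \<Rightarrow> ('b \<Rightarrow> 'c) set) module"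
  where "stable_syz_algebra \<iota> R M T =
    \<lparr>carrier = {\<gamma>. (\<forall>i. \<gamma> i \<in> carrier (stable_hom R M (syz T i))) \<and>
                 finite {i. \<gamma> i \<noteq> \<zero>\<^bsub>stable_hom R M (syz T i)\<^esub>}},
     mult = (\<lambda>\<gamma> \<delta> l. \<Oplus>\<^bsub>stable_hom R M (syz T l)\<^esub>i \<in> {..l}.
                stable_prod R M T (l - i) i (\<gamma> (l - i)) (\<delta> i)),
     one = homog R M T 0 (stable_class R M (syz T 0) (aug T)),
     zero = (\<lambda>i. \<zero>\<^bsub>stable_hom R M (syz T i)\<^esub>),
     add = (\<lambda>\<gamma> \<delta> i. \<gamma> i \<oplus>\<^bsub>stable_hom R M (syz T i)\<^esub> \<delta> i),
     smult = (\<lambda>c \<gamma> i. \<iota> c \<odot>\<^bsub>stable_hom R M (syz T i)\<^esub> \<gamma> i)\<rparr>"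

section \<open>Polynomials and the Veronese subring\<close>

type_synonym 'k mpoly = "(nat \<Rightarrow>\<^sub>0 nat) \<Rightarrow>\<^sub>0 'k"

definition mdeg :: "(nat \<Rightarrow>\<^sub>0 nat) \<Rightarrow> nat"
  where "mdeg m = (\<Sum>s \<in> Poly_Mapping.keys m. Poly_Mapping.lookup m s)"

definition Var :: "nat \<Rightarrow> 'k::comm_ring_1 mpoly"
  where "Var s = Poly_Mapping.single (Poly_Mapping.single s 1) 1"

definition Const :: "'k::comm_ring_1 \<Rightarrow> 'k mpoly"
  where "Const c = Poly_Mapping.single 0 c"

definition polys :: "nat \<Rightarrow> 'k::comm_ring_1 mpoly set"
  where "polys d = {p. \<forall>m \<in> Poly_Mapping.keys p. Poly_Mapping.keys m \<subseteq> {1..d}}"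

definition veronese_summand :: "nat \<Rightarrow> nat \<Rightarrow> nat \<Rightarrow> 'k::comm_ring_1 mpoly set"
  where "veronese_summand d n i = {p \<in> polys d. \<forall>m \<in> Poly_Mapping.keys p. mdeg m mod n = i}"

definition gpolys :: "'k::comm_ring_1 mpoly set \<Rightarrow> nat \<Rightarrow> ('k mpoly, 'k mpoly) gmodule"
  where "gpolys A n = \<lparr>carrier = A, mult = (*), one = 1, zero = 0, add = (+), smult = (*),
    component = (\<lambda>c. {p \<in> A. \<forall>m \<in> Poly_Mapping.keys p. int (mdeg m div n) = c})\<rparr>"

definition poly_S :: "nat \<Rightarrow> nat \<Rightarrow> ('k::comm_ring_1 mpoly, 'k mpoly) gmodule"
  where "poly_S d n = gpolys (polys d) n"

definition veronese_R :: "nat \<Rightarrow> nat \<Rightarrow> ('k::comm_ring_1 mpoly, 'k mpoly) gmodule"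
  where "veronese_R d n = gpolys (veronese_summand d n 0) n"

text \<open>The projection of \<open>S\<close> onto its direct summand \<open>M\<^sub>i\<close>.\<close>

definition proj_M :: "nat \<Rightarrow> nat \<Rightarrow> 'k::comm_ring_1 mpoly \<Rightarrow> 'k mpoly"
  where "proj_M n i p = (\<Sum>m \<in> {m \<in> Poly_Mapping.keys p. mdeg m mod n = i}.
    Poly_Mapping.single m (Poly_Mapping.lookup p m))"

section \<open>Path algebras\<close>

text \<open>
  A path is a pair of its start vertex and the list of its arrows in order of traversal (first arrow
  first); the start vertex is needed for trivial paths.
\<close>

definition paths :: "('v, 'e) pre_digraph \<Rightarrow> ('v \<times> 'e list) set"
  where "paths Q = {(u, p). \<exists>v. pre_digraph.awalk Q u p v}"

definition path_mult ::
    "('v, 'e) pre_digraph \<Rightarrow> (('v \<times> 'e list) \<Rightarrow>\<^sub>0 'k) \<Rightarrow> (('v \<times> 'e list) \<Rightarrow>\<^sub>0 'k::comm_ring_1)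
      \<Rightarrow> (('v \<times> 'e list) \<Rightarrow>\<^sub>0 'k)"
  where "path_mult Q g f = (\<Sum>(w, q) \<in> Poly_Mapping.keys g. \<Sum>(u, p) \<in> Poly_Mapping.keys f.
    if pre_digraph.awlast Q u p = w
    then Poly_Mapping.single (u, p @ q) (Poly_Mapping.lookup g (w, q) * Poly_Mapping.lookup f (u, p))
    else 0)"

definition path_algebra ::
    "('v, 'e) pre_digraph \<Rightarrow> ('k::comm_ring_1, ('v \<times> 'e list) \<Rightarrow>\<^sub>0 'k) module"
  where "path_algebra Q =
    \<lparr>carrier = {f. Poly_Mapping.keys f \<subseteq> paths Q},
     mult = path_mult Q,
     one = (\<Sum>v \<in> verts Q. Poly_Mapping.single (v, []) 1),
     zero = 0, add = (+),
     smult = (\<lambda>c. Poly_Mapping.map ((*) c))\<rparr>"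

definition vertex_idem :: "'v \<Rightarrow> ('v \<times> 'e list) \<Rightarrow>\<^sub>0 'k::comm_ring_1"
  where "vertex_idem v = Poly_Mapping.single (v, []) 1"

definition arrow :: "('v, 'e) pre_digraph \<Rightarrow> 'e \<Rightarrow> ('v \<times> 'e list) \<Rightarrow>\<^sub>0 'k::comm_ring_1"
  where "arrow Q e = Poly_Mapping.single (tail Q e, [e]) 1"

section \<open>The quiver and its relations\<close>

text \<open>\<open>X i s\<close> is the arrow \<open>x\<^sub>s\<^sup>i\<close> and \<open>XX s t\<close> is the arrow \<open>x\<^sub>s\<^sub>t\<close>.\<close>

datatype arr = X nat nat | XX nat nat

definition quiverQ :: "nat \<Rightarrow> nat \<Rightarrow> (nat, arr) pre_digraph"
  where "quiverQ d n =
    \<lparr>verts = {1..n - 1},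
     arcs = {X i s | i s. 1 \<le> i \<and> i < n - 1 \<and> 1 \<le> s \<and> s \<le> d} \<union> {XX s t | s t. 1 \<le> s \<and> s < t \<and> t \<le> d},
     tail = (\<lambda>e. case e of X i s \<Rightarrow> i | XX s t \<Rightarrow> n - 1),
     head = (\<lambda>e. case e of X i s \<Rightarrow> i + 1 | XX s t \<Rightarrow> 1)\<rparr>"

definition relationsQ :: "nat \<Rightarrow> nat \<Rightarrow> ((nat \<times> arr list) \<Rightarrow>\<^sub>0 'k::comm_ring_1) set"
  where "relationsQ d n =
    (let kQ = path_algebra (quiverQ d n);
         x = (\<lambda>i s. arrow (quiverQ d n) (X i s));
         y = (\<lambda>s t. arrow (quiverQ d n) (XX s t))
     in {x (i + 1) s \<otimes>\<^bsub>kQ\<^esub> x i t - x (i + 1) t \<otimes>\<^bsub>kQ\<^esub> x i s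
          | i s t. 1 \<le> i \<and> i < n - 2 \<and> 1 \<le> s \<and> s < t \<and> t \<le> d} \<union>
        {x 1 s \<otimes>\<^bsub>kQ\<^esub> y t u - x 1 t \<otimes>\<^bsub>kQ\<^esub> y s u + x 1 u \<otimes>\<^bsub>kQ\<^esub> y s t
          | s t u. n \<ge> 3 \<and> 1 \<le> s \<and> s < t \<and> t < u \<and> u \<le> d} \<union>
        {y s t \<otimes>\<^bsub>kQ\<^esub> x (n - 2) u - y s u \<otimes>\<^bsub>kQ\<^esub> x (n - 2) t + y t u \<otimes>\<^bsub>kQ\<^esub> x (n - 2) s
          | s t u. n \<ge> 3 \<and> 1 \<le> s \<and> s < t \<and> t < u \<and> u \<le> d} \<union>
        {y u v \<otimes>\<^bsub>kQ\<^esub> y s t - y t v \<otimes>\<^bsub>kQ\<^esub> y s u + y t u \<otimes>\<^bsub>kQ\<^esub> y s v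
           + y s v \<otimes>\<^bsub>kQ\<^esub> y t u - y s u \<otimes>\<^bsub>kQ\<^esub> y t v + y s t \<otimes>\<^bsub>kQ\<^esub> y u v
          | s t u v. n = 2 \<and> 1 \<le> s \<and> s < t \<and> t < u \<and> u < v \<and> v \<le> d})"

end

theory Submission
  imports Defs
begin

text \<open>
  The algebra \<open>\<Gamma>\<close> is computed from an explicit minimal resolution of
  \<open>S\<close> over \<open>R\<close>.

  Let \<open>W\<^sub>c\<close> be the vector space of minimal generators of
  \<open>\<Omega>\<^sup>cS\<close>. The projective cover of \<open>\<Omega>\<^sup>cS\<close> is
  \<open>R \<otimes> W\<^sub>c\<close>, and since \<open>W\<^sub>0\<close> consists of the
  polynomials of degree less than \<open>n\<close>, all these modules sit in tensor powers of
  \<open>S\<close>. A tensor power of \<open>S\<close> is again a polynomial ring, in the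
  variables \<open>x\<^bsub>s+pd\<^esub>\<close> with \<open>s \<in> {1..d}\<close> and a tensor
  position \<open>p\<close>; \<open>R\<close> acts on position \<open>0\<close>, and the cover map
  multiplies positions \<open>0\<close> and \<open>1\<close> together. So
  \<open>\<Omega>\<^bsup>c+1\<^esup>S\<close> is the set of polynomials in \<open>R \<otimes>
  W\<^sub>c\<close> that vanish when the two positions are merged (\<open>syzygies_model\<close>).

  A path \<open>p\<close> of the quiver with \<open>c\<close> arrows of type
  \<open>x\<^sub>s\<^sub>t\<close> and source \<open>M\<^sub>i\<close> gives a polynomial: an
  arrow \<open>x\<^sub>s\<close> multiplies by \<open>x\<^sub>s\<close>, and an arrow
  \<open>x\<^sub>s\<^sub>t\<close> is the syzygy \<open>x\<^sub>t \<otimes> x\<^sub>s - x\<^sub>s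
  \<otimes> x\<^sub>t\<close>, which opens a new tensor position. Call \<open>p\<close> a ribbon
  path if the lower index of each arrow is at most the upper index of the next one. A path that
  violates this can be rewritten by one of the relations, and repeating this ends
  (\<open>straight_all\<close>), so ribbon paths span the path algebra modulo the relations.
  Conversely the polynomials of ribbon paths have distinct leading monomials, hence are
  independent (\<open>ribbon_independent\<close>), and they span the part \<open>Gens c i\<close>
  of lowest degree in \<open>Hom\<^sub>R(M\<^sub>i, \<Omega>\<^sup>cS)\<close>
  (\<open>Gens_span\<close>); the spanning statement comes from the same rewriting applied to the
  kernel of the merging map.

  It remains to see that these parts of lowest degree are the stable maps. Since \<open>S\<close>
  is a factorial domain with at least two variables, every \<open>R\<close>-linear map from
  \<open>M\<^sub>i\<close> to a syzygy is multiplication by a polynomial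
  (\<open>linear_is_multiplication\<close>). For \<open>i \<noteq> 0\<close> such a map factors
  through a projective module exactly when the multiplier has no component in the lowest degree
  (\<open>FP_iff\<close>): a map from \<open>M\<^sub>i\<close> to \<open>R\<close> never has a
  unit in its image, and conversely a multiplier of higher degree is a sum of products of an
  element of \<open>Hom\<^sub>R(M\<^sub>i, R)\<close> and a generator. For \<open>i = 0\<close>
  every map does, as \<open>M\<^sub>0 = R\<close>. Finally \<open>\<Omega>\<^sup>c(g)\<close> is
  represented by applying the multiplier \<open>g\<close> in the last tensor position
  (\<open>syz_map_exists\<close>), so the product of \<open>\<Gamma>\<close> becomes concatenation
  of paths (\<open>path_eval_mult\<close>). The map from the path algebra to
  \<open>\<Gamma>\<close> is therefore a surjective ring homomorphism; its kernel contains the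
  relations, and equals the ideal they generate by comparison of the two bases
  (\<open>ker_eval_rel_ideal\<close>).
\<close>

section \<open>Linear extension of maps on monomials\<close>

type_synonym expo = "nat \<Rightarrow>\<^sub>0 nat"

abbreviation coef :: "('a \<Rightarrow>\<^sub>0 'b::zero) \<Rightarrow> 'a \<Rightarrow> 'b" where "coef \<equiv> Poly_Mapping.lookup"
abbreviation supp :: "('a \<Rightarrow>\<^sub>0 'b::zero) \<Rightarrow> 'a set" where "supp \<equiv> Poly_Mapping.keys"
abbreviation mon :: "'a \<Rightarrow> ('a \<Rightarrow>\<^sub>0 'k::comm_ring_1)" where "mon m \<equiv> Poly_Mapping.single m 1"
abbreviation unit_expo :: "nat \<Rightarrow> expo" where "unit_expo v \<equiv> Poly_Mapping.single v (Suc 0)"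

lemma poly_mapping_sum_singles:
  fixes p :: "'a \<Rightarrow>\<^sub>0 'b::comm_monoid_add"
  shows "(\<Sum>m\<in>supp p. Poly_Mapping.single m (coef p m)) = p"
proof (rule poly_mapping_eqI)
  fix k
  show "coef (\<Sum>m\<in>supp p. Poly_Mapping.single m (coef p m)) k = coef p k"
    by (cases "k \<in> supp p")
      (auto simp: lookup_sum lookup_single when_def in_keys_iff sum.delta cong: if_cong)
qed

lemma poly_mapping_induct [case_names zero single add]:
  fixes p :: "'a \<Rightarrow>\<^sub>0 'b::comm_monoid_add"
  assumes "P 0" "\<And>m c. P (Poly_Mapping.single m c)" "\<And>p q. P p \<Longrightarrow> P q \<Longrightarrow> P (p + q)"
  shows "P p"
proof -
  have "P (\<Sum>m\<in>A. Poly_Mapping.single m (coef p m))" if "finite A" for A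
    using that by induction (auto intro: assms)
  from this[of "supp p"] show ?thesis by (simp add: poly_mapping_sum_singles)
qed

lemma Const_0 [simp]: "Const 0 = 0" by (simp add: Const_def)
lemma Const_1 [simp]: "Const 1 = 1" by (simp add: Const_def)
lemma Const_add: "Const (a + b) = Const a + Const b" by (simp add: Const_def single_add)
lemma Const_mult: "Const (a * b) = Const a * Const b" by (simp add: Const_def mult_single)
lemma Const_times_single: "Const a * Poly_Mapping.single m b = Poly_Mapping.single m (a * b)"
  by (simp add: Const_def mult_single)
lemma single_conv_Const: "Poly_Mapping.single m c = Const c * mon m"
  by (simp add: Const_times_single)

lemma coef_Const_times [simp]: "coef (Const a * p) m = a * coef p m"
proof (induction p rule: poly_mapping_induct)
  case (single m c) then show ?case by (simp add: Const_times_single lookup_single when_def)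
qed (auto simp: lookup_add algebra_simps)

lemma map_scale_conv_Const: "Poly_Mapping.map ((*) c) (p :: 'k::comm_ring_1 mpoly) = Const c * p"
  by (simp add: Const_def mult_map_scale_conv_mult)

lemma coef_mon_times [simp]: "coef (mon (m :: expo) * p) (m + l) = coef p l"
proof (induction p rule: poly_mapping_induct)
  case (single k c) then show ?case by (auto simp: mult_single lookup_single when_def)
qed (auto simp: lookup_add algebra_simps)

lemma supp_mon_times: "supp (mon (m :: expo) * p) = (\<lambda>l. m + l) ` supp p"
proof
  show "supp (mon m * p) \<subseteq> (\<lambda>l. m + l) ` supp p"
  proof
    fix x assume "x \<in> supp (mon m * p)"
    then show "x \<in> (\<lambda>l. m + l) ` supp p"
      using keys_mult[of "mon m" p] by (fastforce split: if_splits)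
  qed
  show "(\<lambda>l. m + l) ` supp p \<subseteq> supp (mon m * p)"
    by (auto simp: in_keys_iff)
qed

definition lin :: "('a \<Rightarrow> 'k::comm_ring_1 mpoly) \<Rightarrow> ('a \<Rightarrow>\<^sub>0 'k) \<Rightarrow> 'k mpoly"
  where "lin g p = (\<Sum>m\<in>supp p. Const (coef p m) * g m)"

lemma lin_superset:
  assumes "finite A" "supp p \<subseteq> A"
  shows "lin g p = (\<Sum>m\<in>A. Const (coef p m) * g m)"
  unfolding lin_def by (rule sum.mono_neutral_left) (use assms in \<open>auto simp: in_keys_iff\<close>)

lemma lin_0 [simp]: "lin g 0 = 0" by (simp add: lin_def)

lemma lin_add: "lin g (p + q) = lin g p + lin g q"
proof -
  have f: "finite (supp p \<union> supp q)" by simp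
  show ?thesis
    by (subst (1 2 3) lin_superset[OF f])
      (use keys_add[of p q] in \<open>auto simp: lookup_add Const_add algebra_simps sum.distrib\<close>)
qed

lemma lin_single [simp]: "lin g (Poly_Mapping.single m c) = Const c * g m"
  by (cases "c = 0") (simp_all add: lin_def)

lemma lin_sum: "lin g (sum f A) = (\<Sum>a\<in>A. lin g (f a))"
  by (induction A rule: infinite_finite_induct) (auto simp: lin_add)

lemma lin_minus: "lin g (- p) = - lin g p"
  using lin_add[of g p "- p"] by (simp add: eq_neg_iff_add_eq_0 add.commute)

lemma lin_diff: "lin g (p - q) = lin g p - lin g q"
  using lin_add[of g p "- q"] lin_minus[of g q] by simp

lemma coef_map_scale: "coef (Poly_Mapping.map ((*) c) p) k = c * coef p (k :: 'a) "
  for c :: "'k::comm_ring_1"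
  by (simp add: map.rep_eq when_def)

lemma lin_scale:
  fixes g :: "'a \<Rightarrow> 'k::comm_ring_1 mpoly"
  shows "lin g (Poly_Mapping.map ((*) c) p) = Const c * lin g p"
proof (induction p rule: poly_mapping_induct)
  case (single m a) then show ?case by (simp add: Const_mult mult.assoc)
next
  case (add p q)
  have "Poly_Mapping.map ((*) c) (p + q) = Poly_Mapping.map ((*) c) p + Poly_Mapping.map ((*) c) q"
    by (rule poly_mapping_eqI)
      (simp add: lookup_add coef_map_scale algebra_simps)
  with add show ?case by (simp add: lin_add distrib_left)
next
  case zero
  have "Poly_Mapping.map ((*) c) 0 = (0 :: 'a \<Rightarrow>\<^sub>0 'k)"
    by (rule poly_mapping_eqI) (simp add: coef_map_scale)
  then show ?case by simp
qed

lemma lin_Const_times: "lin g (Const c * p) = Const c * lin g p"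
  using lin_scale[of g c p] by (simp only: map_scale_conv_Const)

lemma lin_unique:
  assumes "\<And>p q. F (p + q) = F p + F q" "\<And>c m. F (Poly_Mapping.single m c) = Const c * g m"
  shows "F p = lin g p"
proof -
  have "F 0 = 0" using assms(1)[of 0 0] by simp
  then show ?thesis by (induction p rule: poly_mapping_induct) (auto simp: assms lin_add)
qed

lemma lin_expand:
  assumes "\<And>p q. F (p + q) = F p + F q" "\<And>c p. F (Const c * p) = Const c * F p"
  shows "F p = lin (\<lambda>m. F (mon m)) p"
proof (rule lin_unique)
  fix c and m :: "nat \<Rightarrow>\<^sub>0 nat"
  show "F (Poly_Mapping.single m c) = Const c * F (mon m)"
    by (subst single_conv_Const) (rule assms(2))
qed (rule assms(1))

lemma lin_times_left: "lin (\<lambda>m. q * g m) p = q * lin g p"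
  by (induction p rule: poly_mapping_induct) (auto simp: lin_add algebra_simps)

lemma lin_zero_fun [simp]: "lin (\<lambda>m. 0) p = 0"
  by (simp add: lin_def)

lemma lin_cong: "(\<And>m. m \<in> supp p \<Longrightarrow> g m = h m) \<Longrightarrow> lin g p = lin h p"
  by (simp add: lin_def)

lemma lin_mon_id [simp]: "lin mon p = p"
  by (rule lin_unique[symmetric, of "\<lambda>p. p"]) (auto simp: Const_times_single)

lemma lin_comp: "lin g (lin h p) = lin (\<lambda>m. lin g (h m)) p"
  by (rule lin_unique[of "\<lambda>p. lin g (lin h p)"]) (auto simp: lin_add lin_Const_times)

lemma lin_mult:
  fixes g :: "expo \<Rightarrow> 'k::comm_ring_1 mpoly"
  assumes "\<And>m m'. g (m + m') = g m * g m'"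
  shows "lin g (p * q) = lin g p * lin g q"
proof (induction p rule: poly_mapping_induct)
  case (single m c)
  show ?case
    by (induction q rule: poly_mapping_induct)
      (auto simp: mult_single Const_mult assms lin_add algebra_simps)
qed (auto simp: lin_add algebra_simps)

definition part :: "('a \<Rightarrow> bool) \<Rightarrow> ('a \<Rightarrow>\<^sub>0 'k) \<Rightarrow> ('a \<Rightarrow>\<^sub>0 'k::comm_ring_1)"
  where "part P p = (\<Sum>m \<in> {m \<in> supp p. P m}. Poly_Mapping.single m (coef p m))"

lemma coef_part: "coef (part P p) m = (if P m then coef p m else 0)"
proof -
  have "finite {m \<in> supp p. P m}" by simp
  then show ?thesis
    by (cases "m \<in> {m \<in> supp p. P m}")
      (auto simp: part_def lookup_sum lookup_single when_def sum.delta in_keys_iff cong: if_cong)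
qed

lemma supp_part: "supp (part P p) = {m \<in> supp p. P m}"
  by (auto simp: in_keys_iff coef_part split: if_splits)

lemma part_add: "part P (p + q) = part P p + part P q"
  by (rule poly_mapping_eqI) (simp add: coef_part lookup_add)

lemma part_zero [simp]: "part P 0 = 0" by (simp add: part_def)

lemma part_Const_times: "part P (Const c * p) = Const c * part P (p :: 'k::comm_ring_1 mpoly)"
  by (rule poly_mapping_eqI) (simp add: coef_part)

lemma part_eqI: "(\<And>m. m \<in> supp p \<Longrightarrow> P m) \<Longrightarrow> part P p = p"
  by (rule poly_mapping_eqI) (auto simp: coef_part in_keys_iff)

lemma part_eq_0: "(\<And>m. m \<in> supp p \<Longrightarrow> \<not> P m) \<Longrightarrow> part P p = 0"
  by (rule poly_mapping_eqI) (auto simp: coef_part in_keys_iff)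

lemma part_split: "p = part P p + part (\<lambda>m. \<not> P m) p"
  by (rule poly_mapping_eqI) (auto simp: coef_part lookup_add)

text \<open>If all terms of \<open>q\<close> change the property in the same way, multiplication by
  \<open>q\<close> commutes with selecting terms; this is how a selection by a residue of the
  degree passes through homogeneous factors.\<close>
lemma part_times_shift:
  fixes p q :: "'k::comm_ring_1 mpoly"
  assumes "\<And>l m. l \<in> supp q \<Longrightarrow> m \<in> supp p \<Longrightarrow> P (l + m) \<longleftrightarrow> P' m"
  shows "part P (q * p) = q * part P' p"
proof -
  have eq: "q * p = q * part P' p + q * part (\<lambda>m. \<not> P' m) p"
    by (subst part_split[of p P']) (simp add: algebra_simps)
  have "part P (q * part P' p) = q * part P' p"
    using keys_mult[of q "part P' p"] by (intro part_eqI) (auto simp: supp_part dest!: subsetD intro!: assms[THEN iffD2])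
  moreover have "part P (q * part (\<lambda>m. \<not> P' m) p) = 0"
    using keys_mult[of q "part (\<lambda>m. \<not> P' m) p"]
    by (intro part_eq_0) (auto simp: supp_part assms dest!: subsetD)
  ultimately show ?thesis by (subst eq) (simp add: part_add)
qed

section \<open>Polynomials as a vector space\<close>

text \<open>Scalars of the field are constant polynomials, so \<open>kv\<close> provides spans and
  independence over the field.\<close>
interpretation kv: vector_space "\<lambda>(c :: 'k::field) (p :: 'k mpoly). Const c * p"
  by unfold_locales (auto simp: algebra_simps Const_add Const_mult)

lemma kv_linear_span:
  assumes "\<And>p q. F (p + q) = F p + F q" "\<And>c p. F (Const c * p) = Const c * F p"
    and "x \<in> kv.span A" "\<And>a. a \<in> A \<Longrightarrow> F a \<in> kv.span B"
  shows "F x \<in> kv.span (B :: 'k::field mpoly set)"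
proof -
  have F0: "F 0 = 0" using assms(2)[of 0 0] by simp
  show ?thesis
    using assms(3)
  proof (induction rule: kv.span_induct)
    case base show ?case
      by (rule kv.subspaceI) (auto simp: F0 assms(1,2) intro: kv.span_add kv.span_scale kv.span_zero)
  next
    case (step x) then show ?case using assms(4) by simp
  qed
qed

text \<open>Comparing coefficients at the leading monomial of smallest weight among the terms with a nonzero
  coefficient: no other term reaches that monomial. A weight that is minimal exactly at the
  leading monomial of each polynomial can replace a monomial order.\<close>
lemma leading_independent:
  fixes g :: "'i \<Rightarrow> 'k::field mpoly" and weight :: "expo \<Rightarrow> nat"
  assumes fin: "finite F" and inj: "inj_on l F"
    and lead: "\<And>a. a \<in> F \<Longrightarrow> coef (g a) (l a) \<noteq> 0"
    and weight: "\<And>a m. a \<in> F \<Longrightarrow> m \<in> supp (g a) \<Longrightarrow> m = l a \<or> weight (l a) < weight m"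
    and sum0: "(\<Sum>a\<in>F. Const (c a) * g a) = 0" and "a \<in> F"
  shows "c a = 0"
proof (rule ccontr)
  assume "c a \<noteq> 0"
  define N where "N = {a \<in> F. c a \<noteq> 0}"
  have "finite N" "a \<in> N" using fin \<open>a \<in> F\<close> \<open>c a \<noteq> 0\<close> by (auto simp: N_def)
  then obtain b where b: "b \<in> N" "\<And>x. x \<in> N \<Longrightarrow> weight (l b) \<le> weight (l x)"
    using ex_has_least_nat[of "\<lambda>x. x \<in> N" a "\<lambda>x. weight (l x)"] by blast
  have "c x * coef (g x) (l b) = 0" if "x \<in> F" "x \<noteq> b" for x
  proof (cases "x \<in> N")
    case True
    have "l x \<noteq> l b" using inj that b(1) by (auto simp: N_def inj_on_def)
    then have "l b \<notin> supp (g x)" using weight[OF that(1), of "l b"] b(2)[OF True] by auto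
    then show ?thesis by (simp add: in_keys_iff)
  qed (use that in \<open>simp add: N_def\<close>)
  then have "(\<Sum>x\<in>F. c x * coef (g x) (l b)) = c b * coef (g b) (l b)"
    using fin b(1) by (subst sum.remove[of _ b]) (auto simp: N_def simp del: mult_eq_0_iff intro!: sum.neutral)
  moreover have "(\<Sum>x\<in>F. c x * coef (g x) (l b)) = 0"
    using arg_cong[OF sum0, of "\<lambda>p. coef p (l b)"] by (simp add: lookup_sum)
  ultimately show False using b(1) lead[of b] by (auto simp: N_def)
qed

section \<open>Tensor positions\<close>

locale veronese =
  fixes d n :: nat
  assumes d2: "2 \<le> d" and n2: "2 \<le> n"
begin

text \<open>A monomial in the variables \<open>x\<^bsub>s+pd\<^esub>\<close> is a tensor of monomials in
  \<open>x\<^sub>1, \<dots>, x\<^sub>d\<close>, one for each position \<open>p\<close>. Here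
  \<open>low\<close> is its factor at position \<open>0\<close>, \<open>high\<close> is the tensor
  of the remaining factors moved down by one position, and \<open>shift_expo\<close> moves all
  factors up by one position. The index \<open>0\<close> names no variable; keeping it fixed makes
  the three maps total.\<close>
definition low :: "expo \<Rightarrow> expo"
  where "low m = Abs_poly_mapping (\<lambda>v. if v \<in> {1..d} then coef m v else 0)"

definition high :: "expo \<Rightarrow> expo"
  where "high m = Abs_poly_mapping (\<lambda>v. if v = 0 then coef m 0 else coef m (v + d))"

definition shift_expo :: "expo \<Rightarrow> expo"
  where "shift_expo m = Abs_poly_mapping (\<lambda>v. if v = 0 then coef m 0 else if v \<le> d then 0 else coef m (v - d))"

lemma coef_low: "coef (low m) v = (if v \<in> {1..d} then coef m v else 0)"
proof -
  have "finite {v. (if v \<in> {1..d} then coef m v else 0) \<noteq> 0}"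
    by (rule finite_subset[of _ "supp m"]) (auto simp: in_keys_iff split: if_splits)
  then show ?thesis unfolding low_def by (subst lookup_Abs_poly_mapping) auto
qed

lemma coef_high: "coef (high m) v = (if v = 0 then coef m 0 else coef m (v + d))"
proof -
  have "{v. (if v = 0 then coef m 0 else coef m (v + d)) \<noteq> 0} \<subseteq> insert 0 ((\<lambda>v. v - d) ` supp m)"
  proof
    fix v assume "v \<in> {v. (if v = 0 then coef m 0 else coef m (v + d)) \<noteq> 0}"
    then have "v = 0 \<or> v + d \<in> supp m \<and> v = (v + d) - d"
      by (auto simp: in_keys_iff split: if_splits)
    then show "v \<in> insert 0 ((\<lambda>v. v - d) ` supp m)" by blast
  qed
  then have "finite {v. (if v = 0 then coef m 0 else coef m (v + d)) \<noteq> 0}"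
    by (rule finite_subset) auto
  then show ?thesis unfolding high_def by (subst lookup_Abs_poly_mapping) auto
qed

lemma coef_shift_expo: "coef (shift_expo m) v = (if v = 0 then coef m 0 else if v \<le> d then 0 else coef m (v - d))"
proof -
  have "{v. (if v = 0 then coef m 0 else if v \<le> d then 0 else coef m (v - d)) \<noteq> 0}
    \<subseteq> insert 0 ((\<lambda>v. v + d) ` supp m)"
  proof
    fix v assume "v \<in> {v. (if v = 0 then coef m 0 else if v \<le> d then 0 else coef m (v - d)) \<noteq> 0}"
    then have "v = 0 \<or> v - d \<in> supp m \<and> v = (v - d) + d"
      by (auto simp: in_keys_iff split: if_splits)
    then show "v \<in> insert 0 ((\<lambda>v. v + d) ` supp m)" by blast
  qed
  then have "finite {v. (if v = 0 then coef m 0 else if v \<le> d then 0 else coef m (v - d)) \<noteq> 0}"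
    by (rule finite_subset) auto
  then show ?thesis unfolding shift_expo_def by (subst lookup_Abs_poly_mapping) auto
qed

lemmas expo_coefs = coef_low coef_high coef_shift_expo lookup_add

lemma low_add: "low (m + m') = low m + low m'" by (rule poly_mapping_eqI) (simp add: expo_coefs)
lemma high_add: "high (m + m') = high m + high m'" by (rule poly_mapping_eqI) (simp add: expo_coefs)
lemma shift_expo_add: "shift_expo (m + m') = shift_expo m + shift_expo m'" by (rule poly_mapping_eqI) (simp add: expo_coefs)
lemma low_0 [simp]: "low 0 = 0" by (rule poly_mapping_eqI) (simp add: expo_coefs)
lemma high_0 [simp]: "high 0 = 0" by (rule poly_mapping_eqI) (simp add: expo_coefs)
lemma shift_expo_0 [simp]: "shift_expo 0 = 0" by (rule poly_mapping_eqI) (simp add: expo_coefs)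
lemma low_low [simp]: "low (low m) = low m" by (rule poly_mapping_eqI) (simp add: expo_coefs)
lemma high_low [simp]: "high (low m) = 0" by (rule poly_mapping_eqI) (use d2 in \<open>simp add: expo_coefs\<close>)
lemma low_shift_expo [simp]: "low (shift_expo m) = 0" by (rule poly_mapping_eqI) (simp add: expo_coefs)
lemma high_shift_expo [simp]: "high (shift_expo m) = m" by (rule poly_mapping_eqI) (use d2 in \<open>simp add: expo_coefs\<close>)
lemma low_plus_shift_expo_high: "low m + shift_expo (high m) = m"
  by (rule poly_mapping_eqI) (auto simp: expo_coefs)

lemma low_id_iff: "low m = m \<longleftrightarrow> supp m \<subseteq> {1..d}"
proof
  assume "low m = m"
  then show "supp m \<subseteq> {1..d}"
    by (auto simp: in_keys_iff) (metis coef_low atLeastAtMost_iff not_gr_zero One_nat_def not_less_eq_eq)+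
next
  assume "supp m \<subseteq> {1..d}"
  then show "low m = m"
    by (intro poly_mapping_eqI) (auto simp: expo_coefs in_keys_iff)
qed

lemma low_unit: "v \<in> {1..d} \<Longrightarrow> low (unit_expo v) = unit_expo v"
  by (simp add: low_id_iff)

lemma high_of_low: "low m = m \<Longrightarrow> high m = 0"
  by (metis high_low)

definition deg0 :: "expo \<Rightarrow> nat" where "deg0 m = (\<Sum>v\<in>{1..d}. coef m v)"

lemma deg0_add [simp]: "deg0 (m + m') = deg0 m + deg0 m'"
  by (simp add: deg0_def lookup_add sum.distrib)

lemma deg0_0 [simp]: "deg0 0 = 0" by (simp add: deg0_def)
lemma deg0_low [simp]: "deg0 (low m) = deg0 m" by (simp add: deg0_def coef_low)
lemma deg0_shift_expo [simp]: "deg0 (shift_expo m) = 0" by (simp add: deg0_def coef_shift_expo)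
lemma deg0_unit [simp]: "v \<in> {1..d} \<Longrightarrow> deg0 (unit_expo v) = 1"
  by (simp add: deg0_def lookup_single when_def)

lemma deg0_mdeg: "low m = m \<Longrightarrow> deg0 m = mdeg m"
  unfolding deg0_def mdeg_def low_id_iff
  by (rule sum.mono_neutral_right) (auto simp: in_keys_iff)

lemma deg0_single: "v \<in> {1..d} \<Longrightarrow> deg0 (Poly_Mapping.single v e) = e"
  by (simp add: deg0_def lookup_single when_def)

lemma low_eq_0_iff: "low m = 0 \<longleftrightarrow> deg0 m = 0"
proof
  assume "deg0 m = 0" then show "low m = 0"
    by (intro poly_mapping_eqI) (auto simp: deg0_def coef_low)
qed (metis deg0_0 deg0_low)

lemma low_peel:
  assumes "low u = u" "u \<noteq> 0"
  obtains s u' where "s \<in> {1..d}" "u = u' + unit_expo s" "low u' = u'" "supp u' \<subseteq> {1..s}"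
    "supp u \<subseteq> {1..s}" "s \<in> supp u" "deg0 u = Suc (deg0 u')"
proof -
  define s where "s = Max (supp u)"
  have ne: "supp u \<noteq> {}" using assms(2) by simp
  have s: "s \<in> supp u" "\<And>v. v \<in> supp u \<Longrightarrow> v \<le> s"
    using Max_in[OF finite_keys ne] by (auto simp: s_def)
  have ud: "supp u \<subseteq> {1..d}" using assms(1) by (simp add: low_id_iff)
  define u' where "u' = u - unit_expo s"
  have u: "u = u' + unit_expo s"
    by (rule poly_mapping_eqI)
      (use s(1) in \<open>auto simp: u'_def lookup_minus lookup_add lookup_single when_def in_keys_iff\<close>)
  have k: "supp u' \<subseteq> supp u" by (auto simp: in_keys_iff u lookup_add)
  have sd: "s \<in> {1..d}" using s ud by auto
  show ?thesis
  proof
    show "supp u' \<subseteq> {1..s}" "supp u \<subseteq> {1..s}" using k ud s(2) by fastforce+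
    show "low u' = u'" using k ud by (auto simp: low_id_iff)
    show "deg0 u = Suc (deg0 u')" using sd by (subst u) simp
  qed (use u s sd in auto)
qed

lemma low_split:
  assumes "low u = u" "k \<le> deg0 u"
  obtains u1 u2 where "u = u1 + u2" "deg0 u2 = k" "low u1 = u1" "low u2 = u2"
    "supp u1 \<subseteq> supp u" "supp u2 \<subseteq> supp u"
proof -
  have "\<exists>u1 u2. u = u1 + u2 \<and> deg0 u2 = k \<and> low u1 = u1 \<and> low u2 = u2
      \<and> supp u1 \<subseteq> supp u \<and> supp u2 \<subseteq> supp u"
    using assms(2)
  proof (induction k)
    case 0 then show ?case using assms(1) by (intro exI[of _ u] exI[of _ 0]) auto
  next
    case (Suc k)
    then obtain u1 u2 where h: "u = u1 + u2" "deg0 u2 = k" "low u1 = u1" "low u2 = u2" by auto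
    then have "u1 \<noteq> 0" using Suc(2) by auto
    then obtain s u' where s: "s \<in> {1..d}" "u1 = u' + unit_expo s" "low u' = u'"
      using low_peel[OF h(3)] by metis
    have "supp a \<subseteq> supp (a + b)" "supp b \<subseteq> supp (a + b)" for a b :: expo
      by (auto simp: in_keys_iff lookup_add)
    moreover have "u = u' + (u2 + unit_expo s)" using h s by (simp add: algebra_simps)
    ultimately show ?case
      using s h by (intro exI[of _ u'] exI[of _ "u2 + unit_expo s"]) (auto simp: low_add low_unit)
  qed
  with that show ?thesis by blast
qed

section \<open>Shifting, merging and slicing polynomials\<close>

text \<open>The functions on polynomials induced by the maps on monomials: \<open>shift w\<close> is \<open>1
  \<otimes> w\<close>, \<open>merge\<close> multiplies the positions \<open>0\<close> and
  \<open>1\<close>, and \<open>slice u t\<close> is the coefficient in \<open>t\<close> of the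
  monomial \<open>u\<close> at position \<open>0\<close>.\<close>
definition shift :: "'k::field mpoly \<Rightarrow> 'k mpoly" where "shift = lin (\<lambda>m. mon (shift_expo m))"
definition merge :: "'k::field mpoly \<Rightarrow> 'k mpoly" where "merge = lin (\<lambda>m. mon (low m + high m))"
definition slice :: "expo \<Rightarrow> 'k::field mpoly \<Rightarrow> 'k mpoly"
  where "slice u = lin (\<lambda>m. if low m = u then mon (high m) else 0)"

lemma shift_add: "shift (p + q) = shift p + shift q" by (simp add: shift_def lin_add)
lemma shift_diff: "shift (p - q) = shift p - shift q" by (simp add: shift_def lin_diff)
lemma shift_0 [simp]: "shift 0 = 0" by (simp add: shift_def)
lemma shift_mult: "shift (p * q) = shift p * shift q"
  unfolding shift_def by (rule lin_mult) (simp add: mult_single shift_expo_add)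
lemma shift_mon: "shift (mon m) = mon (shift_expo m)" by (simp add: shift_def)
lemma shift_Const [simp]: "shift (Const c) = Const c"
  by (simp add: shift_def Const_def mult_single)
lemma shift_Const_times: "shift (Const c * p) = Const c * shift p" by (simp add: shift_mult)

lemma merge_add: "merge (p + q) = merge p + merge q" by (simp add: merge_def lin_add)
lemma merge_diff: "merge (p - q) = merge p - merge q" by (simp add: merge_def lin_diff)
lemma merge_0 [simp]: "merge 0 = 0" by (simp add: merge_def)
lemma merge_mult: "merge (p * q) = merge p * merge q"
  unfolding merge_def by (rule lin_mult) (simp add: mult_single low_add high_add algebra_simps)
lemma merge_sum: "merge (sum f A) = (\<Sum>a\<in>A. merge (f a))" by (simp add: merge_def lin_sum)
lemma merge_Const [simp]: "merge (Const c) = Const c"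
  by (simp add: merge_def Const_def mult_single)
lemma merge_Const_times: "merge (Const c * p) = Const c * merge p" by (simp add: merge_mult)
lemma merge_shift [simp]: "merge (shift p) = p"
  by (simp add: merge_def shift_def lin_comp)

lemma slice_add: "slice u (p + q) = slice u p + slice u q" by (simp add: slice_def lin_add)
lemma slice_0 [simp]: "slice u 0 = 0" by (simp add: slice_def)
lemma slice_sum: "slice u (sum f A) = (\<Sum>a\<in>A. slice u (f a))" by (simp add: slice_def lin_sum)
lemma slice_Const_times: "slice u (Const c * p) = Const c * slice u p" by (simp add: slice_def lin_Const_times)
lemma slice_mon: "slice u (mon m) = (if low m = u then mon (high m) else 0)" by (simp add: slice_def)

lemma polys_low: "p \<in> polys d \<longleftrightarrow> (\<forall>m\<in>supp p. low m = m)"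
  by (auto simp: polys_def low_id_iff)

lemma merge_polys: assumes "p \<in> polys d" shows "merge p = p"
proof -
  have "lin (\<lambda>m. mon (low m + high m)) p = lin mon p"
    using assms by (intro lin_cong) (auto simp: polys_low high_of_low)
  then show ?thesis by (simp add: merge_def)
qed

lemma coef_slice: "coef (slice u p) m = (if low u = u then coef p (u + shift_expo m) else 0)"
proof (induction p rule: poly_mapping_induct)
  case (single k c)
  show ?case
  proof (cases "low k = u \<and> high k = m")
    case True
    then have "k = u + shift_expo m" using low_plus_shift_expo_high[of k] by auto
    moreover have "low u = u" using True low_low[of k] by metis
    ultimately show ?thesis using True by (simp add: slice_def)
  next
    case False
    have "k = u + shift_expo m \<Longrightarrow> low u = u \<Longrightarrow> False" using False by (auto simp: low_add high_add high_of_low)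
    then show ?thesis using False by (auto simp: slice_def lookup_single when_def)
  qed
qed (auto simp: slice_add lookup_add)

lemma coef_shift: "coef (shift p) m = (if low m = 0 then coef p (high m) else 0)"
proof (induction p rule: poly_mapping_induct)
  case (single k c)
  have "shift_expo k = m \<longleftrightarrow> low m = 0 \<and> k = high m"
    using low_plus_shift_expo_high[of m] by auto
  then show ?case by (auto simp: shift_def lookup_single when_def)
qed (auto simp: shift_add lookup_add)

lemma supp_shift: "supp (shift p) = shift_expo ` supp p"
proof -
  have "m \<in> supp (shift p) \<longleftrightarrow> m \<in> shift_expo ` supp p" for m
    using low_plus_shift_expo_high[of m]
    by (auto simp: in_keys_iff coef_shift image_iff split: if_splits intro!: bexI[of _ "high m"])
  then show ?thesis by blast
qed

lemma shift_part: "shift (part P p) = part (\<lambda>m. P (high m)) (shift p)"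
  by (rule poly_mapping_eqI) (simp add: coef_shift coef_part)

lemma slice_shift_times:
  assumes "r \<in> polys d" shows "slice u (r * shift w) = Const (coef r u) * w"
proof -
  have "slice u (r * shift w) = lin (\<lambda>m. slice u (mon m * shift w)) r"
    by (rule lin_expand[of "\<lambda>r. slice u (r * shift w)"])
      (simp_all add: slice_add distrib_right mult.assoc slice_Const_times)
  also have "\<dots> = lin (\<lambda>m. if m = u then w else 0) r"
  proof (rule lin_cong)
    fix m assume "m \<in> supp r"
    then have m: "low m = m" using assms by (auto simp: polys_low)
    have "slice u (mon m * shift w) = lin (\<lambda>l. slice u (mon m * shift (mon l))) w"
      by (rule lin_expand[of "\<lambda>w. slice u (mon m * shift w)"])
        (simp_all add: slice_add shift_add distrib_left mult.left_commute[of _ "Const _"] slice_Const_times shift_Const_times)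
    also have "\<dots> = lin (\<lambda>l. if m = u then mon l else 0) w"
      by (rule lin_cong) (use m in \<open>auto simp: shift_mon slice_mon mult_single low_add high_add high_of_low\<close>)
    finally have "slice u (mon m * shift w) = lin (\<lambda>l. if m = u then mon l else 0) w" .
    then show "slice u (mon m * shift w) = (if m = u then w else 0)" by (cases "m = u") auto
  qed
  also have "\<dots> = Const (coef r u) * w"
    by (rule lin_unique[symmetric]) (auto simp: lookup_add Const_add algebra_simps lookup_single when_def)
  finally show ?thesis .
qed

lemma slice_mon_times: "low v = v \<Longrightarrow> slice (v + u) (mon v * p) = slice u p"
  by (rule poly_mapping_eqI) (auto simp: coef_slice low_add add.assoc)

lemma slice_decomp: "p = (\<Sum>u\<in>low ` supp p. mon u * shift (slice u p))"
proof -
  have "(\<Sum>u\<in>A. mon u * shift (slice u p)) = lin (\<lambda>m. if low m \<in> A then mon m else 0) p" if "finite A" for A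
  proof -
    have "(\<Sum>u\<in>A. mon u * shift (slice u p)) = lin (\<lambda>m. \<Sum>u\<in>A. mon u * shift (slice u (mon m))) p"
      by (rule lin_expand[of "\<lambda>p. \<Sum>u\<in>A. mon u * shift (slice u p)"])
        (simp_all add: slice_add shift_add distrib_left sum.distrib slice_Const_times shift_Const_times
          mult.left_commute[of _ "Const _"] sum_distrib_left)
    also have "\<dots> = lin (\<lambda>m. if low m \<in> A then mon m else 0) p"
      using that by (intro lin_cong)
        (auto simp: slice_mon if_distrib[of shift] if_distrib[of "\<lambda>x. mon _ * x"] shift_mon mult_single low_plus_shift_expo_high sum.delta' cong: if_cong)
    finally show ?thesis .
  qed
  moreover have "lin (\<lambda>m. if low m \<in> low ` supp p then mon m else 0) p = lin mon p"
    by (rule lin_cong) auto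
  ultimately show ?thesis by simp
qed

text \<open>The slice of a product is a linear combination of slices of the second factor, with the
  coefficients of the first.\<close>
lemma slice_times_mem:
  assumes "q \<in> polys d" "kv.subspace V" "\<And>u. slice u p \<in> V"
  shows "slice u (q * p) \<in> V"
proof -
  have "q * p = (\<Sum>v\<in>low ` supp p. (q * mon v) * shift (slice v p))"
    by (subst slice_decomp[of p]) (simp add: sum_distrib_left mult.assoc)
  moreover have "q * mon v \<in> polys d" if "v \<in> low ` supp p" for v
    using that assms(1) keys_mult[of q "mon v"] by (fastforce simp: polys_low low_add)
  ultimately have "slice u (q * p) = (\<Sum>v\<in>low ` supp p. Const (coef (q * mon v) u) * slice v p)"
    by (simp add: slice_sum slice_shift_times cong: sum.cong)
  also have "\<dots> \<in> V"
    using assms(2,3) by (intro kv.subspace_sum kv.subspace_scale)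
  finally show ?thesis .
qed

end

section \<open>The model of the syzygies\<close>

context veronese begin

text \<open>The degrees at position \<open>0\<close> in which \<open>\<Omega>\<^sup>cS\<close> has its minimal
  generators: below \<open>n\<close> for \<open>S\<close> itself, exactly \<open>n\<close> for all
  higher syzygies.\<close>
definition lowdeg :: "nat \<Rightarrow> nat \<Rightarrow> bool"
  where "lowdeg c e \<longleftrightarrow> (if c = 0 then e < n else e = n)"

text \<open>\<open>Om c 0\<close> is the model of \<open>\<Omega>\<^sup>cS\<close>. In general \<open>Om c
  i\<close> consists of the polynomials \<open>h\<close> with \<open>M\<^sub>i h \<subseteq>
  \<Omega>\<^sup>cS\<close>, that is, it is \<open>Hom\<^sub>R(M\<^sub>i,
  \<Omega>\<^sup>cS)\<close>. Inside it, \<open>Gens c i\<close> consists of the multipliers that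
  take monomials of degree \<open>i\<close> to elements of \<open>W\<^sub>c\<close>, so
  \<open>Gens c 0\<close> is \<open>W\<^sub>c\<close> itself, and \<open>Cov c i\<close> is
  \<open>Hom\<^sub>R(M\<^sub>i, R \<otimes> W\<^sub>c)\<close>. The set in the recursive equation
  is \<open>Gens c 0\<close> written out.\<close>
primrec Om :: "nat \<Rightarrow> nat \<Rightarrow> 'k::field mpoly set" where
  "Om 0 i = polys d"
| "Om (Suc c) i = {t. (\<forall>u. slice u t \<in> {w \<in> Om c 0. \<forall>m\<in>supp w. lowdeg c (deg0 m)}) \<and>
     (\<forall>m\<in>supp t. n dvd deg0 m + i) \<and> merge t = 0}"

definition Gens :: "nat \<Rightarrow> nat \<Rightarrow> 'k::field mpoly set"
  where "Gens c i = {h \<in> Om c i. \<forall>m\<in>supp h. lowdeg c (deg0 m + i)}"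

definition Cov :: "nat \<Rightarrow> nat \<Rightarrow> 'k::field mpoly set"
  where "Cov c i = {t. (\<forall>u. slice u t \<in> Gens c 0) \<and> (\<forall>m\<in>supp t. n dvd deg0 m + i)}"

lemma Om_Suc: "Om (Suc c) i = {t \<in> Cov c i. merge t = 0}"
  by (auto simp: Cov_def Gens_def)

declare Om.simps(2) [simp del]

lemma supp_subspace: "kv.subspace {p :: 'k::field mpoly. \<forall>m\<in>supp p. P m}"
  by (rule kv.subspaceI) (use keys_add in \<open>fastforce simp: in_keys_iff\<close>)+

lemma polys_subspace: "kv.subspace (polys d :: 'k::field mpoly set)"
  using supp_subspace[of "\<lambda>m. supp m \<subseteq> {1..d}"] by (simp add: polys_def)

lemma slice_subspace: "kv.subspace V \<Longrightarrow> kv.subspace {t. \<forall>u. slice u t \<in> V}"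
  by (rule kv.subspaceI)
    (auto simp: slice_add slice_Const_times intro: kv.subspace_0 kv.subspace_add kv.subspace_scale)

lemma merge_subspace: "kv.subspace {t :: 'k::field mpoly. merge t = 0}"
  by (rule kv.subspaceI) (auto simp: merge_add merge_Const_times)

lemma Gens_alt: "Gens c i = Om c i \<inter> {h. \<forall>m\<in>supp h. lowdeg c (deg0 m + i)}"
  by (auto simp: Gens_def)
lemma Cov_alt: "Cov c i = {t. \<forall>u. slice u t \<in> Gens c 0} \<inter> {t. \<forall>m\<in>supp t. n dvd deg0 m + i}"
  by (auto simp: Cov_def)
lemma Om_Suc_alt: "Om (Suc c) i = Cov c i \<inter> {t. merge t = 0}"
  by (auto simp: Om_Suc)

lemma Om_subspace: "kv.subspace (Om c i :: 'k::field mpoly set)"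
proof (induction c arbitrary: i)
  case 0 then show ?case by (simp add: polys_subspace)
next
  case (Suc c)
  have "kv.subspace (Gens c 0 :: 'k mpoly set)"
    unfolding Gens_alt by (intro kv.subspace_inter Suc supp_subspace)
  then show ?case
    unfolding Om_Suc_alt Cov_alt by (intro kv.subspace_inter slice_subspace supp_subspace merge_subspace)
qed

lemma Gens_subspace: "kv.subspace (Gens c i :: 'k::field mpoly set)"
  unfolding Gens_alt by (intro kv.subspace_inter Om_subspace supp_subspace)

lemma Cov_subspace: "kv.subspace (Cov c i :: 'k::field mpoly set)"
  unfolding Cov_alt by (intro kv.subspace_inter slice_subspace supp_subspace Gens_subspace)

lemma Gens_Om: "h \<in> Gens c i \<Longrightarrow> h \<in> Om c i" by (simp add: Gens_def)

lemma dvd_shift: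
  assumes "(a + i) mod n = i' mod n" "n dvd b + i'" shows "n dvd a + b + i"
proof -
  have "(a + b + i) mod n = ((a + i) mod n + b) mod n" by (simp add: mod_simps ac_simps)
  also have "\<dots> = (b + i') mod n" by (simp add: assms(1) mod_simps ac_simps)
  finally show ?thesis using assms(2) by (simp add: dvd_eq_mod_eq_0)
qed

lemma Cov_mult:
  assumes "q \<in> polys d" "\<forall>m\<in>supp q. (deg0 m + i) mod n = i' mod n" "t \<in> Cov c i'"
  shows "q * t \<in> Cov c i"
proof -
  have "slice u (q * t) \<in> Gens c 0" for u
    using assms(1,3) Gens_subspace by (intro slice_times_mem) (auto simp: Cov_def)
  moreover have "n dvd deg0 m + i" if "m \<in> supp (q * t)" for m
  proof -
    obtain a b where "a \<in> supp q" "b \<in> supp t" "m = a + b"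
      using keys_mult[of q t] \<open>m \<in> supp (q * t)\<close> by blast
    then show ?thesis using assms(2,3) dvd_shift[of "deg0 a" i i' "deg0 b"] by (auto simp: Cov_def)
  qed
  ultimately show ?thesis by (auto simp: Cov_def)
qed

lemma polys_mult: "p \<in> polys d \<Longrightarrow> q \<in> polys d \<Longrightarrow> p * q \<in> polys d"
  unfolding polys_low using keys_mult[of p q] by (fastforce simp: low_add)

lemma polys_1 [simp]: "1 \<in> polys d" by (simp add: polys_low)
lemma polys_0 [simp]: "0 \<in> polys d" by (simp add: polys_low)
lemma polys_mon: "low m = m \<Longrightarrow> mon m \<in> polys d" by (simp add: polys_low)
lemma polys_Const [simp]: "Const c \<in> polys d" by (auto simp: polys_low Const_def)

lemma Om_mult:
  assumes "q \<in> polys d" "\<forall>m\<in>supp q. (deg0 m + i) mod n = i' mod n" "t \<in> Om c i'"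
  shows "q * t \<in> Om c i"
  by (cases c) (use assms Cov_mult[OF assms(1,2)] in \<open>auto simp: polys_mult Om_Suc merge_mult\<close>)

lemma Cov_shift:
  assumes "r \<in> polys d" "\<forall>m\<in>supp r. n dvd deg0 m + i" "w \<in> Gens c 0"
  shows "r * shift w \<in> Cov c i"
proof -
  have "slice u (r * shift w) \<in> Gens c 0" for u
    using assms kv.subspace_scale[OF Gens_subspace] by (simp add: slice_shift_times)
  moreover have "n dvd deg0 m + i" if "m \<in> supp (r * shift w)" for m
    using keys_mult[of r "shift w"] that assms(2) by (auto simp: supp_shift)
  ultimately show ?thesis by (auto simp: Cov_def)
qed

text \<open>The cover map has its image in the syzygy: slices are in \<open>W\<^sub>c\<close>, and the syzygy
  is closed under multiplication at position \<open>0\<close>.\<close>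
lemma merge_Cov: assumes "t \<in> Cov c i" shows "merge t \<in> Om c i"
proof -
  have "merge t = (\<Sum>u\<in>low ` supp t. mon u * slice u t)"
    by (subst slice_decomp[of t])
      (auto simp: merge_sum merge_mult merge_polys polys_mon intro!: sum.cong)
  also have "\<dots> \<in> Om c i"
  proof (intro kv.subspace_sum Om_subspace)
    fix u assume "u \<in> low ` supp t"
    then have "low u = u" "n dvd deg0 u + i" using assms by (auto simp: Cov_def)
    moreover have "slice u t \<in> Om c 0" using assms by (auto simp: Cov_def Gens_def)
    ultimately show "mon u * slice u t \<in> Om c i" by (intro Om_mult[where i' = 0]) (auto simp: polys_mon)
  qed
  finally show ?thesis .
qed

lemma Var_mon: "Var s = mon (unit_expo s)" by (simp add: Var_def)

lemma polys_Var: "s \<in> {1..d} \<Longrightarrow> Var s \<in> polys d"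
  by (simp add: Var_mon polys_mon low_unit)

lemma Gens_Var:
  assumes "h \<in> Gens c (Suc i)" "s \<in> {1..d}" shows "Var s * h \<in> Gens c i"
proof -
  have "Var s * h \<in> Om c i"
    using assms by (intro Om_mult[where i' = "Suc i"] polys_Var) (auto simp: Gens_def Var_mon)
  moreover have "lowdeg c (deg0 m + i)" if "m \<in> supp (Var s * h)" for m
    using that assms by (auto simp: Var_mon supp_mon_times Gens_def)
  ultimately show ?thesis by (simp add: Gens_def)
qed

text \<open>The Koszul-like tensor \<open>x\<^sub>t \<otimes> x\<^sub>sh - x\<^sub>s \<otimes>
  x\<^sub>th\<close> is killed by merging because the variables commute. It has degree
  \<open>1\<close> at position \<open>0\<close>, which is a lowest degree for maps from
  \<open>M\<^bsub>n-1\<^esub>\<close>.\<close>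
lemma Gens_wedge:
  assumes "h \<in> Gens c (Suc 0)" "s \<in> {1..d}" "t \<in> {1..d}"
  shows "Var t * shift (Var s * h) - Var s * shift (Var t * h) \<in> Gens (Suc c) (n - Suc 0)" (is "?D \<in> _")
proof -
  have h: "Var s * h \<in> Gens c 0" "Var t * h \<in> Gens c 0" using assms Gens_Var[of h c 0] by auto
  have m: "Var v * shift w \<in> Cov c (n - 1) \<and> (\<forall>m\<in>supp (Var v * shift w). deg0 m = 1)"
    if "v \<in> {1..d}" "w \<in> Gens c 0" for v w
    using that n2 Cov_shift[of "Var v" "n - 1" w c]
    by (auto simp: Var_mon supp_mon_times supp_shift polys_mon low_unit)
  have "?D \<in> Cov c (n - 1)" using m h assms Cov_subspace kv.subspace_diff by blast
  moreover have "merge ?D = 0"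
    using assms by (simp add: merge_diff merge_mult merge_polys polys_Var mult.left_commute)
  moreover have "lowdeg (Suc c) (deg0 k + (n - 1))" if "k \<in> supp ?D" for k
  proof -
    have "k \<in> supp (Var t * shift (Var s * h)) \<union> supp (Var s * shift (Var t * h))"
      using that by (auto simp: in_keys_iff lookup_minus)
    then have "deg0 k = 1" using m h assms by blast
    then show ?thesis using n2 by (simp add: lowdeg_def)
  qed
  ultimately show ?thesis by (simp add: Gens_def Om_Suc)
qed

section \<open>The polynomial of a path\<close>

text \<open>The multiplier by which a path acts on its source; the first arrow of the list is the first one
  traversed.\<close>
fun path_poly :: "arr list \<Rightarrow> 'k::field mpoly" where
  "path_poly [] = 1"
| "path_poly (X i s # p) = Var s * path_poly p"
| "path_poly (XX s t # p) = Var t * shift (Var s * path_poly p) - Var s * shift (Var t * path_poly p)"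

text \<open>The number of arrows \<open>x\<^sub>s\<^sub>t\<close> is the degree of the path in
  \<open>\<Gamma>\<close>.\<close>
fun wedges :: "arr list \<Rightarrow> nat" where
  "wedges [] = 0"
| "wedges (X i s # p) = wedges p"
| "wedges (XX s t # p) = Suc (wedges p)"

text \<open>Besides the paths of the quiver, which start at \<open>1, \<dots>, n - 1\<close>, this admits
  paths that start at the vertex \<open>0\<close> for the summand \<open>M\<^sub>0 = R\<close>.
  They describe the generators of \<open>\<Omega>\<^sup>cS\<close>, and the induction along the
  resolution passes through them.\<close>
fun is_path :: "nat \<Rightarrow> arr list \<Rightarrow> bool" where
  "is_path i [] \<longleftrightarrow> i < n"
| "is_path i (X j s # p) \<longleftrightarrow> j = i \<and> i < n - 1 \<and> s \<in> {1..d} \<and> is_path (Suc i) p"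
| "is_path i (XX s t # p) \<longleftrightarrow> i = n - 1 \<and> 1 \<le> s \<and> s < t \<and> t \<le> d \<and> is_path (Suc 0) p"

text \<open>The upper index of the first arrow; the empty path puts no condition on the arrow before it.\<close>
fun top_index :: "arr list \<Rightarrow> nat" where
  "top_index [] = d"
| "top_index (X i s # p) = s"
| "top_index (XX s t # p) = t"

text \<open>The lower index of each arrow is at most the upper index of the following one. Writing the indices
  of the arrows in a row (vertically adjacent for \<open>x\<^sub>s\<^sub>t\<close>) gives a
  semistandard filling of a ribbon shape.\<close>
fun ribbon :: "arr list \<Rightarrow> bool" where
  "ribbon [] \<longleftrightarrow> True"
| "ribbon (X i s # p) \<longleftrightarrow> s \<le> top_index p \<and> ribbon p"
| "ribbon (XX s t # p) \<longleftrightarrow> s \<le> top_index p \<and> ribbon p"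

definition ribbons :: "nat \<Rightarrow> nat \<Rightarrow> arr list set"
  where "ribbons c i = {p. is_path i p \<and> ribbon p \<and> wedges p = c}"

lemma is_path_less: "is_path i p \<Longrightarrow> i < n"
  using n2 by (induction i p rule: is_path.induct) auto

lemma path_poly_mem: "is_path i p \<Longrightarrow> (path_poly p :: 'k::field mpoly) \<in> Gens (wedges p) i"
proof (induction p arbitrary: i rule: wedges.induct)
  case 1 then show ?case by (simp add: Gens_def lowdeg_def)
next
  case (2 j s p) then show ?case by (auto intro: Gens_Var)
next
  case (3 s t p)
  then have "(path_poly p :: 'k mpoly) \<in> Gens (wedges p) (Suc 0)" by simp
  from Gens_wedge[OF this, of s t] 3 show ?case by simp
qed

subsection \<open>Leading monomials\<close>

definition wsum :: "(nat \<Rightarrow> nat) \<Rightarrow> expo \<Rightarrow> nat"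
  where "wsum f m = (\<Sum>v\<in>supp m. coef m v * f v)"

lemma wsum_superset: "finite A \<Longrightarrow> supp m \<subseteq> A \<Longrightarrow> wsum f m = (\<Sum>v\<in>A. coef m v * f v)"
  unfolding wsum_def by (rule sum.mono_neutral_left) (auto simp: in_keys_iff)

lemma wsum_add [simp]: "wsum f (m + m') = wsum f m + wsum f m'"
proof -
  have "finite (supp m \<union> supp m')" by simp
  from wsum_superset[OF this] keys_add[of m m'] show ?thesis
    by (simp add: lookup_add algebra_simps sum.distrib)
qed

lemma wsum_0 [simp]: "wsum f 0 = 0" by (simp add: wsum_def)

lemma wsum_single [simp]: "wsum f (Poly_Mapping.single v c) = c * f v"
  by (cases "c = 0") (auto simp: wsum_def)

lemma shift_expo_single: "shift_expo (Poly_Mapping.single v c) = Poly_Mapping.single (if v = 0 then 0 else v + d) c"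
  by (rule poly_mapping_eqI) (auto simp: coef_shift_expo lookup_single when_def)

lemma wsum_shift_expo: "wsum f (shift_expo m) = wsum (\<lambda>v. f (if v = 0 then 0 else v + d)) m"
  by (induction m rule: poly_mapping_induct) (auto simp: shift_expo_add shift_expo_single)

lemma wsum_add_fun: "wsum (\<lambda>v. f v + g v) m = wsum f m + wsum g m"
  by (simp add: wsum_def algebra_simps sum.distrib)

text \<open>The variable \<open>x\<^bsub>s+pd\<^esub>\<close> has letter \<open>s\<close> and position
  \<open>p\<close>. The weight of a monomial sums position times letter; among monomials with the
  same letters it is small when large letters stand in early positions.\<close>
definition letter :: "nat \<Rightarrow> nat" where "letter v = (if v = 0 then 0 else (v - 1) mod d + 1)"
definition pos :: "nat \<Rightarrow> nat" where "pos v = (v - 1) div d"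
abbreviation letter_sum :: "expo \<Rightarrow> nat" where "letter_sum \<equiv> wsum letter"
abbreviation weight :: "expo \<Rightarrow> nat" where "weight \<equiv> wsum (\<lambda>v. pos v * letter v)"

lemma letter_shift_expo: "letter (if v = 0 then 0 else v + d) = letter v"
proof (cases "v = 0")
  case False
  then obtain w where "v = Suc w" by (cases v) auto
  then show ?thesis by (simp add: letter_def)
qed simp

lemma pos_shift_expo: "v \<noteq> 0 \<Longrightarrow> pos (v + d) = Suc (pos v)"
proof -
  assume "v \<noteq> 0"
  then obtain w where "v = Suc w" by (cases v) auto
  with d2 show ?thesis by (simp add: pos_def)
qed

lemma letter_sum_shift_expo [simp]: "letter_sum (shift_expo m) = letter_sum m"
  by (simp add: wsum_shift_expo letter_shift_expo)

lemma weight_shift_expo [simp]: "weight (shift_expo m) = weight m + letter_sum m"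
proof -
  have "pos (if v = 0 then 0 else v + d) * letter (if v = 0 then 0 else v + d)
      = pos v * letter v + letter v" for v
    using pos_shift_expo[of v] letter_shift_expo[of v] by (cases "v = 0") (auto simp: letter_def)
  then show ?thesis by (simp add: wsum_shift_expo wsum_add_fun)
qed

lemma letter_low [simp]: "s \<in> {1..d} \<Longrightarrow> letter s = s"
  by (auto simp: letter_def)

lemma pos_low [simp]: "s \<in> {1..d} \<Longrightarrow> pos s = 0"
  by (auto simp: pos_def)

lemma supp_diff: "x \<in> supp (p - q) \<Longrightarrow> x \<in> supp p \<or> x \<in> supp (q :: 'k::field mpoly)"
  by (rule ccontr) (auto simp: in_keys_iff lookup_minus)

text \<open>Shifting adds the sum of the letters to the weight. Requiring this sum to be the same for all
  terms makes leading monomials stay leading under \<open>shift\<close>.\<close>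
definition leads :: "'k::field mpoly \<Rightarrow> expo \<Rightarrow> bool"
  where "leads p m \<longleftrightarrow> coef p m = 1 \<and> (\<forall>m'\<in>supp p. letter_sum m' = letter_sum m \<and> (m' = m \<or> weight m < weight m'))"

lemma leads_mon: "leads p m \<Longrightarrow> leads (mon u * p) (u + m)"
  by (auto simp: leads_def supp_mon_times)

lemma leads_shift: "leads p m \<Longrightarrow> leads (shift p) (shift_expo m)"
  by (auto simp: leads_def supp_shift coef_shift)

lemma leads_diff:
  assumes "leads p m" "leads q l" "letter_sum m = letter_sum l" "weight m < weight l" shows "leads (p - q) m"
proof -
  have "m \<notin> supp q" using assms(2,4) unfolding leads_def by (metis less_asym less_irrefl)
  then have "coef (p - q) m = 1" using assms(1) by (simp add: lookup_minus leads_def in_keys_iff)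
  moreover have "letter_sum x = letter_sum m \<and> (x = m \<or> weight m < weight x)" if "x \<in> supp (p - q)" for x
  proof -
    consider "x \<in> supp p" | "x \<in> supp q"
      using supp_diff[OF \<open>x \<in> supp (p - q)\<close>] by blast
    then show ?thesis
    proof cases
      case 1 then show ?thesis using assms(1) unfolding leads_def by blast
    next
      case 2
      then have x: "letter_sum x = letter_sum l" "x = l \<or> weight l < weight x" using assms(2) unfolding leads_def by blast+
      have "weight m < weight x" using x(2) assms(4) by (elim disjE) (simp, erule less_trans)
      then show ?thesis using x(1) assms(3) by simp
    qed
  qed
  ultimately show ?thesis by (simp add: leads_def)
qed

fun lead_expo :: "arr list \<Rightarrow> expo" where
  "lead_expo [] = 0"
| "lead_expo (X i s # p) = unit_expo s + lead_expo p"
| "lead_expo (XX s t # p) = unit_expo t + shift_expo (unit_expo s + lead_expo p)"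

text \<open>In \<open>x\<^sub>t \<otimes> x\<^sub>sh - x\<^sub>s \<otimes> x\<^sub>th\<close> with \<open>s <
  t\<close> the first term has the smaller weight: it moves the smaller letter to the later
  position.\<close>
lemma leads_path_poly: "is_path i p \<Longrightarrow> leads (path_poly p :: 'k::field mpoly) (lead_expo p)"
proof (induction p arbitrary: i rule: lead_expo.induct)
  case 1 then show ?case by (simp add: leads_def)
next
  case (2 j s p) then show ?case by (auto simp: Var_mon intro: leads_mon)
next
  case (3 s t p)
  then have "leads (path_poly p :: 'k mpoly) (lead_expo p)" by auto
  then have "leads (Var t * shift (Var s * path_poly p :: 'k mpoly)) (unit_expo t + shift_expo (unit_expo s + lead_expo p))"
    "leads (Var s * shift (Var t * path_poly p :: 'k mpoly)) (unit_expo s + shift_expo (unit_expo t + lead_expo p))"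
    by (auto simp: Var_mon intro!: leads_mon leads_shift)
  then show ?case unfolding path_poly.simps lead_expo.simps using 3
    by (elim leads_diff) auto
qed

lemma lead_expo_in_supp: "is_path i p \<Longrightarrow> lead_expo p \<in> supp (path_poly p :: 'k::field mpoly)"
  using leads_path_poly[of i p, where 'k = 'k] by (simp add: leads_def in_keys_iff)

text \<open>Degrees of exponents do not depend on the field, so the rational numbers serve as an auxiliary
  field here.\<close>
lemma lowdeg_lead_expo: "is_path i p \<Longrightarrow> lowdeg (wedges p) (deg0 (lead_expo p) + i)"
  using path_poly_mem[of i p, where 'k = rat] lead_expo_in_supp[of i p, where 'k = rat] by (auto simp: Gens_def)

lemma deg0_lead_expo_pos: "is_path i p \<Longrightarrow> p \<noteq> [] \<Longrightarrow> 0 < deg0 (lead_expo p)"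
  by (cases p rule: lead_expo.cases) auto

text \<open>Both letters are the largest one that occurs in the common monomial.\<close>
lemma max_letter_eq:
  assumes "u + unit_expo s = v + unit_expo t" "supp u \<subseteq> {1..s}" "supp v \<subseteq> {1..t}"
  shows "s = t"
proof -
  have "s \<in> supp (v + unit_expo t)" "t \<in> supp (u + unit_expo s)"
    by (subst assms(1)[symmetric], simp add: in_keys_iff lookup_add)
      (subst assms(1), simp add: in_keys_iff lookup_add)
  moreover have "supp (u + unit_expo s) \<subseteq> insert s (supp u)" "supp (v + unit_expo t) \<subseteq> insert t (supp v)"
    using keys_add[of u "unit_expo s"] keys_add[of v "unit_expo t"] by auto
  ultimately show ?thesis using assms(2,3) by fastforce
qed

text \<open>By induction along the paths. An arrow \<open>x\<^sub>s\<close> is absorbed into the factor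
  \<open>u\<close>, which is why the statement carries a factor in letters up to the top index;
  for an arrow \<open>x\<^sub>s\<^sub>t\<close> the position \<open>0\<close> separates
  \<open>t\<close> from the rest. Once the remaining paths agree, so do the first indices, as
  largest letters of the same monomial.\<close>
lemma lead_expo_inj:
  assumes "is_path i p" "is_path i q" "ribbon p" "ribbon q" "supp u \<subseteq> {1..top_index p}" "supp v \<subseteq> {1..top_index q}"
    "u + lead_expo p = v + lead_expo q" "deg0 (lead_expo p) = deg0 (lead_expo q)"
  shows "p = q"
  using assms
proof (induction p arbitrary: i q u v rule: lead_expo.induct)
  case 1
  then show ?case using deg0_lead_expo_pos[of i q] by force
next
  case (2 j s p)
  have "q \<noteq> []" using 2 deg0_lead_expo_pos[of i "X j s # p"] by force
  then obtain s' q' where q: "q = X i s' # q'" using 2 by (cases q rule: lead_expo.cases) auto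
  have "p = q'"
  proof (rule 2(1)[of "Suc i" q' "u + unit_expo s" "v + unit_expo s'"])
    show "supp (u + unit_expo s) \<subseteq> {1..top_index p}"
      using keys_add[of u "unit_expo s"] 2 by (fastforce simp: q)
    show "supp (v + unit_expo s') \<subseteq> {1..top_index q'}"
      using keys_add[of v "unit_expo s'"] 2 by (fastforce simp: q)
  qed (use 2 in \<open>auto simp: q algebra_simps\<close>)
  moreover from this have "u + unit_expo s = v + unit_expo s'"
    using 2(8) by (simp add: q add.assoc[symmetric])
  then have "s = s'" using 2 q by (intro max_letter_eq) auto
  ultimately show ?case using 2 q by simp
next
  case (3 s t p)
  have "q \<noteq> []" using 3 deg0_lead_expo_pos[of i "XX s t # p"] by force
  then obtain s' t' q' where q: "q = XX s' t' # q'" using 3 by (cases q rule: lead_expo.cases) auto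
  have lu: "low u = u" "low v = v" using 3 q by (auto simp: low_id_iff)
  have st: "s \<in> {1..d}" "t \<in> {1..d}" "s' \<in> {1..d}" "t' \<in> {1..d}" using 3 q by auto
  have eq: "u + (unit_expo t + shift_expo (unit_expo s + lead_expo p)) = v + (unit_expo t' + shift_expo (unit_expo s' + lead_expo q'))"
    using 3(8) by (simp add: q)
  have hi: "unit_expo s + lead_expo p = unit_expo s' + lead_expo q'"
    using arg_cong[OF eq, of high] st lu by (simp add: high_add high_of_low low_unit)
  have lo: "u + unit_expo t = v + unit_expo t'"
    using arg_cong[OF eq, of low] st lu by (simp add: low_add low_unit)
  have d: "deg0 (lead_expo p) = deg0 (lead_expo q')" using arg_cong[OF hi, of deg0] st by simp
  have pq: "p = q'"
    by (rule 3(1)[of "Suc 0" q' "unit_expo s" "unit_expo s'"]) (use 3 q hi d in auto)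
  have "s = s'" using hi by (intro max_letter_eq[of 0 _ 0]) (auto simp: pq)
  moreover have "t = t'" using lo 3 q by (intro max_letter_eq) auto
  ultimately show ?case using pq q by simp
qed

subsection \<open>Bases by ribbon paths\<close>

text \<open>The variables of \<open>u\<close>, in increasing order, become the first arrows of the path; each
  of them is then at most the index after it.\<close>
lemma ribbon_extend:
  assumes "is_path k q" "ribbon q" "low u = u" "supp u \<subseteq> {1..top_index q}" "deg0 u \<le> k"
  shows "\<exists>q'. is_path (k - deg0 u) q' \<and> ribbon q' \<and> wedges q' = wedges q \<and> (path_poly q' :: 'k::field mpoly) = mon u * path_poly q"
  using assms
proof (induction "deg0 u" arbitrary: u k q)
  case 0
  then have "u = 0" by (metis low_eq_0_iff)
  then show ?case using 0 by auto
next
  case (Suc l)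
  then have "u \<noteq> 0" by auto
  then obtain s u' where s: "s \<in> {1..d}" "u = u' + unit_expo s" "low u' = u'" "supp u' \<subseteq> {1..s}"
      "s \<in> supp u" "deg0 u = Suc (deg0 u')"
    using low_peel[OF Suc(5)] by metis
  have k: "k < n" using Suc is_path_less by blast
  have "\<exists>q'. is_path (k - 1 - deg0 u') q' \<and> ribbon q' \<and> wedges q' = wedges (X (k - 1) s # q) \<and>
      (path_poly q' :: 'k mpoly) = mon u' * path_poly (X (k - 1) s # q)"
    by (rule Suc(1)) (use Suc s k in auto)
  then show ?case using s by (auto simp: Var_mon mult_single mult.assoc[symmetric])
qed

text \<open>Two sets of polynomials describe \<open>Om (c + 1) i\<close> inside \<open>Cov c i\<close>:
  \<open>wedge_mults\<close> are elements of \<open>Om (c + 1) i\<close> that come from ribbon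
  paths, and \<open>normal_terms\<close> are the terms \<open>u \<otimes> b\<close> of \<open>Cov
  c i\<close> for which \<open>u b\<close> is again in the ribbon order. Rewriting shows that both
  together span \<open>Cov c i\<close>, and \<open>merge\<close> is injective on the span of the
  latter.\<close>
definition wedge_mults :: "nat \<Rightarrow> nat \<Rightarrow> 'k::field mpoly set"
  where "wedge_mults c i = {mon u * path_poly (XX t s # p) | u s t p. low u = u \<and> supp u \<subseteq> {1..s} \<and>
    n dvd deg0 u + 1 + i \<and> is_path (n - 1) (XX t s # p) \<and> ribbon (XX t s # p) \<and> wedges p = c}"

definition normal_ix :: "nat \<Rightarrow> nat \<Rightarrow> (expo \<times> arr list) set"
  where "normal_ix c i = {(u, b). b \<in> ribbons c 0 \<and> low u = u \<and> supp u \<subseteq> {1..top_index b} \<and> n dvd deg0 u + i}"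

definition normal_terms :: "nat \<Rightarrow> nat \<Rightarrow> 'k::field mpoly set"
  where "normal_terms c i = (\<lambda>(u, b). mon u * shift (path_poly b)) ` normal_ix c i"

text \<open>If the largest letter \<open>s\<close> of \<open>u\<close> exceeds the first index
  \<open>t\<close> of \<open>b\<close>, exchanging the two letters changes the term by an element
  of \<open>wedge_mults\<close> and lowers the sum of letters of \<open>u\<close>. The exchanged
  second factor is no longer the polynomial of a ribbon path, but it is a combination of such
  polynomials by the assumption on \<open>c\<close>.\<close>
lemma straighten_term:
  assumes W: "Gens c 0 \<subseteq> kv.span (path_poly ` ribbons c 0 :: 'k::field mpoly set)"
    and "low u = u" "n dvd deg0 u + i" "b \<in> ribbons c 0"
  shows "mon u * shift (path_poly b) \<in> kv.span (wedge_mults c i \<union> normal_terms c i :: 'k mpoly set)"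
  using assms(2-)
proof (induction "letter_sum u" arbitrary: u b rule: less_induct)
  case less
  show ?case
  proof (cases "supp u \<subseteq> {1..top_index b}")
    case True
    then have "mon u * shift (path_poly b) \<in> normal_terms c i" using less by (force simp: normal_terms_def normal_ix_def)
    then show ?thesis by (intro kv.span_base) auto
  next
    case False
    then have "u \<noteq> 0" by auto
    then obtain s u' where s: "s \<in> {1..d}" "u = u' + unit_expo s" "low u' = u'" "supp u' \<subseteq> {1..s}"
        "supp u \<subseteq> {1..s}" "deg0 u = Suc (deg0 u')"
      using low_peel[OF less(2)] by metis
    have sb: "top_index b < s" using False s(5) by force
    have "b \<noteq> []" using sb s(1) by auto
    then obtain t p where b: "b = X 0 t # p" using less(4) n2 by (cases b rule: lead_expo.cases) (auto simp: ribbons_def)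
    have p: "is_path (Suc 0) p" "ribbon p" "wedges p = c" "t \<le> top_index p" "t < s" "t \<in> {1..d}"
      using less(4) b sb by (auto simp: ribbons_def)
    have mm: "mon (a + b) = (mon a * mon b :: 'k mpoly)" for a b by (simp add: mult_single)
    have eq: "mon u * shift (path_poly b :: 'k mpoly) = mon u' * path_poly (XX t s # p) + mon (u' + unit_expo t) * shift (Var s * path_poly p)"
      by (simp add: b s(2) mm Var_mon algebra_simps)
    have "mon u' * path_poly (XX t s # p) \<in> (wedge_mults c i :: 'k mpoly set)"
    proof -
      have "is_path (n - 1) (XX t s # p)" "ribbon (XX t s # p)" "n dvd deg0 u' + 1 + i"
        using p s less(3) by auto
      then show ?thesis using s p unfolding wedge_mults_def by blast
    qed
    moreover have "mon (u' + unit_expo t) * shift (Var s * path_poly p) \<in> kv.span (wedge_mults c i \<union> normal_terms c i :: 'k mpoly set)"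
    proof (rule kv_linear_span[where F = "\<lambda>w. mon (u' + unit_expo t) * shift w" and A = "path_poly ` ribbons c 0"])
      have "path_poly p \<in> Gens c (Suc 0)" using path_poly_mem[OF p(1)] p(3) by simp
      then show "Var s * path_poly p \<in> kv.span (path_poly ` ribbons c 0 :: 'k mpoly set)" using W Gens_Var[of "path_poly p" c 0 s] s(1) by auto
      fix w :: "'k mpoly" assume "w \<in> path_poly ` ribbons c 0"
      then obtain b' where b': "b' \<in> ribbons c 0" "w = path_poly b'" by auto
      show "mon (u' + unit_expo t) * shift w \<in> kv.span (wedge_mults c i \<union> normal_terms c i)"
        unfolding b'(2)
        by (rule less(1)) (use s p b' less in \<open>auto simp: low_add low_unit\<close>)
    qed (simp_all add: shift_add shift_Const_times distrib_left mult.left_commute)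
    ultimately show ?thesis unfolding eq by (intro kv.span_add) (auto intro: kv.span_base)
  qed
qed

lemma residue_unique:
  assumes "n dvd a + i" "n dvd b + i" "a + x = b + y" "x < n" "y < n" shows "x = (y :: nat)"
proof -
  obtain k l where kl: "a + i = n * k" "b + i = n * l" using assms(1,2) by (elim dvdE)
  have "n * k + x = n * l + y" using kl assms(3) by linarith
  then have "(n * k + x) mod n = (n * l + y) mod n" by simp
  then show ?thesis using assms(4,5) by simp
qed

text \<open>The degrees of \<open>u\<close> and of \<open>lead_expo b\<close> at position \<open>0\<close> are
  determined by their sum: the first is known modulo \<open>n\<close> and the second is in the
  range of \<open>lowdeg\<close>. Then \<open>b\<close> can be read off from the product.\<close>
lemma normal_ix_inj: "inj_on (\<lambda>(u, b). u + lead_expo b) (normal_ix c i)"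
proof (rule inj_onI, clarify)
  fix u b v b' assume h: "(u, b) \<in> normal_ix c i" "(v, b') \<in> normal_ix c i" "u + lead_expo b = v + lead_expo b'"
  have l: "lowdeg c (deg0 (lead_expo b))" "lowdeg c (deg0 (lead_expo b'))"
    using h lowdeg_lead_expo[of 0 b] lowdeg_lead_expo[of 0 b'] by (auto simp: normal_ix_def ribbons_def)
  have e: "deg0 u + deg0 (lead_expo b) = deg0 v + deg0 (lead_expo b')" using arg_cong[OF h(3), of deg0] by simp
  have "deg0 (lead_expo b) = deg0 (lead_expo b')"
  proof (cases c)
    case 0
    show ?thesis
      by (rule residue_unique[of "deg0 u" i "deg0 v"]) (use h l e 0 in \<open>auto simp: normal_ix_def lowdeg_def\<close>)
  qed (use l in \<open>auto simp: lowdeg_def\<close>)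
  then have "b = b'" using h by (intro lead_expo_inj[of 0 b b' u v]) (auto simp: normal_ix_def ribbons_def)
  then show "u = v \<and> b = b'" using h(3) by simp
qed

text \<open>The images under \<open>merge\<close> have distinct leading monomials.\<close>
lemma normal_terms_merge_inj:
  assumes "x \<in> kv.span (normal_terms c i :: 'k::field mpoly set)" "merge x = 0" shows "x = 0"
proof -
  obtain F r where F: "finite F" "F \<subseteq> normal_terms c i" "x = (\<Sum>a\<in>F. Const (r a) * a)"
    using assms(1) unfolding kv.span_explicit by auto
  have "\<forall>y\<in>F. \<exists>a. a \<in> normal_ix c i \<and> y = mon (fst a) * shift (path_poly (snd a))"
    using F(2) by (auto simp: normal_terms_def) fastforce
  then obtain ix where ix: "\<And>y. y \<in> F \<Longrightarrow> ix y \<in> normal_ix c i \<and> y = mon (fst (ix y)) * shift (path_poly (snd (ix y)))"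
    by metis
  have "inj_on ix F" using ix by (metis inj_onI)
  then have inj: "inj_on (\<lambda>y. fst (ix y) + lead_expo (snd (ix y))) F"
    using comp_inj_on[of ix F "\<lambda>(u, b). u + lead_expo b"] inj_on_subset[OF normal_ix_inj[of c i], of "ix ` F"] ix
    by (fastforce simp: comp_def case_prod_beta)
  have mgy: "merge y = mon (fst (ix y)) * path_poly (snd (ix y))" if "y \<in> F" for y
  proof -
    have "merge y = merge (mon (fst (ix y)) * shift (path_poly (snd (ix y))))" using ix[OF that] by simp
    then show ?thesis using ix[OF that] by (auto simp: merge_mult merge_polys polys_mon normal_ix_def)
  qed
  have ld: "leads (merge y) (fst (ix y) + lead_expo (snd (ix y)))" if "y \<in> F" for y
    unfolding mgy[OF that] using ix[OF that] by (intro leads_mon leads_path_poly[of 0]) (auto simp: normal_ix_def ribbons_def)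
  have "r y = 0" if "y \<in> F" for y
  proof (rule leading_independent[OF F(1) inj, of merge weight r])
    show "(\<Sum>a\<in>F. Const (r a) * merge a) = 0"
      using assms(2) by (simp add: F(3) merge_sum merge_Const_times)
  qed (use ld that in \<open>auto simp: leads_def\<close>)
  then show ?thesis by (simp add: F(3))
qed

text \<open>Write an element of the kernel of \<open>merge\<close> as a combination of
  \<open>wedge_mults\<close>, which lie in the kernel, and of normal terms; the latter part is
  then in the kernel too, hence zero.\<close>
lemma Om_Suc_span:
  assumes W: "Gens c 0 \<subseteq> kv.span (path_poly ` ribbons c 0 :: 'k::field mpoly set)" and "t \<in> (Om (Suc c) i :: 'k mpoly set)"
  shows "t \<in> kv.span (wedge_mults c i)"
proof -
  have t: "t \<in> Cov c i" "merge t = 0" using assms(2) by (auto simp: Om_Suc)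
  have "mon u * shift (slice u t) \<in> kv.span (wedge_mults c i \<union> normal_terms c i)" if "u \<in> low ` supp t" for u
  proof (rule kv_linear_span[where F = "\<lambda>w. mon u * shift w" and A = "path_poly ` ribbons c 0"])
    show "slice u t \<in> kv.span (path_poly ` ribbons c 0)" using t W by (auto simp: Cov_def)
    show "mon u * shift a \<in> kv.span (wedge_mults c i \<union> normal_terms c i)" if "a \<in> path_poly ` ribbons c 0" for a :: "'k mpoly"
      using that \<open>u \<in> low ` supp t\<close> t(1) by (auto simp: Cov_def intro!: straighten_term[OF W])
  qed (simp_all add: shift_add shift_Const_times distrib_left mult.left_commute)
  then have "t \<in> kv.span (wedge_mults c i \<union> normal_terms c i)"
    by (subst slice_decomp[of t]) (rule kv.span_sum)
  then obtain g v where gv: "g \<in> kv.span (wedge_mults c i)" "v \<in> kv.span (normal_terms c i)" "t = g + v"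
    by (auto simp: kv.span_Un)
  have "wedge_mults c i \<subseteq> {t :: 'k mpoly. merge t = 0}"
    by (auto simp: wedge_mults_def merge_mult merge_diff merge_polys polys_Var mult.left_commute)
  then have "merge g = 0" using gv(1) kv.span_minimal[OF _ merge_subspace] by blast
  then have "merge v = 0" using t(2) gv(3) by (simp add: merge_add)
  then have "v = 0" by (rule normal_terms_merge_inj[OF gv(2)])
  then show ?thesis using gv by simp
qed

lemma wedge_mults_deg: "x \<in> (wedge_mults c i :: 'k::field mpoly set) \<Longrightarrow>
  \<exists>u s t p. x = mon u * path_poly (XX t s # p) \<and> low u = u \<and> supp u \<subseteq> {1..s} \<and> n dvd deg0 u + 1 + i \<and>
    is_path (n - 1) (XX t s # p) \<and> ribbon (XX t s # p) \<and> wedges p = c \<and> (\<forall>m\<in>supp x. deg0 m = deg0 u + 1)"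
proof -
  assume "x \<in> wedge_mults c i"
  then obtain u s t p where h: "x = mon u * path_poly (XX t s # p)" "low u = u" "supp u \<subseteq> {1..s}"
    "n dvd deg0 u + 1 + i" "is_path (n - 1) (XX t s # p)" "ribbon (XX t s # p)" "wedges p = c"
    unfolding wedge_mults_def by blast
  have "path_poly (XX t s # p) \<in> (Gens (Suc c) (n - 1) :: 'k mpoly set)" using path_poly_mem[OF h(5)] h(7) by simp
  then have "deg0 m = 1" if "m \<in> supp (path_poly (XX t s # p) :: 'k mpoly)" for m
    using that n2 unfolding Gens_def lowdeg_def by auto
  then have "\<forall>m\<in>supp x. deg0 m = deg0 u + 1" unfolding h(1) supp_mon_times by auto
  with h show ?thesis by blast
qed

text \<open>By induction along the resolution: \<open>Om_Suc_span\<close> describes the next syzygy, and its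
  part of lowest degree consists of the products \<open>u x\<^sub>t\<^sub>sp\<close> for which
  \<open>u\<close> can be sorted in front of the path without passing the vertex \<open>0\<close>.\<close>
theorem Gens_span:
  assumes "i < n" shows "(Gens c i :: 'k::field mpoly set) = kv.span (path_poly ` ribbons c i)"
proof (rule antisym)
  show "kv.span (path_poly ` ribbons c i) \<subseteq> (Gens c i :: 'k mpoly set)"
    by (rule kv.span_minimal[OF _ Gens_subspace]) (auto simp: ribbons_def intro: path_poly_mem)
  show "(Gens c i :: 'k mpoly set) \<subseteq> kv.span (path_poly ` ribbons c i)"
    using assms
  proof (induction c arbitrary: i)
    case 0
    show ?case
    proof
      fix h :: "'k mpoly" assume h: "h \<in> Gens 0 i"
      have "mon m \<in> kv.span (path_poly ` ribbons 0 i :: 'k mpoly set)" if "m \<in> supp h" for m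
      proof -
        have m: "low m = m" "deg0 m + i < n" using h that by (auto simp: Gens_def lowdeg_def polys_low)
        have "\<exists>q'. is_path (deg0 m + i - deg0 m) q' \<and> ribbon q' \<and> wedges q' = wedges [] \<and> (path_poly q' :: 'k mpoly) = mon m * path_poly []"
          by (rule ribbon_extend) (use m in \<open>auto simp: low_id_iff\<close>)
        then obtain q' where "is_path i q'" "ribbon q'" "wedges q' = 0" "(path_poly q' :: 'k mpoly) = mon m" by auto
        then show ?thesis by (metis (mono_tags, lifting) ribbons_def image_eqI kv.span_base mem_Collect_eq)
      qed
      then have "(\<Sum>m\<in>supp h. Const (coef h m) * mon m) \<in> kv.span (path_poly ` ribbons 0 i)"
        by (intro kv.span_sum kv.span_scale)
      then show "h \<in> kv.span (path_poly ` ribbons 0 i)"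
        using poly_mapping_sum_singles[of h] by (simp add: Const_times_single)
    qed
  next
    case (Suc c)
    have W: "Gens c 0 \<subseteq> kv.span (path_poly ` ribbons c 0 :: 'k mpoly set)" using Suc n2 by simp
    show ?case
    proof
      fix h :: "'k mpoly" assume h: "h \<in> Gens (Suc c) i"
      let ?P = "\<lambda>m. deg0 m + i = n"
      have "part ?P h \<in> kv.span (path_poly ` ribbons (Suc c) i)"
      proof (rule kv_linear_span[of "part ?P"])
        show "h \<in> kv.span (wedge_mults c i)" using h W by (intro Om_Suc_span) (auto simp: Gens_def)
        fix x :: "'k mpoly" assume "x \<in> wedge_mults c i"
        from wedge_mults_deg[OF this] obtain u s t p where x: "x = mon u * path_poly (XX t s # p)" "low u = u" "supp u \<subseteq> {1..s}"
          "is_path (n - 1) (XX t s # p)" "ribbon (XX t s # p)" "wedges p = c" "\<forall>m\<in>supp x. deg0 m = deg0 u + 1" by blast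
        show "part ?P x \<in> kv.span (path_poly ` ribbons (Suc c) i)"
        proof (cases "deg0 u + 1 + i = n")
          case True
          have "part ?P x = x" using x(7) True by (intro part_eqI) auto
          moreover have "\<exists>q'. is_path (n - 1 - deg0 u) q' \<and> ribbon q' \<and> wedges q' = wedges (XX t s # p)
              \<and> (path_poly q' :: 'k mpoly) = mon u * path_poly (XX t s # p)"
            by (rule ribbon_extend) (use x True in auto)
          then obtain q' where "is_path i q'" "ribbon q'" "wedges q' = Suc c" "path_poly q' = x"
            using True x by (metis add_diff_cancel_left' add.commute add.left_commute wedges.simps(3) diff_diff_left)
          ultimately show ?thesis by (metis (mono_tags, lifting) ribbons_def image_eqI kv.span_base mem_Collect_eq)
        next
          case False
          then have "part ?P x = 0" using x(7) by (intro part_eq_0) auto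
          then show ?thesis by (simp add: kv.span_zero)
        qed
      qed (auto simp: part_add part_Const_times)
      moreover have "part ?P h = h" using h by (intro part_eqI) (auto simp: Gens_def lowdeg_def)
      ultimately show "h \<in> kv.span (path_poly ` ribbons (Suc c) i)" by simp
    qed
  qed
qed

lemma lead_expo_inj_on_ribbons: "inj_on lead_expo (ribbons c i)"
  using lead_expo_inj[of i _ _ 0 0] by (auto simp: inj_on_def ribbons_def)

text \<open>Ribbon paths have distinct leading monomials.\<close>
theorem ribbon_independent:
  fixes r :: "arr list \<Rightarrow> 'k::field"
  assumes "finite F" "F \<subseteq> ribbons c i" "(\<Sum>p\<in>F. Const (r p) * path_poly p) = 0" "p \<in> F"
  shows "r p = 0"
proof (rule leading_independent[OF assms(1) inj_on_subset[OF lead_expo_inj_on_ribbons assms(2)], of path_poly weight r])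
  have "leads (path_poly q :: 'k mpoly) (lead_expo q)" if "q \<in> F" for q using that assms(2) leads_path_poly by (auto simp: ribbons_def)
  then show "coef (path_poly q :: 'k mpoly) (lead_expo q) \<noteq> 0" "m \<in> supp (path_poly q :: 'k mpoly) \<Longrightarrow> m = lead_expo q \<or> weight (lead_expo q) < weight m"
    if "q \<in> F" for q m
    using that by (auto simp: leads_def)
qed (use assms in auto)

subsection \<open>Elements of higher degree come from the generators\<close>

text \<open>Products of a generator of \<open>\<Omega>\<^sup>cS\<close> and an element of
  \<open>M\<^bsub>-i\<^esub> = Hom\<^sub>R(M\<^sub>i, R)\<close>, the index taken modulo
  \<open>n\<close>; for \<open>i = 0\<close> the latter is taken in the maximal ideal of
  \<open>R\<close>.\<close>
definition Rad_gens :: "nat \<Rightarrow> nat \<Rightarrow> 'k::field mpoly set"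
  where "Rad_gens c i = {a * b | a b. a \<in> polys d \<and> (\<forall>m\<in>supp a. n dvd deg0 m + i \<and> 0 < deg0 m + i) \<and> b \<in> Gens c 0}"

text \<open>An element of a degree that is not the lowest one can be split: enough variables of the factor at
  position \<open>0\<close> are combined with the path to a generator, and the rest is an element
  of \<open>M\<^bsub>-i\<^esub>\<close>. For \<open>c = 0\<close> only monomials have to be split.\<close>
lemma Om_decomp:
  assumes "i < n" shows "(Om c i :: 'k::field mpoly set) \<subseteq> kv.span (Gens c i \<union> Rad_gens c i)"
proof (cases c)
  case 0
  show ?thesis
  proof
    fix h :: "'k mpoly" assume h: "h \<in> Om c i"
    have "mon m \<in> kv.span (Gens c i \<union> Rad_gens c i :: 'k mpoly set)" if "m \<in> supp h" for m
    proof (cases "deg0 m + i < n")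
      case True
      then have "mon m \<in> (Gens c i :: 'k mpoly set)" using h that by (auto simp: 0 Gens_def lowdeg_def polys_low)
      then show ?thesis by (intro kv.span_base) simp
    next
      case False
      have m: "low m = m" using h that by (auto simp: 0 polys_low)
      define r where "r = (deg0 m + i) mod n"
      have dm: "deg0 m + i = n * ((deg0 m + i) div n) + r" by (simp add: r_def)
      \<comment> \<open>The remainder of the degree modulo \<open>n\<close> goes into the second factor, so that the
        first one has a degree in the class of \<open>M\<^bsub>-i\<^esub>\<close>.\<close>
      have q: "1 \<le> (deg0 m + i) div n" using False n2 by (simp add: div_greater_zero_iff Suc_le_eq)
      then have nr: "n + r \<le> deg0 m + i" using dm by (metis add_le_mono1 mult_le_mono2 mult.right_neutral)
      then obtain u1 u2 where u: "m = u1 + u2" "deg0 u2 = r" "low u1 = u1" "low u2 = u2"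
        using low_split[OF m, of r] assms by (metis add_leD1 add_le_cancel_right le_trans less_imp_le nat_add_left_cancel_le add.commute)
      have rn: "r < n" using n2 by (simp add: r_def)
      have "deg0 u1 + i = n * ((deg0 m + i) div n)" using dm u by simp
      then have "n dvd deg0 u1 + i" "0 < deg0 u1 + i" using q n2 by auto
      then have "mon u1 * mon u2 \<in> (Rad_gens c i :: 'k mpoly set)"
        unfolding Rad_gens_def using u rn by (intro CollectI exI[of _ "mon u1"] exI[of _ "mon u2"]) (auto simp: 0 Gens_def lowdeg_def polys_low)
      then have "mon m \<in> (Rad_gens c i :: 'k mpoly set)" by (simp add: mult_single u(1))
      then show ?thesis by (intro kv.span_base) simp
    qed
    then have "(\<Sum>m\<in>supp h. Const (coef h m) * mon m) \<in> kv.span (Gens c i \<union> Rad_gens c i)"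
      by (intro kv.span_sum kv.span_scale)
    then show "h \<in> kv.span (Gens c i \<union> Rad_gens c i)"
      using poly_mapping_sum_singles[of h] by (simp add: Const_times_single)
  qed
next
  case (Suc c')
  have W: "Gens c' 0 \<subseteq> kv.span (path_poly ` ribbons c' 0 :: 'k mpoly set)" using Gens_span[of 0 c', where 'k = 'k] n2 by simp
  have "x \<in> Gens c i \<union> Rad_gens c i" if "x \<in> wedge_mults c' i" for x :: "'k mpoly"
  proof -
    from wedge_mults_deg[OF that] obtain u s t p where x: "x = mon u * path_poly (XX t s # p)" "low u = u" "supp u \<subseteq> {1..s}"
      "n dvd deg0 u + 1 + i" "is_path (n - 1) (XX t s # p)" "ribbon (XX t s # p)" "wedges p = c'" by blast
    show ?thesis
    proof (cases "deg0 u + 1 + i = n")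
      case True
      have "\<exists>q'. is_path (n - 1 - deg0 u) q' \<and> ribbon q' \<and> wedges q' = wedges (XX t s # p)
          \<and> (path_poly q' :: 'k mpoly) = mon u * path_poly (XX t s # p)"
        by (rule ribbon_extend) (use x True in auto)
      then obtain q' where "is_path i q'" "wedges q' = c" "path_poly q' = x"
        using True x Suc by (metis add_diff_cancel_left' add.commute add.left_commute wedges.simps(3) diff_diff_left)
      then show ?thesis using path_poly_mem by blast
    next
      case False
      obtain k where k: "deg0 u + 1 + i = n * k" using x(4) by (elim dvdE)
      then have "2 \<le> k" using False by (cases k rule: nat.exhaust; cases "k - 1") auto
      then have "2 * n \<le> n * k" using mult_le_mono1[of 2 k n] by (simp only: mult.commute)
      \<comment> \<open>Exactly \<open>n - 1\<close> variables lead from the vertex \<open>0\<close> to the tail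
        \<open>n - 1\<close> of the arrow.\<close>
      then have "n - 1 \<le> deg0 u" using k assms by linarith
      then obtain u1 u2 where u: "u = u1 + u2" "deg0 u2 = n - 1" "low u1 = u1" "low u2 = u2" "supp u2 \<subseteq> supp u"
        using low_split[OF x(2)] by metis
      have "\<exists>q'. is_path (n - 1 - deg0 u2) q' \<and> ribbon q' \<and> wedges q' = wedges (XX t s # p)
          \<and> (path_poly q' :: 'k mpoly) = mon u2 * path_poly (XX t s # p)"
        by (rule ribbon_extend) (use x u in auto)
      then obtain q' where q': "is_path 0 q'" "wedges q' = c" "path_poly q' = (mon u2 * path_poly (XX t s # p) :: 'k mpoly)"
        using u Suc x by auto
      have "path_poly q' \<in> (Gens c 0 :: 'k mpoly set)" using path_poly_mem[OF q'(1)] q'(2) by simp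
      moreover have "deg0 u1 + i = n * k - n" using k u n2 by simp
      then have "deg0 u1 + i = n * (k - 1)" by (simp add: algebra_simps)
      then have "n dvd deg0 u1 + i" "0 < deg0 u1 + i" using \<open>2 \<le> k\<close> n2 by auto
      ultimately have "mon u1 * path_poly q' \<in> (Rad_gens c i :: 'k mpoly set)"
        unfolding Rad_gens_def using u by (intro CollectI exI[of _ "mon u1"] exI[of _ "path_poly q'"]) (auto simp: polys_mon)
      moreover have "mon u1 * path_poly q' = x" using x(1) u(1) q'(3) by (simp add: mult.assoc[symmetric] mult_single)
      ultimately show ?thesis by simp
    qed
  qed
  then have "kv.span (wedge_mults c' i) \<subseteq> kv.span (Gens c i \<union> Rad_gens c i :: 'k mpoly set)"
    by (intro kv.span_mono) auto
  then show ?thesis using Om_Suc_span[OF W] Suc by blast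
qed

text \<open>All generators of \<open>Om c 0\<close> have an evident preimage \<open>a \<otimes> b\<close>.\<close>
lemma merge_Cov_surj:
  assumes "t \<in> (Om c 0 :: 'k::field mpoly set)" shows "\<exists>s\<in>Cov c 0. merge s = t"
proof -
  let ?V = "merge ` Cov c 0 :: 'k mpoly set"
  have "kv.subspace ?V"
  proof (rule kv.subspaceI)
    show "0 \<in> ?V" using kv.subspace_0[OF Cov_subspace[of c 0]] by (force simp: image_iff)
    show "x + y \<in> ?V" if "x \<in> ?V" "y \<in> ?V" for x y
      using that kv.subspace_add[OF Cov_subspace[of c 0]] by (auto simp: merge_add[symmetric] intro!: imageI)
    show "Const a * x \<in> ?V" if "x \<in> ?V" for x a
      using that kv.subspace_scale[OF Cov_subspace[of c 0]] by (auto simp: merge_Const_times[symmetric] intro!: imageI)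
  qed
  moreover have "Gens c 0 \<union> Rad_gens c 0 \<subseteq> ?V"
  proof -
    have "w = merge (1 * shift w) \<and> 1 * shift w \<in> Cov c 0" if "w \<in> Gens c 0" for w :: "'k mpoly"
      using that by (intro conjI Cov_shift) auto
    moreover have "a * b = merge (a * shift b) \<and> a * shift b \<in> Cov c 0"
      if "a \<in> polys d" "\<forall>m\<in>supp a. n dvd deg0 m + 0 \<and> 0 < deg0 m + 0" "b \<in> Gens c 0" for a b :: "'k mpoly"
      using that by (intro conjI Cov_shift) (auto simp: merge_mult merge_polys)
    ultimately show ?thesis unfolding Rad_gens_def by blast
  qed
  ultimately have "kv.span (Gens c 0 \<union> Rad_gens c 0) \<subseteq> ?V" by (intro kv.span_minimal)
  then show ?thesis using Om_decomp[of 0 c, where 'k = 'k] n2 assms by fastforce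
qed

end

section \<open>Homomorphisms of modules\<close>

lemma mod_homD:
  assumes "f \<in> mod_hom R M N"
  shows "x \<in> carrier M \<Longrightarrow> f x \<in> carrier N"
    "x \<in> carrier M \<Longrightarrow> y \<in> carrier M \<Longrightarrow> f (x \<oplus>\<^bsub>M\<^esub> y) = f x \<oplus>\<^bsub>N\<^esub> f y"
    "r \<in> carrier R \<Longrightarrow> x \<in> carrier M \<Longrightarrow> f (r \<odot>\<^bsub>M\<^esub> x) = r \<odot>\<^bsub>N\<^esub> f x"
    "f \<in> extensional (carrier M)"
  using assms by (auto simp: mod_hom_def PiE_def)

lemma mod_homI:
  assumes "\<And>x. x \<in> carrier M \<Longrightarrow> f x \<in> carrier N"
    "\<And>x y. x \<in> carrier M \<Longrightarrow> y \<in> carrier M \<Longrightarrow> f (x \<oplus>\<^bsub>M\<^esub> y) = f x \<oplus>\<^bsub>N\<^esub> f y"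
    "\<And>r x. r \<in> carrier R \<Longrightarrow> x \<in> carrier M \<Longrightarrow> f (r \<odot>\<^bsub>M\<^esub> x) = r \<odot>\<^bsub>N\<^esub> f x"
    "f \<in> extensional (carrier M)"
  shows "f \<in> mod_hom R M N"
  using assms by (auto simp: mod_hom_def PiE_def)

lemma mod_hom_restrictI:
  assumes "Module.module R M" "\<And>x. x \<in> carrier M \<Longrightarrow> f x \<in> carrier N"
    "\<And>x y. x \<in> carrier M \<Longrightarrow> y \<in> carrier M \<Longrightarrow> f (x \<oplus>\<^bsub>M\<^esub> y) = f x \<oplus>\<^bsub>N\<^esub> f y"
    "\<And>r x. r \<in> carrier R \<Longrightarrow> x \<in> carrier M \<Longrightarrow> f (r \<odot>\<^bsub>M\<^esub> x) = r \<odot>\<^bsub>N\<^esub> f x"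
  shows "restrict f (carrier M) \<in> mod_hom R M N"
proof -
  interpret M: Module.module R M by fact
  show ?thesis by (rule mod_homI) (auto simp: assms)
qed

lemma mod_hom_zero:
  assumes "Module.module R M" "Module.module R N" "f \<in> mod_hom R M N" shows "f \<zero>\<^bsub>M\<^esub> = \<zero>\<^bsub>N\<^esub>"
proof -
  interpret M: Module.module R M by fact
  interpret N: Module.module R N by fact
  show ?thesis
    using mod_homD(3)[OF assms(3), of "\<zero>\<^bsub>R\<^esub>" "\<zero>\<^bsub>M\<^esub>"] mod_homD(1)[OF assms(3), of "\<zero>\<^bsub>M\<^esub>"] by simp
qed

lemma mod_hom_minus:
  assumes "Module.module R M" "Module.module R N" "f \<in> mod_hom R M N" "x \<in> carrier M"
  shows "f (\<ominus>\<^bsub>M\<^esub> x) = \<ominus>\<^bsub>N\<^esub> f x"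
proof -
  interpret M: Module.module R M by fact
  interpret N: Module.module R N by fact
  have "f x \<oplus>\<^bsub>N\<^esub> f (\<ominus>\<^bsub>M\<^esub> x) = f \<zero>\<^bsub>M\<^esub>"
    using mod_homD(2)[OF assms(3), of x "\<ominus>\<^bsub>M\<^esub> x"] assms(4) by (simp add: M.M.r_neg)
  then show ?thesis using mod_homD(1)[OF assms(3)] assms(4) mod_hom_zero[OF assms(1-3)]
    by (metis M.M.a_inv_closed N.M.minus_equality N.M.a_comm)
qed

lemma mod_hom_diff:
  assumes "Module.module R M" "Module.module R N" "f \<in> mod_hom R M N" "x \<in> carrier M" "y \<in> carrier M"
  shows "f (x \<ominus>\<^bsub>M\<^esub> y) = f x \<ominus>\<^bsub>N\<^esub> f y"
proof -
  interpret M: Module.module R M by fact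
  show ?thesis using assms mod_homD(2)[OF assms(3), of x "\<ominus>\<^bsub>M\<^esub> y"] mod_hom_minus[OF assms(1-3)]
    by (simp add: a_minus_def)
qed

lemma mod_hom_compose:
  assumes "Module.module R L" "f \<in> mod_hom R L M" "g \<in> mod_hom R M N"
  shows "compose (carrier L) g f \<in> mod_hom R L N"
  unfolding compose_def
  by (rule mod_hom_restrictI) (use assms mod_homD[OF assms(2)] mod_homD[OF assms(3)] in auto)

definition hdiff :: "('a, 'b, 'm) module_scheme \<Rightarrow> ('a, 'c, 'n) module_scheme \<Rightarrow> ('b \<Rightarrow> 'c) \<Rightarrow> ('b \<Rightarrow> 'c) \<Rightarrow> 'b \<Rightarrow> 'c"
  where "hdiff M N f g = (\<lambda>x\<in>carrier M. f x \<ominus>\<^bsub>N\<^esub> g x)"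

lemma module_diff_cancel:
  assumes "Module.module R N" "x \<in> carrier N" "y \<in> carrier N"
  shows "x \<ominus>\<^bsub>N\<^esub> y \<in> carrier N" "(x \<ominus>\<^bsub>N\<^esub> y) \<oplus>\<^bsub>N\<^esub> y = x"
    "x \<ominus>\<^bsub>N\<^esub> y = \<zero>\<^bsub>N\<^esub> \<longleftrightarrow> x = y"
proof -
  interpret N: Module.module R N by fact
  show "x \<ominus>\<^bsub>N\<^esub> y \<in> carrier N" using assms by simp
  show *: "(x \<ominus>\<^bsub>N\<^esub> y) \<oplus>\<^bsub>N\<^esub> y = x" using assms by (simp add: a_minus_def N.M.a_assoc N.M.l_neg)
  show "x \<ominus>\<^bsub>N\<^esub> y = \<zero>\<^bsub>N\<^esub> \<longleftrightarrow> x = y" using assms * by (metis N.M.l_zero N.M.r_neg a_minus_def)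
qed

lemma hdiff_hom:
  assumes "Module.module R M" "Module.module R N" "f \<in> mod_hom R M N" "g \<in> mod_hom R M N"
  shows "hdiff M N f g \<in> mod_hom R M N"
proof -
  interpret N: Module.module R N by fact
  note f = mod_homD[OF assms(3)] and g = mod_homD[OF assms(4)]
  show ?thesis unfolding hdiff_def
  proof (rule mod_hom_restrictI[OF assms(1)])
    fix x y assume "x \<in> carrier M" "y \<in> carrier M"
    with f(1) g(1) show "f (x \<oplus>\<^bsub>M\<^esub> y) \<ominus>\<^bsub>N\<^esub> g (x \<oplus>\<^bsub>M\<^esub> y) = (f x \<ominus>\<^bsub>N\<^esub> g x) \<oplus>\<^bsub>N\<^esub> (f y \<ominus>\<^bsub>N\<^esub> g y)"
      by (simp add: f(2) g(2) a_minus_def N.M.minus_add N.M.a_ac)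
  next
    fix r x assume "r \<in> carrier R" "x \<in> carrier M"
    with f(1) g(1) show "f (r \<odot>\<^bsub>M\<^esub> x) \<ominus>\<^bsub>N\<^esub> g (r \<odot>\<^bsub>M\<^esub> x) = r \<odot>\<^bsub>N\<^esub> (f x \<ominus>\<^bsub>N\<^esub> g x)"
      by (simp add: f(3) g(3) a_minus_def N.smult_r_distr N.smult_r_minus)
  qed (use f g in simp)
qed

lemma hom_module_abelian_group:
  assumes "Module.module R M" "Module.module R N"
  shows "abelian_group (hom_module R M N)"
proof -
  interpret M: Module.module R M by fact
  interpret N: Module.module R N by fact
  have add: "(\<lambda>x\<in>carrier M. f x \<oplus>\<^bsub>N\<^esub> g x) \<in> mod_hom R M N" if "f \<in> mod_hom R M N" "g \<in> mod_hom R M N" for f g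
    using that[THEN mod_homD(1)] that[THEN mod_homD(2)] that[THEN mod_homD(3)]
    by (intro mod_hom_restrictI assms) (auto simp: N.M.a_ac N.smult_r_distr)
  have zero: "(\<lambda>x\<in>carrier M. \<zero>\<^bsub>N\<^esub>) \<in> mod_hom R M N"
    by (rule mod_hom_restrictI[OF assms(1)]) auto
  show ?thesis
  proof (rule abelian_groupI)
    fix f g h assume f: "f \<in> carrier (hom_module R M N)" and g: "g \<in> carrier (hom_module R M N)"
      and h: "h \<in> carrier (hom_module R M N)"
    note c = f[unfolded hom_module_def, simplified] g[unfolded hom_module_def, simplified] h[unfolded hom_module_def, simplified]
    show "f \<oplus>\<^bsub>hom_module R M N\<^esub> g \<in> carrier (hom_module R M N)"
      using c add by (simp add: hom_module_def)
    show "f \<oplus>\<^bsub>hom_module R M N\<^esub> g \<oplus>\<^bsub>hom_module R M N\<^esub> h = f \<oplus>\<^bsub>hom_module R M N\<^esub> (g \<oplus>\<^bsub>hom_module R M N\<^esub> h)"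
      using c[THEN mod_homD(1)] by (auto simp: hom_module_def N.M.a_assoc)
    show "f \<oplus>\<^bsub>hom_module R M N\<^esub> g = g \<oplus>\<^bsub>hom_module R M N\<^esub> f"
      using c[THEN mod_homD(1)] by (auto simp: hom_module_def N.M.a_comm)
    show "\<zero>\<^bsub>hom_module R M N\<^esub> \<oplus>\<^bsub>hom_module R M N\<^esub> f = f"
      using c(1)[THEN mod_homD(1)] c(1)[THEN mod_homD(4)]
      by (intro extensionalityI[of _ "carrier M"]) (auto simp: hom_module_def)
    have m: "hdiff M N (\<lambda>x\<in>carrier M. \<zero>\<^bsub>N\<^esub>) f \<in> mod_hom R M N"
      by (intro hdiff_hom assms zero c)
    show "\<exists>y\<in>carrier (hom_module R M N). y \<oplus>\<^bsub>hom_module R M N\<^esub> f = \<zero>\<^bsub>hom_module R M N\<^esub>"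
      using m c(1)[THEN mod_homD(1)] module_diff_cancel(2)[OF assms(2)]
      by (intro bexI[of _ "hdiff M N (\<lambda>x\<in>carrier M. \<zero>\<^bsub>N\<^esub>) f"]) (auto simp: hom_module_def hdiff_def)
  qed (use zero in \<open>simp add: hom_module_def\<close>)
qed

section \<open>Free and projective modules\<close>

definition unitf :: "('a, 'r) ring_scheme \<Rightarrow> 'x \<Rightarrow> 'x \<Rightarrow> 'a"
  where "unitf R x = (\<lambda>y. if y = x then \<one>\<^bsub>R\<^esub> else \<zero>\<^bsub>R\<^esub>)"

lemma free_module_simps:
  "f \<in> carrier (free_module R J) \<longleftrightarrow>
     (\<forall>x\<in>J. f x \<in> carrier R) \<and> (\<forall>x. x \<notin> J \<longrightarrow> f x = \<zero>\<^bsub>R\<^esub>) \<and> finite {x. f x \<noteq> \<zero>\<^bsub>R\<^esub>}"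
  "\<zero>\<^bsub>free_module R J\<^esub> = (\<lambda>_. \<zero>\<^bsub>R\<^esub>)"
  "f \<oplus>\<^bsub>free_module R J\<^esub> g = (\<lambda>x. f x \<oplus>\<^bsub>R\<^esub> g x)"
  "r \<odot>\<^bsub>free_module R J\<^esub> f = (\<lambda>x. r \<otimes>\<^bsub>R\<^esub> f x)"
  by (simp_all add: free_module_def)

lemma free_module_in_R:
  assumes "cring R" "f \<in> carrier (free_module R J)" shows "f x \<in> carrier R"
proof -
  interpret cring R by fact
  show ?thesis using assms(2) by (cases "x \<in> J") (auto simp: free_module_simps)
qed

lemma free_module_module:
  assumes "cring R" shows "Module.module R (free_module R J)"
proof -
  interpret cring R by fact
  note inR = free_module_in_R[OF assms]
  have add: "(\<lambda>x. f x \<oplus>\<^bsub>R\<^esub> g x) \<in> carrier (free_module R J)"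
    if "f \<in> carrier (free_module R J)" "g \<in> carrier (free_module R J)" for f g
  proof -
    have "finite ({x. f x \<noteq> \<zero>\<^bsub>R\<^esub>} \<union> {x. g x \<noteq> \<zero>\<^bsub>R\<^esub>})" using that by (simp add: free_module_simps)
    then have "finite {x. f x \<oplus>\<^bsub>R\<^esub> g x \<noteq> \<zero>\<^bsub>R\<^esub>}" by (rule rev_finite_subset) (auto simp: inR that)
    then show ?thesis using that by (auto simp: free_module_simps)
  qed
  have smult: "(\<lambda>x. r \<otimes>\<^bsub>R\<^esub> f x) \<in> carrier (free_module R J)"
    if "f \<in> carrier (free_module R J)" "r \<in> carrier R" for f r
  proof -
    have "finite {x. f x \<noteq> \<zero>\<^bsub>R\<^esub>}" using that by (simp add: free_module_simps)
    then have "finite {x. r \<otimes>\<^bsub>R\<^esub> f x \<noteq> \<zero>\<^bsub>R\<^esub>}" by (rule rev_finite_subset) (use that in auto)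
    then show ?thesis using that by (auto simp: free_module_simps)
  qed
  show ?thesis
  proof (rule moduleI)
    show "abelian_group (free_module R J)"
    proof (rule abelian_groupI)
      fix f assume f: "f \<in> carrier (free_module R J)"
      have "(\<lambda>x. \<ominus>\<^bsub>R\<^esub> \<one>\<^bsub>R\<^esub> \<otimes>\<^bsub>R\<^esub> f x) \<in> carrier (free_module R J)" by (rule smult[OF f]) simp
      then show "\<exists>y\<in>carrier (free_module R J). y \<oplus>\<^bsub>free_module R J\<^esub> f = \<zero>\<^bsub>free_module R J\<^esub>"
        using inR[OF f] by (intro bexI[of _ "\<lambda>x. \<ominus>\<^bsub>R\<^esub> \<one>\<^bsub>R\<^esub> \<otimes>\<^bsub>R\<^esub> f x"])
          (auto simp: free_module_simps l_minus l_neg)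
    qed (auto simp: free_module_simps(2-4) add inR a_ac free_module_simps(1)[of "\<lambda>_. \<zero>\<^bsub>R\<^esub>"])
  qed (auto simp: assms smult free_module_simps(2-4) inR l_distr r_distr m_assoc)
qed

lemma unitf_free: "cring R \<Longrightarrow> x \<in> J \<Longrightarrow> unitf R x \<in> carrier (free_module R J)"
proof -
  assume "cring R" "x \<in> J"
  interpret cring R by fact
  have "{y. unitf R x y \<noteq> \<zero>\<^bsub>R\<^esub>} \<subseteq> {x}" by (auto simp: unitf_def)
  then have "finite {y. unitf R x y \<noteq> \<zero>\<^bsub>R\<^esub>}" by (rule finite_subset) simp
  with \<open>x \<in> J\<close> show ?thesis by (auto simp: free_module_simps(1) unitf_def)
qed

text \<open>Clearing one coordinate at a time, until no basis element in the finite support is left.\<close>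
lemma free_module_induct [consumes 2, case_names zero add]:
  assumes "cring R" "f \<in> carrier (free_module R J)"
    and "P \<zero>\<^bsub>free_module R J\<^esub>"
    and step: "\<And>f x. f \<in> carrier (free_module R J) \<Longrightarrow> x \<in> J \<Longrightarrow> f x \<in> carrier R \<Longrightarrow>
      f(x := \<zero>\<^bsub>R\<^esub>) \<in> carrier (free_module R J) \<Longrightarrow> P (f(x := \<zero>\<^bsub>R\<^esub>)) \<Longrightarrow>
      f = f(x := \<zero>\<^bsub>R\<^esub>) \<oplus>\<^bsub>free_module R J\<^esub> (f x \<odot>\<^bsub>free_module R J\<^esub> unitf R x) \<Longrightarrow> P f"
  shows "P f"
proof -
  interpret cring R by fact
  have "P f" if "finite A" "{x. f x \<noteq> \<zero>\<^bsub>R\<^esub>} \<subseteq> A" "f \<in> carrier (free_module R J)" for A f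
    using that
  proof (induction A arbitrary: f)
    case empty
    then have "f = \<zero>\<^bsub>free_module R J\<^esub>" by (auto simp: free_module_simps(2))
    then show ?case using assms(3) by simp
  next
    case (insert x A)
    show ?case
    proof (cases "f x = \<zero>\<^bsub>R\<^esub>")
      case True then show ?thesis using insert by (intro insert.IH) auto
    next
      case False
      then have x: "x \<in> J" using insert(5) by (auto simp: free_module_simps(1))
      have "{y. (f(x := \<zero>\<^bsub>R\<^esub>)) y \<noteq> \<zero>\<^bsub>R\<^esub>} \<subseteq> {y. f y \<noteq> \<zero>\<^bsub>R\<^esub>}" by auto
      then have fin: "finite {y. (f(x := \<zero>\<^bsub>R\<^esub>)) y \<noteq> \<zero>\<^bsub>R\<^esub>}"
        using insert(5) finite_subset by (auto simp: free_module_simps(1) simp del: fun_upd_apply)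
      have c: "f(x := \<zero>\<^bsub>R\<^esub>) \<in> carrier (free_module R J)"
        using insert(5) fin by (simp add: free_module_simps(1) del: fun_upd_apply) (simp add: fun_upd_apply)
      show ?thesis
      proof (rule step[of f x])
        show "P (f(x := \<zero>\<^bsub>R\<^esub>))" using insert(4) by (intro insert.IH c) auto
        show "f = f(x := \<zero>\<^bsub>R\<^esub>) \<oplus>\<^bsub>free_module R J\<^esub> (f x \<odot>\<^bsub>free_module R J\<^esub> unitf R x)"
          using free_module_in_R[OF assms(1) insert(5)] by (auto simp: free_module_simps(3,4) unitf_def)
      qed (use x c insert(5) free_module_in_R[OF assms(1)] in auto)
    qed
  qed
  from this[of "{x. f x \<noteq> \<zero>\<^bsub>R\<^esub>}"] assms(2) show ?thesis by (simp add: free_module_simps(1))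
qed

text \<open>A homomorphism out of a free module may be prescribed freely on the basis.\<close>
lemma free_module_hom_exists:
  assumes "cring R" "Module.module R N" "\<And>x. x \<in> J \<Longrightarrow> nn x \<in> carrier N"
  shows "\<exists>v \<in> mod_hom R (free_module R J) N. \<forall>x\<in>J. v (unitf R x) = nn x"
proof -
  interpret cring R by fact
  interpret N: Module.module R N by fact
  let ?F = "free_module R J"
  note inR = free_module_in_R[OF assms(1)]
  interpret F: Module.module R ?F by (rule free_module_module) fact
  define v where "v f = (\<Oplus>\<^bsub>N\<^esub>x\<in>{x. f x \<noteq> \<zero>\<^bsub>R\<^esub>}. f x \<odot>\<^bsub>N\<^esub> nn x)" for f
  have vA: "v f = (\<Oplus>\<^bsub>N\<^esub>x\<in>A. f x \<odot>\<^bsub>N\<^esub> nn x)" if "f \<in> carrier ?F" "finite A" "{x. f x \<noteq> \<zero>\<^bsub>R\<^esub>} \<subseteq> A" "A \<subseteq> J" for f A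
    unfolding v_def
    by (rule N.M.add.finprod_mono_neutral_cong_left) (use that inR[OF that(1)] assms(3) in auto)
  have sub: "{x. f x \<noteq> \<zero>\<^bsub>R\<^esub>} \<subseteq> J" "finite {x. f x \<noteq> \<zero>\<^bsub>R\<^esub>}" if "f \<in> carrier ?F" for f
    using that by (auto simp: free_module_simps(1))
  have hom: "restrict v (carrier ?F) \<in> mod_hom R ?F N"
  proof (rule mod_hom_restrictI)
    show "v f \<in> carrier N" if "f \<in> carrier ?F" for f
      unfolding v_def using that sub(1)[OF that] inR[OF that] assms(3)
      by (intro N.M.finsum_closed) (auto intro!: N.smult_closed)
  next
    fix f g assume fg: "f \<in> carrier ?F" "g \<in> carrier ?F"
    obtain A where A: "finite A" "A \<subseteq> J" "{x. f x \<noteq> \<zero>\<^bsub>R\<^esub>} \<subseteq> A" "{x. g x \<noteq> \<zero>\<^bsub>R\<^esub>} \<subseteq> A"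
      using sub[OF fg(1)] sub[OF fg(2)]
        that[of "{x. f x \<noteq> \<zero>\<^bsub>R\<^esub>} \<union> {x. g x \<noteq> \<zero>\<^bsub>R\<^esub>}"] by auto
    have nA: "nn x \<in> carrier N" if "x \<in> A" for x using that A(2) assms(3) by blast
    have "f x = \<zero>\<^bsub>R\<^esub>" "g x = \<zero>\<^bsub>R\<^esub>" if "x \<notin> A" for x using that A(3,4) by blast+
    then have fgA: "x \<in> A" if "f x \<oplus>\<^bsub>R\<^esub> g x \<noteq> \<zero>\<^bsub>R\<^esub>" for x using that by (metis l_zero zero_closed)
    have "v (f \<oplus>\<^bsub>?F\<^esub> g) = (\<Oplus>\<^bsub>N\<^esub>x\<in>A. (f \<oplus>\<^bsub>?F\<^esub> g) x \<odot>\<^bsub>N\<^esub> nn x)"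
      by (rule vA) (use fg A inR F.M.a_closed[OF fg] in \<open>auto simp: free_module_simps(3) fgA\<close>)
    also have "\<dots> = (\<Oplus>\<^bsub>N\<^esub>x\<in>A. f x \<odot>\<^bsub>N\<^esub> nn x \<oplus>\<^bsub>N\<^esub> g x \<odot>\<^bsub>N\<^esub> nn x)"
      using inR[OF fg(1)] inR[OF fg(2)] A nA by (intro N.M.finsum_cong') (auto simp: free_module_simps(3) N.smult_l_distr)
    also have "\<dots> = (\<Oplus>\<^bsub>N\<^esub>x\<in>A. f x \<odot>\<^bsub>N\<^esub> nn x) \<oplus>\<^bsub>N\<^esub> (\<Oplus>\<^bsub>N\<^esub>x\<in>A. g x \<odot>\<^bsub>N\<^esub> nn x)"
      using inR[OF fg(1)] inR[OF fg(2)] A nA by (intro N.M.finsum_addf) auto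
    also have "(\<Oplus>\<^bsub>N\<^esub>x\<in>A. f x \<odot>\<^bsub>N\<^esub> nn x) = v f" using fg A by (intro vA[symmetric]) auto
    also have "(\<Oplus>\<^bsub>N\<^esub>x\<in>A. g x \<odot>\<^bsub>N\<^esub> nn x) = v g" using fg A by (intro vA[symmetric]) auto
    finally show "v (f \<oplus>\<^bsub>?F\<^esub> g) = v f \<oplus>\<^bsub>N\<^esub> v g" .
  next
    fix r f assume r: "r \<in> carrier R" and f: "f \<in> carrier ?F"
    let ?A = "{x. f x \<noteq> \<zero>\<^bsub>R\<^esub>}"
    have nA: "nn x \<in> carrier N" if "x \<in> ?A" for x using that sub(1)[OF f] assms(3) by blast
    have "v (r \<odot>\<^bsub>?F\<^esub> f) = (\<Oplus>\<^bsub>N\<^esub>x\<in>?A. (r \<odot>\<^bsub>?F\<^esub> f) x \<odot>\<^bsub>N\<^esub> nn x)"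
      by (rule vA) (use r f sub[OF f] F.smult_closed[OF r f] in \<open>auto simp: free_module_simps(4)\<close>)
    also have "\<dots> = (\<Oplus>\<^bsub>N\<^esub>x\<in>?A. r \<odot>\<^bsub>N\<^esub> (f x \<odot>\<^bsub>N\<^esub> nn x))"
      using r inR[OF f] nA by (intro N.M.finsum_cong') (auto simp: free_module_simps(4) N.smult_assoc1)
    also have "\<dots> = r \<odot>\<^bsub>N\<^esub> v f"
      unfolding v_def using r sub(2)[OF f] inR[OF f] nA by (intro N.finsum_smult_ldistr[symmetric]) auto
    finally show "v (r \<odot>\<^bsub>?F\<^esub> f) = r \<odot>\<^bsub>N\<^esub> v f" .
  qed (rule F.module_axioms)
  have "v (unitf R x) = nn x" if "x \<in> J" for x
  proof -
    have "v (unitf R x) = (\<Oplus>\<^bsub>N\<^esub>y\<in>{x}. unitf R x y \<odot>\<^bsub>N\<^esub> nn y)"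
      by (rule vA) (use that unitf_free[OF assms(1) that] in \<open>auto simp: unitf_def split: if_splits\<close>)
    then show ?thesis using that assms(3) by (simp add: unitf_def)
  qed
  then show ?thesis by (intro bexI[OF _ hom]) (auto simp: unitf_free[OF assms(1)])
qed

lemma free_module_hom_eq:
  assumes "cring R" "Module.module R N" "g \<in> mod_hom R (free_module R J) N" "h \<in> mod_hom R (free_module R J) N"
    and "\<And>x. x \<in> J \<Longrightarrow> g (unitf R x) = h (unitf R x)" and "f \<in> carrier (free_module R J)"
  shows "g f = h f"
proof -
  note g = mod_homD[OF assms(3)] and h = mod_homD[OF assms(4)]
  interpret F: Module.module R "free_module R J" by (rule free_module_module) fact
  show ?thesis
  proof (rule free_module_induct[where P = "\<lambda>f. g f = h f", OF assms(1,6)])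
    show "g \<zero>\<^bsub>free_module R J\<^esub> = h \<zero>\<^bsub>free_module R J\<^esub>" using mod_hom_zero[OF F.module_axioms assms(2)] assms(3,4) by metis
  next
    fix f x
    assume add: "f \<in> carrier (free_module R J)" "x \<in> J" "f x \<in> carrier R"
      "f(x := \<zero>\<^bsub>R\<^esub>) \<in> carrier (free_module R J)" "g (f(x := \<zero>\<^bsub>R\<^esub>)) = h (f(x := \<zero>\<^bsub>R\<^esub>))"
      "f = f(x := \<zero>\<^bsub>R\<^esub>) \<oplus>\<^bsub>free_module R J\<^esub> (f x \<odot>\<^bsub>free_module R J\<^esub> unitf R x)"
    have u: "unitf R x \<in> carrier (free_module R J)" by (rule unitf_free[OF assms(1) add(2)])
    have e: "k f = k (f(x := \<zero>\<^bsub>R\<^esub>)) \<oplus>\<^bsub>N\<^esub> f x \<odot>\<^bsub>N\<^esub> k (unitf R x)"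
      if k: "k \<in> mod_hom R (free_module R J) N" for k
    proof -
      have "k f = k (f(x := \<zero>\<^bsub>R\<^esub>) \<oplus>\<^bsub>free_module R J\<^esub> (f x \<odot>\<^bsub>free_module R J\<^esub> unitf R x))"
        by (rule arg_cong[OF add(6)])
      also have "\<dots> = k (f(x := \<zero>\<^bsub>R\<^esub>)) \<oplus>\<^bsub>N\<^esub> k (f x \<odot>\<^bsub>free_module R J\<^esub> unitf R x)"
        by (rule mod_homD(2)[OF k add(4) F.smult_closed[OF add(3) u]])
      also have "k (f x \<odot>\<^bsub>free_module R J\<^esub> unitf R x) = f x \<odot>\<^bsub>N\<^esub> k (unitf R x)"
        by (rule mod_homD(3)[OF k add(3) u])
      finally show ?thesis .
    qed
    show "g f = h f" unfolding e[OF assms(3)] e[OF assms(4)] add(5) assms(5)[OF add(2)] ..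
  qed
qed

text \<open>A projective module is only given as a retract of a free module on some set: lift the images of
  the basis elements and restrict along the splitting.\<close>
lemma projective_lift:
  fixes Q :: "('a, 'q, 'm) module_scheme"
  assumes "cring R" "projective R Q" "Module.module R P" "Module.module R N" "p \<in> mod_hom R P N" "p ` carrier P = carrier N"
    and "v \<in> mod_hom R Q N"
  shows "\<exists>w \<in> mod_hom R Q P. \<forall>x\<in>carrier Q. p (w x) = v x"
proof -
  obtain J :: "'q set" and s r where Q: "Module.module R Q" and s: "s \<in> mod_hom R Q (free_module R J)"
    and r: "r \<in> mod_hom R (free_module R J) Q" and rs: "\<And>x. x \<in> carrier Q \<Longrightarrow> r (s x) = x"
    using assms(2) unfolding projective_def by blast
  let ?F = "free_module R J"
  interpret F: Module.module R ?F by (rule free_module_module) fact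
  have "\<exists>y\<in>carrier P. p y = v (r (unitf R x))" if "x \<in> J" for x
  proof -
    have "v (r (unitf R x)) \<in> p ` carrier P"
      unfolding assms(6) by (intro mod_homD(1)[OF assms(7)] mod_homD(1)[OF r] unitf_free assms(1) that)
    then show ?thesis by auto
  qed
  then obtain nn where nn: "\<And>x. x \<in> J \<Longrightarrow> nn x \<in> carrier P" "\<And>x. x \<in> J \<Longrightarrow> p (nn x) = v (r (unitf R x))"
    by metis
  obtain w where w: "w \<in> mod_hom R ?F P" "\<And>x. x \<in> J \<Longrightarrow> w (unitf R x) = nn x"
    using free_module_hom_exists[OF assms(1,3), of J nn] nn(1) by auto
  have eq: "p (w f) = v (r f)" if "f \<in> carrier ?F" for f
    using free_module_hom_eq[OF assms(1,4) mod_hom_compose[OF F.module_axioms w(1) assms(5)]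
        mod_hom_compose[OF F.module_axioms r assms(7)], of f] that
    by (simp add: compose_def w nn unitf_free[OF assms(1)])
  show ?thesis
    using mod_hom_compose[OF Q s w(1)] eq mod_homD(1)[OF s] rs
    by (intro bexI[of _ "compose (carrier Q) w s"]) (auto simp: compose_def)
qed

text \<open>The definition of projectivity asks for a basis inside the carrier type of the module; the unit
  vectors provide it, being distinct as \<open>1 \<noteq> 0\<close>.\<close>
lemma free_module_projective:
  assumes "cring R" "\<one>\<^bsub>R\<^esub> \<noteq> \<zero>\<^bsub>R\<^esub>"
  shows "projective R (free_module R {..<m::nat})"
proof -
  interpret cring R by fact
  let ?F = "free_module R {..<m}"
  interpret F: Module.module R ?F by (rule free_module_module) fact
  define J where "J = unitf R ` {..<m}"
  have JF: "x \<in> carrier ?F" if "x \<in> J" for x using that by (auto simp: J_def unitf_free[OF assms(1)])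
  obtain r where r: "r \<in> mod_hom R (free_module R J) ?F" "\<And>x. x \<in> J \<Longrightarrow> r (unitf R x) = x"
    using free_module_hom_exists[OF assms(1) F.module_axioms, of J "\<lambda>x. x"] JF by auto
  interpret FX: Module.module R "free_module R J" by (rule free_module_module) fact
  have "unitf R (unitf R i) \<in> carrier (free_module R J)" if "i \<in> {..<m}" for i
    by (rule unitf_free[OF assms(1)]) (use that in \<open>simp add: J_def\<close>)
  then obtain s where s: "s \<in> mod_hom R ?F (free_module R J)"
    "\<And>i. i \<in> {..<m} \<Longrightarrow> s (unitf R i) = unitf R (unitf R i)"
    using free_module_hom_exists[OF assms(1) FX.module_axioms, of "{..<m}" "\<lambda>i. unitf R (unitf R i)"] by auto
  have id: "restrict (\<lambda>f. f) (carrier ?F) \<in> mod_hom R ?F ?F"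
    by (rule mod_hom_restrictI) (auto simp: F.module_axioms)
  have "r (s f) = f" if f: "f \<in> carrier ?F" for f
  proof -
    have "compose (carrier ?F) r s f = restrict (\<lambda>f. f) (carrier ?F) f"
    proof (rule free_module_hom_eq[OF assms(1) F.module_axioms mod_hom_compose[OF F.module_axioms s(1) r(1)] id _ f])
      fix i assume i: "i \<in> {..<m}"
      then have "unitf R i \<in> J" by (simp add: J_def)
      then show "compose (carrier ?F) r s (unitf R i) = restrict (\<lambda>f. f) (carrier ?F) (unitf R i)"
        using unitf_free[OF assms(1) i] by (simp only: compose_def restrict_apply' s(2)[OF i] r(2))
    qed
    then show ?thesis using f by (simp add: compose_def)
  qed
  then show ?thesis unfolding projective_def using F.module_axioms s(1) r(1) by blast
qed

section \<open>Maps that factor through projectives\<close>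

lemma factors_hom: "f \<in> factors_through_projective R M N \<Longrightarrow> f \<in> mod_hom R M N"
  by (simp add: factors_through_projective_def)

lemma factors_compose_left:
  assumes "Module.module R M" "f \<in> factors_through_projective R M N" "h \<in> mod_hom R N N'"
  shows "compose (carrier M) h f \<in> factors_through_projective R M N'"
proof -
  obtain Q :: "('a, nat \<Rightarrow> 'a) module" and u v where q: "projective R Q" "u \<in> mod_hom R M Q"
    "v \<in> mod_hom R Q N" "\<forall>x\<in>carrier M. f x = v (u x)"
    using assms(2) unfolding factors_through_projective_def by blast
  have Q: "Module.module R Q" using q(1) by (simp add: projective_def)
  show ?thesis
    unfolding factors_through_projective_def
    using mod_hom_compose[OF assms(1) factors_hom[OF assms(2)] assms(3)] q
      mod_hom_compose[OF Q q(3) assms(3)] mod_homD(1)[OF q(2)]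
    by (intro CollectI conjI exI[of _ Q] exI[of _ u] exI[of _ "compose (carrier Q) h v"]) (auto simp: compose_def)
qed

lemma factors_compose_right:
  assumes "Module.module R L" "f \<in> factors_through_projective R M N" "h \<in> mod_hom R L M"
  shows "compose (carrier L) f h \<in> factors_through_projective R L N"
proof -
  obtain Q :: "('a, nat \<Rightarrow> 'a) module" and u v where q: "projective R Q" "u \<in> mod_hom R M Q"
    "v \<in> mod_hom R Q N" "\<forall>x\<in>carrier M. f x = v (u x)"
    using assms(2) unfolding factors_through_projective_def by blast
  show ?thesis
    unfolding factors_through_projective_def
    using mod_hom_compose[OF assms(1,3) factors_hom[OF assms(2)]] q
      mod_hom_compose[OF assms(1,3) q(2)] mod_homD(1)[OF assms(3)]
    by (intro CollectI conjI exI[of _ Q] exI[of _ "compose (carrier L) u h"] exI[of _ v]) (auto simp: compose_def)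
qed

lemma factors_free:
  assumes "cring R" "\<one>\<^bsub>R\<^esub> \<noteq> \<zero>\<^bsub>R\<^esub>" "f \<in> mod_hom R M N" "u \<in> mod_hom R M (free_module R {..<m::nat})"
    "v \<in> mod_hom R (free_module R {..<m}) N" "\<And>x. x \<in> carrier M \<Longrightarrow> f x = v (u x)"
  shows "f \<in> factors_through_projective R M N"
  unfolding factors_through_projective_def using free_module_projective[OF assms(1,2)] assms by blast

lemma mod_hom_gfree:
  "mod_hom R M (gfree_module R m s) = mod_hom R M (free_module R {..<m})"
  "mod_hom R (gfree_module R m s) M = mod_hom R (free_module R {..<m}) M"
  by (simp_all add: mod_hom_def gfree_module_def module.defs free_module_def)

text \<open>Forgetting the grading, a graded projective module is a retract of a free module of finite rank.\<close>
lemma gprojective_split: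
  assumes "gprojective R P"
  obtains m i r where "i \<in> mod_hom R P (free_module R {..<m::nat})" "r \<in> mod_hom R (free_module R {..<m}) P"
    "\<And>x. x \<in> carrier P \<Longrightarrow> r (i x) = x"
proof -
  obtain m s i r where "i \<in> gmod_hom R P (gfree_module R m s)" "r \<in> gmod_hom R (gfree_module R m s) P"
    "\<forall>x\<in>carrier P. r (i x) = x"
    using assms unfolding gprojective_def by blast
  then show thesis using that[of i m r] by (simp add: gmod_hom_def mod_hom_gfree)
qed

lemma syz_map_hom:
  assumes "is_syzygies R M T" "Module.module R M" "syz_map R M T i j g h"
  shows "h \<in> mod_hom R (syz T i) (syz T (i + j))"
  using assms(3)
proof (induction i arbitrary: h)
  case 0 then show ?case by simp
next
  case (Suc i)
  then obtain h' l where h: "syz_map R M T i j g h'" "l \<in> mod_hom R (cov T i) (cov T (i + j))"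
    "\<And>x. x \<in> carrier (cov T i) \<Longrightarrow> cmap T (i + j) (l x) = h' (cmap T i x)" "h = restrict l (carrier (syz T (Suc i)))"
    by auto
  have h': "h' \<in> mod_hom R (syz T i) (syz T (i + j))" by (rule Suc.IH[OF h(1)])
  have pc: "projective_cover R (cov T k) (syz T k) (cmap T k)"
    "syz T (Suc k) = grestrict (cov T k) (a_kernel (cov T k) (syz T k) (cmap T k))" for k
    using assms(1) by (auto simp: is_syzygies_def)
  have m: "Module.module R (syz T k)" "Module.module R (cov T k)" for k
    using pc[of k] by (auto simp: projective_cover_def graded_module_def gprojective_def)
  have z: "h' \<zero>\<^bsub>syz T i\<^esub> = \<zero>\<^bsub>syz T (i + j)\<^esub>" by (rule mod_hom_zero[OF m(1) m(1) h'])
  note l = mod_homD[OF h(2)]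
  have ms: "Module.module R (syz T (Suc i))" by (rule m(1))
  have sz: "x \<in> carrier (syz T (Suc k)) \<longleftrightarrow> x \<in> carrier (cov T k) \<and> cmap T k x = \<zero>\<^bsub>syz T k\<^esub>"
    "x \<oplus>\<^bsub>syz T (Suc k)\<^esub> y = x \<oplus>\<^bsub>cov T k\<^esub> y" "r \<odot>\<^bsub>syz T (Suc k)\<^esub> x = r \<odot>\<^bsub>cov T k\<^esub> x" for x y r k
    unfolding pc(2) by (auto simp: grestrict_def a_kernel_def')
  show ?case unfolding h(4)
    by (rule mod_hom_restrictI[OF ms]) (auto simp: sz l h(3) z)
qed

lemma (in abelian_group) minus_unique:
  assumes "z \<in> carrier G" "y \<in> carrier G" "z \<oplus> y = x" shows "x \<ominus> y = z"
  using assms by (auto simp: a_minus_def a_assoc r_neg)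

text \<open>The group axioms do not look at further fields of a record.\<close>
lemma comm_group_more:
  assumes "comm_group \<lparr>carrier = C, mult = m, one = e\<rparr>"
  shows "comm_group \<lparr>carrier = C, mult = m, one = e, \<dots> = w\<rparr>"
proof -
  interpret Gens: comm_group "\<lparr>carrier = C, mult = m, one = e\<rparr>" by fact
  show ?thesis
  proof (rule comm_groupI)
    fix x y z
    assume "x \<in> carrier \<lparr>carrier = C, mult = m, one = e, \<dots> = w\<rparr>" "y \<in> carrier \<lparr>carrier = C, mult = m, one = e, \<dots> = w\<rparr>"
      "z \<in> carrier \<lparr>carrier = C, mult = m, one = e, \<dots> = w\<rparr>"
    then show "x \<otimes>\<^bsub>\<lparr>carrier = C, mult = m, one = e, \<dots> = w\<rparr>\<^esub> y \<otimes>\<^bsub>\<lparr>carrier = C, mult = m, one = e, \<dots> = w\<rparr>\<^esub> z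
      = x \<otimes>\<^bsub>\<lparr>carrier = C, mult = m, one = e, \<dots> = w\<rparr>\<^esub> (y \<otimes>\<^bsub>\<lparr>carrier = C, mult = m, one = e, \<dots> = w\<rparr>\<^esub> z)"
      using Gens.m_assoc[of x y z] by simp
  qed (use Gens.m_closed Gens.one_closed Gens.l_one Gens.r_one Gens.m_comm Gens.l_inv_ex in auto)
qed

lemma syzygies_modules:
  assumes "is_syzygies R M T"
  shows "Module.module R (syz T k)" "Module.module R (cov T k)" "gprojective R (cov T k)"
    "cmap T k \<in> mod_hom R (cov T k) (syz T k)" "cmap T k ` carrier (cov T k) = carrier (syz T k)"
    "x \<in> carrier (syz T (Suc k)) \<longleftrightarrow> x \<in> carrier (cov T k) \<and> cmap T k x = \<zero>\<^bsub>syz T k\<^esub>"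
    "x \<oplus>\<^bsub>syz T (Suc k)\<^esub> y = x \<oplus>\<^bsub>cov T k\<^esub> y" "r \<odot>\<^bsub>syz T (Suc k)\<^esub> x = r \<odot>\<^bsub>cov T k\<^esub> x"
    "\<zero>\<^bsub>syz T (Suc k)\<^esub> = \<zero>\<^bsub>cov T k\<^esub>"
proof -
  have pc: "projective_cover R (cov T k) (syz T k) (cmap T k)"
    "syz T (Suc k) = grestrict (cov T k) (a_kernel (cov T k) (syz T k) (cmap T k))"
    using assms by (auto simp: is_syzygies_def)
  show "Module.module R (syz T k)" "Module.module R (cov T k)" "gprojective R (cov T k)"
    "cmap T k \<in> mod_hom R (cov T k) (syz T k)" "cmap T k ` carrier (cov T k) = carrier (syz T k)"
    using pc(1) by (auto simp: projective_cover_def graded_module_def gprojective_def gmod_hom_def)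
  show "x \<in> carrier (syz T (Suc k)) \<longleftrightarrow> x \<in> carrier (cov T k) \<and> cmap T k x = \<zero>\<^bsub>syz T k\<^esub>"
    "x \<oplus>\<^bsub>syz T (Suc k)\<^esub> y = x \<oplus>\<^bsub>cov T k\<^esub> y" "r \<odot>\<^bsub>syz T (Suc k)\<^esub> x = r \<odot>\<^bsub>cov T k\<^esub> x"
    "\<zero>\<^bsub>syz T (Suc k)\<^esub> = \<zero>\<^bsub>cov T k\<^esub>"
    unfolding pc(2) by (auto simp: grestrict_def a_kernel_def')
qed

lemma syzygies_minus:
  assumes "is_syzygies R M T" "x \<in> carrier (syz T (Suc k))" "y \<in> carrier (syz T (Suc k))"
  shows "x \<ominus>\<^bsub>syz T (Suc k)\<^esub> y = x \<ominus>\<^bsub>cov T k\<^esub> y"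
proof -
  note sm = syzygies_modules[OF assms(1)]
  interpret C: Module.module R "cov T k" by (rule sm)
  interpret Y: Module.module R "syz T (Suc k)" by (rule sm)
  have xy: "x \<in> carrier (cov T k)" "y \<in> carrier (cov T k)" using assms(2,3) sm(6) by blast+
  let ?z = "x \<ominus>\<^bsub>syz T (Suc k)\<^esub> y"
  have z: "?z \<in> carrier (cov T k)" using Y.M.minus_closed[OF assms(2,3)] sm(6) by blast
  have "?z \<oplus>\<^bsub>cov T k\<^esub> y = x"
    using module_diff_cancel(2)[OF sm(1) assms(2,3)] by (simp add: sm(7))
  then show ?thesis using C.M.minus_unique[OF z xy(2)] by simp
qed

text \<open>Two choices of \<open>\<Omega>\<^sup>ig\<close> agree modulo projectives, also when
  \<open>g\<close> changes modulo projectives: if the difference of two maps \<open>h\<^sub>1,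
  h\<^sub>2\<close> is \<open>v \<circ> u\<close> with a projective module in the middle, lift
  \<open>v\<close> to a map \<open>w\<close> into the cover. Subtracting \<open>w \<circ> u
  \<circ> cmap\<close> from the difference of the lifts gives a map \<open>k\<close> from the
  cover into the next syzygy, and on the kernel of \<open>cmap\<close> nothing is subtracted. So
  the difference of the restricted lifts is \<open>k\<close> restricted, and factors through the
  cover.\<close>
lemma syz_map_unique:
  assumes T: "is_syzygies R M T" and R: "cring R" "\<one>\<^bsub>R\<^esub> \<noteq> \<zero>\<^bsub>R\<^esub>" and M: "Module.module R M"
    and g: "g \<in> mod_hom R M (syz T j)" "g' \<in> mod_hom R M (syz T j)"
    and gg: "hdiff M (syz T j) g g' \<in> factors_through_projective R M (syz T j)"
    and h: "syz_map R M T i j g h" "syz_map R M T i j g' h'"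
  shows "hdiff (syz T i) (syz T (i + j)) h h' \<in> factors_through_projective R (syz T i) (syz T (i + j))"
  using h
proof (induction i arbitrary: h h')
  case 0
  note sm = syzygies_modules[OF T]
  have aug: "aug T \<in> mod_hom R M (syz T 0)" "bij_betw (aug T) (carrier M) (carrier (syz T 0))"
    using T by (auto simp: is_syzygies_def gmod_iso_def)
  define b where "b = restrict (inv_into (carrier M) (aug T)) (carrier (syz T 0))"
  have b1: "b y \<in> carrier M" "aug T (b y) = y" if "y \<in> carrier (syz T 0)" for y
    using that aug(2) by (auto simp: b_def bij_betw_inv_into_right bij_betwE[OF bij_betw_inv_into])
  have b2: "b (aug T x) = x" if "x \<in> carrier M" for x
    using that aug(2) mod_homD(1)[OF aug(1) that] by (simp add: b_def bij_betw_inv_into_left)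
  interpret M: Module.module R M by (rule M)
  interpret S0: Module.module R "syz T 0" by (rule sm)
  have b: "b \<in> mod_hom R (syz T 0) M"
  proof (rule mod_homI)
    show "b \<in> extensional (carrier (syz T 0))" by (simp add: b_def)
    show "b (x \<oplus>\<^bsub>syz T 0\<^esub> y) = b x \<oplus>\<^bsub>M\<^esub> b y" if "x \<in> carrier (syz T 0)" "y \<in> carrier (syz T 0)" for x y
      using that b1 b2 mod_homD(2)[OF aug(1)] by (metis M.M.a_closed)
    show "b (r \<odot>\<^bsub>syz T 0\<^esub> x) = r \<odot>\<^bsub>M\<^esub> b x" if "r \<in> carrier R" "x \<in> carrier (syz T 0)" for r x
      using that b1 b2 mod_homD(3)[OF aug(1)] by (metis M.smult_closed)
  qed (use b1 in auto)
  have "compose (carrier (syz T 0)) (hdiff M (syz T j) g g') b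
      \<in> factors_through_projective R (syz T 0) (syz T j)"
    by (rule factors_compose_right[OF sm(1) gg b])
  moreover have "compose (carrier (syz T 0)) (hdiff M (syz T j) g g') b = hdiff (syz T 0) (syz T j) h h'"
  proof -
    have "h y = g (b y)" "h' y = g' (b y)" if "y \<in> carrier (syz T 0)" for y
      using that b1 0 by (metis syz_map.simps(1))+
    then show ?thesis using b1 by (auto simp: compose_def hdiff_def intro!: restrict_ext)
  qed
  ultimately show ?case by simp
next
  case (Suc i)
  note sm = syzygies_modules[OF T]
  let ?P = "cov T i" and ?P' = "cov T (i + j)"
  obtain h1 l where h1: "syz_map R M T i j g h1" "l \<in> mod_hom R ?P ?P'"
    "\<And>x. x \<in> carrier ?P \<Longrightarrow> cmap T (i + j) (l x) = h1 (cmap T i x)" "h = restrict l (carrier (syz T (Suc i)))"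
    using Suc.prems(1) by auto
  obtain h2 l' where h2: "syz_map R M T i j g' h2" "l' \<in> mod_hom R ?P ?P'"
    "\<And>x. x \<in> carrier ?P \<Longrightarrow> cmap T (i + j) (l' x) = h2 (cmap T i x)" "h' = restrict l' (carrier (syz T (Suc i)))"
    using Suc.prems(2) by auto
  interpret P: Module.module R ?P by (rule sm)
  interpret P': Module.module R ?P' by (rule sm)
  obtain Q :: "('a, nat \<Rightarrow> 'a) module" and u v where q: "projective R Q" "u \<in> mod_hom R (syz T i) Q"
    "v \<in> mod_hom R Q (syz T (i + j))"
    "\<And>x. x \<in> carrier (syz T i) \<Longrightarrow> hdiff (syz T i) (syz T (i + j)) h1 h2 x = v (u x)"
    using Suc.IH[OF h1(1) h2(1)] unfolding factors_through_projective_def by blast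
  have Q: "Module.module R Q" using q(1) by (simp add: projective_def)
  obtain w where w: "w \<in> mod_hom R Q ?P'" "\<And>x. x \<in> carrier Q \<Longrightarrow> cmap T (i + j) (w x) = v x"
    using projective_lift[OF R(1) q(1) sm(2) sm(1) sm(4) sm(5) q(3)] by blast
  define c where "c = compose (carrier ?P) (compose (carrier (syz T i)) w u) (cmap T i)"
  have c: "c \<in> mod_hom R ?P ?P'"
    unfolding c_def by (intro mod_hom_compose[OF sm(2) sm(4)] mod_hom_compose[OF sm(1) q(2)] w)
  have cx: "c x = w (u (cmap T i x))" if "x \<in> carrier ?P" for x
    using that mod_homD(1)[OF sm(4)] by (simp add: c_def compose_def)
  define k where "k = hdiff ?P ?P' (hdiff ?P ?P' l l') c"
  have k: "k \<in> mod_hom R ?P ?P'" unfolding k_def by (intro hdiff_hom sm h1 h2 c)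
  have kx: "cmap T (i + j) (k x) = \<zero>\<^bsub>syz T (i + j)\<^esub>" if x: "x \<in> carrier ?P" for x
  proof -
    interpret Y: Module.module R "syz T (i + j)" by (rule sm)
    have y: "cmap T i x \<in> carrier (syz T i)" using mod_homD(1)[OF sm(4) x] .
    note in_ = mod_homD(1)[OF h1(2) x] mod_homD(1)[OF h2(2) x] mod_homD(1)[OF c x]
    have uy: "u (cmap T i x) \<in> carrier Q" using mod_homD(1)[OF q(2) y] .
    have "cmap T (i + j) (k x) = (cmap T (i + j) (l x) \<ominus>\<^bsub>syz T (i + j)\<^esub> cmap T (i + j) (l' x)) \<ominus>\<^bsub>syz T (i + j)\<^esub> cmap T (i + j) (c x)"
      using x in_ by (simp add: k_def hdiff_def mod_hom_diff[OF sm(2) sm(1) sm(4)])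
    also have "\<dots> = v (u (cmap T i x)) \<ominus>\<^bsub>syz T (i + j)\<^esub> v (u (cmap T i x))"
      using q(4)[OF y] y by (simp add: h1(3)[OF x] h2(3)[OF x] cx[OF x] w(2)[OF uy] hdiff_def)
    also have "\<dots> = \<zero>\<^bsub>syz T (i + j)\<^esub>"
      using module_diff_cancel(3)[OF sm(1) mod_homD(1)[OF q(3) uy] mod_homD(1)[OF q(3) uy]] by simp
    finally show ?thesis .
  qed
  have k': "k \<in> mod_hom R ?P (syz T (Suc (i + j)))"
    using mod_homD[OF k] kx by (intro mod_homI) (auto simp: sm(6-8))
  obtain m a r where mr: "a \<in> mod_hom R ?P (free_module R {..<m::nat})" "r \<in> mod_hom R (free_module R {..<m}) ?P"
    "\<And>x. x \<in> carrier ?P \<Longrightarrow> r (a x) = x"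
    using gprojective_split[OF sm(3)] by metis
  let ?F = "free_module R {..<m}"
  interpret F: Module.module R ?F by (rule free_module_module) (rule R)
  have hh: "h \<in> mod_hom R (syz T (Suc i)) (syz T (Suc (i + j)))" "h' \<in> mod_hom R (syz T (Suc i)) (syz T (Suc (i + j)))"
    using syz_map_hom[OF T M Suc.prems(1)] syz_map_hom[OF T M Suc.prems(2)] by simp_all
  have incl: "restrict a (carrier (syz T (Suc i))) \<in> mod_hom R (syz T (Suc i)) ?F"
    using mod_homD[OF mr(1)] by (intro mod_hom_restrictI sm(1)) (auto simp: sm(6-8))
  have "hdiff (syz T (Suc i)) (syz T (Suc (i + j))) h h' \<in> factors_through_projective R (syz T (Suc i)) (syz T (Suc (i + j)))"
  proof (rule factors_free[OF R hdiff_hom[OF sm(1) sm(1) hh] incl mod_hom_compose[OF F.module_axioms mr(2) k']])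
    fix x assume x: "x \<in> carrier (syz T (Suc i))"
    then have xP: "x \<in> carrier ?P" "cmap T i x = \<zero>\<^bsub>syz T i\<^esub>" by (simp_all add: sm(6))
    have "u \<zero>\<^bsub>syz T i\<^esub> = \<zero>\<^bsub>Q\<^esub>" by (rule mod_hom_zero[OF sm(1) Q q(2)])
    then have c0: "c x = \<zero>\<^bsub>?P'\<^esub>" using cx[OF xP(1)] xP(2) mod_hom_zero[OF Q sm(2) w(1)] by simp
    note in_ = mod_homD(1)[OF h1(2) xP(1)] mod_homD(1)[OF h2(2) xP(1)]
    have "compose (carrier ?F) k r (restrict a (carrier (syz T (Suc i))) x) = k x"
      using x xP mod_homD(1)[OF mr(1)] mr(3) by (simp add: compose_def)
    also have "\<dots> = l x \<ominus>\<^bsub>?P'\<^esub> l' x"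
      using xP in_ by (simp add: k_def hdiff_def c0 a_minus_def)
    also have "\<dots> = hdiff (syz T (Suc i)) (syz T (Suc (i + j))) h h' x"
      using x syzygies_minus[OF T mod_homD(1)[OF hh(1) x] mod_homD(1)[OF hh(2) x]] 
      by (simp add: hdiff_def h1(4) h2(4))
    finally show "hdiff (syz T (Suc i)) (syz T (Suc (i + j))) h h' x
      = compose (carrier ?F) k r (restrict a (carrier (syz T (Suc i))) x)" by simp
  qed
  then show ?case by simp
qed

section \<open>Stable homomorphisms\<close>

text \<open>Maps that factor through a projective form a subgroup, and the stable group is the quotient. The
  subgroup property is an assumption: a sum of two such maps factors through the direct sum of two
  projective modules, which has another carrier type than the one in
  \<open>factors_through_projective\<close>. For maps from \<open>S\<close> to its syzygies it
  follows from an explicit criterion.\<close>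
locale stable_pair =
  fixes R :: "('a, 'r) ring_scheme" and M :: "('a, 'b, 'm) module_scheme" and N :: "('a, 'c, 'n) module_scheme"
  assumes M: "Module.module R M" and N: "Module.module R N"
    and fac: "additive_subgroup (factors_through_projective R M N) (hom_module R M N)"
begin

abbreviation "FP \<equiv> factors_through_projective R M N"
abbreviation "HM \<equiv> hom_module R M N"
abbreviation "SH \<equiv> stable_hom R M N"
abbreviation "cls \<equiv> stable_class R M N"

sublocale H: abelian_group HM by (rule hom_module_abelian_group[OF M N])
sublocale F: abelian_subgroup FP HM
  by (rule abelian_subgroupI3[OF fac H.abelian_group_axioms])

lemma HM_simps: "carrier HM = mod_hom R M N" "\<zero>\<^bsub>HM\<^esub> = (\<lambda>x\<in>carrier M. \<zero>\<^bsub>N\<^esub>)"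
  "f \<oplus>\<^bsub>HM\<^esub> g = (\<lambda>x\<in>carrier M. f x \<oplus>\<^bsub>N\<^esub> g x)" "r \<odot>\<^bsub>HM\<^esub> f = (\<lambda>x\<in>carrier M. r \<odot>\<^bsub>N\<^esub> f x)"
  by (simp_all add: hom_module_def)

lemma SH_simps: "carrier SH = a_rcosets\<^bsub>HM\<^esub> FP" "\<zero>\<^bsub>SH\<^esub> = FP" "A \<oplus>\<^bsub>SH\<^esub> B = A <+>\<^bsub>HM\<^esub> B"
  by (simp_all add: stable_hom_def)

lemma SH_group: "abelian_group SH"
  by (rule comm_group_abelian_groupI)
    (simp add: stable_hom_def comm_group_more[OF F.a_factorgroup_is_comm_group[unfolded A_FactGroup_def']])

lemma minus_hdiff:
  assumes "f \<in> mod_hom R M N" "g \<in> mod_hom R M N" shows "f \<ominus>\<^bsub>HM\<^esub> g = hdiff M N f g"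
proof -
  have d: "hdiff M N f g \<in> carrier HM" using hdiff_hom[OF M N assms] by (simp add: HM_simps)
  have "hdiff M N f g \<oplus>\<^bsub>HM\<^esub> g = f"
    using assms module_diff_cancel(2)[OF N] mod_homD(1,4)[OF assms(1)] mod_homD(1)[OF assms(2)]
    by (intro extensionalityI[of _ "carrier M"]) (auto simp: HM_simps hdiff_def)
  then show ?thesis using H.minus_unique[OF d] assms(2) by (simp add: HM_simps(1))
qed

lemma cls_in: "f \<in> mod_hom R M N \<Longrightarrow> cls f \<in> carrier SH"
  unfolding SH_simps stable_class_def using H.a_rcosetsI[OF F.a_subset] by (simp add: HM_simps)

lemma cls_self: "f \<in> mod_hom R M N \<Longrightarrow> f \<in> cls f"
  unfolding stable_class_def by (rule F.a_rcos_self) (simp add: HM_simps)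

lemma cls_sub: "f \<in> mod_hom R M N \<Longrightarrow> g \<in> cls f \<Longrightarrow> g \<in> mod_hom R M N"
  unfolding stable_class_def using F.a_elemrcos_carrier by (simp add: HM_simps)

lemma SH_rep: "A \<in> carrier SH \<Longrightarrow> \<exists>f\<in>mod_hom R M N. A = cls f"
  unfolding SH_simps stable_class_def A_RCOSETS_def' by (auto simp: HM_simps a_r_coset_def r_coset_def)

lemma cls_eq:
  assumes "f \<in> mod_hom R M N" "g \<in> mod_hom R M N"
  shows "cls f = cls g \<longleftrightarrow> hdiff M N f g \<in> FP"
proof -
  have fg: "f \<in> carrier HM" "g \<in> carrier HM" using assms by (simp_all add: HM_simps)
  have "cls f = cls g \<longleftrightarrow> f \<in> FP +>\<^bsub>HM\<^esub> g"
    unfolding stable_class_def using fg F.a_repr_independence' F.a_rcos_self by metis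
  also have "\<dots> \<longleftrightarrow> f \<ominus>\<^bsub>HM\<^esub> g \<in> FP"
    using fg F.a_rcos_module by (simp add: a_minus_def)
  finally show ?thesis using minus_hdiff[OF assms] by simp
qed

lemma cls_mem: "f \<in> mod_hom R M N \<Longrightarrow> g \<in> cls f \<Longrightarrow> hdiff M N g f \<in> FP"
  using cls_eq[of g f] cls_sub[of f g] F.a_repr_independence'[of g f] unfolding stable_class_def
  by (simp add: HM_simps)

lemma cls_add:
  assumes "f \<in> mod_hom R M N" "g \<in> mod_hom R M N"
  shows "cls f \<oplus>\<^bsub>SH\<^esub> cls g = cls (\<lambda>x\<in>carrier M. f x \<oplus>\<^bsub>N\<^esub> g x)"
  unfolding SH_simps stable_class_def
  using assms F.a_rcos_sum[of f g] by (simp add: HM_simps)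

lemma cls_zero: "cls (\<lambda>x\<in>carrier M. \<zero>\<^bsub>N\<^esub>) = \<zero>\<^bsub>SH\<^esub>"
  unfolding SH_simps stable_class_def using H.a_coset_add_zero[OF F.a_subset] by (simp add: HM_simps)

text \<open>The definition takes a union over all representatives, but scaling preserves the maps that factor
  through projectives, so all members of the union are equal.\<close>
lemma cls_smult:
  assumes "f \<in> mod_hom R M N" "r \<in> carrier R"
  shows "r \<odot>\<^bsub>SH\<^esub> cls f = cls (\<lambda>x\<in>carrier M. r \<odot>\<^bsub>N\<^esub> f x)"
proof -
  interpret M: Module.module R M by (rule M)
  interpret N: Module.module R N by (rule N)
  have sc: "(\<lambda>x\<in>carrier N. r \<odot>\<^bsub>N\<^esub> x) \<in> mod_hom R N N"
    using assms(2) by (intro mod_hom_restrictI N)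
      (auto simp: N.smult_r_distr N.smult_assoc1[symmetric] M.R.m_comm)
  have rf: "(\<lambda>x\<in>carrier M. r \<odot>\<^bsub>N\<^esub> g x) \<in> mod_hom R M N" if "g \<in> mod_hom R M N" for g
    using mod_hom_compose[OF M that sc] mod_homD(1)[OF that] by (simp add: compose_def cong: restrict_cong)
  have "cls (r \<odot>\<^bsub>HM\<^esub> g) = cls (r \<odot>\<^bsub>HM\<^esub> f)" if g: "g \<in> cls f" for g
  proof -
    have gh: "g \<in> mod_hom R M N" using cls_sub[OF assms(1) g] .
    have "compose (carrier M) (\<lambda>x\<in>carrier N. r \<odot>\<^bsub>N\<^esub> x) (hdiff M N g f) \<in> FP"
      by (rule factors_compose_left[OF M cls_mem[OF assms(1) g] sc])
    also have "compose (carrier M) (\<lambda>x\<in>carrier N. r \<odot>\<^bsub>N\<^esub> x) (hdiff M N g f)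
        = hdiff M N (\<lambda>x\<in>carrier M. r \<odot>\<^bsub>N\<^esub> g x) (\<lambda>x\<in>carrier M. r \<odot>\<^bsub>N\<^esub> f x)"
      using mod_homD(1)[OF gh] mod_homD(1)[OF assms(1)] assms(2)
      by (auto simp: compose_def hdiff_def a_minus_def N.smult_r_distr N.smult_r_minus intro!: restrict_ext)
    finally show ?thesis using cls_eq[OF rf[OF gh] rf[OF assms(1)]] by (simp add: HM_simps)
  qed
  then have "(\<Union>g\<in>cls f. cls (r \<odot>\<^bsub>HM\<^esub> g)) = (\<Union>g\<in>cls f. cls (r \<odot>\<^bsub>HM\<^esub> f))"
    by (intro SUP_cong refl)
  also have "\<dots> = cls (r \<odot>\<^bsub>HM\<^esub> f)" using cls_self[OF assms(1)] by blast
  finally show ?thesis unfolding HM_simps by (simp add: stable_hom_def HM_simps)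
qed

end

section \<open>The Veronese ring and its modules\<close>

lemma mod_hom_finsum:
  assumes "Module.module R M" "Module.module R N" "f \<in> mod_hom R M N" "finite A" "\<And>i. i \<in> A \<Longrightarrow> x i \<in> carrier M"
  shows "f (\<Oplus>\<^bsub>M\<^esub>i\<in>A. x i) = (\<Oplus>\<^bsub>N\<^esub>i\<in>A. f (x i)) \<and> (\<Oplus>\<^bsub>M\<^esub>i\<in>A. x i) \<in> carrier M"
  using assms(4,5)
proof (induction A)
  case empty
  interpret M: Module.module R M by fact
  interpret N: Module.module R N by fact
  show ?case using mod_hom_zero[OF assms(1-3)] by simp
next
  case (insert a A)
  interpret M: Module.module R M by fact
  interpret N: Module.module R N by fact
  have IH: "f (\<Oplus>\<^bsub>M\<^esub>i\<in>A. x i) = (\<Oplus>\<^bsub>N\<^esub>i\<in>A. f (x i))" "(\<Oplus>\<^bsub>M\<^esub>i\<in>A. x i) \<in> carrier M"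
    using insert.IH insert.prems by auto
  have c: "x a \<in> carrier M" "x \<in> A \<rightarrow> carrier M" using insert.prems by auto
  have fc: "f (x a) \<in> carrier N" "(\<lambda>i. f (x i)) \<in> A \<rightarrow> carrier N" using c mod_homD(1)[OF assms(3)] by auto
  have "(\<Oplus>\<^bsub>M\<^esub>i\<in>insert a A. x i) = x a \<oplus>\<^bsub>M\<^esub> (\<Oplus>\<^bsub>M\<^esub>i\<in>A. x i)"
    using insert.hyps c by (intro M.M.finsum_insert) auto
  moreover have "(\<Oplus>\<^bsub>N\<^esub>i\<in>insert a A. f (x i)) = f (x a) \<oplus>\<^bsub>N\<^esub> (\<Oplus>\<^bsub>N\<^esub>i\<in>A. f (x i))"
    using insert.hyps fc by (intro N.M.finsum_insert) auto
  ultimately show ?case using IH c(1) mod_homD(2)[OF assms(3) c(1) IH(2)] by simp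
qed

lemma free_module_hom_obtain:
  assumes "cring R" "Module.module R N" "\<And>x. x \<in> J \<Longrightarrow> nn x \<in> carrier N"
  obtains v where "v \<in> mod_hom R (free_module R J) N" "\<And>x. x \<in> J \<Longrightarrow> v (unitf R x) = nn x"
proof -
  have "\<exists>v \<in> mod_hom R (free_module R J) N. \<forall>x\<in>J. v (unitf R x) = nn x"
    by (rule free_module_hom_exists) (use assms in auto)
  then show thesis using that by auto
qed

lemma mod_hom_image_submodule:
  assumes M: "Module.module R M" and N: "Module.module R N" and f: "f \<in> mod_hom R M N"
  shows "submodule (f ` carrier M) R N" "\<zero>\<^bsub>N\<^esub> \<in> f ` carrier M"
proof -
  interpret M: Module.module R M by fact
  interpret N: Module.module R N by fact
  show z: "\<zero>\<^bsub>N\<^esub> \<in> f ` carrier M"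
    using imageI[of "\<zero>\<^bsub>M\<^esub>" "carrier M" f] by (simp add: mod_hom_zero[OF M N f])
  show "submodule (f ` carrier M) R N"
  proof (rule N.submoduleI)
    show "f ` carrier M \<subseteq> carrier N" using mod_homD(1)[OF f] by blast
    show "\<ominus>\<^bsub>N\<^esub> a \<in> f ` carrier M" if a: "a \<in> f ` carrier M" for a
    proof -
      obtain x where x: "x \<in> carrier M" "a = f x" using a by blast
      then show ?thesis by (intro image_eqI[of _ f "\<ominus>\<^bsub>M\<^esub> x"]) (auto simp: mod_hom_minus[OF M N f])
    qed
    show "a \<oplus>\<^bsub>N\<^esub> b \<in> f ` carrier M" if ab: "a \<in> f ` carrier M" "b \<in> f ` carrier M" for a b
    proof -
      obtain x y where xy: "x \<in> carrier M" "a = f x" "y \<in> carrier M" "b = f y" using ab by blast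
      then show ?thesis by (intro image_eqI[of _ f "x \<oplus>\<^bsub>M\<^esub> y"]) (auto simp: mod_homD(2)[OF f])
    qed
    show "a \<odot>\<^bsub>N\<^esub> b \<in> f ` carrier M" if ab: "a \<in> carrier R" "b \<in> f ` carrier M" for a b
    proof -
      obtain x where x: "x \<in> carrier M" "b = f x" using ab by blast
      then show ?thesis using ab by (intro image_eqI[of _ f "a \<odot>\<^bsub>M\<^esub> x"]) (auto simp: mod_homD(3)[OF f])
    qed
  qed (rule z)
qed

lemma surj_preimage: "f ` A = B \<Longrightarrow> y \<in> B \<Longrightarrow> \<exists>x\<in>A. f x = y"
  by auto

lemma module_cong:
  assumes "Module.module R M" "carrier M' = carrier M" "\<And>x y. x \<oplus>\<^bsub>M'\<^esub> y = x \<oplus>\<^bsub>M\<^esub> y" "\<zero>\<^bsub>M'\<^esub> = \<zero>\<^bsub>M\<^esub>"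
    "\<And>r x. r \<odot>\<^bsub>M'\<^esub> x = r \<odot>\<^bsub>M\<^esub> x"
  shows "Module.module R M'"
proof -
  interpret M: Module.module R M by fact
  show ?thesis
  proof (rule moduleI)
    show "cring R" ..
    show "abelian_group M'"
    proof (rule abelian_groupI)
      fix x assume "x \<in> carrier M'"
      then show "\<exists>y\<in>carrier M'. y \<oplus>\<^bsub>M'\<^esub> x = \<zero>\<^bsub>M'\<^esub>"
        unfolding assms(2-4) by (intro bexI[of _ "\<ominus>\<^bsub>M\<^esub> x"]) (auto simp: M.M.l_neg)
    qed (auto simp: assms(2-4) M.M.a_ac)
  qed (auto simp: assms(2-) M.smult_l_distr M.smult_r_distr M.smult_assoc1)
qed

lemma graded_moduleD:
  assumes "graded_module R M"
  shows "Module.module R M" "additive_subgroup (component M c) M"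
    "x \<in> component M c \<Longrightarrow> x \<in> carrier M" "x \<in> component M c \<Longrightarrow> y \<in> component M c \<Longrightarrow> x \<oplus>\<^bsub>M\<^esub> y \<in> component M c"
    "\<zero>\<^bsub>M\<^esub> \<in> component M c" "r \<in> component R b \<Longrightarrow> x \<in> component M c \<Longrightarrow> r \<odot>\<^bsub>M\<^esub> x \<in> component M (b + c)"
  using assms additive_subgroup.a_subset[of "component M c" M] additive_subgroup.a_closed[of "component M c" M]
    additive_subgroup.zero_closed[of "component M c" M]
  unfolding graded_module_def by blast+

definition decomposition :: "('a, 'b) gmodule \<Rightarrow> 'b \<Rightarrow> (int \<Rightarrow> 'b) \<Rightarrow> bool"
  where "decomposition M x f \<longleftrightarrow> (\<forall>c. f c \<in> component M c) \<and> finite {c. f c \<noteq> \<zero>\<^bsub>M\<^esub>} \<and>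
    (\<Oplus>\<^bsub>M\<^esub>c \<in> {c. f c \<noteq> \<zero>\<^bsub>M\<^esub>}. f c) = x"

lemma decomposition_ex1: "graded_module R M \<Longrightarrow> x \<in> carrier M \<Longrightarrow> \<exists>!f. decomposition M x f"
  by (simp add: graded_module_def decomposition_def)

lemma decomposition_superset:
  assumes "graded_module R M" "\<And>c. f c \<in> component M c" "finite A" "{c. f c \<noteq> \<zero>\<^bsub>M\<^esub>} \<subseteq> A"
  shows "decomposition M (\<Oplus>\<^bsub>M\<^esub>c\<in>A. f c) f"
proof -
  interpret M: Module.module R M by (rule graded_moduleD) fact
  have "(\<Oplus>\<^bsub>M\<^esub>c \<in> {c. f c \<noteq> \<zero>\<^bsub>M\<^esub>}. f c) = (\<Oplus>\<^bsub>M\<^esub>c\<in>A. f c)"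
    by (rule M.M.add.finprod_mono_neutral_cong_left) (use assms graded_moduleD(3)[OF assms(1)] in auto)
  then show ?thesis using assms(2-4) finite_subset by (auto simp: decomposition_def)
qed

lemma decomposition_add:
  assumes "graded_module R M" "decomposition M x f" "decomposition M y g"
  shows "decomposition M (x \<oplus>\<^bsub>M\<^esub> y) (\<lambda>c. f c \<oplus>\<^bsub>M\<^esub> g c)"
proof -
  interpret M: Module.module R M by (rule graded_moduleD) fact
  let ?A = "{c. f c \<noteq> \<zero>\<^bsub>M\<^esub>} \<union> {c. g c \<noteq> \<zero>\<^bsub>M\<^esub>}"
  have A: "finite ?A" using assms(2,3) by (simp add: decomposition_def)
  have fg: "f c \<in> component M c" "g c \<in> component M c" "f c \<in> carrier M" "g c \<in> carrier M" for c
    using assms(2,3) graded_moduleD(3)[OF assms(1)] by (auto simp: decomposition_def)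
  have "(\<Oplus>\<^bsub>M\<^esub>c\<in>?A. f c) = x" "(\<Oplus>\<^bsub>M\<^esub>c\<in>?A. g c) = y"
    using assms decomposition_superset[OF assms(1) fg(1) A] decomposition_superset[OF assms(1) fg(2) A]
    by (auto simp: decomposition_def)
  then have "x \<oplus>\<^bsub>M\<^esub> y = (\<Oplus>\<^bsub>M\<^esub>c\<in>?A. f c \<oplus>\<^bsub>M\<^esub> g c)"
    using A fg by (subst M.M.finsum_addf) auto
  moreover have "{c. f c \<oplus>\<^bsub>M\<^esub> g c \<noteq> \<zero>\<^bsub>M\<^esub>} \<subseteq> ?A" by auto
  ultimately show ?thesis
    using decomposition_superset[OF assms(1) graded_moduleD(4)[OF assms(1) fg(1,2)] A] by simp
qed

lemma decomposition_homogeneous: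
  assumes "graded_module R M" "x \<in> component M c"
  shows "decomposition M x (\<lambda>e. if e = c then x else \<zero>\<^bsub>M\<^esub>)"
proof -
  interpret M: Module.module R M by (rule graded_moduleD) fact
  have "decomposition M (\<Oplus>\<^bsub>M\<^esub>e\<in>{c}. if e = c then x else \<zero>\<^bsub>M\<^esub>) (\<lambda>e. if e = c then x else \<zero>\<^bsub>M\<^esub>)"
    by (rule decomposition_superset) (use assms graded_moduleD[OF assms(1)] in auto)
  then show ?thesis using graded_moduleD(3)[OF assms] by simp
qed

text \<open>Take the component of degree \<open>c\<close> of any preimage; by uniqueness of decompositions the
  components of the image are the images of the components.\<close>
lemma gmod_hom_homogeneous_preimage:
  assumes P: "graded_module R P" and M: "graded_module R M" and p: "p \<in> gmod_hom R P M"
    and y: "y \<in> carrier P" "p y \<in> component M c"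
  shows "\<exists>z\<in>component P c. p z = p y"
proof -
  have ph: "p \<in> mod_hom R P M" "\<And>e x. x \<in> component P e \<Longrightarrow> p x \<in> component M e"
    using p by (auto simp: gmod_hom_def)
  obtain f where f: "decomposition P y f" using decomposition_ex1[OF P y(1)] by blast
  let ?A = "{c. f c \<noteq> \<zero>\<^bsub>P\<^esub>}"
  have fc: "f e \<in> component P e" "f e \<in> carrier P" for e
    using f graded_moduleD(3)[OF P] by (auto simp: decomposition_def)
  have A: "finite ?A" "(\<Oplus>\<^bsub>P\<^esub>c\<in>?A. f c) = y" using f by (auto simp: decomposition_def)
  have z: "p \<zero>\<^bsub>P\<^esub> = \<zero>\<^bsub>M\<^esub>" by (rule mod_hom_zero[OF graded_moduleD(1)[OF P] graded_moduleD(1)[OF M] ph(1)])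
  have "p y = (\<Oplus>\<^bsub>M\<^esub>c\<in>?A. p (f c))"
    using mod_hom_finsum[OF graded_moduleD(1)[OF P] graded_moduleD(1)[OF M] ph(1) A(1), of f] fc A(2) by auto
  moreover have "decomposition M (\<Oplus>\<^bsub>M\<^esub>c\<in>?A. p (f c)) (\<lambda>c. p (f c))"
    by (rule decomposition_superset[OF M]) (use A ph fc z in auto)
  ultimately have "decomposition M (p y) (\<lambda>c. p (f c))" by simp
  moreover have "decomposition M (p y) (\<lambda>e. if e = c then p y else \<zero>\<^bsub>M\<^esub>)"
    by (rule decomposition_homogeneous[OF M y(2)])
  ultimately have "(\<lambda>c. p (f c)) = (\<lambda>e. if e = c then p y else \<zero>\<^bsub>M\<^esub>)"
    using decomposition_ex1[OF M graded_moduleD(3)[OF M y(2)]] by blast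
  then have "p (f c) = p y" by (metis (full_types))
  then show ?thesis using fc by blast
qed

lemma graded_submoduleI:
  assumes R: "\<And>b. component R b \<subseteq> carrier R" and P: "graded_module R P" and N: "submodule N R P"
    and dec: "\<And>x. x \<in> N \<Longrightarrow> \<exists>f. decomposition P x f \<and> (\<forall>c. f c \<in> N)"
  shows "graded_submodule N R P"
proof -
  interpret P: Module.module R P by (rule graded_moduleD) fact
  note Ns = P.submoduleE[OF N]
  have N0: "\<zero>\<^bsub>P\<^esub> \<in> N" using Ns(2,3,5) Ns(1) by (metis P.M.r_neg ex_in_conv subsetD)
  let ?Gens = "grestrict P N"
  have Gens: "carrier ?Gens = N" "x \<oplus>\<^bsub>?Gens\<^esub> y = x \<oplus>\<^bsub>P\<^esub> y" "\<zero>\<^bsub>?Gens\<^esub> = \<zero>\<^bsub>P\<^esub>" "r \<odot>\<^bsub>?Gens\<^esub> x = r \<odot>\<^bsub>P\<^esub> x"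
    "component ?Gens c = component P c \<inter> N" for x y r c
    by (simp_all add: grestrict_def)
  have mod: "Module.module R ?Gens"
    by (rule module_cong[OF submodule.submodule_is_module[OF N P.module_axioms]]) (simp_all add: grestrict_def)
  interpret Gens: Module.module R ?Gens by (rule mod)
  have minus: "\<ominus>\<^bsub>?Gens\<^esub> x = \<ominus>\<^bsub>P\<^esub> x" if "x \<in> N" for x
    using that Ns(1) Ns(3)[OF that] by (intro Gens.M.minus_equality) (auto simp: Gens P.M.l_neg)
  have fs: "finsum ?Gens f A = finsum P f A" if "finite A" "\<And>i. i \<in> A \<Longrightarrow> f i \<in> N" for f and A :: "int set"
    using that
  proof (induction A)
    case (insert a A)
    have "finsum ?Gens f (insert a A) = f a \<oplus>\<^bsub>?Gens\<^esub> finsum ?Gens f A"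
      using insert by (intro Gens.M.finsum_insert) (auto simp: Gens)
    moreover have "finsum P f (insert a A) = f a \<oplus>\<^bsub>P\<^esub> finsum P f A"
      using insert Ns(1) by (intro P.M.finsum_insert) auto
    ultimately show ?case using insert by (simp add: Gens)
  qed (simp add: Gens)
  have dG: "decomposition ?Gens x f \<longleftrightarrow> decomposition P x f \<and> (\<forall>c. f c \<in> N)" for x f
    unfolding decomposition_def Gens using fs by auto
  have "graded_module R ?Gens"
    unfolding graded_module_def
  proof (intro conjI allI ballI mod)
    fix c show "additive_subgroup (component ?Gens c) ?Gens"
    proof (rule additive_subgroupI, rule group.subgroupI)
      show "group (add_monoid ?Gens)" by (rule Gens.M.a_group)
      show "component ?Gens c \<subseteq> carrier (add_monoid ?Gens)" by (simp add: Gens)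
      show "component ?Gens c \<noteq> {}" using N0 graded_moduleD(5)[OF P] by (auto simp: Gens)
      show "inv\<^bsub>add_monoid ?Gens\<^esub> a \<in> component ?Gens c" if "a \<in> component ?Gens c" for a
        using that minus[of a] Ns(3)[of a] additive_subgroup.a_inv_closed[OF graded_moduleD(2)[OF P]]
        by (auto simp: Gens a_inv_def)
      show "a \<otimes>\<^bsub>add_monoid ?Gens\<^esub> b \<in> component ?Gens c" if "a \<in> component ?Gens c" "b \<in> component ?Gens c" for a b
        using that Ns(5) graded_moduleD(4)[OF P] by (auto simp: Gens)
    qed
  next
    fix x assume x: "x \<in> carrier ?Gens"
    then have "x \<in> carrier P" using Ns(1) by (auto simp: Gens)
    then have "\<exists>!f. decomposition ?Gens x f"
      using dec[of x] x decomposition_ex1[OF P] unfolding dG Gens by metis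
    then show "\<exists>!f. (\<forall>c. f c \<in> component ?Gens c) \<and> finite {c. f c \<noteq> \<zero>\<^bsub>?Gens\<^esub>} \<and>
        (\<Oplus>\<^bsub>?Gens\<^esub>c\<in>{c. f c \<noteq> \<zero>\<^bsub>?Gens\<^esub>}. f c) = x" by (simp add: decomposition_def)
  next
    fix b c r x assume rx: "r \<in> component R b" "x \<in> component ?Gens c"
    then have "r \<odot>\<^bsub>P\<^esub> x \<in> N" using Ns(4) R by (auto simp: Gens)
    with rx show "r \<odot>\<^bsub>?Gens\<^esub> x \<in> component ?Gens (b + c)"
      using graded_moduleD(6)[OF P] by (auto simp: Gens)
  qed
  then show ?thesis using N by (simp add: graded_submodule_def)
qed

context veronese begin

abbreviation VR :: "('k::field mpoly, 'k mpoly) gmodule" where "VR \<equiv> veronese_R d n"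
abbreviation VS :: "('k::field mpoly, 'k mpoly) gmodule" where "VS \<equiv> poly_S d n"

lemma VR_simps: "r \<in> carrier VR \<longleftrightarrow> r \<in> polys d \<and> (\<forall>m\<in>supp r. n dvd deg0 m)"
  "x \<oplus>\<^bsub>VR\<^esub> y = x + y" "x \<otimes>\<^bsub>VR\<^esub> y = x * y" "\<zero>\<^bsub>VR\<^esub> = 0" "\<one>\<^bsub>VR\<^esub> = 1"
  "component VR c = {p \<in> carrier VR. \<forall>m\<in>supp p. int (deg0 m div n) = c}"
proof -
  show "r \<in> carrier VR \<longleftrightarrow> r \<in> polys d \<and> (\<forall>m\<in>supp r. n dvd deg0 m)"
    by (auto simp: veronese_R_def gpolys_def veronese_summand_def polys_low deg0_mdeg dvd_eq_mod_eq_0)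
  show "component VR c = {p \<in> carrier VR. \<forall>m\<in>supp p. int (deg0 m div n) = c}"
    by (auto simp: veronese_R_def gpolys_def veronese_summand_def polys_low deg0_mdeg)
qed (simp_all add: veronese_R_def gpolys_def)

lemma VR_carrier_subspace: "kv.subspace (carrier VR :: 'k::field mpoly set)"
proof -
  have "(carrier VR :: 'k mpoly set) = polys d \<inter> {r. \<forall>m\<in>supp r. n dvd deg0 m}" by (auto simp: VR_simps)
  then show ?thesis using kv.subspace_inter[OF polys_subspace supp_subspace[of "\<lambda>m. n dvd deg0 m"]] by simp
qed

lemma VR_mult: "r \<in> carrier VR \<Longrightarrow> s \<in> carrier VR \<Longrightarrow> r * s \<in> carrier VR"
  using keys_mult[of r s] by (fastforce simp: VR_simps polys_mult)

lemma VR_1: "1 \<in> carrier VR" and VR_Const: "Const c \<in> carrier VR"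
  by (auto simp: VR_simps) (auto simp: Const_def split: if_splits)

lemma VR_cring: "cring (VR :: ('k::field mpoly, 'k mpoly) gmodule)"
proof (rule cringI)
  note sub = VR_carrier_subspace[where 'k = 'k]
  show "abelian_group (VR :: ('k mpoly, 'k mpoly) gmodule)"
  proof (rule abelian_groupI)
    fix x :: "'k mpoly" assume "x \<in> carrier VR"
    then show "\<exists>y\<in>carrier VR. y \<oplus>\<^bsub>VR\<^esub> x = \<zero>\<^bsub>VR\<^esub>"
      using kv.subspace_neg[OF sub] by (intro bexI[of _ "- x"]) (auto simp: VR_simps(2-5))
  qed (use kv.subspace_add[OF sub] kv.subspace_0[OF sub] in \<open>auto simp: VR_simps(2-5) add.assoc add.commute\<close>)
  show "Group.comm_monoid (VR :: ('k mpoly, 'k mpoly) gmodule)"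
    by (rule comm_monoidI) (auto simp: VR_simps(2-5) VR_mult VR_1 mult.assoc mult.commute)
qed (simp add: VR_simps(2-5) algebra_simps)

lemma VR_one_neq: "\<one>\<^bsub>VR\<^esub> \<noteq> \<zero>\<^bsub>VR\<^esub>" by (simp add: VR_simps)

lemma gpolys_simps: "carrier (gpolys A n) = A" "x \<oplus>\<^bsub>gpolys A n\<^esub> y = x + y" "\<zero>\<^bsub>gpolys A n\<^esub> = 0"
  "r \<odot>\<^bsub>gpolys A n\<^esub> x = r * x"
  by (simp_all add: gpolys_def)

lemma gpolys_module:
  assumes "kv.subspace (A :: 'k::field mpoly set)" "\<And>r x. r \<in> carrier VR \<Longrightarrow> x \<in> A \<Longrightarrow> r * x \<in> A"
  shows "Module.module VR (gpolys A n)"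
proof (rule moduleI)
  show "abelian_group (gpolys A n)"
  proof (rule abelian_groupI)
    fix x assume "x \<in> carrier (gpolys A n)"
    then show "\<exists>y\<in>carrier (gpolys A n). y \<oplus>\<^bsub>gpolys A n\<^esub> x = \<zero>\<^bsub>gpolys A n\<^esub>"
      using kv.subspace_neg[OF assms(1)] by (intro bexI[of _ "- x"]) (auto simp: gpolys_simps)
  qed (use kv.subspace_add[OF assms(1)] kv.subspace_0[OF assms(1)] in \<open>auto simp: gpolys_simps add.assoc add.commute\<close>)
qed (auto simp: gpolys_simps VR_simps(2-5) assms(2) VR_cring algebra_simps)

lemma VR_times_Om: "r \<in> carrier VR \<Longrightarrow> x \<in> Om c i \<Longrightarrow> r * x \<in> Om c i"
  by (rule Om_mult[where i' = i]) (auto simp: VR_simps mod_add_eq[symmetric, of "deg0 _"] dvd_eq_mod_eq_0)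

lemma VR_times_Cov: "r \<in> carrier VR \<Longrightarrow> x \<in> Cov c i \<Longrightarrow> r * x \<in> Cov c i"
  by (rule Cov_mult[where i' = i]) (auto simp: VR_simps mod_add_eq[symmetric, of "deg0 _"] dvd_eq_mod_eq_0)

lemma VS_eq: "VS = gpolys (Om 0 0) n" by (simp add: poly_S_def)
lemma VS_module: "Module.module VR VS"
  unfolding VS_eq by (rule gpolys_module[OF Om_subspace VR_times_Om])
lemma Cov_module: "Module.module VR (gpolys (Cov c i) n)"
  by (rule gpolys_module[OF Cov_subspace VR_times_Cov])

lemma VR_component_sub: "component VR b \<subseteq> carrier VR"
  by (auto simp: VR_simps)

section \<open>Identifying the given syzygies with the model\<close>

text \<open>An isomorphism of \<open>R\<close>-modules from a set of polynomials, with the operations of the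
  polynomial ring, to an abstract module.\<close>
definition lin_iso :: "'k::field mpoly set \<Rightarrow> ('k mpoly, 'b) gmodule \<Rightarrow> ('k mpoly \<Rightarrow> 'b) \<Rightarrow> bool"
  where "lin_iso A M \<theta> \<longleftrightarrow> bij_betw \<theta> A (carrier M) \<and>
    (\<forall>x\<in>A. \<forall>y\<in>A. \<theta> (x + y) = \<theta> x \<oplus>\<^bsub>M\<^esub> \<theta> y) \<and>
    (\<forall>r\<in>carrier VR. \<forall>x\<in>A. \<theta> (r * x) = r \<odot>\<^bsub>M\<^esub> \<theta> x)"

lemma lin_isoD:
  assumes "lin_iso A M \<theta>"
  shows "x \<in> A \<Longrightarrow> \<theta> x \<in> carrier M" "x \<in> A \<Longrightarrow> y \<in> A \<Longrightarrow> \<theta> (x + y) = \<theta> x \<oplus>\<^bsub>M\<^esub> \<theta> y"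
    "r \<in> carrier VR \<Longrightarrow> x \<in> A \<Longrightarrow> \<theta> (r * x) = r \<odot>\<^bsub>M\<^esub> \<theta> x"
    "inj_on \<theta> A" "\<theta> ` A = carrier M"
  using assms by (auto simp: lin_iso_def bij_betw_def)

lemma lin_iso_zero:
  assumes "lin_iso A M \<theta>" "Module.module VR M" "0 \<in> A" shows "\<theta> 0 = \<zero>\<^bsub>M\<^esub>"
proof -
  interpret M: Module.module VR M by fact
  have "0 \<in> carrier VR" by (simp add: VR_simps)
  then show ?thesis
    using lin_isoD(3)[OF assms(1), of 0 0] assms(3) lin_isoD(1)[OF assms(1,3)] M.smult_l_null
    by (simp add: VR_simps(4))
qed

text \<open>The factor at position \<open>0\<close> of an element of a proper syzygy is in the maximal ideal:
  this is the minimality of the resolution.\<close>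
lemma Om_Suc_deg_pos:
  assumes "t \<in> (Om (Suc c) i :: 'k::field mpoly set)" "m \<in> supp t" shows "0 < deg0 m"
proof -
  have "wedge_mults c i \<subseteq> {x :: 'k mpoly. \<forall>m\<in>supp x. 0 < deg0 m}" using wedge_mults_deg by fastforce
  then have "kv.span (wedge_mults c i) \<subseteq> {x :: 'k mpoly. \<forall>m\<in>supp x. 0 < deg0 m}"
    by (rule kv.span_minimal[OF _ supp_subspace])
  moreover have "t \<in> kv.span (wedge_mults c i)"
    using Om_Suc_span[OF _ assms(1)] Gens_span[of 0 c, where 'k = 'k] n2 by simp
  ultimately show ?thesis using assms(2) by blast
qed

text \<open>
  The projective cover \<open>P\<close> of \<open>\<Omega>\<^sup>cS\<close> is compared directly
  with \<open>R \<otimes> W\<^sub>c\<close>, the module \<open>Cov c 0\<close>, which is free on a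
  vector space basis of \<open>W\<^sub>c\<close> (map \<open>J\<close>). Homogeneous preimages of
  the basis in \<open>P\<close> define a map \<open>v\<close> from this free module to
  \<open>P\<close> that is compatible with the two maps to \<open>\<Omega>\<^sup>cS\<close>.

  The map is surjective because its image and the kernel of \<open>p\<close> generate
  \<open>P\<close> and that kernel is superfluous. As \<open>P\<close> is projective,
  \<open>v\<close> has a section \<open>s\<close>. The difference of \<open>s \<circ> v\<close>
  and the identity takes values in \<open>Om (c + 1) 0\<close>, so it strictly raises the lowest
  degree at position \<open>0\<close>; if \<open>v f = 0\<close> the difference is \<open>-
  f\<close>, which forces \<open>f = 0\<close>.

  The statement on components, for the generators of the next syzygy, keeps the induction over
  \<open>c\<close> going: all maps have degree \<open>0\<close>, and the resolution is linear.
\<close>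
lemma cover_iso:
  fixes P M :: "('k::field mpoly, 'b) gmodule"
  assumes pc: "projective_cover VR P M p" and th: "lin_iso (Om c 0) M \<theta>"
    and thG: "\<theta> ` Gens c 0 \<subseteq> component M (int c)"
  shows "\<exists>\<Theta>. lin_iso (Cov c 0) P \<Theta> \<and> (\<forall>t\<in>Cov c 0. p (\<Theta> t) = \<theta> (merge t)) \<and>
    \<Theta> ` Gens (Suc c) 0 \<subseteq> component P (int (Suc c))"
proof -
  have gr: "graded_module VR P" "graded_module VR M" "gprojective VR P" "p \<in> gmod_hom VR P M"
      "p ` carrier P = carrier M"
    and small: "\<And>N. graded_submodule N VR P \<Longrightarrow> N <+>\<^bsub>P\<^esub> a_kernel P M p = carrier P \<Longrightarrow> N = carrier P"
    using pc by (auto simp: projective_cover_def gprojective_def)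
  have ph: "p \<in> mod_hom VR P M" using gr(4) by (simp add: gmod_hom_def)
  note Pm = graded_moduleD(1)[OF gr(1)] and Mm = graded_moduleD(1)[OF gr(2)]
  interpret P: Module.module VR P by (rule Pm)
  interpret M: Module.module VR M by (rule Mm)
  have cr: "cring (VR :: ('k mpoly, 'k mpoly) gmodule)" by (rule VR_cring)
  obtain Bs :: "'k mpoly set" where Bs: "Bs \<subseteq> Gens c 0" "kv.independent Bs" "Gens c 0 \<subseteq> kv.span Bs"
    using kv.maximal_independent_subset by blast
  have spB: "kv.span Bs = Gens c 0" using Bs kv.span_minimal[OF Bs(1) Gens_subspace] by blast
  let ?F = "free_module (VR :: ('k mpoly, 'k mpoly) gmodule) Bs"
  let ?C = "gpolys (Cov c 0 :: 'k mpoly set) n"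
  note Fm = free_module_module[OF cr, of Bs]
  interpret F: Module.module VR ?F by (rule Fm)
  interpret C: Module.module VR ?C by (rule Cov_module)
  have shpSW: "shift b \<in> Cov c 0" if "b \<in> Gens c 0" for b :: "'k mpoly"
    using Cov_shift[of 1 0 b c] that by simp
  have shpB: "shift b \<in> carrier ?C" if "b \<in> Bs" for b using shpSW that Bs(1) by (auto simp: gpolys_simps)
  obtain J where J: "J \<in> mod_hom VR ?F ?C" "\<And>b. b \<in> Bs \<Longrightarrow> J (unitf VR b) = shift b"
    by (rule free_module_hom_obtain[OF cr C.module_axioms, of Bs shift]) (erule shpB, rule that)
  note Jh = mod_homD[OF J(1), unfolded gpolys_simps]
  have Jslc: "slice u (J f) \<in> kv.span Bs" if "f \<in> carrier ?F" for f u
    using Jh(1)[OF that] spB by (auto simp: Cov_def)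
  have J0: "J \<zero>\<^bsub>?F\<^esub> = 0" using mod_hom_zero[OF Fm C.module_axioms J(1)] by (simp add: gpolys_simps)
  \<comment> \<open>The coordinates of an element of the free module can be read off from the slices of its image,
    hence \<open>J\<close> is injective.\<close>
  have rep: "\<forall>u. \<forall>b\<in>Bs. kv.representation Bs (slice u (J f)) b = coef (f b) u" if f: "f \<in> carrier ?F" for f
  proof (rule free_module_induct[where P = "\<lambda>f. \<forall>u. \<forall>b\<in>Bs. kv.representation Bs (slice u (J f)) b = coef (f b) u", OF cr f])
    show "\<forall>u. \<forall>b\<in>Bs. kv.representation Bs (slice u (J \<zero>\<^bsub>?F\<^esub>)) b = coef (\<zero>\<^bsub>?F\<^esub> b) u"
      unfolding J0 slice_0 kv.representation_zero by (simp add: free_module_simps VR_simps)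
  next
    fix f x assume f: "f \<in> carrier ?F" "x \<in> Bs" "f x \<in> carrier VR" "f(x := \<zero>\<^bsub>VR\<^esub>) \<in> carrier ?F"
      and IH: "\<forall>u. \<forall>b\<in>Bs. kv.representation Bs (slice u (J (f(x := \<zero>\<^bsub>VR\<^esub>)))) b = coef ((f(x := \<zero>\<^bsub>VR\<^esub>)) b) u"
      and eq: "f = f(x := \<zero>\<^bsub>VR\<^esub>) \<oplus>\<^bsub>?F\<^esub> (f x \<odot>\<^bsub>?F\<^esub> unitf VR x)"
    note u = unitf_free[OF cr f(2)]
    have Jf: "J f = J (f(x := \<zero>\<^bsub>VR\<^esub>)) + f x * shift x"
      using arg_cong[OF eq, of J] by (simp only: Jh(2)[OF f(4) F.smult_closed[OF f(3) u]] Jh(3)[OF f(3) u] J(2)[OF f(2)])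
    show "\<forall>u. \<forall>b\<in>Bs. kv.representation Bs (slice u (J f)) b = coef (f b) u"
    proof (intro allI ballI)
      fix u b assume b: "b \<in> Bs"
      have s1: "slice u (J (f(x := \<zero>\<^bsub>VR\<^esub>))) \<in> kv.span Bs" using Jslc[OF f(4)] .
      have s2: "x \<in> kv.span Bs" using f(2) by (rule kv.span_base)
      have "slice u (J f) = slice u (J (f(x := \<zero>\<^bsub>VR\<^esub>))) + Const (coef (f x) u) * x"
        unfolding Jf slice_add using f(3) by (simp add: slice_shift_times VR_simps)
      then have "kv.representation Bs (slice u (J f)) b
          = coef ((f(x := \<zero>\<^bsub>VR\<^esub>)) b) u + coef (f x) u * (if b = x then 1 else 0)"
        using IH b by (simp only: kv.representation_add[OF Bs(2) kv.span_scale[OF s2] s1]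
            kv.representation_scale[OF Bs(2) s2] kv.representation_basis[OF Bs(2) f(2)])
      then show "kv.representation Bs (slice u (J f)) b = coef (f b) u" by (simp add: VR_simps(4))
    qed
  qed
  have Jinj: "inj_on J (carrier ?F)"
  proof (rule inj_onI)
    fix f g assume fg: "f \<in> carrier ?F" "g \<in> carrier ?F" "J f = J g"
    have "f b = g b" for b
    proof (cases "b \<in> Bs")
      case True
      then show ?thesis using rep[OF fg(1)] rep[OF fg(2)] fg(3) by (intro poly_mapping_eqI) metis
    qed (use fg in \<open>simp add: free_module_simps\<close>)
    then show "f = g" by (rule ext)
  qed
  note Jim = mod_hom_image_submodule[OF Fm C.module_axioms J(1)]
  note JimE = C.submoduleE[OF Jim(1), unfolded gpolys_simps]
  have Jsub: "kv.subspace (J ` carrier ?F)"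
    by (rule kv.subspaceI) (use JimE(4)[OF VR_Const] JimE(5) Jim(2) in \<open>simp_all add: gpolys_simps\<close>)
  have Jsurj: "J ` carrier ?F = Cov c 0"
  proof
    show "J ` carrier ?F \<subseteq> Cov c 0" using Jh(1) by blast
    show "Cov c 0 \<subseteq> J ` carrier ?F"
    proof
      fix t :: "'k mpoly" assume t: "t \<in> Cov c 0"
      have "mon u * shift (slice u t) \<in> J ` carrier ?F" if u: "u \<in> low ` supp t" for u
      proof -
        have "mon u \<in> carrier VR" using t u by (auto simp: VR_simps Cov_def polys_mon)
        then have base: "mon u * shift b \<in> kv.span (J ` carrier ?F)" if b: "b \<in> Bs" for b
          using JimE(4)[of "mon u" "J (unitf VR b)"] imageI[OF unitf_free[OF cr b], of J]
          by (intro kv.span_base) (simp add: J(2)[OF b])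
        have "slice u t \<in> kv.span Bs" using t spB by (simp add: Cov_def)
        then have "mon u * shift (slice u t) \<in> kv.span (J ` carrier ?F)"
          by (rule kv_linear_span[where F = "\<lambda>w. mon u * shift w" and A = Bs, rotated 2])
            (rule base, assumption, simp_all only: shift_add shift_Const_times distrib_left mult.left_commute)
        then show ?thesis using Jsub by (simp add: kv.span_eq_iff[THEN iffD2])
      qed
      then show "t \<in> J ` carrier ?F"
        by (subst slice_decomp[of t]) (rule kv.subspace_sum[OF Jsub])
    qed
  qed
  have "\<exists>y\<in>component P (int c). p y = \<theta> b" if "b \<in> Bs" for b
  proof -
    have bG: "b \<in> Gens c 0" using that Bs(1) by blast
    have b: "b \<in> Om c 0" "\<theta> b \<in> component M (int c)" using Gens_Om[OF bG] imageI[OF bG, of \<theta>] thG by (blast, blast)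
    obtain y where y: "y \<in> carrier P" "p y = \<theta> b" using surj_preimage[OF gr(5) lin_isoD(1)[OF th b(1)]] by blast
    then show ?thesis using gmod_hom_homogeneous_preimage[OF gr(1,2,4) y(1)] b(2) by metis
  qed
  then obtain pb where pb: "\<And>b. b \<in> Bs \<Longrightarrow> pb b \<in> component P (int c)" "\<And>b. b \<in> Bs \<Longrightarrow> p (pb b) = \<theta> b"
    by metis
  obtain v where v: "v \<in> mod_hom VR ?F P" "\<And>b. b \<in> Bs \<Longrightarrow> v (unitf VR b) = pb b"
    by (rule free_module_hom_obtain[OF cr Pm, of Bs pb])
      (erule graded_moduleD(3)[OF gr(1) pb(1)], rule that)
  note vh = mod_homD[OF v(1)]
  have mgZ: "merge (J f) \<in> Om c 0" if "f \<in> carrier ?F" for f using merge_Cov[OF Jh(1)[OF that]] .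
  have mgr: "merge r = r" if "r \<in> carrier VR" for r :: "'k mpoly" using that by (simp add: merge_polys VR_simps)
  have pv: "p (v f) = \<theta> (merge (J f))" if f: "f \<in> carrier ?F" for f
  proof -
    have "(\<lambda>f\<in>carrier ?F. \<theta> (merge (J f))) \<in> mod_hom VR ?F M"
      by (rule mod_hom_restrictI[OF Fm])
        (simp_all add: mgZ lin_isoD(1-3)[OF th] Jh(2,3) merge_add merge_mult mgr)
    from free_module_hom_eq[OF cr Mm mod_hom_compose[OF Fm v(1) ph] this _ f] f
    show ?thesis using unitf_free[OF cr] J(2) v(2) pb(2) by (auto simp: compose_def)
  qed
  \<comment> \<open>The kernel of \<open>p\<close> is superfluous.\<close>
  have vsurj: "v ` carrier ?F = carrier P"
  proof (rule small)
    show "graded_submodule (v ` carrier ?F) VR P"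
    proof (rule graded_submoduleI[OF VR_component_sub gr(1)])
      show sm: "submodule (v ` carrier ?F) VR P" by (rule mod_hom_image_submodule[OF Fm Pm v(1)])
      note v0 = mod_hom_image_submodule(2)[OF Fm Pm v(1)]
      let ?D = "\<lambda>x. \<exists>f. decomposition P x f \<and> (\<forall>c. f c \<in> v ` carrier ?F)"
      note sE = P.submoduleE[OF sm]
      have D_hom: "?D x" if "x \<in> component P e" "x \<in> v ` carrier ?F" for x e
      proof -
        show ?thesis using decomposition_homogeneous[OF gr(1) that(1)] that(2) v0
          by (intro exI[of _ "\<lambda>i. if i = e then x else \<zero>\<^bsub>P\<^esub>"]) auto
      qed
      have D_add: "?D (x \<oplus>\<^bsub>P\<^esub> y)" if D: "?D x" "?D y" for x y
      proof -
        obtain f g where "decomposition P x f" "\<forall>c. f c \<in> v ` carrier ?F" "decomposition P y g" "\<forall>c. g c \<in> v ` carrier ?F"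
          using D by blast
        then show ?thesis using decomposition_add[OF gr(1)] sE(5) by (intro exI[of _ "\<lambda>c. f c \<oplus>\<^bsub>P\<^esub> g c"]) blast
      qed
      have D_zero: "?D \<zero>\<^bsub>P\<^esub>"
        by (rule D_hom[OF graded_moduleD(5)[OF gr(1)] v0])
      have D_smult: "?D (r \<odot>\<^bsub>P\<^esub> pb b)" if r: "r \<in> carrier VR" and b: "b \<in> Bs" for r b
      proof -
        have pbP: "pb b \<in> carrier P" "pb b \<in> v ` carrier ?F"
          using graded_moduleD(3)[OF gr(1) pb(1)[OF b]] imageI[OF unitf_free[OF cr b], of v] v(2)[OF b] by simp_all
        have "?D ((\<Sum>m\<in>A. Poly_Mapping.single m (coef r m)) \<odot>\<^bsub>P\<^esub> pb b)
            \<and> (\<Sum>m\<in>A. Poly_Mapping.single m (coef r m)) \<in> carrier VR" if "finite A" "A \<subseteq> supp r" for A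
          using that
        proof (induction A)
          case empty
          have "(0 :: 'k mpoly) \<odot>\<^bsub>P\<^esub> pb b = \<zero>\<^bsub>P\<^esub>" using P.smult_l_null[OF pbP(1)] by (simp add: VR_simps(4))
          then show ?case using D_zero by (simp add: VR_simps)
        next
          case (insert m A)
          have m: "Poly_Mapping.single m (coef r m) \<in> component VR (int (deg0 m div n))"
            using insert.prems r by (auto simp: VR_simps polys_low split: if_splits)
          then have mV: "Poly_Mapping.single m (coef r m) \<in> carrier VR" using VR_component_sub by blast
          have "?D (Poly_Mapping.single m (coef r m) \<odot>\<^bsub>P\<^esub> pb b)"
            by (rule D_hom[OF graded_moduleD(6)[OF gr(1) m pb(1)[OF b]] sE(4)[OF mV pbP(2)]])
          moreover have IH: "?D ((\<Sum>m\<in>A. Poly_Mapping.single m (coef r m)) \<odot>\<^bsub>P\<^esub> pb b)"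
            "(\<Sum>m\<in>A. Poly_Mapping.single m (coef r m)) \<in> carrier VR" using insert by auto
          ultimately show ?case
            using insert.hyps P.smult_l_distr[OF mV IH(2) pbP(1)] D_add kv.subspace_add[OF VR_carrier_subspace mV IH(2)]
            by (simp add: VR_simps(2))
        qed
        from this[of "supp r"] show ?thesis by (simp add: poly_mapping_sum_singles)
      qed
      fix x assume "x \<in> v ` carrier ?F"
      then obtain f where f: "f \<in> carrier ?F" "x = v f" by blast
      show "?D x" unfolding f(2)
      proof (rule free_module_induct[where P = "\<lambda>f. ?D (v f)", OF cr f(1)])
        show "?D (v \<zero>\<^bsub>?F\<^esub>)" using D_zero mod_hom_zero[OF Fm Pm v(1)] by simp
        fix f x assume f: "f \<in> carrier ?F" "x \<in> Bs" "f x \<in> carrier VR" "f(x := \<zero>\<^bsub>VR\<^esub>) \<in> carrier ?F"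
          and IH: "?D (v (f(x := \<zero>\<^bsub>VR\<^esub>)))"
          and eq: "f = f(x := \<zero>\<^bsub>VR\<^esub>) \<oplus>\<^bsub>?F\<^esub> (f x \<odot>\<^bsub>?F\<^esub> unitf VR x)"
        note u = unitf_free[OF cr f(2)]
        have "v f = v (f(x := \<zero>\<^bsub>VR\<^esub>)) \<oplus>\<^bsub>P\<^esub> f x \<odot>\<^bsub>P\<^esub> pb x"
          using arg_cong[OF eq, of v] by (simp only: vh(2)[OF f(4) F.smult_closed[OF f(3) u]] vh(3)[OF f(3) u] v(2)[OF f(2)])
        then show "?D (v f)" using D_add[OF IH D_smult[OF f(3,2)]] by simp
      qed
    qed
    show "v ` carrier ?F <+>\<^bsub>P\<^esub> a_kernel P M p = carrier P"
    proof
      show "v ` carrier ?F <+>\<^bsub>P\<^esub> a_kernel P M p \<subseteq> carrier P"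
        using vh(1) by (auto simp: set_add_def' a_kernel_def')
      show "carrier P \<subseteq> v ` carrier ?F <+>\<^bsub>P\<^esub> a_kernel P M p"
      proof
        fix y assume y: "y \<in> carrier P"
        obtain t where t: "t \<in> Om c 0" "p y = \<theta> t" using surj_preimage[OF lin_isoD(5)[OF th] mod_homD(1)[OF ph y]] by metis
        obtain s where s: "s \<in> Cov c 0" "merge s = t" using merge_Cov_surj[OF t(1)] by blast
        obtain f where f: "f \<in> carrier ?F" "J f = s" using surj_preimage[OF Jsurj s(1)] by blast
        have e: "p (v f) = p y" using pv[OF f(1)] f(2) s(2) t(2) by simp
        note vf = vh(1)[OF f(1)]
        have "p (y \<ominus>\<^bsub>P\<^esub> v f) = \<zero>\<^bsub>M\<^esub>"
          using mod_hom_diff[OF Pm Mm ph y vf] e module_diff_cancel(3)[OF Mm mod_homD(1)[OF ph y] mod_homD(1)[OF ph y]] by simp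
        then have "y \<ominus>\<^bsub>P\<^esub> v f \<in> a_kernel P M p" using module_diff_cancel(1)[OF Pm y vf] by (simp add: a_kernel_def')
        moreover have "y = v f \<oplus>\<^bsub>P\<^esub> (y \<ominus>\<^bsub>P\<^esub> v f)"
          using module_diff_cancel(1,2)[OF Pm y vf] vf P.M.a_comm by metis
        ultimately show "y \<in> v ` carrier ?F <+>\<^bsub>P\<^esub> a_kernel P M p"
          using f(1) by (auto simp: set_add_def')
      qed
    qed
  qed
  have vker: "f = \<zero>\<^bsub>?F\<^esub>" if f: "f \<in> carrier ?F" and vf: "v f = \<zero>\<^bsub>P\<^esub>" for f
  proof (rule ccontr)
    assume f0: "f \<noteq> \<zero>\<^bsub>?F\<^esub>"
    obtain m a r where mr: "a \<in> mod_hom VR P (free_module VR {..<m::nat})" "r \<in> mod_hom VR (free_module VR {..<m}) P"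
      "\<And>x. x \<in> carrier P \<Longrightarrow> r (a x) = x"
      using gprojective_split[OF gr(3)] by metis
    obtain w where w: "w \<in> mod_hom VR (free_module VR {..<m}) ?F"
      "\<And>x. x \<in> carrier (free_module VR {..<m}) \<Longrightarrow> v (w x) = r x"
      using projective_lift[OF cr free_module_projective[OF cr VR_one_neq] Fm Pm v(1) vsurj mr(2)]
      by (rule bexE) (rule that, assumption, erule (1) bspec)
    define s where "s = compose (carrier P) w a"
    have s: "s \<in> mod_hom VR P ?F" unfolding s_def by (rule mod_hom_compose[OF Pm mr(1) w(1)])
    have vs: "v (s y) = y" if "y \<in> carrier P" for y
      using that w(2) mr(3) mod_homD(1)[OF mr(1)] by (simp add: s_def compose_def)
    note sh' = mod_homD[OF s]
    have sv: "s (v g) \<in> carrier ?F" if "g \<in> carrier ?F" for g using that sh'(1) vh(1) by blast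
    have kk: "J (s (v g)) - J g \<in> Om (Suc c) 0" if g: "g \<in> carrier ?F" for g
    proof -
      have "\<theta> (merge (J (s (v g)))) = \<theta> (merge (J g))"
        using pv[OF sv[OF g]] pv[OF g] vs vh(1)[OF g] by simp
      then have "merge (J (s (v g))) = merge (J g)"
        using lin_isoD(4)[OF th] mgZ[OF g] mgZ[OF sv[OF g]] by (meson inj_onD)
      then show ?thesis
        using kv.subspace_diff[OF Cov_subspace Jh(1)[OF sv[OF g]] Jh(1)[OF g]] by (simp add: Om_Suc merge_diff)
    qed
    \<comment> \<open>The lowest degree at position \<open>0\<close> that occurs in \<open>f\<close>.\<close>
    define \<delta> where "\<delta> = Min (deg0 ` supp (J f))"
    have Jf0: "J f \<noteq> 0" using f0 Jinj f J0 by (metis F.M.zero_closed inj_onD)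
    have \<delta>: "\<delta> \<in> deg0 ` supp (J f)" "\<And>m. m \<in> supp (J f) \<Longrightarrow> \<delta> \<le> deg0 m"
      using Jf0 by (auto simp: \<delta>_def intro!: Min_in)
    have deg: "\<forall>m\<in>supp (J (s (v g)) - J g). \<delta> < deg0 m"
      if g: "g \<in> carrier ?F" and gd: "\<forall>b\<in>Bs. \<forall>u\<in>supp (g b). \<delta> \<le> deg0 u" for g
      using gd
    proof (rule mp[rotated, OF _ free_module_induct[where P = "\<lambda>g. (\<forall>b\<in>Bs. \<forall>u\<in>supp (g b). \<delta> \<le> deg0 u) \<longrightarrow>
          (\<forall>m\<in>supp (J (s (v g)) - J g). \<delta> < deg0 m)", OF cr g]])
      have "s (v \<zero>\<^bsub>?F\<^esub>) = \<zero>\<^bsub>?F\<^esub>" using mod_hom_zero[OF Fm Pm v(1)] mod_hom_zero[OF Pm Fm s] by simp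
      then show "(\<forall>b\<in>Bs. \<forall>u\<in>supp (\<zero>\<^bsub>?F\<^esub> b). \<delta> \<le> deg0 u) \<longrightarrow>
          (\<forall>m\<in>supp (J (s (v \<zero>\<^bsub>?F\<^esub>)) - J \<zero>\<^bsub>?F\<^esub>). \<delta> < deg0 m)" by simp
    next
      fix g x assume g: "g \<in> carrier ?F" "x \<in> Bs" "g x \<in> carrier VR" "g(x := \<zero>\<^bsub>VR\<^esub>) \<in> carrier ?F"
        and IH: "(\<forall>b\<in>Bs. \<forall>u\<in>supp ((g(x := \<zero>\<^bsub>VR\<^esub>)) b). \<delta> \<le> deg0 u) \<longrightarrow>
          (\<forall>m\<in>supp (J (s (v (g(x := \<zero>\<^bsub>VR\<^esub>)))) - J (g(x := \<zero>\<^bsub>VR\<^esub>))). \<delta> < deg0 m)"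
        and eq: "g = g(x := \<zero>\<^bsub>VR\<^esub>) \<oplus>\<^bsub>?F\<^esub> (g x \<odot>\<^bsub>?F\<^esub> unitf VR x)"
      let ?g = "g(x := \<zero>\<^bsub>VR\<^esub>)" and ?u = "unitf VR x"
      note u = unitf_free[OF cr g(2)]
      have Jg: "J g = J ?g + g x * J ?u"
        using arg_cong[OF eq, of J] by (simp only: Jh(2)[OF g(4) F.smult_closed[OF g(3) u]] Jh(3)[OF g(3) u])
      have "v g = v ?g \<oplus>\<^bsub>P\<^esub> g x \<odot>\<^bsub>P\<^esub> v ?u"
        using arg_cong[OF eq, of v] by (simp only: vh(2)[OF g(4) F.smult_closed[OF g(3) u]] vh(3)[OF g(3) u])
      then have "s (v g) = s (v ?g) \<oplus>\<^bsub>?F\<^esub> g x \<odot>\<^bsub>?F\<^esub> s (v ?u)"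
        by (simp only: sh'(2)[OF vh(1)[OF g(4)] P.smult_closed[OF g(3) vh(1)[OF u]]] sh'(3)[OF g(3) vh(1)[OF u]])
      then have Jsv: "J (s (v g)) = J (s (v ?g)) + g x * J (s (v ?u))"
        by (simp only: Jh(2)[OF sv[OF g(4)] F.smult_closed[OF g(3) sv[OF u]]] Jh(3)[OF g(3) sv[OF u]])
      have e: "J (s (v g)) - J g = (J (s (v ?g)) - J ?g) + g x * (J (s (v ?u)) - J ?u)"
        unfolding Jg Jsv by (simp add: algebra_simps)
      show "(\<forall>b\<in>Bs. \<forall>u\<in>supp (g b). \<delta> \<le> deg0 u) \<longrightarrow> (\<forall>m\<in>supp (J (s (v g)) - J g). \<delta> < deg0 m)"
      proof (intro impI ballI)
        fix l assume gd: "\<forall>b\<in>Bs. \<forall>u\<in>supp (g b). \<delta> \<le> deg0 u" and l: "l \<in> supp (J (s (v g)) - J g)"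
        have "\<forall>b\<in>Bs. \<forall>u\<in>supp (?g b). \<delta> \<le> deg0 u" using gd by (auto simp: VR_simps(4))
        then have l1: "\<forall>m\<in>supp (J (s (v ?g)) - J ?g). \<delta> < deg0 m" using IH by blast
        consider "l \<in> supp (J (s (v ?g)) - J ?g)" | "l \<in> supp (g x * (J (s (v ?u)) - J ?u))"
          using subsetD[OF keys_add l[unfolded e]] by blast
        then show "\<delta> < deg0 l"
        proof cases
          case 2
          obtain a b where ab: "a \<in> supp (g x)" "b \<in> supp (J (s (v ?u)) - J ?u)" "l = a + b"
            using subsetD[OF keys_mult 2] by blast
          have "0 < deg0 b" by (rule Om_Suc_deg_pos[OF kk[OF u] ab(2)])
          moreover have "\<delta> \<le> deg0 a" using gd g(2) ab(1) by blast
          ultimately show ?thesis using ab(3) by simp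
        qed (use l1 in blast)
      qed
    qed
    have "\<forall>b\<in>Bs. \<forall>u\<in>supp (f b). \<delta> \<le> deg0 u"
    proof (intro ballI)
      fix b u assume b: "b \<in> Bs" and u: "u \<in> supp (f b)"
      have "kv.representation Bs (slice u (J f)) b \<noteq> 0" using rep[OF f] b u by (simp add: in_keys_iff)
      then have "slice u (J f) \<noteq> 0" using kv.representation_zero by metis
      then obtain k where "k \<in> supp (slice u (J f))" by (metis all_not_in_conv keys_eq_empty)
      then have "low u = u" "u + shift_expo k \<in> supp (J f)" by (auto simp: in_keys_iff coef_slice split: if_splits)
      then show "\<delta> \<le> deg0 u" using \<delta>(2)[of "u + shift_expo k"] by simp
    qed
    then have "\<forall>m\<in>supp (J (s (v f)) - J f). \<delta> < deg0 m" by (rule deg[OF f])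
    moreover have "J (s (v f)) = 0" using vf mod_hom_zero[OF Pm Fm s] J0 by simp
    ultimately have "\<forall>m\<in>supp (J f). \<delta> < deg0 m" by (simp add: in_keys_iff lookup_uminus)
    then show False using \<delta>(1) by auto
  qed
  have vinj: "inj_on v (carrier ?F)"
  proof (rule inj_onI)
    fix f g assume fg: "f \<in> carrier ?F" "g \<in> carrier ?F" "v f = v g"
    have "v (f \<ominus>\<^bsub>?F\<^esub> g) = \<zero>\<^bsub>P\<^esub>"
      using mod_hom_diff[OF Fm Pm v(1) fg(1,2)] fg(3) module_diff_cancel(3)[OF Pm vh(1)[OF fg(2)] vh(1)[OF fg(2)]] by simp
    then have "f \<ominus>\<^bsub>?F\<^esub> g = \<zero>\<^bsub>?F\<^esub>" using vker module_diff_cancel(1)[OF Fm fg(1,2)] by blast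
    then show "f = g" using module_diff_cancel(3)[OF Fm fg(1,2)] by blast
  qed
  define \<Theta> where "\<Theta> t = v (inv_into (carrier ?F) J t)" for t
  have TJ: "\<Theta> (J f) = v f" if "f \<in> carrier ?F" for f using that Jinj by (simp add: \<Theta>_def)
  have pre: "\<exists>f\<in>carrier ?F. t = J f" if "t \<in> Cov c 0" for t using that Jsurj by blast
  have "lin_iso (Cov c 0) P \<Theta>"
    unfolding lin_iso_def
  proof (intro conjI ballI)
    have "bij_betw (inv_into (carrier ?F) J) (Cov c 0) (carrier ?F)"
      using Jinj Jsurj by (intro bij_betw_inv_into) (simp add: bij_betw_def)
    moreover have "bij_betw v (carrier ?F) (carrier P)" using vinj vsurj by (simp add: bij_betw_def)
    ultimately have "bij_betw (v \<circ> inv_into (carrier ?F) J) (Cov c 0) (carrier P)" by (rule bij_betw_trans)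
    then show "bij_betw \<Theta> (Cov c 0) (carrier P)" by (simp add: \<Theta>_def[abs_def] comp_def)
  next
    fix x y :: "'k mpoly" assume "x \<in> Cov c 0" "y \<in> Cov c 0"
    then obtain f g where "f \<in> carrier ?F" "x = J f" "g \<in> carrier ?F" "y = J g" using pre by metis
    then show "\<Theta> (x + y) = \<Theta> x \<oplus>\<^bsub>P\<^esub> \<Theta> y" using TJ F.M.a_closed vh(2) by (simp flip: Jh(2))
  next
    fix r x :: "'k mpoly" assume r: "r \<in> carrier VR" and "x \<in> Cov c 0"
    then obtain f where "f \<in> carrier ?F" "x = J f" using pre by metis
    then show "\<Theta> (r * x) = r \<odot>\<^bsub>P\<^esub> \<Theta> x" using r TJ F.smult_closed vh(3) by (simp flip: Jh(3))
  qed
  moreover have "\<forall>t\<in>Cov c 0. p (\<Theta> t) = \<theta> (merge t)" using pre TJ pv by metis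
  moreover have "\<Theta> ` Gens (Suc c) 0 \<subseteq> component P (int (Suc c))"
  proof
    fix y assume "y \<in> \<Theta> ` Gens (Suc c) 0"
    then obtain t where t: "t \<in> Gens (Suc c) 0" "y = \<Theta> t" by blast
    then have tS: "t \<in> Cov c 0" "\<And>m. m \<in> supp t \<Longrightarrow> deg0 m = n" by (auto simp: Gens_def Om_Suc lowdeg_def)
    obtain f where f: "f \<in> carrier ?F" "t = J f" using pre[OF tS(1)] by blast
    have comp: "\<forall>b\<in>Bs. f b \<in> component VR 1"
    proof
      fix b assume b: "b \<in> Bs"
      have "deg0 u = n" if u: "u \<in> supp (f b)" for u
      proof -
        have "kv.representation Bs (slice u (J f)) b \<noteq> 0" using rep[OF f(1)] b u by (simp add: in_keys_iff)
        then have "slice u (J f) \<noteq> 0" using kv.representation_zero by metis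
        then obtain k where "k \<in> supp (slice u (J f))" by (metis all_not_in_conv keys_eq_empty)
        then have "u + shift_expo k \<in> supp t" by (auto simp: f(2) in_keys_iff coef_slice split: if_splits)
        then show ?thesis using tS(2)[of "u + shift_expo k"] by simp
      qed
      then show "f b \<in> component VR 1" using free_module_in_R[OF cr f(1), of b] n2 by (simp add: VR_simps(6))
    qed
    have "(\<forall>b\<in>Bs. f b \<in> component VR 1) \<longrightarrow> v f \<in> component P (int (Suc c))"
    proof (rule free_module_induct[where P = "\<lambda>f. (\<forall>b\<in>Bs. f b \<in> component VR 1) \<longrightarrow> v f \<in> component P (int (Suc c))", OF cr f(1)])
      show "(\<forall>b\<in>Bs. \<zero>\<^bsub>?F\<^esub> b \<in> component VR 1) \<longrightarrow> v \<zero>\<^bsub>?F\<^esub> \<in> component P (int (Suc c))"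
        using mod_hom_zero[OF Fm Pm v(1)] graded_moduleD(5)[OF gr(1)] by simp
      fix f x assume f: "f \<in> carrier ?F" "x \<in> Bs" "f x \<in> carrier VR" "f(x := \<zero>\<^bsub>VR\<^esub>) \<in> carrier ?F"
        and IH: "(\<forall>b\<in>Bs. (f(x := \<zero>\<^bsub>VR\<^esub>)) b \<in> component VR 1) \<longrightarrow> v (f(x := \<zero>\<^bsub>VR\<^esub>)) \<in> component P (int (Suc c))"
        and eq: "f = f(x := \<zero>\<^bsub>VR\<^esub>) \<oplus>\<^bsub>?F\<^esub> (f x \<odot>\<^bsub>?F\<^esub> unitf VR x)"
      note u = unitf_free[OF cr f(2)]
      have vf: "v f = v (f(x := \<zero>\<^bsub>VR\<^esub>)) \<oplus>\<^bsub>P\<^esub> f x \<odot>\<^bsub>P\<^esub> pb x"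
        using arg_cong[OF eq, of v] by (simp only: vh(2)[OF f(4) F.smult_closed[OF f(3) u]] vh(3)[OF f(3) u] v(2)[OF f(2)])
      show "(\<forall>b\<in>Bs. f b \<in> component VR 1) \<longrightarrow> v f \<in> component P (int (Suc c))"
      proof
        assume fb: "\<forall>b\<in>Bs. f b \<in> component VR 1"
        have z: "0 \<in> component VR 1" by (simp add: VR_simps)
        have 1: "v (f(x := \<zero>\<^bsub>VR\<^esub>)) \<in> component P (int (Suc c))" using IH fb z by (auto simp: VR_simps(4))
        have 2: "f x \<odot>\<^bsub>P\<^esub> pb x \<in> component P (int (Suc c))"
          using graded_moduleD(6)[OF gr(1) bspec[OF fb f(2)] pb(1)[OF f(2)]] by simp
        show "v f \<in> component P (int (Suc c))" unfolding vf by (rule graded_moduleD(4)[OF gr(1) 1 2])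
      qed
    qed
    then show "y \<in> component P (int (Suc c))" using comp TJ[OF f(1)] f(2) t(2) by simp
  qed
  ultimately show ?thesis by blast
qed

text \<open>Starting from \<open>aug T\<close>, each cover is identified with the model by
  \<open>cover_iso\<close>, and the next syzygy, a kernel on both sides, by restriction.\<close>
theorem syzygies_model:
  fixes T :: "('k::field mpoly, 'k mpoly, 'b) syzygies"
  assumes T: "is_syzygies VR VS T"
  obtains \<theta> \<Theta> where "\<And>p. p \<in> polys d \<Longrightarrow> \<theta> 0 p = aug T p" "\<And>c. lin_iso (Om c 0) (syz T c) (\<theta> c)"
    "\<And>c. lin_iso (Cov c 0) (cov T c) (\<Theta> c)" "\<And>c t. t \<in> Cov c 0 \<Longrightarrow> cmap T c (\<Theta> c t) = \<theta> c (merge t)"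
    "\<And>c t. t \<in> Om (Suc c) 0 \<Longrightarrow> \<theta> (Suc c) t = \<Theta> c t"
proof -
  let ?ok = "\<lambda>c \<theta>. lin_iso (Om c 0) (syz T c) \<theta> \<and> \<theta> ` Gens c 0 \<subseteq> component (syz T c) (int c)"
  let ?cov = "\<lambda>c \<theta> \<Theta>. lin_iso (Cov c 0) (cov T c) \<Theta> \<and> (\<forall>t\<in>Cov c 0. cmap T c (\<Theta> t) = \<theta> (merge t))"
  have pc: "projective_cover VR (cov T c) (syz T c) (cmap T c)"
    "syz T (Suc c) = grestrict (cov T c) (a_kernel (cov T c) (syz T c) (cmap T c))" for c
    using T by (auto simp: is_syzygies_def)
  note sm = syzygies_modules[OF T]
  have aug: "aug T \<in> gmod_iso VR VS (syz T 0)" using T by (simp add: is_syzygies_def)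
  have base: "?ok 0 (aug T)"
  proof
    show "lin_iso (Om 0 0) (syz T 0) (aug T)"
      using aug mod_homD[of "aug T" VR VS "syz T 0"]
      unfolding gmod_iso_def lin_iso_def VS_eq gpolys_simps by blast
    have "Gens 0 0 = component VS 0"
      using n2 by (auto simp: Gens_def lowdeg_def poly_S_def gpolys_def polys_low deg0_mdeg div_eq_0_iff)
    then show "aug T ` Gens 0 0 \<subseteq> component (syz T 0) (int 0)"
      using aug by (auto simp: gmod_iso_def)
  qed
  have step: "\<exists>\<Theta>. ?cov c \<theta> \<Theta> \<and> ?ok (Suc c) \<Theta>" if ok: "?ok c \<theta>" for c \<theta>
  proof -
    obtain \<Theta> where h: "lin_iso (Cov c 0) (cov T c) \<Theta>" "\<forall>t\<in>Cov c 0. cmap T c (\<Theta> t) = \<theta> (merge t)"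
      "\<Theta> ` Gens (Suc c) 0 \<subseteq> component (cov T c) (int (Suc c))"
      using cover_iso[OF pc(1) conjunct1[OF ok] conjunct2[OF ok]] by blast
    have ok1: "lin_iso (Om c 0) (syz T c) \<theta>" by (rule conjunct1[OF ok])
    have z: "\<theta> 0 = \<zero>\<^bsub>syz T c\<^esub>"
      by (rule lin_iso_zero[OF ok1 sm(1) kv.subspace_0[OF Om_subspace]])
    have mem: "\<Theta> t \<in> carrier (syz T (Suc c)) \<longleftrightarrow> t \<in> Om (Suc c) 0" if t: "t \<in> Cov c 0" for t
    proof -
      have "\<Theta> t \<in> carrier (syz T (Suc c)) \<longleftrightarrow> \<theta> (merge t) = \<theta> 0"
        using h(2) t lin_isoD(1)[OF h(1) t] z by (simp add: sm(6))
      also have "\<dots> \<longleftrightarrow> merge t = 0"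
        using inj_on_eq_iff[OF lin_isoD(4)[OF ok1] merge_Cov[OF t] kv.subspace_0[OF Om_subspace]] .
      finally show ?thesis using t by (simp add: Om_Suc)
    qed
    have ZS: "Om (Suc c) 0 \<subseteq> (Cov c 0 :: 'k mpoly set)" by (auto simp: Om_Suc)
    have img: "\<Theta> ` Om (Suc c) 0 = carrier (syz T (Suc c))"
    proof
      show "\<Theta> ` Om (Suc c) 0 \<subseteq> carrier (syz T (Suc c))" using mem ZS by blast
      show "carrier (syz T (Suc c)) \<subseteq> \<Theta> ` Om (Suc c) 0"
      proof
        fix y assume y: "y \<in> carrier (syz T (Suc c))"
        then have "y \<in> carrier (cov T c)" by (simp add: sm(6))
        then obtain t where "t \<in> Cov c 0" "y = \<Theta> t" using surj_preimage[OF lin_isoD(5)[OF h(1)]] by metis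
        then show "y \<in> \<Theta> ` Om (Suc c) 0" using mem y by blast
      qed
    qed
    have "bij_betw \<Theta> (Om (Suc c) 0) (carrier (syz T (Suc c)))"
      using img inj_on_subset[OF lin_isoD(4)[OF h(1)] ZS] by (simp add: bij_betw_def)
    then have "lin_iso (Om (Suc c) 0) (syz T (Suc c)) \<Theta>"
      using lin_isoD(2,3)[OF h(1)] ZS unfolding lin_iso_def sm(7,8) by blast
    moreover have "\<Theta> ` Gens (Suc c) 0 \<subseteq> component (syz T (Suc c)) (int (Suc c))"
    proof -
      have "\<Theta> ` Gens (Suc c) 0 \<subseteq> carrier (syz T (Suc c))" using img Gens_Om by blast
      moreover have "component (syz T (Suc c)) e = component (cov T c) e \<inter> carrier (syz T (Suc c))" for e
        unfolding pc(2) by (simp add: grestrict_def)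
      ultimately show ?thesis using h(3) by blast
    qed
    ultimately show ?thesis using h by blast
  qed
  have "\<exists>f. \<forall>c. (?ok c (f c) \<and> (c = 0 \<longrightarrow> f c = aug T)) \<and> ?cov c (f c) (f (Suc c))"
  proof (rule dependent_nat_choice)
    show "\<exists>\<theta>. ?ok 0 \<theta> \<and> (0 = (0::nat) \<longrightarrow> \<theta> = aug T)" using base by blast
    fix \<theta> and c :: nat
    assume "?ok c \<theta> \<and> (c = 0 \<longrightarrow> \<theta> = aug T)"
    then show "\<exists>\<Theta>. (?ok (Suc c) \<Theta> \<and> (Suc c = 0 \<longrightarrow> \<Theta> = aug T)) \<and> ?cov c \<theta> \<Theta>"
      using step[of c \<theta>] by (elim conjE) blast
  qed
  then obtain f where f: "\<forall>c. (?ok c (f c) \<and> (c = 0 \<longrightarrow> f c = aug T)) \<and> ?cov c (f c) (f (Suc c))"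
    by (rule exE)
  note ok = f[THEN spec, THEN conjunct1, THEN conjunct1, THEN conjunct1]
    and z = f[THEN spec, THEN conjunct1, THEN conjunct2, rule_format]
    and cov = f[THEN spec, THEN conjunct2]
  show thesis
  proof (rule that[of f "\<lambda>c. f (Suc c)"])
    show "f 0 p = aug T p" for p by (simp add: z)
    show "lin_iso (Om c 0) (syz T c) (f c)" for c by (rule ok)
    show "lin_iso (Cov c 0) (cov T c) (f (Suc c))" for c by (rule cov[THEN conjunct1])
    show "cmap T c (f (Suc c) t) = f c (merge t)" if "t \<in> Cov c 0" for c t
      by (rule cov[THEN conjunct2, THEN bspec, OF that])
    show "f (Suc c) t = f (Suc c) t" for c t by (rule refl)
  qed
qed

end

section \<open>Homomorphisms from the polynomial ring to the syzygies\<close>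

context veronese begin

definition summand :: "nat \<Rightarrow> 'k::field mpoly \<Rightarrow> 'k mpoly"
  where "summand i = part (\<lambda>m. deg0 m mod n = i)"

lemma proj_M_summand: "q \<in> polys d \<Longrightarrow> proj_M n i q = summand i q"
  unfolding proj_M_def summand_def part_def
  by (rule sum.cong) (auto simp: polys_low deg0_mdeg)

lemma summand_polys: "q \<in> polys d \<Longrightarrow> summand i q \<in> polys d"
  by (auto simp: summand_def polys_low supp_part)

lemma summand_deg: "m \<in> supp (summand i q) \<Longrightarrow> deg0 m mod n = i"
  by (simp add: summand_def supp_part)

lemma summand_add: "summand i (p + q) = summand i p + summand i q" by (simp add: summand_def part_add)

lemma summand_sum_all: "(\<Sum>i<n. summand i q) = q"
proof (rule poly_mapping_eqI)
  fix m
  have "(\<Sum>i<n. coef (summand i q) m) = (\<Sum>i<n. if i = deg0 m mod n then coef q m else 0)"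
    by (rule sum.cong) (auto simp: summand_def coef_part)
  also have "\<dots> = coef q m" using n2 by (simp add: sum.delta)
  finally show "coef (\<Sum>i<n. summand i q) m = coef q m" by (simp add: lookup_sum)
qed

lemma summand_VR_mult: "r \<in> carrier VR \<Longrightarrow> summand i (r * q) = r * summand i q"
  unfolding summand_def
  by (rule part_times_shift) (auto simp: VR_simps mod_add_left_eq[symmetric, of "deg0 _"] dvd_eq_mod_eq_0)

lemma summand_homogeneous:
  assumes "\<forall>m\<in>supp q. deg0 m mod n = i" shows "summand j q = (if j = i then q else 0)"
  using assms by (auto simp: summand_def intro!: part_eqI part_eq_0)

text \<open>A map from \<open>S = M\<^sub>0 \<oplus> \<dots> \<oplus> M\<^bsub>n-1\<^esub>\<close> to
  \<open>\<Omega>\<^sup>cS\<close> is given by a family of multipliers \<open>h i\<close> in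
  \<open>Om c i\<close>; \<open>apply_fam h\<close> is the corresponding map in the model.\<close>
definition mult_fams :: "nat \<Rightarrow> (nat \<Rightarrow> 'k::field mpoly) set"
  where "mult_fams c = {h. \<forall>i<n. h i \<in> Om c i}"

definition apply_fam :: "(nat \<Rightarrow> 'k::field mpoly) \<Rightarrow> 'k mpoly \<Rightarrow> 'k mpoly"
  where "apply_fam h q = (\<Sum>i<n. summand i q * h i)"

lemma apply_fam_add: "apply_fam h (p + q) = apply_fam h p + apply_fam h q"
  by (simp add: apply_fam_def summand_add algebra_simps sum.distrib)

lemma apply_fam_VR: "r \<in> carrier VR \<Longrightarrow> apply_fam h (r * q) = r * apply_fam h q"
  by (simp add: apply_fam_def summand_VR_mult sum_distrib_left mult.assoc)

lemma apply_fam_diff_fun: "apply_fam (\<lambda>i. h i - g i) q = apply_fam h q - apply_fam g q"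
  by (simp add: apply_fam_def algebra_simps sum_subtractf)

lemma apply_fam_homogeneous:
  assumes "\<forall>m\<in>supp q. deg0 m mod n = i" "i < n" shows "apply_fam h q = q * h i"
proof -
  have "apply_fam h q = (\<Sum>j<n. if j = i then q * h i else 0)"
    unfolding apply_fam_def by (rule sum.cong) (auto simp: summand_homogeneous[OF assms(1)])
  then show ?thesis using assms(2) by (simp add: sum.delta)
qed

lemma Om_mult_homogeneous:
  assumes "q \<in> polys d" "\<forall>m\<in>supp q. deg0 m mod n = i" "h \<in> Om c i" shows "q * h \<in> Om c 0"
  by (rule Om_mult[OF assms(1) _ assms(3)]) (use assms(2) in auto)

lemma apply_fam_Om: "h \<in> mult_fams c \<Longrightarrow> q \<in> polys d \<Longrightarrow> apply_fam h q \<in> Om c 0"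
  unfolding apply_fam_def
  by (intro kv.subspace_sum Om_subspace Om_mult_homogeneous[OF summand_polys]) (auto simp: mult_fams_def summand_deg)

lemma mon_nonzero: "mon m \<noteq> (0 :: 'k::field mpoly)"
  by (metis in_keys_iff keys_single keys_zero one_neq_zero singletonI empty_iff)

text \<open>Membership in \<open>Om c i\<close> can be tested on a single monomial of degree \<open>i\<close>,
  because a monomial at position \<open>0\<close> is not a zero divisor for slices and for
  \<open>merge\<close>.\<close>
lemma Om_divide:
  fixes h :: "'k::field mpoly"
  assumes "mon v * h \<in> Om c 0" "low v = v" "deg0 v = i" shows "h \<in> Om c i"
proof (cases c)
  case 0
  have "low l = l" if "l \<in> supp h" for l
  proof -
    have "v + l \<in> supp (mon v * h)" using that by (simp add: supp_mon_times)
    then have "low (v + l) = v + l" using assms(1) 0 by (auto simp: polys_low)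
    then show ?thesis using assms(2) by (simp add: low_add)
  qed
  then show ?thesis by (simp add: 0 polys_low)
next
  case (Suc c')
  have h: "mon v * h \<in> Cov c' 0" "merge (mon v * h) = 0" using assms(1) by (auto simp: Suc Om_Suc)
  have "slice u h \<in> Gens c' 0" for u
    using h(1) slice_mon_times[OF assms(2), of u h] by (auto simp: Cov_def) metis
  moreover have "n dvd deg0 m + i" if "m \<in> supp h" for m
  proof -
    have "v + m \<in> supp (mon v * h)" using that by (simp add: supp_mon_times)
    then have "n dvd deg0 (v + m)" using h(1) by (auto simp: Cov_def)
    then show ?thesis by (simp add: assms(3) add.commute)
  qed
  moreover have "merge h = 0"
    using h(2) assms(2) mon_nonzero[of v, where 'k = 'k] by (simp add: merge_mult merge_polys polys_mon)
  ultimately show ?thesis by (simp add: Suc Om_Suc Cov_def)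
qed

text \<open>For \<open>q\<close> in \<open>M\<^sub>i\<close> and \<open>v \<in> {1, 2}\<close> linearity gives
  \<open>x\<^sub>v\<^sup>i g(q) = q g(x\<^sub>v\<^sup>i)\<close>, after multiplication with
  \<open>x\<^sub>v\<^bsup>n-i\<^esup>\<close>, which moves both factors into \<open>R\<close>. So
  \<open>g\<close> is multiplication by the fraction \<open>g(x\<^sub>1\<^sup>i) /
  x\<^sub>1\<^sup>i\<close>. Taking \<open>q = x\<^sub>2\<^sup>i\<close>, the power
  \<open>x\<^sub>1\<^sup>i\<close> divides \<open>x\<^sub>2\<^sup>i g(x\<^sub>1\<^sup>i)\<close>,
  hence \<open>g(x\<^sub>1\<^sup>i)\<close>, and the fraction is a polynomial.\<close>
lemma linear_is_multiplication:
  fixes g :: "'k::field mpoly \<Rightarrow> 'k mpoly"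
  assumes lin: "\<And>r q. r \<in> carrier VR \<Longrightarrow> q \<in> polys d \<Longrightarrow> g (r * q) = r * g q"
    and i: "i < n"
  shows "\<exists>h. \<forall>q\<in>polys d. (\<forall>m\<in>supp q. deg0 m mod n = i) \<longrightarrow> g q = q * h"
proof -
  let ?x = "\<lambda>v e. mon (Poly_Mapping.single v e) :: 'k mpoly"
  have lowx: "low (Poly_Mapping.single v e) = Poly_Mapping.single v e" if "v \<in> {1, 2}" for v e
    using that d2 by (auto simp: low_id_iff)
  have degx: "deg0 (Poly_Mapping.single v e) = e" if "v \<in> {1, 2}" for v e
    using that d2 by (intro deg0_single) auto
  have frac: "?x v i * g q = q * g (?x v i)"
    if v: "v \<in> {1, 2}" and q: "q \<in> polys d" "\<forall>m\<in>supp q. deg0 m mod n = i" for v q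
  proof -
    let ?b = "?x v (n - i)"
    have xp: "?x v e \<in> polys d" for e using lowx[OF v] by (rule polys_mon)
    have bx: "?b * ?x v i = ?x v n" using i by (simp add: mult_single flip: single_add)
    have n1: "?b * ?x v i \<in> carrier VR" unfolding bx using xp degx[OF v] by (simp add: VR_simps)
    have n2: "?b * q \<in> carrier VR"
    proof -
      have "n dvd deg0 m" if "m \<in> supp (?b * q)" for m
      proof -
        obtain l where l: "l \<in> supp q" "m = Poly_Mapping.single v (n - i) + l"
          using \<open>m \<in> supp (?b * q)\<close> by (auto simp: supp_mon_times)
        have "(n - i + deg0 l) mod n = (n - i + deg0 l mod n) mod n" by (simp add: mod_simps)
        also have "\<dots> = 0" using q(2) l(1) i by simp
        finally show ?thesis using degx[OF v] by (simp add: l(2) dvd_eq_mod_eq_0)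
      qed
      then show ?thesis using polys_mult[OF xp q(1)] by (simp add: VR_simps)
    qed
    have "?b * (?x v i * g q) = g ((?b * ?x v i) * q)" using lin[OF n1 q(1)] by (simp add: mult.assoc)
    also have "(?b * ?x v i) * q = (?b * q) * ?x v i" by (simp add: ac_simps)
    also have "g \<dots> = ?b * (q * g (?x v i))" using lin[OF n2 xp] by (simp add: mult.assoc)
    finally show ?thesis using mon_nonzero by (metis mult_left_cancel)
  qed
  have x12: "?x v i \<in> polys d" "\<forall>m\<in>supp (?x v i). deg0 m mod n = i" if "v \<in> {1, 2}" for v
    using lowx[OF that] degx[OF that] i by (auto simp: polys_mon)
  have e: "?x 1 i * g (?x 2 i) = ?x 2 i * g (?x 1 i)"
    by (rule frac) (use x12[of 2] in auto)
  \<comment> \<open>As \<open>x\<^sub>1\<^sup>i\<close> divides \<open>x\<^sub>2\<^sup>i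
    g(x\<^sub>1\<^sup>i)\<close>, it divides every term of \<open>g(x\<^sub>1\<^sup>i)\<close>.\<close>
  have ge: "i \<le> coef m 1" if m: "m \<in> supp (g (?x 1 i))" for m
  proof -
    have "Poly_Mapping.single 2 i + m \<in> supp (?x 1 i * g (?x 2 i))"
      unfolding e supp_mon_times using m by blast
    then obtain l where "Poly_Mapping.single 2 i + m = Poly_Mapping.single 1 i + l"
      by (auto simp: supp_mon_times)
    then have "coef (Poly_Mapping.single 2 i + m) 1 = coef (Poly_Mapping.single 1 i + l) 1" by simp
    then show ?thesis by (simp add: lookup_add lookup_single when_def)
  qed
  define h where "h = lin (\<lambda>m. mon (m - Poly_Mapping.single 1 i)) (g (?x 1 i))"
  have "?x 1 i * h = lin (\<lambda>m. ?x 1 i * mon (m - Poly_Mapping.single 1 i)) (g (?x 1 i))"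
    by (simp add: h_def lin_times_left)
  also have "\<dots> = lin mon (g (?x 1 i))"
  proof (rule lin_cong)
    fix m assume "m \<in> supp (g (?x 1 i))"
    then have "Poly_Mapping.single 1 i + (m - Poly_Mapping.single 1 i) = m"
      using ge[of m] by (intro poly_mapping_eqI) (auto simp: lookup_add lookup_minus lookup_single when_def)
    then show "?x 1 i * mon (m - Poly_Mapping.single 1 i) = mon m" by (simp add: mult_single)
  qed
  finally have xh: "?x 1 i * h = g (?x 1 i)" by simp
  have "g q = q * h" if "q \<in> polys d" "\<forall>m\<in>supp q. deg0 m mod n = i" for q
  proof -
    have "?x 1 i * g q = q * g (?x 1 i)" by (rule frac) (use that in auto)
    also have "\<dots> = ?x 1 i * (q * h)" unfolding xh[symmetric] by (rule mult.left_commute)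
    finally have "?x 1 i * g q = ?x 1 i * (q * h)" .
    then show ?thesis using mon_nonzero by (metis mult_left_cancel)
  qed
  then show ?thesis by blast
qed

lemma in_radical_add_pos:
  assumes "n dvd e" "0 < e" "lowdeg c f" "c = 0 \<or> f = n" shows "\<not> lowdeg c (e + f)"
  using assms dvd_imp_le[of n e] by (auto simp: lowdeg_def)

text \<open>The submodule spanned by the degrees above those of the generators, that is, the radical of
  \<open>\<Omega>\<^sup>cS\<close>.\<close>
definition Rad :: "nat \<Rightarrow> 'k::field mpoly set"
  where "Rad c = {t \<in> Om c 0. \<forall>m\<in>supp t. \<not> lowdeg c (deg0 m)}"

lemma Rad_subspace: "kv.subspace (Rad c :: 'k::field mpoly set)"
proof -
  have "Rad c = Om c 0 \<inter> {t :: 'k mpoly. \<forall>m\<in>supp t. \<not> lowdeg c (deg0 m)}" by (auto simp: Rad_def)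
  then show ?thesis using kv.subspace_inter[OF Om_subspace supp_subspace] by simp
qed

lemma Rad_mult:
  assumes "r \<in> carrier VR" "\<forall>m\<in>supp r. 0 < deg0 m" "t \<in> Om c 0" shows "r * t \<in> Rad c"
proof -
  have "\<not> lowdeg c (deg0 m)" if "m \<in> supp (r * t)" for m
  proof -
    obtain a b where ab: "a \<in> supp r" "b \<in> supp t" "m = a + b"
      using keys_mult[of r t] \<open>m \<in> supp (r * t)\<close> by blast
    have a: "n \<le> deg0 a" using ab(1) assms(1,2) by (auto simp: VR_simps intro: dvd_imp_le)
    show ?thesis
    proof (cases c)
      case 0 then show ?thesis using a ab(3) by (simp add: lowdeg_def)
    next
      case (Suc c')
      have "0 < deg0 b" using Om_Suc_deg_pos[of t c' 0 b] assms(3) ab(2) Suc by simp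
      then show ?thesis using a ab(3) Suc by (simp add: lowdeg_def)
    qed
  qed
  then show ?thesis using VR_times_Om[OF assms(1,3)] by (simp add: Rad_def)
qed

lemma Rad_gens_in_radical:
  assumes "x \<in> kv.span (Rad_gens c i :: 'k::field mpoly set)" "m \<in> supp x" shows "\<not> lowdeg c (deg0 m + i)"
proof -
  have "Rad_gens c i \<subseteq> {x :: 'k mpoly. \<forall>m\<in>supp x. \<not> lowdeg c (deg0 m + i)}"
  proof (intro subsetI CollectI ballI)
    fix x :: "'k mpoly" and m assume "x \<in> Rad_gens c i" and m: "m \<in> supp x"
    then obtain a b where ab: "x = a * b" "\<forall>m\<in>supp a. n dvd deg0 m + i \<and> 0 < deg0 m + i" "b \<in> Gens c 0"
      unfolding Rad_gens_def by blast
    obtain k l where kl: "k \<in> supp a" "l \<in> supp b" "m = k + l"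
      using keys_mult[of a b] m ab(1) by blast
    have "\<not> lowdeg c ((deg0 k + i) + deg0 l)"
      by (rule in_radical_add_pos) (use kl ab in \<open>auto simp: Gens_def lowdeg_def split: if_splits\<close>)
    then show "\<not> lowdeg c (deg0 m + i)" by (simp add: kl(3) ac_simps)
  qed
  then have "kv.span (Rad_gens c i) \<subseteq> {x :: 'k mpoly. \<forall>m\<in>supp x. \<not> lowdeg c (deg0 m + i)}"
    by (rule kv.span_minimal[OF _ supp_subspace])
  then show ?thesis using assms by blast
qed

lemma Om_split:
  assumes "h \<in> (Om c i :: 'k::field mpoly set)" "i < n"
  obtains g e where "h = g + e" "g \<in> Gens c i" "e \<in> kv.span (Rad_gens c i)"
proof -
  have "h \<in> kv.span (Gens c i \<union> Rad_gens c i)" using Om_decomp[OF assms(2)] assms(1) by blast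
  then obtain g e where "g \<in> kv.span (Gens c i)" "e \<in> kv.span (Rad_gens c i)" "h = g + e"
    by (auto simp: kv.span_Un)
  moreover have "kv.span (Gens c i) = (Gens c i :: 'k mpoly set)"
    using kv.span_eq_iff[of "Gens c i"] Gens_subspace[of c i] by simp
  ultimately show thesis using that by simp
qed

text \<open>A list of pairs of a map \<open>M\<^sub>i \<rightarrow> R\<close>, given by its multiplier
  \<open>a\<close> in \<open>M\<^bsub>-i\<^esub>\<close>, and an element \<open>w\<close> of
  \<open>\<Omega>\<^sup>cS\<close>. It factors the multiplication by \<open>x\<close> through a
  free module whose rank is the length of the list.\<close>
definition combination :: "nat \<Rightarrow> nat \<Rightarrow> ('k mpoly \<times> 'k mpoly) list \<Rightarrow> 'k::field mpoly \<Rightarrow> bool"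
  where "combination c i ys x \<longleftrightarrow> x = (\<Sum>(a, w)\<leftarrow>ys. a * w) \<and>
    (\<forall>(a, w)\<in>set ys. a \<in> polys d \<and> (\<forall>m\<in>supp a. n dvd deg0 m + i) \<and> w \<in> Om c 0)"

lemma combination_ex:
  assumes "x \<in> kv.span (Rad_gens c i :: 'k::field mpoly set)" shows "\<exists>ys. combination c i ys x"
  using assms
proof (induction rule: kv.span_induct)
  case base
  show ?case
  proof (rule kv.subspaceI)
    show "0 \<in> {x. \<exists>ys. combination c i ys x}"
      by (intro CollectI exI[of _ "[]"]) (simp add: combination_def)
    show "x + y \<in> {x. \<exists>ys. combination c i ys x}"
      if xy: "x \<in> {x. \<exists>ys. combination c i ys x}" "y \<in> {x. \<exists>ys. combination c i ys x}" for x y :: "'k mpoly"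
    proof -
      obtain ys zs where "combination c i ys x" "combination c i zs y" using xy by blast
      then have "combination c i (ys @ zs) (x + y)" by (auto simp: combination_def)
      then show ?thesis by blast
    qed
    show "Const k * x \<in> {x. \<exists>ys. combination c i ys x}"
      if x: "x \<in> {x. \<exists>ys. combination c i ys x}" for k and x :: "'k mpoly"
    proof -
      obtain ys where ys: "combination c i ys x" using x by blast
      have "(\<Sum>(a, w)\<leftarrow>map (\<lambda>(a, w). (Const k * a, w)) ys. a * w) = Const k * (\<Sum>(a, w)\<leftarrow>ys. a * w)"
        by (induction ys) (auto simp: algebra_simps)
      moreover have "supp (Const k * a) \<subseteq> supp a" for a :: "'k mpoly" by (auto simp: in_keys_iff)
      ultimately have "combination c i (map (\<lambda>(a, w). (Const k * a, w)) ys) (Const k * x)"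
        using ys by (auto simp: combination_def polys_mult split: prod.splits) blast+
      then show ?thesis by blast
    qed
  qed
next
  case (step x)
  then obtain a b where "x = a * b" "a \<in> polys d" "\<forall>m\<in>supp a. n dvd deg0 m + i" "b \<in> Gens c 0"
    unfolding Rad_gens_def by blast
  then have "combination c i [(a, b)] x" by (simp add: combination_def Gens_Om)
  then show ?case by blast
qed

definition pos_deg :: "nat \<Rightarrow> expo \<Rightarrow> nat" where "pos_deg c m = deg0 ((high ^^ c) m)"

lemma pos_deg_0 [simp]: "pos_deg 0 m = deg0 m" by (simp add: pos_deg_def)
lemma pos_deg_Suc [simp]: "pos_deg (Suc c) m = pos_deg c (high m)" by (simp add: pos_deg_def funpow_Suc_right del: funpow.simps)
lemma pos_deg_add [simp]: "pos_deg c (m + m') = pos_deg c m + pos_deg c m'"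
  by (induction c arbitrary: m m') (auto simp: high_add)
lemma pos_deg_zero [simp]: "pos_deg c 0 = 0" by (induction c) auto
lemma pos_deg_low: "low u = u \<Longrightarrow> pos_deg c u = (if c = 0 then deg0 u else 0)"
  by (cases c) (auto simp: high_of_low)

definition shift_iter :: "nat \<Rightarrow> 'k::field mpoly \<Rightarrow> 'k mpoly" where "shift_iter c = shift ^^ c"

lemma shift_iter_0 [simp]: "shift_iter 0 p = p" and shift_iter_Suc [simp]: "shift_iter (Suc c) p = shift (shift_iter c p)"
  by (simp_all add: shift_iter_def)
lemma shift_iter_zero [simp]: "shift_iter c 0 = 0" by (induction c) auto
lemma shift_iter_add: "shift_iter c (p + q) = shift_iter c p + shift_iter c q" by (induction c) (auto simp: shift_add)
lemma shift_iter_Const_times: "shift_iter c (Const k * p) = Const k * shift_iter c p"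
  by (induction c) (auto simp: shift_Const_times)

text \<open>Let \<open>m\<close> be a monomial of a map \<open>M\<^sub>i \<rightarrow>
  \<Omega>\<^sup>cS\<close>. Its target vertex is the residue of the degree at the last position
  \<open>c\<close>. For \<open>c = 0\<close> the last position also receives the argument, whose
  degree is \<open>i\<close> modulo \<open>n\<close>.\<close>
definition tgt :: "nat \<Rightarrow> nat \<Rightarrow> expo \<Rightarrow> nat"
  where "tgt c i m = (pos_deg c m + (if c = 0 then i else 0)) mod n"

text \<open>Each term of \<open>t\<close> is multiplied at position \<open>c\<close> by the multiplier
  \<open>g v\<close>, where \<open>v\<close> is the target vertex of the term. On the model of
  \<open>\<Omega>\<^sup>cS\<close> this represents \<open>\<Omega>\<^sup>cg\<close>.\<close>
definition mult_last :: "nat \<Rightarrow> nat \<Rightarrow> (nat \<Rightarrow> 'k::field mpoly) \<Rightarrow> 'k mpoly \<Rightarrow> 'k mpoly"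
  where "mult_last c i g t = (\<Sum>v<n. part (\<lambda>m. tgt c i m = v) t * shift_iter c (g v))"

lemma mult_last_add: "mult_last c i g (p + q) = mult_last c i g p + mult_last c i g q"
  by (simp add: mult_last_def part_add algebra_simps sum.distrib)
lemma mult_last_Const: "mult_last c i g (Const k * p) = Const k * mult_last c i g p"
  by (simp add: mult_last_def part_Const_times sum_distrib_left mult.assoc)
lemma mult_last_0 [simp]: "mult_last c i g 0 = 0" by (simp add: mult_last_def)
lemma mult_last_sum: "mult_last c i g (sum f A) = (\<Sum>a\<in>A. mult_last c i g (f a))"
  by (induction A rule: infinite_finite_induct) (auto simp: mult_last_add)

end

text \<open>The data provided by \<open>syzygies_model\<close>.\<close>
locale veronese_syz = veronese d n for d n +
  fixes T :: "('k::field mpoly, 'k mpoly, 'b) syzygies"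
    and \<theta> :: "nat \<Rightarrow> 'k mpoly \<Rightarrow> 'b" and \<Theta> :: "nat \<Rightarrow> 'k mpoly \<Rightarrow> 'b"
  assumes T: "is_syzygies (veronese_R d n) (poly_S d n) T"
    and th0: "\<And>p. p \<in> polys d \<Longrightarrow> \<theta> 0 p = aug T p"
    and th: "\<And>c. lin_iso (Om c 0) (syz T c) (\<theta> c)"
    and Th: "\<And>c. lin_iso (Cov c 0) (cov T c) (\<Theta> c)"
    and cmap_Th: "\<And>c t. t \<in> Cov c 0 \<Longrightarrow> cmap T c (\<Theta> c t) = \<theta> c (merge t)"
    and th_Suc: "\<And>c t. t \<in> Om (Suc c) 0 \<Longrightarrow> \<theta> (Suc c) t = \<Theta> c t"
begin

abbreviation "KR \<equiv> (veronese_R d n :: ('k mpoly, 'k mpoly) gmodule)"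
abbreviation "KS \<equiv> (poly_S d n :: ('k mpoly, 'k mpoly) gmodule)"

lemmas sm = syzygies_modules[OF T]

lemma KS_simps: "carrier KS = polys d" "x \<oplus>\<^bsub>KS\<^esub> y = x + y" "r \<odot>\<^bsub>KS\<^esub> x = r * x" "\<zero>\<^bsub>KS\<^esub> = 0"
  by (simp_all add: poly_S_def gpolys_def)

lemma KS_module: "Module.module KR KS" by (rule VS_module)

definition fam_map :: "nat \<Rightarrow> (nat \<Rightarrow> 'k mpoly) \<Rightarrow> 'k mpoly \<Rightarrow> 'b"
  where "fam_map c h = (\<lambda>q\<in>carrier KS. \<theta> c (apply_fam h q))"

abbreviation FP :: "nat \<Rightarrow> ('k mpoly \<Rightarrow> 'b) set" where "FP c \<equiv> factors_through_projective KR KS (syz T c)"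
abbreviation hom :: "nat \<Rightarrow> ('k mpoly \<Rightarrow> 'b) set" where "hom c \<equiv> mod_hom KR KS (syz T c)"

lemma fam_map_hom: assumes "h \<in> mult_fams c" shows "fam_map c h \<in> hom c"
  unfolding fam_map_def
  by (rule mod_hom_restrictI[OF KS_module])
    (simp_all add: KS_simps apply_fam_Om[OF assms] apply_fam_add apply_fam_VR lin_isoD(1-3)[OF th])

text \<open>Transport the map to the model, where \<open>linear_is_multiplication\<close> gives the
  multipliers.\<close>
lemma hom_fam_map: assumes "f \<in> hom c" shows "\<exists>h\<in>mult_fams c. f = fam_map c h"
proof -
  note f = mod_homD[OF assms, unfolded KS_simps]
  define g where "g q = inv_into (Om c 0) (\<theta> c) (f q)" for q
  have g: "g q \<in> Om c 0" "\<theta> c (g q) = f q" if "q \<in> polys d" for q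
    using f(1)[OF that] lin_isoD(5)[OF th, of c]
    by (auto simp: g_def inv_into_into f_inv_into_f)
  have geq: "g q = t" if "q \<in> polys d" "t \<in> Om c 0" "\<theta> c t = f q" for q t
    using g[OF that(1)] that inj_onD[OF lin_isoD(4)[OF th, of c]] by metis
  have add: "g (p + q) = g p + g q" if pq: "p \<in> polys d" "q \<in> polys d" for p q
    by (rule geq[OF kv.subspace_add[OF polys_subspace pq]
          kv.subspace_add[OF Om_subspace g(1)[OF pq(1)] g(1)[OF pq(2)]]])
      (simp add: lin_isoD(2)[OF th g(1)[OF pq(1)] g(1)[OF pq(2)]] g(2) pq f(2))
  have lin: "g (r * q) = r * g q" if rq: "r \<in> carrier KR" "q \<in> polys d" for r q
    by (rule geq) (use rq g in \<open>auto simp: lin_isoD(3)[OF th] f(3) VR_times_Om polys_mult VR_simps(1)\<close>)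
  have "\<forall>i. i < n \<longrightarrow> (\<exists>h. \<forall>q\<in>polys d. (\<forall>m\<in>supp q. deg0 m mod n = i) \<longrightarrow> g q = q * h)"
    using linear_is_multiplication[OF lin] by blast
  then obtain h where h: "\<And>i q. i < n \<Longrightarrow> q \<in> polys d \<Longrightarrow> \<forall>m\<in>supp q. deg0 m mod n = i \<Longrightarrow> g q = q * h i"
    by metis
  have "h i \<in> Om c i" if i: "i < n" for i
  proof -
    let ?v = "Poly_Mapping.single 1 i"
    have v: "low ?v = ?v" "deg0 ?v = i" using d2 by (auto simp: low_id_iff deg0_single)
    have mp: "mon ?v \<in> (polys d :: 'k mpoly set)" using v(1) by (rule polys_mon)
    have "g (mon ?v) = mon ?v * h i" using i v mp by (intro h) auto
    then have "mon ?v * h i \<in> Om c 0" using g(1)[OF mp] by simp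
    then show ?thesis by (rule Om_divide[OF _ v])
  qed
  then have hHF: "h \<in> mult_fams c" by (simp add: mult_fams_def)
  have "g (0 + 0) = g 0 + g 0" by (rule add) simp_all
  then have g0: "g 0 = 0" by (metis add_0 add_cancel_right_right)
  have gsum: "g (\<Sum>i\<in>A. x i) = (\<Sum>i\<in>A. g (x i))" if "finite A" "\<And>i. i \<in> A \<Longrightarrow> x i \<in> polys d" for A and x :: "nat \<Rightarrow> 'k mpoly"
    using that
  proof (induction A)
    case (insert a A)
    have "(\<Sum>i\<in>A. x i) \<in> polys d" using insert.prems by (intro kv.subspace_sum[OF polys_subspace]) auto
    then show ?case using insert by (simp add: add)
  qed (simp add: g0)
  have "g q = apply_fam h q" if q: "q \<in> polys d" for q
  proof -
    have "g q = g (\<Sum>i<n. summand i q)" by (simp add: summand_sum_all)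
    also have "\<dots> = (\<Sum>i<n. g (summand i q))" by (rule gsum) (auto simp: summand_polys q)
    also have "\<dots> = apply_fam h q" unfolding apply_fam_def
      by (rule sum.cong) (auto intro!: h summand_polys q simp: summand_deg)
    finally show ?thesis .
  qed
  then have "f = fam_map c h"
    using g f(4) by (intro extensionalityI[of _ "polys d"]) (auto simp: fam_map_def KS_simps)
  then show ?thesis using hHF by blast
qed

lemma hdiff_fam_map:
  assumes "h \<in> mult_fams c" "g \<in> mult_fams c"
  shows "hdiff KS (syz T c) (fam_map c h) (fam_map c g) = fam_map c (\<lambda>i. h i - g i)" "(\<lambda>i. h i - g i) \<in> mult_fams c"
proof -
  interpret Y: Module.module KR "syz T c" by (rule sm)
  show hg: "(\<lambda>i. h i - g i) \<in> mult_fams c" using assms by (auto simp: mult_fams_def intro!: kv.subspace_diff[OF Om_subspace])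
  show "hdiff KS (syz T c) (fam_map c h) (fam_map c g) = fam_map c (\<lambda>i. h i - g i)"
    unfolding hdiff_def fam_map_def
  proof (rule restrict_ext)
    fix q assume q: "q \<in> carrier KS"
    then have q': "q \<in> polys d" by (simp add: KS_simps)
    have "\<theta> c (apply_fam (\<lambda>i. h i - g i) q) \<oplus>\<^bsub>syz T c\<^esub> \<theta> c (apply_fam g q) = \<theta> c (apply_fam (\<lambda>i. h i - g i) q + apply_fam g q)"
      using lin_isoD(2)[OF th apply_fam_Om[OF hg q'] apply_fam_Om[OF assms(2) q']] by simp
    then have "\<theta> c (apply_fam (\<lambda>i. h i - g i) q) \<oplus>\<^bsub>syz T c\<^esub> \<theta> c (apply_fam g q) = \<theta> c (apply_fam h q)"
      by (simp add: apply_fam_diff_fun)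
    then show "(\<lambda>q\<in>carrier KS. \<theta> c (apply_fam h q)) q \<ominus>\<^bsub>syz T c\<^esub> (\<lambda>q\<in>carrier KS. \<theta> c (apply_fam g q)) q
        = \<theta> c (apply_fam (\<lambda>i. h i - g i) q)"
      using Y.M.minus_unique lin_isoD(1)[OF th apply_fam_Om[OF hg q']] lin_isoD(1)[OF th apply_fam_Om[OF assms(2) q']] q by simp
  qed
qed

text \<open>The index \<open>0\<close> is exempt: maps from \<open>M\<^sub>0 = R\<close> always factor through
  a projective.\<close>
definition in_radical :: "nat \<Rightarrow> (nat \<Rightarrow> 'k mpoly) \<Rightarrow> bool"
  where "in_radical c h \<longleftrightarrow> (\<forall>i. 1 \<le> i \<and> i < n \<longrightarrow> (\<forall>m\<in>supp (h i). \<not> lowdeg c (deg0 m + i)))"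

text \<open>A map from \<open>M\<^sub>i\<close> with \<open>i \<noteq> 0\<close> to a free module is
  multiplication by a polynomial in each coordinate, so the coordinates of the image of
  \<open>x\<^sub>1\<^sup>i\<close> are multiples of \<open>x\<^sub>1\<^sup>i\<close> and have no
  constant term. A map from the free module therefore takes this image to the radical of
  \<open>\<Omega>\<^sup>cS\<close>.\<close>
lemma factors_in_radical:
  assumes "h \<in> mult_fams c" "fam_map c h \<in> FP c" shows "in_radical c h"
  unfolding in_radical_def
proof (intro allI impI ballI)
  fix i m assume i: "1 \<le> i \<and> i < n" and m: "m \<in> supp (h i)"
  let ?v = "Poly_Mapping.single 1 i"
  have v: "low ?v = ?v" "deg0 ?v = i" using d2 by (auto simp: low_id_iff deg0_single)
  let ?q = "mon ?v :: 'k mpoly"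
  have q: "?q \<in> polys d" "\<forall>m\<in>supp ?q. deg0 m mod n = i" using v i by (auto simp: polys_mon)
  obtain Q :: "('k mpoly, nat \<Rightarrow> 'k mpoly) module" and u v' where Q: "projective KR Q" "u \<in> mod_hom KR KS Q"
    "v' \<in> mod_hom KR Q (syz T c)" "\<forall>x\<in>carrier KS. fam_map c h x = v' (u x)"
    using assms(2) unfolding factors_through_projective_def by blast
  obtain J :: "(nat \<Rightarrow> 'k mpoly) set" and s r where J: "Module.module KR Q" "s \<in> mod_hom KR Q (free_module KR J)"
    "r \<in> mod_hom KR (free_module KR J) Q" "\<forall>x\<in>carrier Q. r (s x) = x"
    using Q(1) unfolding projective_def by blast
  let ?F = "free_module KR J"
  have cr: "cring KR" by (rule VR_cring)
  note Fm = free_module_module[OF cr, of J]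
  define y where "y q = s (u q)" for q
  have yF: "y q \<in> carrier ?F" if "q \<in> polys d" for q
    using mod_homD(1)[OF J(2)] mod_homD(1)[OF Q(2)] that by (simp add: y_def KS_simps)
  have ylin: "y (r * q) = r \<odot>\<^bsub>?F\<^esub> y q" if "r \<in> carrier KR" "q \<in> polys d" for r q
    using mod_homD(3)[OF Q(2), of r q] mod_homD(3)[OF J(2), of r "u q"] mod_homD(1)[OF Q(2), of q] that
    by (simp add: y_def KS_simps)
  have ydeg: "0 < deg0 l" if l: "l \<in> supp (y ?q x)" for x l
  proof -
    have "\<exists>k. \<forall>q\<in>polys d. (\<forall>m\<in>supp q. deg0 m mod n = i) \<longrightarrow> y q x = q * k"
      by (rule linear_is_multiplication) (use ylin i in \<open>auto simp: free_module_simps(4) VR_simps(3)\<close>)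
    then obtain k where "y ?q x = ?q * k" using q by blast
    then show ?thesis using l v i by (auto simp: supp_mon_times)
  qed
  define V where "V = compose (carrier ?F) v' r"
  have V: "V \<in> mod_hom KR ?F (syz T c)" unfolding V_def by (rule mod_hom_compose[OF Fm J(3) Q(3)])
  interpret F: Module.module KR ?F by (rule Fm)
  have "(\<forall>x\<in>J. \<forall>l\<in>supp (y ?q x). 0 < deg0 l) \<longrightarrow> V (y ?q) \<in> \<theta> c ` Rad c"
  proof (rule free_module_induct[where P = "\<lambda>f. (\<forall>x\<in>J. \<forall>l\<in>supp (f x). 0 < deg0 l) \<longrightarrow> V f \<in> \<theta> c ` Rad c", OF cr yF[OF q(1)]])
    have "0 \<in> (Rad c :: 'k mpoly set)" by (rule kv.subspace_0[OF Rad_subspace])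
    then show "(\<forall>x\<in>J. \<forall>l\<in>supp (\<zero>\<^bsub>?F\<^esub> x). 0 < deg0 l) \<longrightarrow> V \<zero>\<^bsub>?F\<^esub> \<in> \<theta> c ` Rad c"
      using mod_hom_zero[OF Fm sm(1) V] lin_iso_zero[OF th sm(1) kv.subspace_0[OF Om_subspace]] by (metis imageI)
    fix f x assume f: "f \<in> carrier ?F" "x \<in> J" "f x \<in> carrier KR" "f(x := \<zero>\<^bsub>KR\<^esub>) \<in> carrier ?F"
      and IH: "(\<forall>z\<in>J. \<forall>l\<in>supp ((f(x := \<zero>\<^bsub>KR\<^esub>)) z). 0 < deg0 l) \<longrightarrow> V (f(x := \<zero>\<^bsub>KR\<^esub>)) \<in> \<theta> c ` Rad c"
      and eq: "f = f(x := \<zero>\<^bsub>KR\<^esub>) \<oplus>\<^bsub>?F\<^esub> (f x \<odot>\<^bsub>?F\<^esub> unitf KR x)"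
    note un = unitf_free[OF cr f(2)]
    have Vf: "V f = V (f(x := \<zero>\<^bsub>KR\<^esub>)) \<oplus>\<^bsub>syz T c\<^esub> f x \<odot>\<^bsub>syz T c\<^esub> V (unitf KR x)"
      using arg_cong[OF eq, of V]
      by (simp only: mod_homD(2)[OF V f(4) F.smult_closed[OF f(3) un]] mod_homD(3)[OF V f(3) un])
    show "(\<forall>x\<in>J. \<forall>l\<in>supp (f x). 0 < deg0 l) \<longrightarrow> V f \<in> \<theta> c ` Rad c"
    proof
      assume pos: "\<forall>x\<in>J. \<forall>l\<in>supp (f x). 0 < deg0 l"
      then have "\<forall>z\<in>J. \<forall>l\<in>supp ((f(x := \<zero>\<^bsub>KR\<^esub>)) z). 0 < deg0 l" by (auto simp: VR_simps(4))
      then obtain t1 where t1: "t1 \<in> Rad c" "V (f(x := \<zero>\<^bsub>KR\<^esub>)) = \<theta> c t1" using IH by blast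
      obtain t where t: "t \<in> Om c 0" "V (unitf KR x) = \<theta> c t"
        using surj_preimage[OF lin_isoD(5)[OF th] mod_homD(1)[OF V un]] by metis
      have ft: "f x * t \<in> Rad c" using pos f(2) by (intro Rad_mult f(3) t(1)) blast
      have "V f = \<theta> c (t1 + f x * t)"
        using t1 t ft lin_isoD(3)[OF th f(3) t(1)] lin_isoD(2)[OF th, of t1 c "f x * t"]
        unfolding Vf by (simp add: Rad_def)
      then show "V f \<in> \<theta> c ` Rad c" using kv.subspace_add[OF Rad_subspace t1(1) ft] by blast
    qed
  qed
  then have "V (y ?q) \<in> \<theta> c ` Rad c" using ydeg by blast
  then obtain t where t: "t \<in> Rad c" "V (y ?q) = \<theta> c t" by blast
  have "V (y ?q) = v' (u ?q)"
    using yF[OF q(1)] J(4) mod_homD(1)[OF Q(2), of ?q] q(1) by (simp add: V_def compose_def y_def KS_simps)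
  also have "\<dots> = fam_map c h ?q" using Q(4) q(1) by (simp add: KS_simps)
  also have "\<dots> = \<theta> c (?q * h i)"
    using q(1) i apply_fam_homogeneous[OF q(2), of h] by (simp add: fam_map_def KS_simps)
  finally have "\<theta> c t = \<theta> c (?q * h i)" using t(2) by simp
  moreover have "?q * h i \<in> Om c 0"
    by (rule Om_mult_homogeneous[OF q]) (use assms(1) i in \<open>simp add: mult_fams_def\<close>)
  ultimately have "?q * h i \<in> Rad c" using t(1) inj_onD[OF lin_isoD(4)[OF th, of c]] by (metis (no_types, lifting) Rad_def mem_Collect_eq)
  moreover have "?v + m \<in> supp (?q * h i)" using m by (simp add: supp_mon_times)
  ultimately have "\<not> lowdeg c (deg0 (?v + m))" unfolding Rad_def by blast
  then show "\<not> lowdeg c (deg0 m + i)" using v(2) by (simp add: add.commute)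
qed

text \<open>The combinations for all summands \<open>M\<^sub>i\<close> are joined into one list, whose entries
  are the coordinates of a free module.\<close>
lemma combination_factors:
  assumes ys: "\<And>i. i < n \<Longrightarrow> combination c i (ys i) (h i)" and h: "h \<in> mult_fams c"
  shows "fam_map c h \<in> FP c"
proof -
  define zs where "zs = concat (map (\<lambda>i. map (\<lambda>(a, w). (i, a, w)) (ys i)) [0..<n])"
  define m where "m = length zs"
  have sum_zs: "apply_fam h q = (\<Sum>(i, a, w)\<leftarrow>zs. (summand i q * a) * w)" for q
  proof -
    have "(\<Sum>(i, a, w)\<leftarrow>concat (map (\<lambda>i. map (\<lambda>(a, w). (i, a, w)) (ys i)) L). (summand i q * a) * w)
        = (\<Sum>i\<leftarrow>L. \<Sum>(a, w)\<leftarrow>ys i. (summand i q * a) * w)" for L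
      by (induction L) (simp_all add: comp_def case_prod_beta)
    then have "(\<Sum>(i, a, w)\<leftarrow>zs. (summand i q * a) * w) = (\<Sum>i\<leftarrow>[0..<n]. \<Sum>(a, w)\<leftarrow>ys i. (summand i q * a) * w)"
      unfolding zs_def .
    also have "\<dots> = (\<Sum>i\<leftarrow>[0..<n]. summand i q * h i)"
    proof (rule arg_cong[of _ _ sum_list], rule map_cong[OF refl])
      fix i assume "i \<in> set [0..<n]"
      then have hi: "h i = (\<Sum>(a, w)\<leftarrow>ys i. a * w)" using ys[of i] by (simp add: combination_def)
      show "(\<Sum>(a, w)\<leftarrow>ys i. (summand i q * a) * w) = summand i q * h i"
        by (simp only: hi split_def mult.assoc sum_list_const_mult)
    qed
    also have "\<dots> = apply_fam h q" by (simp add: apply_fam_def sum_list_distinct_conv_sum_set atLeast0LessThan)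
    finally show ?thesis by simp
  qed
  have zsp: "i < n \<and> a \<in> polys d \<and> (\<forall>m\<in>supp a. n dvd deg0 m + i) \<and> w \<in> Om c 0" if "(i, a, w) \<in> set zs" for i a w
  proof -
    have 1: "i < n" "(a, w) \<in> set (ys i)" using that by (auto simp: zs_def)
    show ?thesis using bspec[OF conjunct2[OF ys[OF 1(1), unfolded combination_def]] 1(2)] 1(1) by simp
  qed
  let ?F = "free_module KR {..<m}"
  have cr: "cring KR" by (rule VR_cring)
  note Fm = free_module_module[OF cr, of "{..<m}"]
  interpret F: Module.module KR ?F by (rule Fm)
  define e where "e j q = (case zs ! j of (i, a, w) \<Rightarrow> summand i q * a)" for j and q :: "'k mpoly"
  define wf where "wf j = (case zs ! j of (i, a, w) \<Rightarrow> w)" for j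
  have nth: "zs ! j \<in> set zs" if "j < m" for j using that by (simp add: m_def)
  have wZ: "wf j \<in> Om c 0" if "j < m" for j
  proof -
    obtain i a w where z: "zs ! j = (i, a, w)" by (cases "zs ! j")
    then show ?thesis using zsp[of i a w] nth[OF that] by (simp add: wf_def)
  qed
  have eR: "e j q \<in> carrier KR" if j: "j < m" and q: "q \<in> polys d" for j q
  proof -
    obtain i a w where z: "zs ! j = (i, a, w)" by (cases "zs ! j")
    have h: "i < n" "a \<in> polys d" "\<forall>m\<in>supp a. n dvd deg0 m + i" using zsp nth[OF j] z by auto
    have "n dvd deg0 k" if k: "k \<in> supp (summand i q * a)" for k
    proof -
      obtain x l where xl: "x \<in> supp (summand i q)" "l \<in> supp a" "k = x + l" using keys_mult[of "summand i q" a] k by blast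
      have "(deg0 x + deg0 l) mod n = (deg0 l + deg0 x mod n) mod n" by (simp add: mod_simps add.commute)
      also have "\<dots> = 0" using h(3) xl(2) summand_deg[OF xl(1)] by (simp add: dvd_eq_mod_eq_0)
      finally show ?thesis using xl(3) by (simp add: dvd_eq_mod_eq_0)
    qed
    then show ?thesis using polys_mult[OF summand_polys[OF q] h(2)] by (simp add: e_def z VR_simps)
  qed
  have sum_zs': "apply_fam h q = (\<Sum>j<m. e j q * wf j)" for q
    unfolding sum_zs m_def by (simp add: sum_list_sum_nth atLeast0LessThan e_def wf_def case_prod_beta)
  define u where "u = (\<lambda>q\<in>carrier KS. \<lambda>j. if j < m then e j q else 0)"
  define v where "v = (\<lambda>f\<in>carrier ?F. \<theta> c (\<Sum>j<m. f j * wf j))"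
  have uF: "(\<lambda>j. if j < m then e j q else 0) \<in> carrier ?F" if "q \<in> polys d" for q
  proof -
    have "finite {j. (if j < m then e j q else 0) \<noteq> 0}" by (rule finite_subset[of _ "{..<m}"]) auto
    then show ?thesis using eR[OF _ that] by (auto simp: free_module_simps(1) VR_simps(4))
  qed
  have u: "u \<in> mod_hom KR KS ?F"
    unfolding u_def
    by (rule mod_hom_restrictI[OF KS_module])
      (auto simp: KS_simps uF free_module_simps(3,4) VR_simps(2,3) e_def summand_add summand_VR_mult algebra_simps split: prod.splits)
  have sumZ: "(\<Sum>j<m. f j * wf j) \<in> Om c 0" if "f \<in> carrier ?F" for f
    using free_module_in_R[OF cr that] wZ by (intro kv.subspace_sum[OF Om_subspace] VR_times_Om) auto
  have v: "v \<in> mod_hom KR ?F (syz T c)"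
    unfolding v_def
  proof (rule mod_hom_restrictI[OF Fm])
    show "\<theta> c (\<Sum>j<m. f j * wf j) \<in> carrier (syz T c)" if "f \<in> carrier ?F" for f
      by (rule lin_isoD(1)[OF th sumZ[OF that]])
    show "\<theta> c (\<Sum>j<m. (f \<oplus>\<^bsub>?F\<^esub> g) j * wf j) = \<theta> c (\<Sum>j<m. f j * wf j) \<oplus>\<^bsub>syz T c\<^esub> \<theta> c (\<Sum>j<m. g j * wf j)"
      if "f \<in> carrier ?F" "g \<in> carrier ?F" for f g
      unfolding lin_isoD(2)[OF th sumZ[OF that(1)] sumZ[OF that(2)], symmetric]
      by (simp add: free_module_simps(3) VR_simps(2) algebra_simps sum.distrib)
    show "\<theta> c (\<Sum>j<m. (r \<odot>\<^bsub>?F\<^esub> f) j * wf j) = r \<odot>\<^bsub>syz T c\<^esub> \<theta> c (\<Sum>j<m. f j * wf j)"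
      if "r \<in> carrier KR" "f \<in> carrier ?F" for r f
      unfolding lin_isoD(3)[OF th that(1) sumZ[OF that(2)], symmetric]
      by (simp add: free_module_simps(4) VR_simps(3) sum_distrib_left mult.assoc)
  qed
  show ?thesis
  proof (rule factors_free[OF cr VR_one_neq fam_map_hom[OF h] u v])
    fix q assume q: "q \<in> carrier KS"
    then have "v (u q) = \<theta> c (\<Sum>j<m. e j q * wf j)"
      using uF[of q] by (simp add: u_def v_def KS_simps)
    then show "fam_map c h q = v (u q)" using q by (simp add: fam_map_def sum_zs')
  qed
qed

text \<open>For \<open>i \<noteq> 0\<close> the part of lowest degree in the decomposition of the multiplier
  vanishes, and what remains is a combination of \<open>Rad_gens\<close>. For \<open>i = 0\<close>
  the multiplier itself is an element of the syzygy, with coefficient \<open>1 \<in> R\<close>.\<close>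
lemma in_radical_factors:
  assumes "h \<in> mult_fams c" "in_radical c h" shows "fam_map c h \<in> FP c"
proof -
  have "\<exists>ys. combination c i ys (h i)" if i: "i < n" for i
  proof (cases "i = 0")
    case True
    have "combination c i [(1, h i)] (h i)" using assms(1) i True by (simp add: combination_def mult_fams_def)
    then show ?thesis by blast
  next
    case False
    have hi: "h i \<in> Om c i" using assms(1) i by (simp add: mult_fams_def)
    obtain g e where ge: "h i = g + e" "g \<in> Gens c i" "e \<in> kv.span (Rad_gens c i)" using Om_split[OF hi i] .
    have "m \<notin> supp g" for m
    proof
      assume m: "m \<in> supp g"
      then have l: "lowdeg c (deg0 m + i)" using ge(2) by (simp add: Gens_def)
      then have "m \<notin> supp e" using Rad_gens_in_radical[OF ge(3)] by blast
      then have "m \<in> supp (h i)" using m by (simp add: ge(1) in_keys_iff lookup_add)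
      then show False using assms(2) i False l by (simp add: in_radical_def)
    qed
    then have "g = 0" by (metis all_not_in_conv keys_eq_empty)
    then show ?thesis using combination_ex[OF ge(3)] ge(1) by simp
  qed
  then have "\<exists>ys. \<forall>i. i < n \<longrightarrow> combination c i (ys i) (h i)" by metis
  then show ?thesis using combination_factors[OF _ assms(1)] by blast
qed

lemma FP_iff: "h \<in> mult_fams c \<Longrightarrow> fam_map c h \<in> FP c \<longleftrightarrow> in_radical c h"
  using factors_in_radical in_radical_factors by blast

text \<open>The criterion \<open>in_radical\<close> is closed under sums and negation.\<close>
lemma FP_additive: "additive_subgroup (FP c) (hom_module KR KS (syz T c))"
proof -
  let ?H = "hom_module KR KS (syz T c)"
  interpret Y: Module.module KR "syz T c" by (rule sm)
  interpret H: abelian_group ?H by (rule hom_module_abelian_group[OF KS_module sm(1)])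
  have Hs: "carrier ?H = hom c" "f \<oplus>\<^bsub>?H\<^esub> g = (\<lambda>x\<in>carrier KS. f x \<oplus>\<^bsub>syz T c\<^esub> g x)" for f g
    by (simp_all add: hom_module_def)
  have add: "fam_map c h \<oplus>\<^bsub>?H\<^esub> fam_map c g = fam_map c (\<lambda>i. h i + g i)" if "h \<in> mult_fams c" "g \<in> mult_fams c" for h g
    unfolding Hs fam_map_def
    by (rule restrict_ext)
      (simp add: KS_simps lin_isoD(2)[OF th apply_fam_Om[OF that(1)] apply_fam_Om[OF that(2)], symmetric],
        simp add: apply_fam_def algebra_simps sum.distrib)
  have rep: "\<exists>h\<in>mult_fams c. f = fam_map c h \<and> in_radical c h" if "f \<in> FP c" for f
    using hom_fam_map[OF factors_hom[OF that]] that FP_iff by blast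
  have HFadd: "(\<lambda>i. h i + g i) \<in> mult_fams c" if "h \<in> mult_fams c" "g \<in> mult_fams c" for h g
    using that by (auto simp: mult_fams_def intro!: kv.subspace_add[OF Om_subspace])
  have HFneg: "(\<lambda>i. - h i) \<in> mult_fams c" if "h \<in> mult_fams c" for h
    using that by (auto simp: mult_fams_def intro!: kv.subspace_neg[OF Om_subspace])
  have zero: "fam_map c (\<lambda>i. 0) = \<zero>\<^bsub>?H\<^esub>"
    using lin_iso_zero[OF th sm(1) kv.subspace_0[OF Om_subspace]]
    by (auto simp: fam_map_def apply_fam_def hom_module_def intro!: restrict_ext)
  show ?thesis
  proof (rule additive_subgroupI, rule group.subgroupI)
    show "group (add_monoid ?H)" by (rule H.a_group)
    show "FP c \<subseteq> carrier (add_monoid ?H)" using factors_hom by (auto simp: Hs)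
    have "(\<lambda>i. 0) \<in> mult_fams c" by (simp add: mult_fams_def kv.subspace_0[OF Om_subspace])
    then have "fam_map c (\<lambda>i. 0) \<in> FP c" by (rule in_radical_factors) (simp add: in_radical_def)
    then show "FP c \<noteq> {}" by blast
    show "inv\<^bsub>add_monoid ?H\<^esub> f \<in> FP c" if f: "f \<in> FP c" for f
    proof -
      obtain h where h: "h \<in> mult_fams c" "f = fam_map c h" "in_radical c h" using rep[OF f] by blast
      have "fam_map c (\<lambda>i. - h i) \<oplus>\<^bsub>?H\<^esub> f = \<zero>\<^bsub>?H\<^esub>" using add[OF HFneg[OF h(1)] h(1)] zero h(2) by simp
      then have "\<ominus>\<^bsub>?H\<^esub> f = fam_map c (\<lambda>i. - h i)"
        by (rule H.minus_equality) (use fam_map_hom HFneg h in \<open>auto simp: Hs\<close>)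
      moreover have "fam_map c (\<lambda>i. - h i) \<in> FP c"
        by (rule in_radical_factors[OF HFneg[OF h(1)]]) (use h(3) in \<open>simp add: in_radical_def\<close>)
      ultimately show ?thesis by (simp add: a_inv_def)
    qed
    show "f \<otimes>\<^bsub>add_monoid ?H\<^esub> g \<in> FP c" if f: "f \<in> FP c" and g: "g \<in> FP c" for f g
    proof -
      obtain h where h: "h \<in> mult_fams c" "f = fam_map c h" "in_radical c h" using rep[OF f] by blast
      obtain k where k: "k \<in> mult_fams c" "g = fam_map c k" "in_radical c k" using rep[OF g] by blast
      have "in_radical c (\<lambda>i. h i + k i)"
        unfolding in_radical_def
      proof (intro allI impI ballI)
        fix i m assume i: "1 \<le> i \<and> i < n" and m: "m \<in> supp (h i + k i)"
        have "m \<in> supp (h i) \<or> m \<in> supp (k i)" using subsetD[OF keys_add m] by simp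
        then show "\<not> lowdeg c (deg0 m + i)" using h(3) k(3) i by (auto simp only: in_radical_def)
      qed
      then have "fam_map c (\<lambda>i. h i + k i) \<in> FP c" by (rule in_radical_factors[OF HFadd[OF h(1) k(1)]])
      then show ?thesis using add[OF h(1) k(1)] h(2) k(2) by simp
    qed
  qed
qed

lemma stable_pair: "stable_pair KR KS (syz T c)"
  by (intro stable_pair.intro KS_module sm FP_additive)

text \<open>Families with multipliers of lowest degree for \<open>i \<noteq> 0\<close> and zero at \<open>i =
  0\<close>: each stable class contains exactly one of them.\<close>
definition gen_fams :: "nat \<Rightarrow> (nat \<Rightarrow> 'k mpoly) set"
  where "gen_fams c = {h. \<forall>i. if 1 \<le> i \<and> i < n then h i \<in> Gens c i else h i = 0}"

lemma gen_fams_mult_fams: "h \<in> gen_fams c \<Longrightarrow> h \<in> mult_fams c"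
  unfolding gen_fams_def mult_fams_def
  by (auto split: if_splits intro: Gens_Om simp: kv.subspace_0[OF Om_subspace])

abbreviation cls :: "nat \<Rightarrow> ('k mpoly \<Rightarrow> 'b) \<Rightarrow> ('k mpoly \<Rightarrow> 'b) set"
  where "cls c \<equiv> stable_class KR KS (syz T c)"

lemma cls_fam_map_eq:
  assumes "h \<in> mult_fams c" "g \<in> mult_fams c"
  shows "cls c (fam_map c h) = cls c (fam_map c g) \<longleftrightarrow> in_radical c (\<lambda>i. h i - g i)"
  using stable_pair.cls_eq[OF stable_pair fam_map_hom[OF assms(1)] fam_map_hom[OF assms(2)]]
    hdiff_fam_map[OF assms] FP_iff by simp

lemma cls_fam_map_inj:
  assumes "h \<in> gen_fams c" "g \<in> gen_fams c" "cls c (fam_map c h) = cls c (fam_map c g)" shows "h = g"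
proof
  fix i
  have nl: "in_radical c (\<lambda>i. h i - g i)" using cls_fam_map_eq[OF assms(1,2)[THEN gen_fams_mult_fams]] assms(3) by simp
  show "h i = g i"
  proof (cases "1 \<le> i \<and> i < n")
    case True
    then have "h i - g i \<in> Gens c i"
      using assms(1,2) by (intro kv.subspace_diff[OF Gens_subspace]) (auto simp: gen_fams_def)
    then have "supp (h i - g i) = {}" using nl True unfolding in_radical_def Gens_def by blast
    then show ?thesis by simp
  next
    case False
    then have "h i = 0 \<and> g i = 0" using assms(1,2) unfolding gen_fams_def mem_Collect_eq by meson
    then show ?thesis by simp
  qed
qed

lemma stable_hom_fam_map:
  assumes "A \<in> carrier (stable_hom KR KS (syz T c))" shows "\<exists>h\<in>gen_fams c. A = cls c (fam_map c h)"
proof -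
  obtain f where f: "f \<in> hom c" "A = cls c f" using stable_pair.SH_rep[OF stable_pair assms] by blast
  obtain h where h: "h \<in> mult_fams c" "f = fam_map c h" using hom_fam_map[OF f(1)] by blast
  have "\<exists>g. g \<in> Gens c i \<and> h i - g \<in> kv.span (Rad_gens c i)" if i: "i < n" for i
  proof -
    have "h i \<in> Om c i" using h(1) i by (simp add: mult_fams_def)
    then obtain g e where "h i = g + e" "g \<in> Gens c i" "e \<in> kv.span (Rad_gens c i)" using Om_split[OF _ i] by blast
    then show ?thesis by (intro exI[of _ g]) simp
  qed
  then obtain g where g: "\<And>i. i < n \<Longrightarrow> g i \<in> Gens c i \<and> h i - g i \<in> kv.span (Rad_gens c i)" by metis
  define k where "k i = (if 1 \<le> i \<and> i < n then g i else 0)" for i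
  have k: "k \<in> gen_fams c" using g by (simp add: gen_fams_def k_def)
  have "in_radical c (\<lambda>i. h i - k i)"
    using g Rad_gens_in_radical by (simp add: in_radical_def k_def) blast
  then have "cls c (fam_map c h) = cls c (fam_map c k)" using cls_fam_map_eq[OF h(1) gen_fams_mult_fams[OF k]] by simp
  then show ?thesis using k f(2) h(2) by blast
qed

section \<open>Products of stable maps\<close>

lemma mult_last_mult:
  assumes "q \<in> polys d" "\<forall>m\<in>supp q. deg0 m mod n = i mod n"
  shows "mult_last c 0 g (q * t) = q * mult_last c i g t"
proof -
  have "part (\<lambda>m. tgt c 0 m = v) (q * t) = q * part (\<lambda>m. tgt c i m = v) t" for v
  proof (rule part_times_shift)
    fix l m assume l: "l \<in> supp q"
    then have l1: "low l = l" "deg0 l mod n = i mod n" using assms by (auto simp: polys_low)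
    have "(deg0 l + deg0 m) mod n = (deg0 m + i) mod n" using l1(2) by (metis add.commute mod_add_right_eq)
    then show "tgt c 0 (l + m) = v \<longleftrightarrow> tgt c i m = v"
      by (simp add: tgt_def pos_deg_low[OF l1(1)])
  qed
  then show ?thesis by (simp add: mult_last_def sum_distrib_left mult.assoc)
qed

lemma mult_last_shift: "low u = u \<Longrightarrow> mult_last (Suc c) 0 g (mon u * shift w) = mon u * shift (mult_last c 0 g w)"
proof -
  assume u: "low u = u"
  have "part (\<lambda>m. tgt (Suc c) 0 m = v) (mon u * shift w) = mon u * part (\<lambda>m. tgt (Suc c) 0 m = v) (shift w)" for v
    by (rule part_times_shift) (auto simp: tgt_def high_add high_of_low u)
  moreover have "part (\<lambda>m. tgt (Suc c) 0 m = v) (shift w) = shift (part (\<lambda>m. tgt c 0 m = v) w)" for v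
    by (simp add: shift_part tgt_def)
  ultimately show ?thesis
    by (simp add: mult_last_def shift_def lin_sum sum_distrib_left flip: shift_mult)
      (simp add: shift_mult mult.assoc flip: shift_def)
qed

lemma mult_last_Cov_decomp: "mult_last (Suc c) 0 g t = (\<Sum>u\<in>low ` supp t. mon u * shift (mult_last c 0 g (slice u t)))"
  by (subst slice_decomp[of t], subst mult_last_sum) (auto intro!: sum.cong mult_last_shift)

text \<open>The two operations concern different positions, except on terms where position \<open>1\<close> is
  the last one; there merging adds the degree at position \<open>0\<close>, a multiple of
  \<open>n\<close>, and the target vertex does not change.\<close>
lemma merge_mult_last:
  assumes t: "t \<in> Cov c 0" shows "merge (mult_last (Suc c) 0 g t) = mult_last c 0 g (merge t)"
proof -
  have u: "low u = u \<and> n dvd deg0 u" if "u \<in> low ` supp t" for u using t that by (auto simp: Cov_def)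
  have mgt: "merge t = (\<Sum>u\<in>low ` supp t. mon u * slice u t)"
    by (subst slice_decomp[of t]) (auto simp: merge_sum merge_mult merge_polys polys_mon intro!: sum.cong)
  have "merge (mult_last (Suc c) 0 g t) = (\<Sum>u\<in>low ` supp t. merge (mon u * shift (mult_last c 0 g (slice u t))))"
    by (simp only: mult_last_Cov_decomp merge_sum)
  also have "\<dots> = (\<Sum>u\<in>low ` supp t. mult_last c 0 g (mon u * slice u t))"
  proof (rule sum.cong[OF refl])
    fix v assume "v \<in> low ` supp t"
    then have v: "low v = v" "n dvd deg0 v" using u by blast+
    have "mult_last c 0 g (mon v * slice v t) = mon v * mult_last c 0 g (slice v t)"
      by (rule mult_last_mult) (use v in \<open>auto simp: polys_mon\<close>)
    then show "merge (mon v * shift (mult_last c 0 g (slice v t))) = mult_last c 0 g (mon v * slice v t)"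
      using v by (simp add: merge_mult merge_polys polys_mon)
  qed
  also have "\<dots> = mult_last c 0 g (merge t)" by (simp only: mgt mult_last_sum)
  finally show ?thesis .
qed

text \<open>For \<open>c = 0\<close> this says that \<open>g\<close> gives a map from \<open>S\<close> to
  \<open>\<Omega>\<^bsup>c'\<^esup>S\<close> that takes \<open>W\<^sub>0\<close> to
  \<open>W\<^bsub>c'\<^esub>\<close>, because an element of degree \<open>v < n\<close> meets the
  multiplier \<open>g v\<close> only. Higher positions follow slice by slice.\<close>
lemma mult_last_model:
  assumes g: "g \<in> gen_fams c'"
  shows "(\<forall>t\<in>Om c 0. mult_last c 0 g t \<in> Om (c + c') 0) \<and> (\<forall>t\<in>Gens c 0. mult_last c 0 g t \<in> Gens (c + c') 0)"
proof (induction c)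
  case 0
  have gH: "g \<in> mult_fams c'" by (rule gen_fams_mult_fams[OF g])
  have eq: "mult_last 0 0 g t = apply_fam g t" for t by (simp add: mult_last_def apply_fam_def summand_def tgt_def)
  have "apply_fam g t \<in> Gens c' 0" if t: "t \<in> Gens 0 0" for t
    unfolding apply_fam_def
  proof (rule kv.subspace_sum[OF Gens_subspace])
    fix v assume v: "v \<in> {..<n}"
    have top_index: "t \<in> polys d" using t by (simp add: Gens_def)
    have pz: "summand v t * g v \<in> Om c' 0"
      using gH v by (intro Om_mult_homogeneous[OF summand_polys[OF top_index]]) (auto simp: mult_fams_def summand_deg)
    have "lowdeg c' (deg0 m)" if m: "m \<in> supp (summand v t * g v)" for m
    proof -
      obtain a b where ab: "a \<in> supp (summand v t)" "b \<in> supp (g v)" "m = a + b"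
        using keys_mult[of "summand v t" "g v"] m by blast
      have "a \<in> supp t" "deg0 a mod n = v" using ab(1) by (auto simp: summand_def supp_part)
      then have "deg0 a = v" using t by (auto simp: Gens_def lowdeg_def)
      moreover have "g v \<noteq> 0" using ab(2) by auto
      then have "g v \<in> Gens c' v" using g unfolding gen_fams_def mem_Collect_eq by meson
      ultimately show ?thesis using ab(2,3) by (simp add: Gens_def add.commute)
    qed
    then show "summand v t * g v \<in> Gens c' 0" using pz by (simp add: Gens_def)
  qed
  then show ?case using apply_fam_Om[OF gH] by (simp add: eq)
next
  case (Suc c)
  have Cov: "mult_last (Suc c) 0 g t \<in> Cov (c + c') 0" if t: "t \<in> Cov c 0" for t
    unfolding mult_last_Cov_decomp
    using t Suc by (intro kv.subspace_sum[OF Cov_subspace] Cov_shift polys_mon) (auto simp: Cov_def)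
  have deg: "deg0 m \<in> deg0 ` supp t" if m: "m \<in> supp (mult_last (Suc c) 0 g t)" for m t
  proof -
    obtain u where u: "u \<in> low ` supp t" "m \<in> supp (mon u * shift (mult_last c 0 g (slice u t)))"
      using subsetD[OF keys_sum m[unfolded mult_last_Cov_decomp]] by blast
    then have "deg0 m = deg0 u" by (auto simp: supp_mon_times supp_shift)
    then show ?thesis using u(1) by auto
  qed
  show ?case
  proof (intro conjI ballI)
    show Om: "mult_last (Suc c) 0 g t \<in> Om (Suc c + c') 0" if "t \<in> Om (Suc c) 0" for t
      using that Cov[of t] merge_mult_last[of t c g] by (simp add: Om_Suc)
    show "mult_last (Suc c) 0 g t \<in> Gens (Suc c + c') 0" if t: "t \<in> Gens (Suc c) 0" for t
    proof -
      have "lowdeg (Suc c + c') (deg0 m + 0)" if "m \<in> supp (mult_last (Suc c) 0 g t)" for m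
        using deg[OF that] t by (auto simp: Gens_def lowdeg_def)
      then show ?thesis using Om[OF Gens_Om[OF t]] by (simp add: Gens_def)
    qed
  qed
qed

lemma mult_last_Cov:
  assumes g: "g \<in> gen_fams c'" and t: "t \<in> Cov c 0"
  shows "mult_last (Suc c) 0 g t \<in> Cov (c + c') 0" "merge (mult_last (Suc c) 0 g t) = mult_last c 0 g (merge t)"
proof -
  show "mult_last (Suc c) 0 g t \<in> Cov (c + c') 0"
    unfolding mult_last_Cov_decomp
    using t mult_last_model[OF g, of c] by (intro kv.subspace_sum[OF Cov_subspace] Cov_shift polys_mon) (auto simp: Cov_def)
  show "merge (mult_last (Suc c) 0 g t) = mult_last c 0 g (merge t)" by (rule merge_mult_last[OF t])
qed

lemma mult_last_VR: "r \<in> carrier KR \<Longrightarrow> mult_last c 0 g (r * t) = r * mult_last c 0 g t"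
  by (rule mult_last_mult) (auto simp: VR_simps)

text \<open>The lift to the covers is \<open>mult_last\<close> with one more position, and it commutes with
  the cover maps by \<open>merge_mult_last\<close>.\<close>
lemma syz_map_exists:
  assumes g: "g \<in> gen_fams c'"
  shows "\<exists>h. syz_map KR KS T i c' (fam_map c' g) h \<and> (\<forall>t\<in>Om i 0. h (\<theta> i t) = \<theta> (i + c') (mult_last i 0 g t))"
proof (induction i)
  case 0
  note th' = lin_isoD[OF th]
  define h where "h = (\<lambda>y\<in>carrier (syz T 0). \<theta> c' (mult_last 0 0 g (inv_into (Om 0 0) (\<theta> 0) y)))"
  have ht: "h (\<theta> 0 t) = \<theta> c' (mult_last 0 0 g t)" if "t \<in> Om 0 0" for t
    using that th'(1)[of t 0] th'(4)[of 0] by (simp add: h_def)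
  have eq: "mult_last 0 0 g t = apply_fam g t" for t by (simp add: mult_last_def apply_fam_def summand_def tgt_def)
  have pre: "\<exists>t\<in>Om 0 0. \<theta> 0 t = y" if "y \<in> carrier (syz T 0)" for y
    by (rule surj_preimage[OF th'(5) that])
  have HZ: "mult_last 0 0 g t \<in> Om c' 0" if "t \<in> Om 0 0" for t using mult_last_model[OF g, of 0] that by simp
  have "h \<in> mod_hom KR (syz T 0) (syz T c')"
  proof (rule mod_homI)
    show "h \<in> extensional (carrier (syz T 0))" by (simp add: h_def)
    show "h y \<in> carrier (syz T c')" if y: "y \<in> carrier (syz T 0)" for y
    proof -
      obtain t where t: "t \<in> Om 0 0" "\<theta> 0 t = y" using pre[OF y] by blast
      then show ?thesis using ht[OF t(1)] th'(1)[OF HZ[OF t(1)]] by simp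
    qed
    show "h (x \<oplus>\<^bsub>syz T 0\<^esub> y) = h x \<oplus>\<^bsub>syz T c'\<^esub> h y" if x: "x \<in> carrier (syz T 0)" and y: "y \<in> carrier (syz T 0)" for x y
    proof -
      obtain t where t: "t \<in> Om 0 0" "\<theta> 0 t = y" using pre[OF y] by blast
      obtain s where s: "s \<in> Om 0 0" "\<theta> 0 s = x" using pre[OF x] by blast
      have st: "s + t \<in> Om 0 0" by (rule kv.subspace_add[OF Om_subspace s(1) t(1)])
      have "h (\<theta> 0 (s + t)) = \<theta> c' (mult_last 0 0 g s + mult_last 0 0 g t)" by (simp only: ht[OF st] mult_last_add)
      then show ?thesis
        by (simp only: th'(2)[OF s(1) t(1)] th'(2)[OF HZ[OF s(1)] HZ[OF t(1)]] s(2) t(2)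
            ht[OF s(1), unfolded s(2)] ht[OF t(1), unfolded t(2)])
    qed
    show "h (r \<odot>\<^bsub>syz T 0\<^esub> y) = r \<odot>\<^bsub>syz T c'\<^esub> h y" if r: "r \<in> carrier KR" and y: "y \<in> carrier (syz T 0)" for r y
    proof -
      obtain t where t: "t \<in> Om 0 0" "\<theta> 0 t = y" using pre[OF y] by blast
      have rt: "r * t \<in> Om 0 0" by (rule VR_times_Om[OF r t(1)])
      have "h (\<theta> 0 (r * t)) = \<theta> c' (r * mult_last 0 0 g t)" by (simp only: ht[OF rt] mult_last_VR[OF r])
      then show ?thesis
        by (simp only: th'(3)[OF r t(1)] th'(3)[OF r HZ[OF t(1)]] t(2) ht[OF t(1), unfolded t(2)])
    qed
  qed
  moreover have "h (aug T x) = fam_map c' g x" if "x \<in> carrier KS" for x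
    using that ht[of x] th0[of x] by (simp add: KS_simps fam_map_def eq)
  ultimately have "syz_map KR KS T 0 c' (fam_map c' g) h" by simp
  then show ?case using ht by auto
next
  case (Suc i)
  then obtain h' where h': "syz_map KR KS T i c' (fam_map c' g) h'" "\<And>t. t \<in> Om i 0 \<Longrightarrow> h' (\<theta> i t) = \<theta> (i + c') (mult_last i 0 g t)"
    by blast
  note Th' = lin_isoD[OF Th]
  define l where "l = (\<lambda>y\<in>carrier (cov T i). \<Theta> (i + c') (mult_last (Suc i) 0 g (inv_into (Cov i 0) (\<Theta> i) y)))"
  have lt: "l (\<Theta> i t) = \<Theta> (i + c') (mult_last (Suc i) 0 g t)" if "t \<in> Cov i 0" for t
    using that Th'(1)[of t i] Th'(4)[of i] by (simp add: l_def)
  have pre: "\<exists>t\<in>Cov i 0. \<Theta> i t = y" if "y \<in> carrier (cov T i)" for y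
    by (rule surj_preimage[OF Th'(5) that])
  note HS = mult_last_Cov[OF g]
  have l: "l \<in> mod_hom KR (cov T i) (cov T (i + c'))"
  proof (rule mod_homI)
    show "l \<in> extensional (carrier (cov T i))" by (simp add: l_def)
    show "l y \<in> carrier (cov T (i + c'))" if y: "y \<in> carrier (cov T i)" for y
    proof -
      obtain t where t: "t \<in> Cov i 0" "\<Theta> i t = y" using pre[OF y] by blast
      then show ?thesis using lt[OF t(1)] Th'(1)[OF HS(1)[OF t(1)]] by simp
    qed
    show "l (x \<oplus>\<^bsub>cov T i\<^esub> y) = l x \<oplus>\<^bsub>cov T (i + c')\<^esub> l y" if x: "x \<in> carrier (cov T i)" and y: "y \<in> carrier (cov T i)" for x y
    proof -
      obtain t where t: "t \<in> Cov i 0" "\<Theta> i t = y" using pre[OF y] by blast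
      obtain s where s: "s \<in> Cov i 0" "\<Theta> i s = x" using pre[OF x] by blast
      have st: "s + t \<in> Cov i 0" by (rule kv.subspace_add[OF Cov_subspace s(1) t(1)])
      have "l (\<Theta> i (s + t)) = \<Theta> (i + c') (mult_last (Suc i) 0 g s + mult_last (Suc i) 0 g t)" by (simp only: lt[OF st] mult_last_add)
      then show ?thesis
        by (simp only: Th'(2)[OF s(1) t(1)] Th'(2)[OF HS(1)[OF s(1)] HS(1)[OF t(1)]] s(2) t(2)
            lt[OF s(1), unfolded s(2)] lt[OF t(1), unfolded t(2)])
    qed
    show "l (r \<odot>\<^bsub>cov T i\<^esub> y) = r \<odot>\<^bsub>cov T (i + c')\<^esub> l y" if r: "r \<in> carrier KR" and y: "y \<in> carrier (cov T i)" for r y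
    proof -
      obtain t where t: "t \<in> Cov i 0" "\<Theta> i t = y" using pre[OF y] by blast
      have rt: "r * t \<in> Cov i 0" by (rule VR_times_Cov[OF r t(1)])
      have "l (\<Theta> i (r * t)) = \<Theta> (i + c') (r * mult_last (Suc i) 0 g t)" by (simp only: lt[OF rt] mult_last_VR[OF r])
      then show ?thesis
        by (simp only: Th'(3)[OF r t(1)] Th'(3)[OF r HS(1)[OF t(1)]] t(2) lt[OF t(1), unfolded t(2)])
    qed
  qed
  have comm: "cmap T (i + c') (l y) = h' (cmap T i y)" if y: "y \<in> carrier (cov T i)" for y
  proof -
    obtain t where t: "t \<in> Cov i 0" "\<Theta> i t = y" using pre[OF y] by blast
    have "cmap T (i + c') (l (\<Theta> i t)) = \<theta> (i + c') (merge (mult_last (Suc i) 0 g t))"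
      by (simp only: lt[OF t(1)] cmap_Th[OF HS(1)[OF t(1)]])
    also have "\<dots> = h' (cmap T i (\<Theta> i t))"
      by (simp only: HS(2)[OF t(1)] cmap_Th[OF t(1)] h'(2)[OF merge_Cov[OF t(1)]])
    finally show ?thesis by (simp only: t(2))
  qed
  let ?h = "restrict l (carrier (syz T (Suc i)))"
  have "syz_map KR KS T (Suc i) c' (fam_map c' g) ?h"
    using h'(1) l comm by (simp only: syz_map.simps) blast
  moreover have "?h (\<theta> (Suc i) t) = \<theta> (Suc i + c') (mult_last (Suc i) 0 g t)" if t: "t \<in> Om (Suc i) 0" for t
  proof -
    have tS: "t \<in> Cov i 0" using t by (simp add: Om_Suc)
    have H: "mult_last (Suc i) 0 g t \<in> Om (Suc (i + c')) 0" using mult_last_model[OF g, of "Suc i"] t by simp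
    have "?h (\<theta> (Suc i) t) = l (\<Theta> i t)" using lin_isoD(1)[OF th t] th_Suc[OF t] by simp
    then show ?thesis by (simp add: lt[OF tS] th_Suc[OF H])
  qed
  ultimately show ?case by blast
qed

definition fam_prod :: "nat \<Rightarrow> (nat \<Rightarrow> 'k mpoly) \<Rightarrow> (nat \<Rightarrow> 'k mpoly) \<Rightarrow> nat \<Rightarrow> 'k mpoly"
  where "fam_prod c g f = (\<lambda>i. mult_last c i g (f i))"

lemma mult_last_apply_fam: "q \<in> polys d \<Longrightarrow> mult_last c 0 g (apply_fam f q) = apply_fam (fam_prod c g f) q"
  unfolding apply_fam_def fam_prod_def mult_last_sum
  by (rule sum.cong[OF refl], rule mult_last_mult) (auto simp: summand_polys summand_deg)

text \<open>The product is a union over all representatives and all choices of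
  \<open>\<Omega>\<^sup>c\<close>. By \<open>syz_map_unique\<close> all of them give the same
  class, so the explicit representative can be used.\<close>
theorem stable_prod_fam_map:
  assumes g: "g \<in> gen_fams c'" and f: "f \<in> mult_fams c"
  shows "stable_prod KR KS T c' c (cls c' (fam_map c' g)) (cls c (fam_map c f)) = cls (c + c') (fam_map (c + c') (fam_prod c g f))"
    "fam_map (c + c') (fam_prod c g f) \<in> hom (c + c')"
proof -
  obtain h where h: "syz_map KR KS T c c' (fam_map c' g) h" "\<And>t. t \<in> Om c 0 \<Longrightarrow> h (\<theta> c t) = \<theta> (c + c') (mult_last c 0 g t)"
    using syz_map_exists[OF g, of c] by blast
  have gh: "fam_map c' g \<in> hom c'" by (rule fam_map_hom[OF gen_fams_mult_fams[OF g]])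
  have fh: "fam_map c f \<in> hom c" by (rule fam_map_hom[OF f])
  note smh = syz_map_hom[OF T KS_module]
  note hh = smh[OF h(1)]
  let ?C = "compose (carrier KS)"
  have hf: "?C h (fam_map c f) = fam_map (c + c') (fam_prod c g f)"
    unfolding compose_def fam_map_def
    by (rule restrict_ext) (simp add: KS_simps h(2) apply_fam_Om[OF f] mult_last_apply_fam)
  have comp: "?C k f' \<in> hom (c + c')" if "k \<in> mod_hom KR (syz T c) (syz T (c + c'))" "f' \<in> hom c" for k f'
    by (rule mod_hom_compose[OF KS_module that(2,1)])
  show "fam_map (c + c') (fam_prod c g f) \<in> hom (c + c')" using comp[OF hh fh] hf by simp
  note SPc = stable_pair[of c] and SPc' = stable_pair[of c'] and SP = stable_pair[of "c + c'"]
  have eq: "cls (c + c') (?C h' f') = cls (c + c') (?C h (fam_map c f))"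
    if f': "f' \<in> cls c (fam_map c f)" and g': "g' \<in> cls c' (fam_map c' g)" and h': "syz_map KR KS T c c' g' h'" for f' g' h'
  proof -
    have fh': "f' \<in> hom c" by (rule stable_pair.cls_sub[OF SPc fh f'])
    have gh': "g' \<in> hom c'" by (rule stable_pair.cls_sub[OF SPc' gh g'])
    note hh' = smh[OF h']
    have "hdiff (syz T c) (syz T (c + c')) h' h \<in> factors_through_projective KR (syz T c) (syz T (c + c'))"
      by (rule syz_map_unique[OF T VR_cring VR_one_neq KS_module gh' gh stable_pair.cls_mem[OF SPc' gh g'] h' h(1)])
    then have "?C (hdiff (syz T c) (syz T (c + c')) h' h) f' \<in> FP (c + c')"
      by (rule factors_compose_right[OF KS_module _ fh'])
    moreover have "?C (hdiff (syz T c) (syz T (c + c')) h' h) f' = hdiff KS (syz T (c + c')) (?C h' f') (?C h f')"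
      using mod_homD(1)[OF fh'] by (auto simp: compose_def hdiff_def intro!: restrict_ext)
    ultimately have 1: "cls (c + c') (?C h' f') = cls (c + c') (?C h f')"
      using stable_pair.cls_eq[OF SP comp[OF hh' fh'] comp[OF hh fh']] by simp
    have "?C h (hdiff KS (syz T c) f' (fam_map c f)) \<in> FP (c + c')"
      by (rule factors_compose_left[OF KS_module stable_pair.cls_mem[OF SPc fh f'] hh])
    moreover have "?C h (hdiff KS (syz T c) f' (fam_map c f)) = hdiff KS (syz T (c + c')) (?C h f') (?C h (fam_map c f))"
      unfolding compose_def hdiff_def
      by (rule restrict_ext)
        (simp add: mod_hom_diff[OF sm(1) sm(1) hh] mod_homD(1)[OF fh'] mod_homD(1)[OF fh])
    ultimately have 2: "cls (c + c') (?C h f') = cls (c + c') (?C h (fam_map c f))"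
      using stable_pair.cls_eq[OF SP comp[OF hh fh'] comp[OF hh fh]] by simp
    show ?thesis using 1 2 by simp
  qed
  have ne: "fam_map c f \<in> cls c (fam_map c f)" "fam_map c' g \<in> cls c' (fam_map c' g)"
    using stable_pair.cls_self[OF SPc fh] stable_pair.cls_self[OF SPc' gh] by auto
  have "stable_prod KR KS T c' c (cls c' (fam_map c' g)) (cls c (fam_map c f)) = cls (c + c') (?C h (fam_map c f))"
  proof
    show "stable_prod KR KS T c' c (cls c' (fam_map c' g)) (cls c (fam_map c f)) \<subseteq> cls (c + c') (?C h (fam_map c f))"
      unfolding stable_prod_def using eq by (intro UN_least) blast
    show "cls (c + c') (?C h (fam_map c f)) \<subseteq> stable_prod KR KS T c' c (cls c' (fam_map c' g)) (cls c (fam_map c f))"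
      unfolding stable_prod_def using ne h(1) by blast
  qed
  then show "stable_prod KR KS T c' c (cls c' (fam_map c' g)) (cls c (fam_map c f)) = cls (c + c') (fam_map (c + c') (fam_prod c g f))"
    by (simp only: hf)
qed

end

section \<open>The path algebra\<close>

lemma poly_mapping_induct_on [consumes 1, case_names zero single add]:
  fixes p :: "'a \<Rightarrow>\<^sub>0 'b::comm_monoid_add"
  assumes "supp p \<subseteq> S" "P 0" "\<And>m c. m \<in> S \<Longrightarrow> P (Poly_Mapping.single m c)"
    "\<And>p q. supp p \<subseteq> S \<Longrightarrow> supp q \<subseteq> S \<Longrightarrow> P p \<Longrightarrow> P q \<Longrightarrow> P (p + q)"
  shows "P p"
proof -
  have "P (\<Sum>m\<in>A. Poly_Mapping.single m (coef p m)) \<and> supp (\<Sum>m\<in>A. Poly_Mapping.single m (coef p m)) \<subseteq> S"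
    if "finite A" "A \<subseteq> S" for A
    using that
  proof (induction A)
    case empty then show ?case by (simp add: assms(2))
  next
    case (insert a A)
    have s: "supp (Poly_Mapping.single a (coef p a)) \<subseteq> S" using insert.prems by auto
    have IH: "P (\<Sum>m\<in>A. Poly_Mapping.single m (coef p m))" "supp (\<Sum>m\<in>A. Poly_Mapping.single m (coef p m)) \<subseteq> S"
      using insert by auto
    have "P (Poly_Mapping.single a (coef p a) + (\<Sum>m\<in>A. Poly_Mapping.single m (coef p m)))"
      by (rule assms(4)[OF s IH(2) assms(3) IH(1)]) (use insert.prems in auto)
    moreover have "supp (Poly_Mapping.single a (coef p a) + (\<Sum>m\<in>A. Poly_Mapping.single m (coef p m))) \<subseteq> S"
      by (rule order_trans[OF keys_add]) (use s IH(2) in auto)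
    ultimately show ?case using insert.hyps by simp
  qed
  from this[of "supp p"] assms(1) show ?thesis by (simp add: poly_mapping_sum_singles)
qed

context
  fixes Q :: "('v, 'e) pre_digraph"
begin

abbreviation aw :: "'v \<Rightarrow> 'e list \<Rightarrow> 'v" where "aw \<equiv> pre_digraph.awlast Q"

text \<open>With the same finite index sets for all arguments, bilinearity is bilinearity of each term.\<close>
lemma path_mult_superset:
  fixes g f :: "('v \<times> 'e list) \<Rightarrow>\<^sub>0 'k::comm_ring_1"
  assumes "finite A" "supp g \<subseteq> A" "finite B" "supp f \<subseteq> B"
  shows "path_mult Q g f = (\<Sum>x\<in>A. \<Sum>y\<in>B. if aw (fst y) (snd y) = fst x
    then Poly_Mapping.single (fst y, snd y @ snd x) (coef g x * coef f y) else 0)"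
proof -
  have "path_mult Q g f = (\<Sum>x\<in>supp g. \<Sum>y\<in>supp f. if aw (fst y) (snd y) = fst x
    then Poly_Mapping.single (fst y, snd y @ snd x) (coef g x * coef f y) else 0)"
    unfolding path_mult_def by (intro sum.cong refl) (auto split: prod.splits intro!: sum.cong)
  also have "\<dots> = (\<Sum>x\<in>supp g. \<Sum>y\<in>B. if aw (fst y) (snd y) = fst x
    then Poly_Mapping.single (fst y, snd y @ snd x) (coef g x * coef f y) else 0)"
    using assms by (intro sum.cong refl sum.mono_neutral_left) (auto simp: in_keys_iff)
  also have "\<dots> = (\<Sum>x\<in>A. \<Sum>y\<in>B. if aw (fst y) (snd y) = fst x
    then Poly_Mapping.single (fst y, snd y @ snd x) (coef g x * coef f y) else 0)"
    using assms by (intro sum.mono_neutral_left) (auto simp: in_keys_iff intro!: sum.neutral)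
  finally show ?thesis .
qed

lemma path_mult_add_left: "path_mult Q (g + g') f = path_mult Q g f + path_mult Q g' (f :: _ \<Rightarrow>\<^sub>0 'k::comm_ring_1)"
proof -
  have A: "finite (supp g \<union> supp g')" "supp g \<subseteq> supp g \<union> supp g'" "supp g' \<subseteq> supp g \<union> supp g'"
    "supp (g + g') \<subseteq> supp g \<union> supp g'" using keys_add[of g g'] by auto
  note e = path_mult_superset[OF A(1) _ finite_keys subset_refl]
  show ?thesis
    unfolding e[OF A(4)] e[OF A(2)] e[OF A(3)] sum.distrib[symmetric]
    by (intro sum.cong refl) (simp add: lookup_add distrib_right single_add)
qed

lemma path_mult_add_right: "path_mult Q g (f + f') = path_mult Q g f + path_mult Q g (f' :: _ \<Rightarrow>\<^sub>0 'k::comm_ring_1)"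
proof -
  have A: "finite (supp f \<union> supp f')" "supp f \<subseteq> supp f \<union> supp f'" "supp f' \<subseteq> supp f \<union> supp f'"
    "supp (f + f') \<subseteq> supp f \<union> supp f'" using keys_add[of f f'] by auto
  note e = path_mult_superset[OF finite_keys subset_refl A(1)]
  show ?thesis
    unfolding e[OF A(4)] e[OF A(2)] e[OF A(3)] sum.distrib[symmetric]
    by (intro sum.cong refl) (simp add: lookup_add distrib_left single_add)
qed

lemma path_mult_single: "path_mult Q (Poly_Mapping.single (w, q) a) (Poly_Mapping.single (u, p) b) =
    (if aw u p = w then Poly_Mapping.single (u, p @ q) (a * b :: 'k::comm_ring_1) else 0)"
  by (subst path_mult_superset[of "{(w, q)}" _ "{(u, p)}"]) auto

lemma path_mult_0 [simp]: "path_mult Q 0 f = 0" "path_mult Q g (0 :: _ \<Rightarrow>\<^sub>0 'k::comm_ring_1) = 0"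
  by (simp_all add: path_mult_def)

lemma path_mult_sum_left: "path_mult Q (sum g A) f = (\<Sum>a\<in>A. path_mult Q (g a) (f :: _ \<Rightarrow>\<^sub>0 'k::comm_ring_1))"
  by (induction A rule: infinite_finite_induct) (auto simp: path_mult_add_left)

lemma path_mult_sum_right: "path_mult Q g (sum f A) = (\<Sum>a\<in>A. path_mult Q g (f a :: _ \<Rightarrow>\<^sub>0 'k::comm_ring_1))"
  by (induction A rule: infinite_finite_induct) (auto simp: path_mult_add_right)

lemma path_mult_diff_left: "path_mult Q (g - g') f = path_mult Q g f - path_mult Q g' (f :: _ \<Rightarrow>\<^sub>0 'k::comm_ring_1)"
  using path_mult_add_left[of "g - g'" g' f] by simp

lemma path_mult_diff_right: "path_mult Q g (f - f') = path_mult Q g f - path_mult Q g (f' :: _ \<Rightarrow>\<^sub>0 'k::comm_ring_1)"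
  using path_mult_add_right[of g "f - f'" f'] by simp

end

context veronese begin

abbreviation QQ :: "(nat, arr) pre_digraph" where "QQ \<equiv> quiverQ d n"
abbreviation KQ :: "('k::field, (nat \<times> arr list) \<Rightarrow>\<^sub>0 'k) module" where "KQ \<equiv> path_algebra QQ"

fun end_vertex :: "nat \<Rightarrow> arr list \<Rightarrow> nat" where
  "end_vertex u [] = u"
| "end_vertex u (X i s # p) = end_vertex (Suc i) p"
| "end_vertex u (XX s t # p) = end_vertex (Suc 0) p"

lemma QQ_simps: "verts QQ = {1..n - 1}" "tail QQ (X i s) = i" "tail QQ (XX s t) = n - 1"
  "head QQ (X i s) = Suc i" "head QQ (XX s t) = 1"
  "X i s \<in> arcs QQ \<longleftrightarrow> 1 \<le> i \<and> i < n - 1 \<and> s \<in> {1..d}"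
  "XX s t \<in> arcs QQ \<longleftrightarrow> 1 \<le> s \<and> s < t \<and> t \<le> d"
  by (auto simp: quiverQ_def)

lemma awlast_end_vertex: "pre_digraph.awlast QQ u p = end_vertex u p"
proof (induction u p rule: end_vertex.induct)
  case (2 u i s p)
  have "pre_digraph.awalk_verts QQ (Suc i) p \<noteq> []" by (cases p) (simp_all add: pre_digraph.awalk_verts.simps)
  then show ?case using 2 by (simp add: pre_digraph.awalk_verts.simps QQ_simps)
next
  case (3 u s t p)
  have "pre_digraph.awalk_verts QQ (Suc 0) p \<noteq> []" by (cases p) (simp_all add: pre_digraph.awalk_verts.simps)
  then show ?case using 3 by (simp add: pre_digraph.awalk_verts.simps QQ_simps)
qed (simp add: pre_digraph.awalk_verts.simps)

lemma paths_iff: "(u, p) \<in> paths QQ \<longleftrightarrow> 1 \<le> u \<and> is_path u p"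
proof -
  have "u \<in> verts QQ \<and> set p \<subseteq> arcs QQ \<and> (\<exists>v. pre_digraph.cas QQ u p v) \<longleftrightarrow> 1 \<le> u \<and> is_path u p"
  proof (induction u p rule: end_vertex.induct)
    case (1 u) then show ?case using n2 by (auto simp: QQ_simps pre_digraph.cas.simps)
  next
    case (2 u i s p) then show ?case using n2 by (auto simp: QQ_simps pre_digraph.cas.simps)
  next
    case (3 u s t p) then show ?case using n2 by (auto simp: QQ_simps pre_digraph.cas.simps)
  qed
  then show ?thesis by (auto simp: paths_def pre_digraph.awalk_def)
qed

lemma end_vertex_append [simp]: "end_vertex u (p @ q) = end_vertex (end_vertex u p) q"
  by (induction u p rule: end_vertex.induct) auto

lemma is_path_append: "is_path u (p @ q) \<longleftrightarrow> is_path u p \<and> is_path (end_vertex u p) q"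
  by (induction u p rule: is_path.induct) (auto dest: is_path_less)

lemma end_vertex_range: "1 \<le> u \<Longrightarrow> is_path u p \<Longrightarrow> 1 \<le> end_vertex u p \<and> end_vertex u p < n"
  using n2 by (induction u p rule: is_path.induct) auto

lemma wedges_append [simp]: "wedges (p @ q) = wedges p + wedges q"
  by (induction p rule: wedges.induct) auto

lemma path_poly_append: "path_poly (p @ q) = path_poly p * shift_iter (wedges p) (path_poly q)"
  by (induction p rule: wedges.induct) (auto simp: shift_mult algebra_simps)

text \<open>The degree at the last position is the number of arrows after the last arrow
  \<open>x\<^sub>s\<^sub>t\<close>, plus \<open>1\<close> for the variable that this arrow puts
  there; and this arrow ends at the vertex \<open>1\<close>.\<close>
lemma path_poly_tgt: "is_path u p \<Longrightarrow> m \<in> supp (path_poly p :: 'k::field mpoly) \<Longrightarrow> tgt (wedges p) u m = end_vertex u p"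
proof (induction p arbitrary: u m rule: wedges.induct)
  case (1 u) then show ?case by (simp add: tgt_def)
next
  case (2 j s p)
  then obtain l where l: "l \<in> supp (path_poly p :: 'k mpoly)" "m = unit_expo s + l"
    by (auto simp: Var_mon supp_mon_times)
  have "tgt (wedges p) (Suc j) l = end_vertex (Suc j) p" using 2 l by auto
  then show ?case using 2(2) l(2) by (auto simp: tgt_def pos_deg_low low_unit)
next
  case (3 s t p)
  have st: "s \<in> {1..d}" "t \<in> {1..d}" using 3(2) by auto
  have "m \<in> supp (Var t * shift (Var s * path_poly p :: 'k mpoly)) \<or> m \<in> supp (Var s * shift (Var t * path_poly p :: 'k mpoly))"
    using 3(3) supp_diff by fastforce
  then obtain a b l where l: "l \<in> supp (path_poly p :: 'k mpoly)" "m = unit_expo a + shift_expo (unit_expo b + l)"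
      "a \<in> {1..d}" "b \<in> {1..d}"
    using st by (auto simp: Var_mon supp_mon_times supp_shift)
  have "tgt (wedges p) (Suc 0) l = end_vertex (Suc 0) p" using 3 l by auto
  then show ?case using l by (auto simp: tgt_def high_add high_of_low low_unit pos_deg_low)
qed

text \<open>All terms of the polynomial of a path have its end vertex as target, so a single member of the
  family acts.\<close>
lemma mult_last_path_poly:
  assumes "is_path u p" shows "mult_last (wedges p) u g (path_poly p :: 'k::field mpoly) = path_poly p * shift_iter (wedges p) (g (end_vertex u p))"
proof -
  have "part (\<lambda>m. tgt (wedges p) u m = v) (path_poly p :: 'k mpoly) = (if v = end_vertex u p then path_poly p else 0)" for v
    using path_poly_tgt[OF assms, where 'k = 'k] by (auto intro!: part_eqI part_eq_0)
  moreover have "end_vertex u p < n"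
  proof -
    have "lead_expo p \<in> supp (path_poly p :: 'k mpoly)" by (rule lead_expo_in_supp[OF assms])
    from path_poly_tgt[OF assms this] have "end_vertex u p = tgt (wedges p) u (lead_expo p)" by simp
    also have "\<dots> < n" using n2 by (simp add: tgt_def)
    finally show ?thesis .
  qed
  ultimately show ?thesis
    unfolding mult_last_def by (simp add: if_distrib[of "\<lambda>x. x * _"] sum.delta cong: if_cong)
qed

lemma KQ_simps: "x \<in> carrier KQ \<longleftrightarrow> supp x \<subseteq> paths QQ" "x \<otimes>\<^bsub>KQ\<^esub> y = path_mult QQ x y"
  "x \<oplus>\<^bsub>KQ\<^esub> y = x + y" "\<zero>\<^bsub>KQ\<^esub> = 0" "c \<odot>\<^bsub>KQ\<^esub> x = Poly_Mapping.map ((*) c) x"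
  "\<one>\<^bsub>KQ\<^esub> = (\<Sum>v\<in>{1..n - 1}. Poly_Mapping.single (v, []) 1)"
  by (simp_all add: path_algebra_def QQ_simps)

lemmas path_mult_single' = path_mult_single[of QQ, unfolded awlast_end_vertex]

lemma KQ_add: "x \<in> carrier KQ \<Longrightarrow> y \<in> carrier KQ \<Longrightarrow> x + y \<in> carrier KQ"
  using keys_add[of x y] by (auto simp: KQ_simps)
lemma KQ_uminus: "x \<in> carrier KQ \<Longrightarrow> - x \<in> carrier (KQ :: ('k::field, _) module)"
  by (auto simp: KQ_simps in_keys_iff)
lemma KQ_diff: "x \<in> carrier KQ \<Longrightarrow> y \<in> carrier KQ \<Longrightarrow> x - y \<in> carrier (KQ :: ('k::field, _) module)"
  using KQ_add[of x "- y"] KQ_uminus[of y] by simp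
lemma KQ_single: "1 \<le> u \<Longrightarrow> is_path u p \<Longrightarrow> Poly_Mapping.single (u, p) c \<in> carrier KQ"
  by (auto simp: KQ_simps paths_iff)

lemma KQ_induct [consumes 1, case_names zero single add]:
  assumes "x \<in> carrier (KQ :: ('k::field, _) module)" "P 0"
    "\<And>u p c. 1 \<le> u \<Longrightarrow> is_path u p \<Longrightarrow> P (Poly_Mapping.single (u, p) c)"
    "\<And>x y. x \<in> carrier (KQ :: ('k, _) module) \<Longrightarrow> y \<in> carrier (KQ :: ('k, _) module) \<Longrightarrow> P x \<Longrightarrow> P y \<Longrightarrow> P (x + y)"
  shows "P x"
  using assms(1)[unfolded KQ_simps]
proof (induction rule: poly_mapping_induct_on)
  case zero show ?case by (rule assms(2))
next
  case (single m c)
  then show ?case using assms(3)[of "fst m" "snd m" c] paths_iff[of "fst m" "snd m"] by simp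
next
  case (add p q)
  then show ?case by (intro assms(4)) (simp_all only: KQ_simps)
qed

lemma KQ_mult:
  assumes "x \<in> carrier (KQ :: ('k::field, _) module)" "y \<in> carrier (KQ :: ('k, _) module)"
  shows "path_mult QQ x y \<in> carrier (KQ :: ('k, _) module)"
  using assms(1)
proof (induction rule: KQ_induct)
  case (single w q a)
  show ?case
    using assms(2)
  proof (induction rule: KQ_induct)
    case (single u p b)
    then show ?case using \<open>is_path w q\<close>
      by (cases "end_vertex u p = w") (auto simp: path_mult_single' is_path_append intro!: KQ_single, simp add: KQ_simps)
  qed (auto simp: path_mult_add_right KQ_add, simp add: KQ_simps)
qed (auto simp: path_mult_add_left KQ_add, simp add: KQ_simps)

lemma KQ_assoc: "path_mult QQ (path_mult QQ x y) (z :: _ \<Rightarrow>\<^sub>0 'k::field) = path_mult QQ x (path_mult QQ y z)"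
proof (induction x rule: poly_mapping_induct)
  case (single m a)
  show ?case
  proof (induction y rule: poly_mapping_induct)
    case (single m' b)
    show ?case
    proof (induction z rule: poly_mapping_induct)
      case (single m'' c)
      show ?case by (cases m; cases m'; cases m'') (simp add: path_mult_single' mult.assoc)
    qed (auto simp: path_mult_add_right)
  qed (auto simp: path_mult_add_right path_mult_add_left)
qed (auto simp: path_mult_add_left)

lemma KQ_one: "(\<Sum>v\<in>{1..n - 1}. Poly_Mapping.single (v, []) 1) \<in> carrier (KQ :: ('k::field, _) module)"
proof -
  have "supp (\<Sum>v\<in>{1..n - 1}. Poly_Mapping.single (v, []) (1 :: 'k)) \<subseteq> (\<Union>v\<in>{1..n - 1}. {(v, [])})"
    using keys_sum[of "\<lambda>v. Poly_Mapping.single (v, []) (1 :: 'k)" "{1..n - 1}"] by auto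
  also have "\<dots> \<subseteq> paths QQ" using n2 by (auto simp: paths_iff)
  finally show ?thesis by (simp add: KQ_simps)
qed

lemma KQ_one_mult:
  assumes "x \<in> carrier (KQ :: ('k::field, _) module)"
  shows "path_mult QQ (\<Sum>v\<in>{1..n - 1}. Poly_Mapping.single (v, []) c) x = Poly_Mapping.map ((*) c) x"
    "path_mult QQ x (\<Sum>v\<in>{1..n - 1}. Poly_Mapping.single (v, []) 1) = x"
proof -
  have madd: "Poly_Mapping.map ((*) c) (x + y) = Poly_Mapping.map ((*) c) x + Poly_Mapping.map ((*) c) y"
    for x y :: "(nat \<times> arr list) \<Rightarrow>\<^sub>0 'k"
    by (rule poly_mapping_eqI) (simp add: lookup_add coef_map_scale algebra_simps)
  have mzero: "Poly_Mapping.map ((*) c) 0 = (0 :: (nat \<times> arr list) \<Rightarrow>\<^sub>0 'k)"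
    by (rule poly_mapping_eqI) (simp add: coef_map_scale)
  show "path_mult QQ (\<Sum>v\<in>{1..n - 1}. Poly_Mapping.single (v, []) c) x = Poly_Mapping.map ((*) c) x"
    using assms
  proof (induction rule: KQ_induct)
    case (single u p a)
    then have "end_vertex u p \<in> {1..n - 1}" using end_vertex_range[of u p] n2 by auto
    then show ?case
      by (simp add: path_mult_sum_left path_mult_single' sum.delta' map_single)
  qed (simp_all add: path_mult_add_right madd mzero)
  show "path_mult QQ x (\<Sum>v\<in>{1..n - 1}. Poly_Mapping.single (v, []) 1) = x"
    using assms
  proof (induction rule: KQ_induct)
    case (single u p a)
    then have "u \<in> {1..n - 1}" using is_path_less[of u p] n2 by auto
    then show ?case
      by (simp add: path_mult_sum_right path_mult_single' sum.delta')
  qed (simp_all add: path_mult_add_left)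
qed

lemma map_times_one: "Poly_Mapping.map ((*) 1) x = (x :: 'a \<Rightarrow>\<^sub>0 'k::field)"
  by (rule poly_mapping_eqI) (simp add: coef_map_scale)

lemma KQ_ring: "ring (KQ :: ('k::field, (nat \<times> arr list) \<Rightarrow>\<^sub>0 'k) module)"
proof (rule ringI)
  show "abelian_group (KQ :: ('k, (nat \<times> arr list) \<Rightarrow>\<^sub>0 'k) module)"
  proof (rule abelian_groupI)
    fix x :: "(nat \<times> arr list) \<Rightarrow>\<^sub>0 'k" assume "x \<in> carrier KQ"
    then show "\<exists>y\<in>carrier KQ. y \<oplus>\<^bsub>KQ\<^esub> x = \<zero>\<^bsub>KQ\<^esub>"
      using KQ_uminus by (intro bexI[of _ "- x"]) (auto simp: KQ_simps(2-))
  qed (auto simp: KQ_simps(2-) KQ_add algebra_simps, simp add: KQ_simps(1))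
  show "Group.monoid (KQ :: ('k, (nat \<times> arr list) \<Rightarrow>\<^sub>0 'k) module)"
    by (rule monoidI)
      (simp_all only: KQ_simps(2,6) KQ_mult KQ_one KQ_assoc KQ_one_mult map_times_one)
qed (simp_all add: KQ_simps(2-) path_mult_add_left path_mult_add_right)

section \<open>Evaluating paths in the model\<close>

text \<open>The multiplier by which the component of degree \<open>c\<close> of an element of the path algebra
  acts on \<open>M\<^sub>v\<close>.\<close>
definition path_eval :: "nat \<Rightarrow> nat \<Rightarrow> ((nat \<times> arr list) \<Rightarrow>\<^sub>0 'k) \<Rightarrow> 'k::field mpoly"
  where "path_eval c v = lin (\<lambda>(u, p). if u = v \<and> wedges p = c then path_poly p else 0)"

lemma path_eval_add: "path_eval c v (x + y) = path_eval c v x + path_eval c v y" by (simp add: path_eval_def lin_add)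
lemma path_eval_diff: "path_eval c v (x - y) = path_eval c v x - path_eval c v y" by (simp add: path_eval_def lin_diff)
lemma path_eval_0 [simp]: "path_eval c v 0 = 0" by (simp add: path_eval_def)
lemma path_eval_single: "path_eval c v (Poly_Mapping.single (u, p) a) = (if u = v \<and> wedges p = c then Const a * path_poly p else 0)"
  by (simp add: path_eval_def)
lemma path_eval_scale: "path_eval c v (Poly_Mapping.map ((*) a) x) = Const a * path_eval c v x" by (simp add: path_eval_def lin_scale)

lemma mult_last_fun_add: "mult_last c i (\<lambda>z. g z + h z) t = mult_last c i g t + mult_last c i h t"
  by (simp add: mult_last_def shift_iter_add algebra_simps sum.distrib)
lemma mult_last_fun_zero [simp]: "mult_last c i (\<lambda>z. 0) t = 0" by (simp add: mult_last_def)

text \<open>By bilinearity it suffices to multiply two paths, where concatenation of paths becomes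
  multiplication at the last position by \<open>path_poly_append\<close> and
  \<open>mult_last_path_poly\<close>.\<close>
theorem path_eval_mult:
  assumes "g \<in> carrier (KQ :: ('k::field, _) module)" "f \<in> carrier (KQ :: ('k, _) module)"
  shows "path_eval c v (path_mult QQ g f) = (\<Sum>c1\<in>{..c}. mult_last c1 v (\<lambda>z. path_eval (c - c1) z g) (path_eval c1 v f))"
  using assms(1)
proof (induction rule: KQ_induct)
  case (single w q a)
  show ?case
    using assms(2)
  proof (induction rule: KQ_induct)
    case (single u p b)
    have "(\<Sum>c1\<in>{..c}. mult_last c1 v (\<lambda>z. path_eval (c - c1) z (Poly_Mapping.single (w, q) a)) (path_eval c1 v (Poly_Mapping.single (u, p) b)))
      = (\<Sum>c1\<in>{..c}. if c1 = wedges p then (if u = v then Const b * (path_poly p * shift_iter (wedges p) (path_eval (c - wedges p) (end_vertex u p) (Poly_Mapping.single (w, q) a))) else 0) else 0)"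
      using single by (intro sum.cong refl) (auto simp: path_eval_single mult_last_Const mult_last_path_poly)
    also have "\<dots> = (if wedges p \<le> c \<and> u = v then Const b * (path_poly p * shift_iter (wedges p) (path_eval (c - wedges p) (end_vertex u p) (Poly_Mapping.single (w, q) a))) else 0)"
      by (simp add: sum.delta')
    also have "\<dots> = path_eval c v (path_mult QQ (Poly_Mapping.single (w, q) a) (Poly_Mapping.single (u, p) b))"
    proof (cases "wedges p \<le> c \<and> u = v \<and> end_vertex u p = w \<and> wedges q = c - wedges p")
      case True
      then have "wedges p + wedges q = c" by simp
      then show ?thesis using True
        by (simp add: path_mult_single' path_eval_single path_poly_append shift_iter_Const_times Const_mult)
    next
      case False
      then have "wedges p \<le> c \<and> u = v \<longrightarrow> end_vertex u p = w \<longrightarrow> wedges p + wedges q \<noteq> c" by auto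
      then show ?thesis using False
        by (cases "end_vertex u p = w") (auto simp: path_mult_single' path_eval_single)
    qed
    finally show ?case ..
  qed (simp_all add: path_mult_add_right path_eval_add mult_last_add sum.distrib)
qed (simp_all add: path_mult_add_left path_eval_add mult_last_fun_add sum.distrib)

definition ker_eval :: "((nat \<times> arr list) \<Rightarrow>\<^sub>0 'k::field) set"
  where "ker_eval = {x \<in> carrier KQ. \<forall>c v. path_eval c v x = 0}"

lemma ker_eval_ideal: "ideal (ker_eval :: ((nat \<times> arr list) \<Rightarrow>\<^sub>0 'k::field) set) KQ"
proof (rule idealI[OF KQ_ring])
  interpret ring "KQ :: ('k, (nat \<times> arr list) \<Rightarrow>\<^sub>0 'k) module" by (rule KQ_ring)
  show "subgroup ker_eval (add_monoid (KQ :: ('k, (nat \<times> arr list) \<Rightarrow>\<^sub>0 'k) module))"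
  proof (rule add.subgroupI)
    show "ker_eval \<subseteq> carrier (KQ :: ('k, (nat \<times> arr list) \<Rightarrow>\<^sub>0 'k) module)" by (auto simp: ker_eval_def)
    have "(0 :: (nat \<times> arr list) \<Rightarrow>\<^sub>0 'k) \<in> ker_eval" by (simp add: ker_eval_def KQ_simps)
    then show "(ker_eval :: ((nat \<times> arr list) \<Rightarrow>\<^sub>0 'k) set) \<noteq> {}" by blast
    fix a b :: "(nat \<times> arr list) \<Rightarrow>\<^sub>0 'k" assume a: "a \<in> ker_eval" and b: "b \<in> ker_eval"
    show "a \<oplus>\<^bsub>KQ\<^esub> b \<in> ker_eval" using a b by (simp add: ker_eval_def KQ_add path_eval_add KQ_simps(3))
  next
    fix a :: "(nat \<times> arr list) \<Rightarrow>\<^sub>0 'k" assume a: "a \<in> ker_eval"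
    have "\<ominus>\<^bsub>KQ\<^esub> a = - a"
      by (rule minus_equality) (use a in \<open>auto simp: ker_eval_def KQ_uminus KQ_simps(3,4)\<close>)
    then show "\<ominus>\<^bsub>KQ\<^esub> a \<in> ker_eval"
      using a path_eval_diff[of _ _ 0 a] by (simp add: ker_eval_def KQ_uminus)
  qed
qed (simp_all add: ker_eval_def KQ_simps(2) KQ_mult path_eval_mult)

lemma arrow_X: "arrow QQ (X i s) = Poly_Mapping.single (i, [X i s]) 1"
  and arrow_XX: "arrow QQ (XX s t) = Poly_Mapping.single (n - 1, [XX s t]) 1"
  by (simp_all add: arrow_def QQ_simps)

lemma ker_eval_I: "x \<in> carrier KQ \<Longrightarrow> (\<And>c v. path_eval c v x = 0) \<Longrightarrow> x \<in> ker_eval" by (simp add: ker_eval_def)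

text \<open>The relations written as combinations of paths of length two; in the list the arrow traversed
  first comes first.\<close>
lemma relationsQ_paths:
  "relationsQ d n = {Poly_Mapping.single (i, [X i t, X (Suc i) s]) 1 - Poly_Mapping.single (i, [X i s, X (Suc i) t]) 1
      | i s t. 1 \<le> i \<and> i < n - 2 \<and> 1 \<le> s \<and> s < t \<and> t \<le> d} \<union>
    {Poly_Mapping.single (n - 1, [XX t u, X 1 s]) 1 - Poly_Mapping.single (n - 1, [XX s u, X 1 t]) 1
      + Poly_Mapping.single (n - 1, [XX s t, X 1 u]) (1 :: 'k::field)
      | s t u. n \<ge> 3 \<and> 1 \<le> s \<and> s < t \<and> t < u \<and> u \<le> d} \<union>
    {Poly_Mapping.single (n - 2, [X (n - 2) u, XX s t]) 1 - Poly_Mapping.single (n - 2, [X (n - 2) t, XX s u]) 1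
      + Poly_Mapping.single (n - 2, [X (n - 2) s, XX t u]) 1
      | s t u. n \<ge> 3 \<and> 1 \<le> s \<and> s < t \<and> t < u \<and> u \<le> d} \<union>
    {Poly_Mapping.single (1, [XX s t, XX u v]) 1 - Poly_Mapping.single (1, [XX s u, XX t v]) 1
      + Poly_Mapping.single (1, [XX s v, XX t u]) 1 + Poly_Mapping.single (1, [XX t u, XX s v]) 1
      - Poly_Mapping.single (1, [XX t v, XX s u]) 1 + Poly_Mapping.single (1, [XX u v, XX s t]) 1
      | s t u v. n = 2 \<and> 1 \<le> s \<and> s < t \<and> t < u \<and> u < v \<and> v \<le> d}"
proof -
  have 3: "Suc (n - 2) = n - 1" using n2 by simp
  have xx: "arrow QQ (X (i + 1) s) \<otimes>\<^bsub>KQ\<^esub> arrow QQ (X i t) = Poly_Mapping.single (i, [X i t, X (Suc i) s]) (1 :: 'k)" for i s t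
    by (simp add: arrow_X KQ_simps(2) path_mult_single')
  have xy: "arrow QQ (X 1 s) \<otimes>\<^bsub>KQ\<^esub> arrow QQ (XX t u) = Poly_Mapping.single (n - 1, [XX t u, X 1 s]) (1 :: 'k)" for s t u
    by (simp add: arrow_X arrow_XX KQ_simps(2) path_mult_single')
  have yx: "arrow QQ (XX s t) \<otimes>\<^bsub>KQ\<^esub> arrow QQ (X (n - 2) u) = Poly_Mapping.single (n - 2, [X (n - 2) u, XX s t]) (1 :: 'k)" for s t u
    using 3 by (simp add: arrow_X arrow_XX KQ_simps(2) path_mult_single')
  have yy: "arrow QQ (XX u v) \<otimes>\<^bsub>KQ\<^esub> arrow QQ (XX s t) = Poly_Mapping.single (1, [XX s t, XX u v]) (1 :: 'k)" if "n = 2" for s t u v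
  proof -
    have m: "n - Suc 0 = Suc 0" using that by simp
    show ?thesis by (simp add: arrow_XX KQ_simps(2) path_mult_single' m)
  qed
  show ?thesis
  proof (cases "n = 2")
    case True
    show ?thesis unfolding relationsQ_def Let_def xx xy yx yy[OF True] by (rule refl)
  next
    case False
    then show ?thesis unfolding relationsQ_def Let_def xx xy yx by simp
  qed
qed

text \<open>The relations are the commutativity of variables, the Koszul-type identities for three indices,
  and for \<open>n = 2\<close> the Pluecker-type identity for four indices.\<close>
lemma relations_ker_eval: "relationsQ d n \<subseteq> (ker_eval :: ((nat \<times> arr list) \<Rightarrow>\<^sub>0 'k::field) set)"
  unfolding relationsQ_paths
proof (intro Un_least subsetI; elim CollectE exE conjE)
  fix x :: "(nat \<times> arr list) \<Rightarrow>\<^sub>0 'k" and i s t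
  assume h: "x = Poly_Mapping.single (i, [X i t, X (Suc i) s]) 1 - Poly_Mapping.single (i, [X i s, X (Suc i) t]) 1"
    "1 \<le> i" "i < n - 2" "1 \<le> s" "s < t" "t \<le> d"
  show "x \<in> ker_eval" unfolding h(1)
    by (rule ker_eval_I; (intro KQ_diff KQ_single)?) (use h in \<open>auto simp: path_eval_diff path_eval_single\<close>)
next
  fix x :: "(nat \<times> arr list) \<Rightarrow>\<^sub>0 'k" and s t u
  assume h: "x = Poly_Mapping.single (n - 1, [XX t u, X 1 s]) 1 - Poly_Mapping.single (n - 1, [XX s u, X 1 t]) 1
      + Poly_Mapping.single (n - 1, [XX s t, X 1 u]) 1" "3 \<le> n" "1 \<le> s" "s < t" "t < u" "u \<le> d"
  show "x \<in> ker_eval" unfolding h(1)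
    by (rule ker_eval_I; (intro KQ_diff KQ_add KQ_single)?)
      (use h in \<open>auto simp: path_eval_diff path_eval_add path_eval_single shift_mult algebra_simps\<close>)
next
  fix x :: "(nat \<times> arr list) \<Rightarrow>\<^sub>0 'k" and s t u
  assume h: "x = Poly_Mapping.single (n - 2, [X (n - 2) u, XX s t]) 1 - Poly_Mapping.single (n - 2, [X (n - 2) t, XX s u]) 1
      + Poly_Mapping.single (n - 2, [X (n - 2) s, XX t u]) 1" "3 \<le> n" "1 \<le> s" "s < t" "t < u" "u \<le> d"
  show "x \<in> ker_eval" unfolding h(1)
    by (rule ker_eval_I; (intro KQ_diff KQ_add KQ_single)?)
      (use h in \<open>auto simp: path_eval_diff path_eval_add path_eval_single shift_mult algebra_simps\<close>)
next
  fix x :: "(nat \<times> arr list) \<Rightarrow>\<^sub>0 'k" and s t u v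
  assume h: "x = Poly_Mapping.single (1, [XX s t, XX u v]) 1 - Poly_Mapping.single (1, [XX s u, XX t v]) 1
      + Poly_Mapping.single (1, [XX s v, XX t u]) 1 + Poly_Mapping.single (1, [XX t u, XX s v]) 1
      - Poly_Mapping.single (1, [XX t v, XX s u]) 1 + Poly_Mapping.single (1, [XX u v, XX s t]) 1"
    "n = 2" "1 \<le> s" "s < t" "t < u" "u < v" "v \<le> d"
  have m: "n - Suc 0 = Suc 0" using h(2) by simp
  show "x \<in> ker_eval" unfolding h(1)
    by (rule ker_eval_I; (intro KQ_diff KQ_add KQ_single)?)
      (use h(3-7) m in \<open>auto simp: path_eval_diff path_eval_add path_eval_single shift_mult shift_diff algebra_simps\<close>)
qed

abbreviation rel_ideal :: "((nat \<times> arr list) \<Rightarrow>\<^sub>0 'k::field) set" where "rel_ideal \<equiv> Idl\<^bsub>KQ\<^esub> (relationsQ d n)"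

lemma relations_carrier: "relationsQ d n \<subseteq> carrier (KQ :: ('k::field, (nat \<times> arr list) \<Rightarrow>\<^sub>0 'k) module)"
  using relations_ker_eval[where 'k = 'k] by (auto simp: ker_eval_def)

lemma rel_ideal_ideal: "ideal (rel_ideal :: ((nat \<times> arr list) \<Rightarrow>\<^sub>0 'k::field) set) KQ"
  by (rule ring.genideal_ideal[OF KQ_ring relations_carrier])

lemma rel_ideal_ker_eval: "rel_ideal \<subseteq> (ker_eval :: ((nat \<times> arr list) \<Rightarrow>\<^sub>0 'k::field) set)"
  by (rule ring.genideal_minimal[OF KQ_ring ker_eval_ideal relations_ker_eval])

section \<open>Straightening paths\<close>

lemma rel_ideal_rules:
  fixes x y :: "(nat \<times> arr list) \<Rightarrow>\<^sub>0 'k::field"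
  shows "x \<in> rel_ideal \<Longrightarrow> x \<in> carrier KQ" "x \<in> rel_ideal \<Longrightarrow> y \<in> rel_ideal \<Longrightarrow> x + y \<in> rel_ideal" "(0 :: (nat \<times> arr list) \<Rightarrow>\<^sub>0 'k) \<in> rel_ideal"
    "x \<in> rel_ideal \<Longrightarrow> - x \<in> rel_ideal" "x \<in> rel_ideal \<Longrightarrow> y \<in> carrier KQ \<Longrightarrow> path_mult QQ y x \<in> rel_ideal"
    "x \<in> rel_ideal \<Longrightarrow> y \<in> carrier KQ \<Longrightarrow> path_mult QQ x y \<in> rel_ideal" "x \<in> relationsQ d n \<Longrightarrow> x \<in> rel_ideal"
proof -
  interpret ring "KQ :: ('k, (nat \<times> arr list) \<Rightarrow>\<^sub>0 'k) module" by (rule KQ_ring)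
  interpret I: ideal "rel_ideal :: ((nat \<times> arr list) \<Rightarrow>\<^sub>0 'k) set" KQ by (rule rel_ideal_ideal)
  show c: "x \<in> rel_ideal \<Longrightarrow> x \<in> carrier KQ" using I.a_subset by blast
  show "x \<in> rel_ideal \<Longrightarrow> y \<in> rel_ideal \<Longrightarrow> x + y \<in> rel_ideal" using I.a_closed[of x y] by (simp add: KQ_simps(3))
  show "(0 :: (nat \<times> arr list) \<Rightarrow>\<^sub>0 'k) \<in> rel_ideal" using I.zero_closed by (simp add: KQ_simps(4))
  show "- x \<in> rel_ideal" if "x \<in> rel_ideal"
  proof -
    have "\<ominus>\<^bsub>KQ\<^esub> x = - x"
      by (rule minus_equality) (use c[OF that] in \<open>auto simp: KQ_uminus KQ_simps(3,4)\<close>)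
    then show ?thesis using I.a_inv_closed[OF that] by simp
  qed
  show "x \<in> rel_ideal \<Longrightarrow> y \<in> carrier KQ \<Longrightarrow> path_mult QQ y x \<in> rel_ideal" using I.I_l_closed by (simp add: KQ_simps(2))
  show "x \<in> rel_ideal \<Longrightarrow> y \<in> carrier KQ \<Longrightarrow> path_mult QQ x y \<in> rel_ideal" using I.I_r_closed by (simp add: KQ_simps(2))
  show "x \<in> relationsQ d n \<Longrightarrow> x \<in> rel_ideal" using genideal_self[OF relations_carrier] by blast
qed

definition straight :: "((nat \<times> arr list) \<Rightarrow>\<^sub>0 'k::field) \<Rightarrow> bool"
  where "straight x \<longleftrightarrow> (\<exists>y. supp y \<subseteq> {(u, p). 1 \<le> u \<and> is_path u p \<and> ribbon p} \<and> x - y \<in> rel_ideal)"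

lemma straight_add: "straight x \<Longrightarrow> straight y \<Longrightarrow> straight (x + y)"
proof -
  assume "straight x" "straight y"
  then obtain a b where ab: "supp a \<subseteq> {(u, p). 1 \<le> u \<and> is_path u p \<and> ribbon p}" "x - a \<in> rel_ideal"
    "supp b \<subseteq> {(u, p). 1 \<le> u \<and> is_path u p \<and> ribbon p}" "y - b \<in> rel_ideal" unfolding straight_def by blast
  have "x + y - (a + b) \<in> rel_ideal" using rel_ideal_rules(2)[OF ab(2,4)] by (simp add: algebra_simps)
  moreover have "supp (a + b) \<subseteq> {(u, p). 1 \<le> u \<and> is_path u p \<and> ribbon p}" by (rule order_trans[OF keys_add]) (use ab(1,3) in blast)
  ultimately show ?thesis unfolding straight_def by blast
qed

lemma straight_uminus: "straight x \<Longrightarrow> straight (- x)"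
proof -
  assume "straight x"
  then obtain a where a: "supp a \<subseteq> {(u, p). 1 \<le> u \<and> is_path u p \<and> ribbon p}" "x - a \<in> rel_ideal"
    unfolding straight_def by blast
  have "- x - (- a) \<in> rel_ideal" using rel_ideal_rules(4)[OF a(2)] by (simp add: algebra_simps)
  moreover have "supp (- a) = supp a" by (auto simp: in_keys_iff)
  ultimately show ?thesis using a(1) unfolding straight_def by (intro exI[of _ "- a"]) simp
qed

lemma straight_diff: "straight x \<Longrightarrow> straight y \<Longrightarrow> straight (x - y)"
  using straight_add[of x "- y"] straight_uminus[of y] by simp

lemma straight_0: "straight 0"
  unfolding straight_def by (intro exI[of _ 0]) (simp add: rel_ideal_rules(3))

lemma straight_cong: "x - y \<in> rel_ideal \<Longrightarrow> straight y \<Longrightarrow> straight x"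
proof -
  assume xy: "x - y \<in> rel_ideal" and "straight y"
  then obtain a where a: "supp a \<subseteq> {(u, p). 1 \<le> u \<and> is_path u p \<and> ribbon p}" "y - a \<in> rel_ideal"
    unfolding straight_def by blast
  have "x - a \<in> rel_ideal" using rel_ideal_rules(2)[OF xy a(2)] by simp
  then show ?thesis using a(1) unfolding straight_def by blast
qed

text \<open>The indices of a path are the digits of a number in base \<open>d + 1\<close>, those near the end
  of the path being the most significant. Straightening moves large indices towards the end, so it
  increases this number, which is bounded in terms of the number of indices.\<close>
fun digit_value :: "arr list \<Rightarrow> nat" where
  "digit_value [] = 0"
| "digit_value (X i s # p) = s + Suc d * digit_value p"
| "digit_value (XX s t # p) = t + Suc d * (s + Suc d * digit_value p)"

fun num_letters :: "arr list \<Rightarrow> nat" where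
  "num_letters [] = 0"
| "num_letters (X i s # p) = Suc (num_letters p)"
| "num_letters (XX s t # p) = Suc (Suc (num_letters p))"

lemma digit_less: "a < b \<Longrightarrow> l \<le> d \<Longrightarrow> l + Suc d * a < l' + Suc d * b"
proof -
  assume "a < b" "l \<le> d"
  then have "l + Suc d * a < Suc d * Suc a" by simp
  also have "\<dots> \<le> Suc d * b" using \<open>a < b\<close> by (intro mult_le_mono2) simp
  finally show ?thesis by simp
qed

lemma digit_value_bound: "is_path u p \<Longrightarrow> digit_value p < Suc d ^ num_letters p"
proof (induction p arbitrary: u rule: digit_value.induct)
  case (2 i s p)
  then have "digit_value p < Suc d ^ num_letters p" by auto
  from digit_less[OF this, of s 0] 2(2) show ?case by simp
next
  case (3 s t p)
  then have "digit_value p < Suc d ^ num_letters p" by auto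
  from digit_less[OF this, of s 0] 3(2) have "s + Suc d * digit_value p < Suc d * Suc d ^ num_letters p" by auto
  from digit_less[OF this, of t 0] 3(2) show ?case by simp
qed simp

lemma digit_value_append: "digit_value (p @ q) = digit_value p + Suc d ^ num_letters p * digit_value q"
  by (induction p rule: digit_value.induct) (auto simp: algebra_simps)

lemma num_letters_append [simp]: "num_letters (p @ q) = num_letters p + num_letters q"
  by (induction p rule: num_letters.induct) auto

text \<open>The ribbon condition concerns only pairs of adjacent arrows.\<close>
lemma not_ribbon_split:
  assumes "is_path u p" "\<not> ribbon p"
  shows "\<exists>p1 a b p2. p = p1 @ [a, b] @ p2 \<and> \<not> ribbon [a, b]"
  using assms
proof (induction p arbitrary: u rule: ribbon.induct)
  case (2 i s p)
  show ?case
  proof (cases "ribbon p")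
    case True
    then have "\<not> s \<le> top_index p" using 2 by simp
    then obtain b p' where "p = b # p'" using 2 by (cases p) auto
    then show ?thesis using \<open>\<not> s \<le> top_index p\<close> 2(2)
      by (intro exI[of _ "[]"] exI[of _ "X i s"] exI[of _ b] exI[of _ p']) (cases b; auto)
  next
    case False
    have "is_path (Suc i) p" using 2(2) by auto
    from 2(1)[OF this False] obtain p1 a b p2 where "p = p1 @ [a, b] @ p2 \<and> \<not> ribbon [a, b]" by blast
    then show ?thesis by (intro exI[of _ "X i s # p1"]) auto
  qed
next
  case (3 s t p)
  show ?case
  proof (cases "ribbon p")
    case True
    then have "\<not> s \<le> top_index p" using 3 by simp
    then obtain b p' where "p = b # p'" using 3 by (cases p) auto
    then show ?thesis using \<open>\<not> s \<le> top_index p\<close> 3(2)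
      by (intro exI[of _ "[]"] exI[of _ "XX s t"] exI[of _ b] exI[of _ p']) (cases b; auto)
  next
    case False
    have "is_path (Suc 0) p" using 3(2) by auto
    from 3(1)[OF this False] obtain p1 a b p2 where "p = p1 @ [a, b] @ p2 \<and> \<not> ribbon [a, b]" by blast
    then show ?thesis by (intro exI[of _ "XX s t # p1"]) auto
  qed
qed simp

text \<open>A pair of adjacent arrows that violates the ribbon condition is a term of one of the relations. In
  the other terms of that relation the same indices are arranged so that, compared from the end of
  the path, the first differing index is larger; they are straight by induction. There is one
  relation for each of the four combinations of arrow types; the last combination, two consecutive
  arrows \<open>x\<^sub>s\<^sub>t\<close>, is possible for \<open>n = 2\<close> only.\<close>
theorem straight_path:
  assumes "1 \<le> u" "is_path u p"
  shows "straight (Poly_Mapping.single (u, p) (c :: 'k::field))"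
  using assms(2)
proof (induction "Suc d ^ num_letters p - digit_value p" arbitrary: p rule: less_induct)
  case less
  show ?case
  proof (cases "ribbon p")
    case True
    then show ?thesis unfolding straight_def
      using assms(1) less.prems by (intro exI[of _ "Poly_Mapping.single (u, p) c"]) (auto simp: rel_ideal_rules(3))
  next
    case False
    then obtain p1 a b p2 where p: "p = p1 @ [a, b] @ p2" and nr: "\<not> ribbon [a, b]"
      using not_ribbon_split[OF less.prems] by blast
    define w where "w = end_vertex u p1"
    define z where "z = end_vertex w [a, b]"
    have g1: "is_path u p1" and gab: "is_path w [a, b]" and g2: "is_path z p2"
    proof -
      have "is_path u p1 \<and> is_path w ([a, b] @ p2)" using less.prems unfolding p w_def is_path_append .
      then show "is_path u p1" "is_path w [a, b]" "is_path z p2" unfolding is_path_append z_def by auto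
    qed
    have w1: "1 \<le> w" using end_vertex_range[OF assms(1) g1] by (simp add: w_def)
    have z1: "1 \<le> z" using end_vertex_range[OF w1 gab] by (simp add: z_def)
    \<comment> \<open>The rewriting step takes place inside the path; \<open>sw\<close> puts the unchanged beginning
      and end around it.\<close>
    define sw where "sw x = path_mult QQ (Poly_Mapping.single (z, p2) 1) (path_mult QQ x (Poly_Mapping.single (u, p1) c))"
      for x :: "(nat \<times> arr list) \<Rightarrow>\<^sub>0 'k"
    have sw_single: "sw (Poly_Mapping.single (w, q) 1) = Poly_Mapping.single (u, p1 @ q @ p2) c" if "end_vertex w q = z" for q
      using that by (simp add: sw_def path_mult_single' w_def)
    have sw_add: "sw (x + y) = sw x + sw y" and sw_diff: "sw (x - y) = sw x - sw y" for x y
      by (simp_all add: sw_def path_mult_add_left path_mult_add_right path_mult_diff_left path_mult_diff_right)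
    have sw_I: "sw x \<in> rel_ideal" if "x \<in> relationsQ d n" for x
      unfolding sw_def
      by (intro rel_ideal_rules(5,6) rel_ideal_rules(7)[OF that] KQ_single z1 g2 assms(1) g1)
    have P: "Poly_Mapping.single (u, p) c = sw (Poly_Mapping.single (w, [a, b]) 1)"
      by (simp add: sw_single z_def p)
    have IH: "straight (sw (Poly_Mapping.single (w, q) 1))"
      if q: "is_path w q" "end_vertex w q = z" "num_letters q = num_letters [a, b]" "digit_value ([a, b] @ p2) < digit_value (q @ p2)" for q
    proof -
      have g: "is_path u (p1 @ q @ p2)" using g1 g2 q(1,2) by (simp add: is_path_append w_def)
      have "digit_value p1 + Suc d ^ num_letters p1 * digit_value ([a, b] @ p2) < digit_value p1 + Suc d ^ num_letters p1 * digit_value (q @ p2)"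
        using q(4) by (intro add_strict_left_mono mult_strict_left_mono) simp_all
      then have "digit_value p < digit_value (p1 @ q @ p2)" unfolding p by (simp only: digit_value_append[of p1])
      moreover have "num_letters (p1 @ q @ p2) = num_letters p" unfolding p num_letters_append q(3) ..
      moreover have "digit_value (p1 @ q @ p2) < Suc d ^ num_letters (p1 @ q @ p2)" by (rule digit_value_bound[OF g])
      ultimately have "Suc d ^ num_letters (p1 @ q @ p2) - digit_value (p1 @ q @ p2) < Suc d ^ num_letters p - digit_value p" by simp
      from less.hyps[OF this g] show ?thesis using q(2) by (simp add: sw_single)
    qed
    have conc: "straight (Poly_Mapping.single (u, p) c)" if "sw (Poly_Mapping.single (w, [a, b]) 1) - y \<in> rel_ideal" "straight y" for y
      unfolding P by (rule straight_cong[OF that])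
    show ?thesis
    proof (cases a)
      case a: (X i t)
      show ?thesis
      proof (cases b)
        case b: (X j s)
        have h: "i = w" "j = Suc i" "Suc i < n - 1" "s \<in> {1..d}" "t \<in> {1..d}" "s < t" "1 \<le> i"
          using gab nr w1 by (auto simp: a b)
        let ?R = "Poly_Mapping.single (i, [X i t, X (Suc i) s]) 1 - Poly_Mapping.single (i, [X i s, X (Suc i) t]) (1 :: 'k)"
        have "?R \<in> relationsQ d n"
        proof -
          have "1 \<le> i \<and> i < n - 2 \<and> 1 \<le> s \<and> s < t \<and> t \<le> d" using h by auto
          then show ?thesis unfolding relationsQ_paths by blast
        qed
        from sw_I[OF this] have "sw (Poly_Mapping.single (w, [a, b]) 1) - sw (Poly_Mapping.single (w, [X i s, X (Suc i) t]) 1) \<in> rel_ideal"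
          by (simp add: sw_diff a b h(1)[symmetric] h(2))
        moreover have "straight (sw (Poly_Mapping.single (w, [X i s, X (Suc i) t]) 1))"
        proof (rule IH)
          show "is_path w [X i s, X (Suc i) t]" using gab h by (simp add: a b)
          show "end_vertex w [X i s, X (Suc i) t] = z" using h(2) by (simp add: a b z_def)
          show "num_letters [X i s, X (Suc i) t] = num_letters [a, b]" by (simp add: a b)
          have "t + Suc d * (s + Suc d * digit_value p2) < s + Suc d * (t + Suc d * digit_value p2)"
            using h by - (rule digit_less, auto)
          then show "digit_value ([a, b] @ p2) < digit_value ([X i s, X (Suc i) t] @ p2)" by (simp add: a b)
        qed
        ultimately show ?thesis by (rule conc)
      next
        case b: (XX s t')
        have h: "i = w" "Suc i = n - 1" "1 \<le> s" "s < t'" "t' < t" "t \<le> d" "1 \<le> i" "3 \<le> n" "i = n - 2"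
          using gab nr w1 by (auto simp: a b)
        let ?R = "Poly_Mapping.single (n - 2, [X (n - 2) t, XX s t']) 1 - Poly_Mapping.single (n - 2, [X (n - 2) t', XX s t]) 1
          + Poly_Mapping.single (n - 2, [X (n - 2) s, XX t' t]) (1 :: 'k)"
        have "?R \<in> relationsQ d n" using h(3-6,8) unfolding relationsQ_paths by blast
        from sw_I[OF this] have "sw (Poly_Mapping.single (w, [a, b]) 1) -
            (sw (Poly_Mapping.single (w, [X i t', XX s t]) 1) - sw (Poly_Mapping.single (w, [X i s, XX t' t]) 1)) \<in> rel_ideal"
          by (simp add: sw_diff sw_add a b h(1)[symmetric] h(9)[symmetric] algebra_simps)
        moreover have "straight (sw (Poly_Mapping.single (w, [X i t', XX s t]) 1) - sw (Poly_Mapping.single (w, [X i s, XX t' t]) 1))"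
        proof (rule straight_diff; rule IH)
          have "t + Suc d * (t' + Suc d * (s + Suc d * digit_value p2)) < t' + Suc d * (t + Suc d * (s + Suc d * digit_value p2))"
            using h by - (rule digit_less, auto)
          then show "digit_value ([a, b] @ p2) < digit_value ([X i t', XX s t] @ p2)" by (simp add: a b)
          have "t' + Suc d * (s + Suc d * digit_value p2) < t + Suc d * (t' + Suc d * digit_value p2)"
            using h by - (rule digit_less, auto)
          then have "t + Suc d * (t' + Suc d * (s + Suc d * digit_value p2)) < s + Suc d * (t + Suc d * (t' + Suc d * digit_value p2))"
            using h by - (rule digit_less, auto)
          then show "digit_value ([a, b] @ p2) < digit_value ([X i s, XX t' t] @ p2)" by (simp add: a b)
        qed (use gab h in \<open>auto simp: a b z_def\<close>)
        ultimately show ?thesis by (rule conc)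
      qed
    next
      case a: (XX t v)
      show ?thesis
      proof (cases b)
        case b: (X j s)
        have h: "w = n - 1" "j = 1" "1 \<le> s" "s < t" "t < v" "v \<le> d" "3 \<le> n" "1 < n - 1"
          using gab nr by (auto simp: a b)
        let ?R = "Poly_Mapping.single (n - 1, [XX t v, X 1 s]) 1 - Poly_Mapping.single (n - 1, [XX s v, X 1 t]) 1
          + Poly_Mapping.single (n - 1, [XX s t, X 1 v]) (1 :: 'k)"
        have "?R \<in> relationsQ d n" using h(3-7) unfolding relationsQ_paths by blast
        from sw_I[OF this] have "sw (Poly_Mapping.single (w, [a, b]) 1) -
            (sw (Poly_Mapping.single (w, [XX s v, X 1 t]) 1) - sw (Poly_Mapping.single (w, [XX s t, X 1 v]) 1)) \<in> rel_ideal"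
          by (simp add: sw_diff sw_add a b h(1,2) algebra_simps)
        moreover have "straight (sw (Poly_Mapping.single (w, [XX s v, X 1 t]) 1) - sw (Poly_Mapping.single (w, [XX s t, X 1 v]) 1))"
        proof (rule straight_diff; rule IH)
          have "t + Suc d * (s + Suc d * digit_value p2) < s + Suc d * (t + Suc d * digit_value p2)"
            using h by - (rule digit_less, auto)
          then have "v + Suc d * (t + Suc d * (s + Suc d * digit_value p2)) < v + Suc d * (s + Suc d * (t + Suc d * digit_value p2))"
            using h by - (rule digit_less, auto)
          then show "digit_value ([a, b] @ p2) < digit_value ([XX s v, X 1 t] @ p2)" by (simp add: a b)
          have "t + Suc d * (s + Suc d * digit_value p2) < s + Suc d * (v + Suc d * digit_value p2)"
            using h by - (rule digit_less, auto)
          then have "v + Suc d * (t + Suc d * (s + Suc d * digit_value p2)) < t + Suc d * (s + Suc d * (v + Suc d * digit_value p2))"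
            using h by - (rule digit_less, auto)
          then show "digit_value ([a, b] @ p2) < digit_value ([XX s t, X 1 v] @ p2)" by (simp add: a b)
        qed (use gab h in \<open>auto simp: a b z_def\<close>)
        ultimately show ?thesis by (rule conc)
      next
        case b: (XX r s)
        have h: "w = 1" "n = 2" "1 \<le> r" "r < s" "s < t" "t < v" "v \<le> d"
          using gab nr n2 w1 by (auto simp: a b)
        let ?S = "\<lambda>a b c e. sw (Poly_Mapping.single (w, [XX a b, XX c e]) 1)"
        let ?R = "Poly_Mapping.single (1, [XX r s, XX t v]) 1 - Poly_Mapping.single (1, [XX r t, XX s v]) 1
          + Poly_Mapping.single (1, [XX r v, XX s t]) 1 + Poly_Mapping.single (1, [XX s t, XX r v]) 1
          - Poly_Mapping.single (1, [XX s v, XX r t]) 1 + Poly_Mapping.single (1, [XX t v, XX r s]) (1 :: 'k)"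
        have "?R \<in> relationsQ d n" using h(2-7) unfolding relationsQ_paths by blast
        from sw_I[OF this] have "sw (Poly_Mapping.single (w, [a, b]) 1) -
            (?S r t s v + ?S s v r t - ?S r s t v - ?S r v s t - ?S s t r v) \<in> rel_ideal"
          by (simp add: sw_diff sw_add a b h(1) algebra_simps)
        moreover have "straight (?S r t s v + ?S s v r t - ?S r s t v - ?S r v s t - ?S s t r v)"
        proof -
          have two: "digit_value ([a, b] @ p2) < digit_value ([XX x y, XX x' y'] @ p2)"
            if "s + Suc d * (r + Suc d * digit_value p2) < y' + Suc d * (x' + Suc d * digit_value p2)" for x y x' y'
          proof -
            have "t + Suc d * (s + Suc d * (r + Suc d * digit_value p2)) < x + Suc d * (y' + Suc d * (x' + Suc d * digit_value p2))"
              using h that by - (rule digit_less, auto)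
            then have "v + Suc d * (t + Suc d * (s + Suc d * (r + Suc d * digit_value p2)))
                < y + Suc d * (x + Suc d * (y' + Suc d * (x' + Suc d * digit_value p2)))"
              using h by - (rule digit_less, auto)
            then show ?thesis by (simp add: a b)
          qed
          have S: "straight (?S x y x' y')"
            if "s + Suc d * (r + Suc d * digit_value p2) < y' + Suc d * (x' + Suc d * digit_value p2)"
              "1 \<le> x" "x < y" "y \<le> d" "1 \<le> x'" "x' < y'" "y' \<le> d" for x y x' y'
          proof (rule IH)
            have m: "n - Suc 0 = Suc 0" using h(2) by simp
            then show "is_path w [XX x y, XX x' y']" using that(2-) n2 h(1) by simp
          qed (use two[OF that(1)] in \<open>simp_all add: a b z_def\<close>)
          have big: "s + Suc d * (r + Suc d * digit_value p2) < y' + Suc d * (x' + Suc d * digit_value p2)" if "r < x'" for x' y'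
            using h that by - (rule digit_less, auto)
          show ?thesis
          proof (intro straight_diff straight_add)
            have same: "s + Suc d * (r + Suc d * digit_value p2) < y' + Suc d * (r + Suc d * digit_value p2)" if "s < y'" for y'
              using that by simp
            have rt: "r < t" and sv: "s < v" and rv: "r < v" using h(4-6) by simp_all
            show "straight (?S r t s v)" by (rule S[OF big[OF h(4)]]) (use h in simp_all)
            show "straight (?S s v r t)" by (rule S[OF same[OF h(5)]]) (use h in simp_all)
            show "straight (?S r s t v)" by (rule S[OF big[OF rt]]) (use h in simp_all)
            show "straight (?S r v s t)" by (rule S[OF big[OF h(4)]]) (use h in simp_all)
            show "straight (?S s t r v)" by (rule S[OF same[OF sv]]) (use h in simp_all)
          qed
        qed
        ultimately show ?thesis by (rule conc)
      qed
    qed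
  qed
qed

theorem straight_all:
  assumes "x \<in> carrier (KQ :: ('k::field, (nat \<times> arr list) \<Rightarrow>\<^sub>0 'k) module)" shows "straight x"
  using assms
proof (induction rule: KQ_induct)
  case zero show ?case by (rule straight_0)
next
  case (single u p c) then show ?case by (rule straight_path)
next
  case (add x y) then show ?case by (intro straight_add)
qed

end

section \<open>The isomorphism\<close>

context veronese begin

lemma path_eval_sum: "path_eval c v (sum f A) = (\<Sum>a\<in>A. path_eval c v (f a))"
  by (simp add: path_eval_def lin_sum)

lemma path_eval_outside:
  assumes "x \<in> carrier (KQ :: ('k::field, _) module)" "\<not> (1 \<le> v \<and> v < n)" shows "path_eval c v x = 0"
  using assms(1)
proof (induction rule: KQ_induct)
  case (single u p a)
  then have "u \<noteq> v" using assms(2) is_path_less by blast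
  then show ?case by (simp add: path_eval_single)
qed (simp_all add: path_eval_add)

lemma path_eval_Gens: "x \<in> carrier (KQ :: ('k::field, _) module) \<Longrightarrow> path_eval c v x \<in> Gens c v"
proof (induction rule: KQ_induct)
  case zero show ?case by (simp add: kv.subspace_0[OF Gens_subspace])
next
  case (single u p a)
  then show ?case
    using kv.subspace_scale[OF Gens_subspace path_poly_mem[OF single(2)], of a] kv.subspace_0[OF Gens_subspace]
    by (auto simp: path_eval_single)
next
  case (add x y) then show ?case by (simp only: path_eval_add kv.subspace_add[OF Gens_subspace])
qed

lemma path_eval_eventually_0:
  assumes "x \<in> carrier (KQ :: ('k::field, _) module)" shows "\<exists>N. \<forall>c\<ge>N. \<forall>v. path_eval c v x = 0"
  using assms
proof (induction rule: KQ_induct)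
  case (single u p a)
  show ?case by (rule exI[of _ "Suc (wedges p)"]) (auto simp: path_eval_single)
next
  case (add x y)
  then obtain N N' where "\<forall>c\<ge>N. \<forall>v. path_eval c v x = 0" "\<forall>c\<ge>N'. \<forall>v. path_eval c v y = 0" by blast
  then show ?case by (intro exI[of _ "max N N'"]) (auto simp: path_eval_add)
qed simp

lemma path_eval_one:
  "path_eval c v (\<Sum>w\<in>{1..n - 1}. Poly_Mapping.single (w, []) 1) = (if c = 0 \<and> 1 \<le> v \<and> v < n then 1 else (0 :: 'k::field mpoly))"
proof -
  have "path_eval c v (\<Sum>w\<in>{1..n - 1}. Poly_Mapping.single (w, []) 1)
      = (\<Sum>w\<in>{1..n - 1}. if w = v then (if c = 0 then 1 else 0) else (0 :: 'k mpoly))"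
    unfolding path_eval_sum by (rule sum.cong) (auto simp: path_eval_single)
  also have "\<dots> = (if c = 0 \<and> 1 \<le> v \<and> v < n then 1 else 0)" using n2 by (auto simp: sum.delta)
  finally show ?thesis .
qed

lemma ribbon_combination_0:
  fixes y :: "(nat \<times> arr list) \<Rightarrow>\<^sub>0 'k::field"
  assumes y: "supp y \<subseteq> {(u, p). 1 \<le> u \<and> is_path u p \<and> ribbon p}" and 0: "\<And>c v. path_eval c v y = 0"
  shows "y = 0"
proof (rule ccontr)
  assume "y \<noteq> 0"
  then obtain m where "m \<in> supp y" unfolding keys_eq_empty[symmetric] by blast
  moreover obtain u p where "m = (u, p)" by (cases m)
  ultimately have up: "(u, p) \<in> supp y" by simp
  define F where "F = {q. (u, q) \<in> supp y \<and> wedges q = wedges p}"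
  have "F \<subseteq> snd ` supp y" unfolding F_def by force
  then have F: "finite F" by (rule finite_subset) simp
  have FB: "F \<subseteq> ribbons (wedges p) u" using y by (auto simp: F_def ribbons_def)
  have "(\<Sum>q\<in>F. Const (coef y (u, q)) * path_poly q) = (\<Sum>m\<in>Pair u ` F. Const (coef y m) * path_poly (snd m))"
    by (simp add: sum.reindex inj_on_def)
  also have "\<dots> = (\<Sum>m\<in>Pair u ` F. Const (coef y m) * (case m of (u', q) \<Rightarrow> if u' = u \<and> wedges q = wedges p then path_poly q else 0))"
    by (rule sum.cong) (auto simp: F_def)
  also have "\<dots> = (\<Sum>m\<in>supp y. Const (coef y m) * (case m of (u', q) \<Rightarrow> if u' = u \<and> wedges q = wedges p then path_poly q else 0))"
    by (rule sum.mono_neutral_left) (auto simp: F_def split: if_splits)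
  also have "\<dots> = path_eval (wedges p) u y" by (simp add: path_eval_def lin_def)
  finally have "(\<Sum>q\<in>F. Const (coef y (u, q)) * path_poly q) = 0" using 0 by simp
  then have "coef y (u, p) = 0" by (rule ribbon_independent[OF F FB]) (simp add: F_def up)
  then show False using up by (simp add: in_keys_iff)
qed

text \<open>An element in the kernel is congruent, modulo the relations, to a combination of ribbon paths.
  That combination is in the kernel as well, and it vanishes because the polynomials of ribbon
  paths are independent.\<close>
theorem ker_eval_rel_ideal: "(ker_eval :: ((nat \<times> arr list) \<Rightarrow>\<^sub>0 'k::field) set) = rel_ideal"
proof
  show "(ker_eval :: ((nat \<times> arr list) \<Rightarrow>\<^sub>0 'k) set) \<subseteq> rel_ideal"
  proof
    fix x :: "(nat \<times> arr list) \<Rightarrow>\<^sub>0 'k" assume x: "x \<in> ker_eval"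
    then have "straight x" by (intro straight_all) (simp add: ker_eval_def)
    then obtain y where y: "supp y \<subseteq> {(u, p). 1 \<le> u \<and> is_path u p \<and> ribbon p}" "x - y \<in> rel_ideal" unfolding straight_def by blast
    have "path_eval c v y = 0" for c v
    proof -
      have "path_eval c v (x - y) = 0" "path_eval c v x = 0" using x y(2) rel_ideal_ker_eval[where 'k = 'k] by (auto simp: ker_eval_def)
      then show ?thesis by (simp add: path_eval_diff)
    qed
    then have "y = 0" by (rule ribbon_combination_0[OF y(1)])
    then show "x \<in> rel_ideal" using y(2) by simp
  qed
qed (rule rel_ideal_ker_eval)

text \<open>Surjectivity onto the generators in one degree and at one vertex is \<open>Gens_span\<close>.\<close>
lemma path_eval_realize:
  assumes "1 \<le> v" "v < n" "t \<in> (Gens c v :: 'k::field mpoly set)"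
  shows "\<exists>x\<in>carrier (KQ :: ('k, (nat \<times> arr list) \<Rightarrow>\<^sub>0 'k) module). \<forall>c' v'. path_eval c' v' x = (if c' = c \<and> v' = v then t else 0)"
proof -
  have "t \<in> kv.span (path_poly ` ribbons c v)" using Gens_span[OF assms(2), where 'k = 'k] assms(3) by simp
  then show ?thesis
  proof (induction rule: kv.span_induct_alt)
    case base
    show ?case by (rule bexI[of _ 0]) (simp_all add: KQ_simps)
  next
    case (step a x t)
    then obtain p y where p: "x = path_poly p" "is_path v p" "wedges p = c"
      and y: "y \<in> carrier (KQ :: ('k, (nat \<times> arr list) \<Rightarrow>\<^sub>0 'k) module)" "\<forall>c' v'. path_eval c' v' y = (if c' = c \<and> v' = v then t else 0)"
      unfolding ribbons_def by blast
    show ?case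
      by (rule bexI[of _ "Poly_Mapping.single (v, p) a + y"])
        (use p y in \<open>auto simp: path_eval_add path_eval_single intro!: KQ_add KQ_single assms(1)\<close>)
  qed
qed

lemma KQ_sum: "(\<And>a. a \<in> A \<Longrightarrow> f a \<in> carrier (KQ :: ('k::field, _) module)) \<Longrightarrow> sum f A \<in> carrier (KQ :: ('k, _) module)"
  by (induction A rule: infinite_finite_induct) (auto simp: KQ_add, simp_all add: KQ_simps)

end

context veronese_syz begin

abbreviation "SH c \<equiv> stable_hom KR KS (syz T c)"
abbreviation "\<Gamma> \<equiv> stable_syz_algebra Const KR KS T"

definition cl :: "nat \<Rightarrow> (nat \<Rightarrow> 'k mpoly) \<Rightarrow> ('k mpoly \<Rightarrow> 'b) set" where "cl c h = cls c (fam_map c h)"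

text \<open>A family of multipliers that defines a map to \<open>\<Omega>\<^sup>cS\<close>, stated through the
  map and not through the membership of each multiplier, so that it holds for products by
  \<open>mult_last_model\<close>.\<close>
definition acts :: "nat \<Rightarrow> (nat \<Rightarrow> 'k mpoly) \<Rightarrow> bool"
  where "acts c h \<longleftrightarrow> (\<forall>q\<in>polys d. apply_fam h q \<in> Om c 0)"

lemma mult_fams_acts: "h \<in> mult_fams c \<Longrightarrow> acts c h" by (simp add: acts_def apply_fam_Om)

lemma fam_prod_acts: "g \<in> gen_fams c' \<Longrightarrow> f \<in> mult_fams c \<Longrightarrow> acts (c + c') (fam_prod c g f)"
  using mult_last_model[of g c' c] by (simp add: acts_def apply_fam_Om flip: mult_last_apply_fam)

lemma acts_hom: "acts c h \<Longrightarrow> fam_map c h \<in> hom c"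
  unfolding fam_map_def acts_def
  by (rule mod_hom_restrictI[OF KS_module])
    (simp_all add: KS_simps apply_fam_add apply_fam_VR lin_isoD(1-3)[OF th])

lemma apply_fam_add_fun: "apply_fam (\<lambda>i. h i + g i) q = apply_fam h q + apply_fam g q"
  by (simp add: apply_fam_def algebra_simps sum.distrib)

lemma acts_add: "acts c h \<Longrightarrow> acts c g \<Longrightarrow> acts c (\<lambda>i. h i + g i)"
  by (simp add: acts_def apply_fam_add_fun kv.subspace_add[OF Om_subspace])

lemma acts_zero: "acts c (\<lambda>i. 0)"
  by (simp add: acts_def apply_fam_def kv.subspace_0[OF Om_subspace])

lemma cl_in: "acts c h \<Longrightarrow> cl c h \<in> carrier (SH c)"
  unfolding cl_def by (intro stable_pair.cls_in[OF stable_pair] acts_hom)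

lemma cl_add:
  assumes "acts c h" "acts c g" shows "cl c (\<lambda>i. h i + g i) = cl c h \<oplus>\<^bsub>SH c\<^esub> cl c g"
proof -
  have "fam_map c (\<lambda>i. h i + g i) = (\<lambda>q\<in>carrier KS. fam_map c h q \<oplus>\<^bsub>syz T c\<^esub> fam_map c g q)"
    unfolding fam_map_def
    by (rule restrict_ext) (use assms in \<open>simp add: apply_fam_add_fun lin_isoD(2)[OF th] acts_def KS_simps\<close>)
  then show ?thesis
    unfolding cl_def using stable_pair.cls_add[OF stable_pair acts_hom[OF assms(1)] acts_hom[OF assms(2)]] by simp
qed

lemma cl_zero: "cl c (\<lambda>i. 0) = \<zero>\<^bsub>SH c\<^esub>"
proof -
  have "fam_map c (\<lambda>i. 0) = (\<lambda>q\<in>carrier KS. \<zero>\<^bsub>syz T c\<^esub>)"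
    unfolding fam_map_def
    by (rule restrict_ext) (simp add: apply_fam_def lin_iso_zero[OF th sm(1) kv.subspace_0[OF Om_subspace]])
  then show ?thesis unfolding cl_def using stable_pair.cls_zero[OF stable_pair] by simp
qed

lemma cl_scale:
  assumes "acts c h" shows "cl c (\<lambda>i. Const k * h i) = Const k \<odot>\<^bsub>SH c\<^esub> cl c h"
proof -
  have "apply_fam (\<lambda>i. Const k * h i) q = Const k * apply_fam h q" for q
    unfolding apply_fam_def sum_distrib_left by (simp add: mult_ac)
  then have "fam_map c (\<lambda>i. Const k * h i) = (\<lambda>q\<in>carrier KS. Const k \<odot>\<^bsub>syz T c\<^esub> fam_map c h q)"
    unfolding fam_map_def
    by (intro restrict_ext) (use assms in \<open>simp add: lin_isoD(3)[OF th] acts_def KS_simps VR_Const\<close>)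
  then show ?thesis
    unfolding cl_def using stable_pair.cls_smult[OF stable_pair acts_hom[OF assms] VR_Const] by simp
qed

lemma cl_finsum:
  assumes "finite J" "\<And>i. i \<in> J \<Longrightarrow> acts c (h i)"
  shows "(\<Oplus>\<^bsub>SH c\<^esub>i\<in>J. cl c (h i)) = cl c (\<lambda>v. \<Sum>i\<in>J. h i v) \<and> acts c (\<lambda>v. \<Sum>i\<in>J. h i v)"
  using assms
proof (induction J)
  case empty
  interpret abelian_group "SH c" by (rule stable_pair.SH_group[OF stable_pair])
  show ?case by (simp add: cl_zero acts_zero)
next
  case (insert i J)
  interpret abelian_group "SH c" by (rule stable_pair.SH_group[OF stable_pair])
  have "(\<Oplus>\<^bsub>SH c\<^esub>j\<in>insert i J. cl c (h j)) = cl c (h i) \<oplus>\<^bsub>SH c\<^esub> (\<Oplus>\<^bsub>SH c\<^esub>j\<in>J. cl c (h j))"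
    by (rule finsum_insert) (use insert cl_in in auto)
  then show ?case using insert acts_add[of c "h i" "\<lambda>v. \<Sum>i\<in>J. h i v"] cl_add[of c "h i" "\<lambda>v. \<Sum>i\<in>J. h i v"] by simp
qed

definition \<Phi> :: "((nat \<times> arr list) \<Rightarrow>\<^sub>0 'k) \<Rightarrow> nat \<Rightarrow> ('k mpoly \<Rightarrow> 'b) set"
  where "\<Phi> x = (\<lambda>c. cl c (\<lambda>v. path_eval c v x))"

lemma path_eval_gen_fams: "x \<in> carrier KQ \<Longrightarrow> (\<lambda>v. path_eval c v x) \<in> gen_fams c"
  unfolding gen_fams_def mem_Collect_eq using path_eval_Gens[where 'k = 'k] path_eval_outside[where 'k = 'k] by metis

lemmas path_eval_mult_fams = path_eval_gen_fams[THEN gen_fams_mult_fams]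
lemmas path_eval_acts = path_eval_mult_fams[THEN mult_fams_acts]

lemma \<Gamma>_simps: "\<gamma> \<in> carrier \<Gamma> \<longleftrightarrow> (\<forall>i. \<gamma> i \<in> carrier (SH i)) \<and> finite {i. \<gamma> i \<noteq> \<zero>\<^bsub>SH i\<^esub>}"
  "\<gamma> \<oplus>\<^bsub>\<Gamma>\<^esub> \<delta> = (\<lambda>i. \<gamma> i \<oplus>\<^bsub>SH i\<^esub> \<delta> i)" "\<zero>\<^bsub>\<Gamma>\<^esub> = (\<lambda>i. \<zero>\<^bsub>SH i\<^esub>)" "k \<odot>\<^bsub>\<Gamma>\<^esub> \<gamma> = (\<lambda>i. Const k \<odot>\<^bsub>SH i\<^esub> \<gamma> i)"
  "\<one>\<^bsub>\<Gamma>\<^esub> = homog KR KS T 0 (cls 0 (aug T))"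
  "\<gamma> \<otimes>\<^bsub>\<Gamma>\<^esub> \<delta> = (\<lambda>l. \<Oplus>\<^bsub>SH l\<^esub>i \<in> {..l}. stable_prod KR KS T (l - i) i (\<gamma> (l - i)) (\<delta> i))"
  by (simp_all add: stable_syz_algebra_def)

lemma \<Phi>_carrier: assumes "x \<in> carrier KQ" shows "\<Phi> x \<in> carrier \<Gamma>"
proof -
  obtain N where N: "\<forall>c\<ge>N. \<forall>v. path_eval c v x = 0" using path_eval_eventually_0[OF assms] by blast
  have "\<Phi> x c = \<zero>\<^bsub>SH c\<^esub>" if "c \<ge> N" for c using N that by (simp add: \<Phi>_def cl_zero)
  then have "{i. \<Phi> x i \<noteq> \<zero>\<^bsub>SH i\<^esub>} \<subseteq> {..<N}" by (auto simp: not_le[symmetric])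
  then have "finite {i. \<Phi> x i \<noteq> \<zero>\<^bsub>SH i\<^esub>}" using finite_subset by blast
  then show ?thesis using assms by (simp add: \<Gamma>_simps \<Phi>_def cl_in path_eval_acts)
qed

lemma \<Phi>_add: "x \<in> carrier KQ \<Longrightarrow> y \<in> carrier KQ \<Longrightarrow> \<Phi> (x + y) = \<Phi> x \<oplus>\<^bsub>\<Gamma>\<^esub> \<Phi> y"
  unfolding \<Phi>_def \<Gamma>_simps path_eval_add by (rule ext) (rule cl_add; erule path_eval_acts)

lemma \<Phi>_scale: "x \<in> carrier KQ \<Longrightarrow> \<Phi> (Poly_Mapping.map ((*) k) x) = k \<odot>\<^bsub>\<Gamma>\<^esub> \<Phi> x"
  unfolding \<Phi>_def \<Gamma>_simps path_eval_scale by (rule ext) (rule cl_scale; erule path_eval_acts)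

lemma \<Phi>_0: "\<Phi> 0 = \<zero>\<^bsub>\<Gamma>\<^esub>"
  by (simp add: \<Phi>_def \<Gamma>_simps cl_zero)

lemma \<Phi>_mult:
  assumes "g \<in> carrier KQ" "f \<in> carrier KQ" shows "\<Phi> (path_mult QQ g f) = \<Phi> g \<otimes>\<^bsub>\<Gamma>\<^esub> \<Phi> f"
proof
  fix l
  interpret abelian_group "SH l" by (rule stable_pair.SH_group[OF stable_pair])
  let ?h = "\<lambda>i. fam_prod i (\<lambda>v. path_eval (l - i) v g) (\<lambda>v. path_eval i v f)"
  have a: "acts l (?h i)" if "i \<in> {..l}" for i
    using fam_prod_acts[OF path_eval_gen_fams[OF assms(1), of "l - i"] path_eval_mult_fams[OF assms(2), of i]] that by simp
  have "(\<Phi> g \<otimes>\<^bsub>\<Gamma>\<^esub> \<Phi> f) l = (\<Oplus>\<^bsub>SH l\<^esub>i \<in> {..l}. cl l (?h i))"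
    unfolding \<Gamma>_simps
  proof (rule finsum_cong'[OF refl])
    show "(\<lambda>i. cl l (?h i)) \<in> {..l} \<rightarrow> carrier (SH l)" using a cl_in by blast
    fix i assume "i \<in> {..l}"
    then have "i + (l - i) = l" by simp
    then show "stable_prod KR KS T (l - i) i (\<Phi> g (l - i)) (\<Phi> f i) = cl l (?h i)"
      using stable_prod_fam_map(1)[OF path_eval_gen_fams[OF assms(1), of "l - i"] path_eval_mult_fams[OF assms(2), of i]]
      by (simp add: \<Phi>_def cl_def)
  qed
  also have "\<dots> = cl l (\<lambda>v. \<Sum>i\<in>{..l}. ?h i v)" using cl_finsum[of "{..l}" l ?h] a by blast
  also have "\<dots> = \<Phi> (path_mult QQ g f) l"
    unfolding \<Phi>_def fam_prod_def path_eval_mult[OF assms] ..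
  finally show "\<Phi> (path_mult QQ g f) l = (\<Phi> g \<otimes>\<^bsub>\<Gamma>\<^esub> \<Phi> f) l" ..
qed

lemma \<Phi>_homog:
  assumes "\<And>l v. l \<noteq> c \<Longrightarrow> path_eval l v x = 0" shows "\<Phi> x = homog KR KS T c (cl c (\<lambda>v. path_eval c v x))"
proof
  fix l show "\<Phi> x l = homog KR KS T c (cl c (\<lambda>v. path_eval c v x)) l"
    using assms[of l] by (cases "l = c") (simp_all add: \<Phi>_def homog_def cl_zero)
qed

lemma const_mult_fams: "h \<in> polys d \<Longrightarrow> (\<lambda>v. h) \<in> mult_fams 0"
  by (simp add: mult_fams_def)

text \<open>The unit of the path algebra acts as the identity on \<open>M\<^sub>1, \<dots>,
  M\<^bsub>n-1\<^esub>\<close> and as zero on \<open>M\<^sub>0\<close>. The difference from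
  \<open>aug T\<close> is concentrated on \<open>M\<^sub>0\<close> and therefore stably zero.\<close>
lemma \<Phi>_one: "\<Phi> (\<Sum>w\<in>{1..n - 1}. Poly_Mapping.single (w, []) 1) = \<one>\<^bsub>\<Gamma>\<^esub>"
proof -
  let ?o = "\<Sum>w\<in>{1..n - 1}. Poly_Mapping.single (w, []) (1 :: 'k)"
  have one: "(1 :: 'k mpoly) \<in> polys d" by (simp add: polys_low)
  have aug: "aug T \<in> mod_hom KR KS (syz T 0)" using T by (simp add: is_syzygies_def gmod_iso_def)
  have "fam_map 0 (\<lambda>v. 1) = aug T"
  proof (rule extensionalityI[of _ "carrier KS"])
    show "fam_map 0 (\<lambda>v. 1) \<in> extensional (carrier KS)" by (simp add: fam_map_def)
    show "aug T \<in> extensional (carrier KS)" using aug unfolding mod_hom_def PiE_def by blast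
    fix q assume "q \<in> carrier KS"
    then show "fam_map 0 (\<lambda>v. 1) q = aug T q"
      using th0 by (simp add: fam_map_def apply_fam_def summand_sum_all KS_simps)
  qed
  moreover have "cls 0 (fam_map 0 (\<lambda>v. path_eval 0 v ?o)) = cls 0 (fam_map 0 (\<lambda>v. 1))"
    using cls_fam_map_eq[OF path_eval_mult_fams[OF KQ_one] const_mult_fams[OF one]]
    by (simp only: in_radical_def path_eval_one) simp
  ultimately have "cl 0 (\<lambda>v. path_eval 0 v ?o) = cls 0 (aug T)" by (simp add: cl_def)
  moreover have "\<Phi> ?o = homog KR KS T 0 (cl 0 (\<lambda>v. path_eval 0 v ?o))"
    by (rule \<Phi>_homog) (simp only: path_eval_one, simp)
  ultimately show ?thesis by (simp only: \<Gamma>_simps)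
qed

text \<open>Each stable class has only one representative in \<open>gen_fams\<close>, and evaluation gives
  families of this kind.\<close>
lemma \<Phi>_kernel: "x \<in> carrier KQ \<Longrightarrow> \<Phi> x = \<zero>\<^bsub>\<Gamma>\<^esub> \<longleftrightarrow> x \<in> ker_eval"
proof
  assume x: "x \<in> carrier KQ" and 0: "\<Phi> x = \<zero>\<^bsub>\<Gamma>\<^esub>"
  have "(\<lambda>v. path_eval c v x) = (\<lambda>v. 0)" for c
  proof (rule cls_fam_map_inj[of _ c])
    show "(\<lambda>v. path_eval c v x) \<in> gen_fams c" by (rule path_eval_gen_fams[OF x])
    show "(\<lambda>v. 0) \<in> gen_fams c" by (simp add: gen_fams_def kv.subspace_0[OF Gens_subspace])
    show "cls c (fam_map c (\<lambda>v. path_eval c v x)) = cls c (fam_map c (\<lambda>v. 0))"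
      using fun_cong[OF 0, of c] cl_zero[of c] by (simp add: \<Phi>_def \<Gamma>_simps cl_def)
  qed
  then show "x \<in> ker_eval" using x by (simp add: ker_eval_def fun_eq_iff)
next
  assume "x \<in> ker_eval"
  then show "\<Phi> x = \<zero>\<^bsub>\<Gamma>\<^esub>" by (simp add: ker_eval_def \<Phi>_def \<Gamma>_simps cl_zero)
qed

lemma \<Phi>_surj: assumes \<gamma>: "\<gamma> \<in> carrier \<Gamma>" shows "\<exists>x\<in>carrier KQ. \<Phi> x = \<gamma>"
proof -
  define J where "J = {i. \<gamma> i \<noteq> \<zero>\<^bsub>SH i\<^esub>}"
  have J: "finite J" using \<gamma> by (simp add: \<Gamma>_simps J_def)
  have "\<exists>h\<in>gen_fams c. \<gamma> c = cl c h" for c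
    using \<gamma> stable_hom_fam_map[of "\<gamma> c" c] unfolding cl_def by (simp add: \<Gamma>_simps)
  then obtain h where h: "\<And>c. h c \<in> gen_fams c" "\<And>c. \<gamma> c = cl c (h c)" by metis
  have "\<exists>x\<in>carrier KQ. \<forall>c' v'. path_eval c' v' x = (if c' = c \<and> v' = v then h c v else 0)" if v: "v \<in> {1..n - 1}" for c v
  proof -
    have v': "1 \<le> v" "v < n" using v n2 by auto
    then have "h c v \<in> Gens c v" using h(1)[of c] unfolding gen_fams_def by (simp split: if_splits)
    then show ?thesis by (rule path_eval_realize[OF v'])
  qed
  then have "\<exists>x. v \<in> {1..n - 1} \<longrightarrow> x \<in> carrier KQ \<and> (\<forall>c' v'. path_eval c' v' x = (if c' = c \<and> v' = v then h c v else 0))" for c v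
    by blast
  then have "\<exists>x. \<forall>c v. v \<in> {1..n - 1} \<longrightarrow> x c v \<in> carrier KQ \<and>
      (\<forall>c' v'. path_eval c' v' (x c v) = (if c' = c \<and> v' = v then h c v else 0))"
    by (intro choice allI)
  then obtain x where "\<And>c v. v \<in> {1..n - 1} \<longrightarrow> x c v \<in> carrier KQ \<and>
      (\<forall>c' v'. path_eval c' v' (x c v) = (if c' = c \<and> v' = v then h c v else 0))"
    by blast
  then have x: "\<And>c v. v \<in> {1..n - 1} \<Longrightarrow> x c v \<in> carrier KQ"
    "\<And>c v c' v'. v \<in> {1..n - 1} \<Longrightarrow> path_eval c' v' (x c v) = (if c' = c \<and> v' = v then h c v else 0)" by blast+
  define y where "y = (\<Sum>c\<in>J. \<Sum>v\<in>{1..n - 1}. x c v)"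
  have y: "y \<in> carrier KQ" unfolding y_def by (intro KQ_sum x(1))
  have EFy: "path_eval c' v' y = (if c' \<in> J then h c' v' else 0)" for c' v'
  proof -
    have hv: "h c' v' = 0" if "v' \<notin> {1..n - 1}"
    proof -
      have "\<not> (1 \<le> v' \<and> v' < n)" using that by auto
      then show ?thesis using h(1)[of c'] unfolding gen_fams_def mem_Collect_eq by meson
    qed
    have "path_eval c' v' y = (\<Sum>c\<in>J. \<Sum>v\<in>{1..n - 1}. if c' = c \<and> v' = v then h c v else 0)"
      unfolding y_def path_eval_sum by (intro sum.cong refl x(2))
    also have "\<dots> = (\<Sum>c\<in>J. if c' = c then (\<Sum>v\<in>{1..n - 1}. if v' = v then h c v else 0) else 0)"
      by (intro sum.cong refl) auto
    also have "\<dots> = (if c' \<in> J then (if v' \<in> {1..n - 1} then h c' v' else 0) else 0)"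
      using J by (simp add: sum.delta')
    finally show ?thesis using hv by auto
  qed
  have "\<Phi> y = \<gamma>"
  proof
    fix c show "\<Phi> y c = \<gamma> c"
      using h(2)[of c] by (cases "c \<in> J") (simp_all add: \<Phi>_def EFy cl_zero J_def)
  qed
  then show ?thesis using y by blast
qed

text \<open>That \<open>\<Gamma>\<close> is a ring, with associativity and distributivity, is inherited along
  the surjection from the path algebra.\<close>
theorem \<Phi>_ring_hom: "ring_hom_ring KQ \<Gamma> \<Phi>"
proof -
  interpret ring "KQ :: ('k, (nat \<times> arr list) \<Rightarrow>\<^sub>0 'k) module" by (rule KQ_ring)
  have hom: "\<Phi> \<in> ring_hom KQ \<Gamma>"
  proof (rule ring_hom_memI)
    show "\<Phi> \<one>\<^bsub>KQ\<^esub> = \<one>\<^bsub>\<Gamma>\<^esub>" unfolding KQ_simps(6) by (rule \<Phi>_one)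
  qed (simp_all only: KQ_simps(2,3) \<Phi>_carrier \<Phi>_mult \<Phi>_add)
  have im: "\<Phi> ` carrier KQ = carrier \<Gamma>" using \<Phi>_carrier \<Phi>_surj by fast
  have "ring (\<Gamma>\<lparr>carrier := \<Phi> ` carrier KQ, zero := \<Phi> \<zero>\<^bsub>KQ\<^esub>\<rparr>)" by (rule ring_hom_imp_img_ring[OF hom])
  moreover have "\<Gamma>\<lparr>carrier := \<Phi> ` carrier KQ, zero := \<Phi> \<zero>\<^bsub>KQ\<^esub>\<rparr> = \<Gamma>"
    by (simp add: im KQ_simps(4) \<Phi>_0)
  ultimately have "ring \<Gamma>" by simp
  then show ?thesis using hom by (intro ring_hom_ringI2 ring_axioms)
qed

lemma kernel_\<Phi>: "a_kernel KQ \<Gamma> \<Phi> = rel_ideal"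
  unfolding ker_eval_rel_ideal[symmetric] a_kernel_def' using \<Phi>_kernel by (auto simp: ker_eval_def)

lemma fam_map_single:
  assumes "i < n" shows "fam_map 0 (\<lambda>v. if v = i then t else 0) = (\<lambda>p\<in>carrier KS. \<theta> 0 (t * proj_M n i p))"
proof -
  have "apply_fam (\<lambda>v. if v = i then t else 0) p = t * summand i p" for p
    using assms by (simp add: apply_fam_def if_distrib[of "\<lambda>x. _ * x"] sum.delta mult.commute cong: if_cong)
  then show ?thesis unfolding fam_map_def by (intro restrict_ext) (simp add: KS_simps proj_M_summand)
qed

lemma \<Phi>_degree_0:
  assumes "1 \<le> i" "is_path i p" "wedges p = 0" "(path_poly p :: 'k mpoly) \<in> polys d"
  shows "\<Phi> (Poly_Mapping.single (i, p) 1) = homog KR KS T 0 (cls 0 (\<lambda>q\<in>carrier KS. aug T (path_poly p * proj_M n i q)))"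
proof -
  have i: "i < n" by (rule is_path_less[OF assms(2)])
  have "(\<lambda>v. path_eval 0 v (Poly_Mapping.single (i, p) 1)) = (\<lambda>v. if v = i then path_poly p else (0 :: 'k mpoly))"
    using assms(3) by (auto simp: path_eval_single)
  moreover have "fam_map 0 (\<lambda>v. if v = i then path_poly p else 0) = (\<lambda>q\<in>carrier KS. aug T (path_poly p * proj_M n i q))"
    unfolding fam_map_single[OF i]
    by (rule restrict_ext) (use assms(4) in \<open>simp add: th0 KS_simps proj_M_summand polys_mult summand_polys\<close>)
  ultimately have "cl 0 (\<lambda>v. path_eval 0 v (Poly_Mapping.single (i, p) 1)) = cls 0 (\<lambda>q\<in>carrier KS. aug T (path_poly p * proj_M n i q))"
    by (simp add: cl_def)
  then show ?thesis using \<Phi>_homog[of 0 "Poly_Mapping.single (i, p) 1"] assms(3) by (simp add: path_eval_single)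
qed

theorem presentation:
  "\<exists>\<phi> \<in> ring_iso (KQ Quot rel_ideal) \<Gamma>.
    (\<forall>c. \<forall>p \<in> carrier KQ. \<phi> (rel_ideal +>\<^bsub>KQ\<^esub> (c \<odot>\<^bsub>KQ\<^esub> p)) = c \<odot>\<^bsub>\<Gamma>\<^esub> \<phi> (rel_ideal +>\<^bsub>KQ\<^esub> p)) \<and>
    (\<forall>i \<in> {1..n - 1}. \<phi> (rel_ideal +>\<^bsub>KQ\<^esub> vertex_idem i) =
       homog KR KS T 0 (cls 0 (\<lambda>p \<in> carrier KS. aug T (proj_M n i p)))) \<and>
    (\<forall>i s. 1 \<le> i \<and> i < n - 1 \<and> 1 \<le> s \<and> s \<le> d \<longrightarrow>
       \<phi> (rel_ideal +>\<^bsub>KQ\<^esub> arrow QQ (X i s)) =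
       homog KR KS T 0 (cls 0 (\<lambda>p \<in> carrier KS. aug T (Var s * proj_M n i p)))) \<and>
    (\<forall>s t. 1 \<le> s \<and> s < t \<and> t \<le> d \<longrightarrow>
       (\<exists>A \<in> carrier (SH 1). \<phi> (rel_ideal +>\<^bsub>KQ\<^esub> arrow QQ (XX s t)) = homog KR KS T 1 A))"
proof -
  interpret h: ring_hom_ring KQ \<Gamma> \<Phi> by (rule \<Phi>_ring_hom)
  let ?\<phi> = "\<lambda>C. the_elem (\<Phi> ` C)"
  have im: "\<Phi> ` carrier KQ = carrier \<Gamma>" using \<Phi>_carrier \<Phi>_surj by fast
  have iso: "?\<phi> \<in> ring_iso (KQ Quot rel_ideal) \<Gamma>" using h.FactRing_iso_set[OF im] by (simp add: kernel_\<Phi>)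
  have \<phi>: "?\<phi> (rel_ideal +>\<^bsub>KQ\<^esub> x) = \<Phi> x" if "x \<in> carrier KQ" for x
    using h.the_elem_simp[OF that] by (simp add: kernel_\<Phi>)
  show ?thesis
  proof (intro bexI[OF _ iso] conjI allI ballI impI)
    fix c p assume p: "p \<in> carrier (KQ :: ('k, (nat \<times> arr list) \<Rightarrow>\<^sub>0 'k) module)"
    have "Poly_Mapping.map ((*) c) p \<in> carrier KQ" using p by (auto simp: KQ_simps in_keys_iff coef_map_scale)
    then show "?\<phi> (rel_ideal +>\<^bsub>KQ\<^esub> (c \<odot>\<^bsub>KQ\<^esub> p)) = c \<odot>\<^bsub>\<Gamma>\<^esub> ?\<phi> (rel_ideal +>\<^bsub>KQ\<^esub> p)"
      using p by (simp add: \<phi> \<Phi>_scale KQ_simps(5))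
  next
    fix i assume i: "i \<in> {1..n - 1}"
    then have g: "1 \<le> i" "is_path i []" using n2 by auto
    show "?\<phi> (rel_ideal +>\<^bsub>KQ\<^esub> vertex_idem i) = homog KR KS T 0 (cls 0 (\<lambda>p \<in> carrier KS. aug T (proj_M n i p)))"
      using \<phi>[OF KQ_single[OF g]] \<Phi>_degree_0[OF g] by (simp add: vertex_idem_def polys_low)
  next
    fix i s assume i: "1 \<le> i \<and> i < n - 1 \<and> 1 \<le> s \<and> s \<le> d"
    then have g: "1 \<le> i" "is_path i [X i s]" by auto
    show "?\<phi> (rel_ideal +>\<^bsub>KQ\<^esub> arrow QQ (X i s)) = homog KR KS T 0 (cls 0 (\<lambda>p \<in> carrier KS. aug T (Var s * proj_M n i p)))"
      using \<phi>[OF KQ_single[OF g]] \<Phi>_degree_0[OF g] i by (simp add: arrow_X polys_Var)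
  next
    fix s t assume st: "1 \<le> s \<and> s < t \<and> t \<le> d"
    then have g: "1 \<le> n - 1" "is_path (n - 1) [XX s t]" using n2 by auto
    let ?a = "Poly_Mapping.single (n - 1, [XX s t]) (1 :: 'k)"
    have a: "?a \<in> carrier KQ" by (rule KQ_single[OF g])
    have "\<Phi> ?a = homog KR KS T 1 (cl 1 (\<lambda>v. path_eval 1 v ?a))" by (rule \<Phi>_homog) (auto simp: path_eval_single)
    then show "\<exists>A \<in> carrier (SH 1). ?\<phi> (rel_ideal +>\<^bsub>KQ\<^esub> arrow QQ (XX s t)) = homog KR KS T 1 A"
      using \<phi>[OF a] cl_in[OF path_eval_acts[OF a]] by (intro bexI[of _ "cl 1 (\<lambda>v. path_eval 1 v ?a)"]) (simp_all add: arrow_XX)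
  qed
qed

end

theorem theorem4p12:
  fixes a n d :: nat
    and R S :: "('k::field mpoly, 'k mpoly) gmodule"
    and T :: "('k mpoly, 'k mpoly, 'b) syzygies"
    and \<Gamma> :: "('k, nat \<Rightarrow> ('k mpoly \<Rightarrow> 'b) set) module"
    and kQ :: "('k, (nat \<times> arr list) \<Rightarrow>\<^sub>0 'k) module"
    and I :: "((nat \<times> arr list) \<Rightarrow>\<^sub>0 'k) set"
  assumes "a \<ge> 1" and "n \<ge> 2" and "d = a * n"
    and "S = poly_S d n" and "R = veronese_R d n"
    and "is_syzygies R S T"
    and "\<Gamma> = stable_syz_algebra Const R S T"
    and "kQ = path_algebra (quiverQ d n)"
    and "I = Idl\<^bsub>kQ\<^esub> (relationsQ d n)"
  shows "\<exists>\<phi> \<in> ring_iso (kQ Quot I) \<Gamma>.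
    (\<forall>c. \<forall>p \<in> carrier kQ. \<phi> (I +>\<^bsub>kQ\<^esub> (c \<odot>\<^bsub>kQ\<^esub> p)) = c \<odot>\<^bsub>\<Gamma>\<^esub> \<phi> (I +>\<^bsub>kQ\<^esub> p)) \<and>
    (\<forall>i \<in> {1..n - 1}. \<phi> (I +>\<^bsub>kQ\<^esub> vertex_idem i) =
       homog R S T 0 (stable_class R S (syz T 0) (\<lambda>p \<in> carrier S. aug T (proj_M n i p)))) \<and>
    (\<forall>i s. 1 \<le> i \<and> i < n - 1 \<and> 1 \<le> s \<and> s \<le> d \<longrightarrow>
       \<phi> (I +>\<^bsub>kQ\<^esub> arrow (quiverQ d n) (X i s)) =
       homog R S T 0 (stable_class R S (syz T 0) (\<lambda>p \<in> carrier S. aug T (Var s * proj_M n i p)))) \<and>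
    (\<forall>s t. 1 \<le> s \<and> s < t \<and> t \<le> d \<longrightarrow>
       (\<exists>A \<in> carrier (stable_hom R S (syz T 1)).
          \<phi> (I +>\<^bsub>kQ\<^esub> arrow (quiverQ d n) (XX s t)) = homog R S T 1 A))"
proof -
  have d2: "2 \<le> d"
  proof -
    have "1 * n \<le> a * n" using assms(1) by (rule mult_le_mono1)
    then show ?thesis using assms(2,3) by linarith
  qed
  interpret V: veronese d n by (rule veronese.intro[OF d2 assms(2)])
  have T: "is_syzygies (veronese_R d n) (poly_S d n) T" using assms(6) by (simp only: assms(4,5))
  obtain \<theta> \<Theta> where m: "\<And>p. p \<in> polys d \<Longrightarrow> \<theta> 0 p = aug T p" "\<And>c. V.lin_iso (V.Om c 0) (syz T c) (\<theta> c)"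
    "\<And>c. V.lin_iso (V.Cov c 0) (cov T c) (\<Theta> c)" "\<And>c t. t \<in> V.Cov c 0 \<Longrightarrow> cmap T c (\<Theta> c t) = \<theta> c (V.merge t)"
    "\<And>c t. t \<in> V.Om (Suc c) 0 \<Longrightarrow> \<theta> (Suc c) t = \<Theta> c t"
    using V.syzygies_model[OF T] by blast
  interpret M: veronese_syz d n T \<theta> \<Theta>
    by unfold_locales (fact T m)+
  show ?thesis unfolding assms(4,5,7-9) by (rule M.presentation)
qed

end
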